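(* Let $1<p<\infty$ and $\alpha\ge0$, and let $$\mathcal{H}_+f(t)=\mathrm{p.v.}\,\frac i\pi\int_0^\infty\frac{f(s)}{t-s}\,ds,\qquad t>0.$$ Then: (i) $(D_+^\alpha)^{-1}\circ\mathcal{H}_+=\mathcal{H}_+\circ(D_+^\alpha)^{-1}$ (on $L^p(\mathbb{R}^+)$). (ii) $D_+^\alpha\circ\mathcal{H}_+=\mathcal{H}_+\circ D_+^\alpha$ (on $\mathcal{T}_p^{(\alpha)}(t^\alpha)$), the operator $\mathcal{H}_+$ is bounded on $\mathcal{T}_p^{(\alpha)}(t^\alpha)$, and its operator norm there is $\|\mathcal{H}_+\|=\cot\dfrac{\pi}{2p^*}$, where $p^*=\max\{p,p'\}$ and $\frac1p+\frac1{p'}=1$. (iii) $\mathcal{H}_+\circ\mathcal{S}_{\beta,\mu}=\mathcal{S}_{\beta,\mu}\circ\mathcal{H}_+$ on $\mathcal{T}_p^{(\alpha)}(t^\alpha)$ for all $\beta,\mu$ with $0<\beta-\frac1p<\mu$, where $\mathcal{S}_{\beta,\mu}f(t)=t^{\mu-\beta}\int_0^\infty\frac{s^{\beta-1}}{(s+t)^\mu}f(s)\,ds$.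
   Context: Let $\mathcal{S}_+$ be the Schwartz class on $[0,\infty)$. For $f\in\mathcal{S}_+$ and $\alpha>0$ put $W_+^{-\alpha}f(t)=\frac1{\Gamma(\alpha)}\int_t^\infty(s-t)^{\alpha-1}f(s)\,ds$ and $W_+^{\alpha}f(t)=(-1)^n\frac{d^n}{dt^n}W_+^{-(n-\alpha)}f(t)$ with $n=[\alpha]+1$; $W_+^0=\mathrm{Id}$. For $1\le p<\infty$ and $\alpha>0$, $\mathcal{T}_p^{(\alpha)}(t^\alpha)$ is the completion of $\mathcal{S}_+$ in the norm $\|f\|_{\alpha,p}=\frac1{\Gamma(\alpha+1)}\left(\int_0^\infty|W_+^\alpha f(t)|^p t^{\alpha p}dt\right)^{1/p}$; $\mathcal{T}_p^{(0)}(t^0)=L^p(\mathbb{R}^+)$. These spaces are continuously embedded in $L^p(\mathbb{R}^+)$ and regarded as subspaces of it. The map $D_+^\alpha f(t)=\frac1{\Gamma(\alpha+1)}t^\alpha W_+^\alpha f(t)$ extends to an isometric isomorphism $\mathcal{T}_p^{(\alpha)}(t^\alpha)\to L^p(\mathbb{R}^+)$ with inverse (for $\alpha>0$) $(D_+^\alpha)^{-1}h(t)=\alpha\int_t^\infty(s-t)^{\alpha-1}\frac{h(s)}{s^\alpha}ds$ (for $\alpha=0$ both are the identity). Here p.v. denotes the Cauchy principal value (limit as $\varepsilon\to0^+$ of the integral over $(0,t-\varepsilon)\cup(t+\varepsilon,\infty)$). It is known that $\mathcal{H}_+$ is bounded on $L^p(\mathbb{R}^+)$ for $1<p<\infty$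 with norm $\cot\frac{\pi}{2p^*}$. The operator $\mathcal{S}_{\beta,\mu}$ is bounded on $\mathcal{T}_p^{(\alpha)}(t^\alpha)$ for $0<\beta-\frac1p<\mu$. *)

theory Defs
  imports "HOL-Analysis.Analysis"
begin

text \<open>
  Elements of \<open>L\<^sup>p(\<real>\<^sup>+)\<close> are represented by functions of type \<open>real \<Rightarrow> complex\<close>, of which only the
  values on \<open>(0, \<infinity>)\<close> matter, identified up to almost everywhere equality on \<open>(0, \<infinity>)\<close>.
\<close>

abbreviation half_line :: "real measure"
  where "half_line \<equiv> lebesgue_on {0<..}"

definition ae_eq :: "(real \<Rightarrow> complex) \<Rightarrow> (real \<Rightarrow> complex) \<Rightarrow> bool"
  where "ae_eq f g \<longleftrightarrow> (AE t in half_line. f t = g t)"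

definition Lp :: "real \<Rightarrow> (real \<Rightarrow> complex) set"
  where "Lp p = {f. f \<in> borel_measurable half_line \<and>
                    integrable half_line (\<lambda>t. norm (f t) powr p)}"

definition Lp_norm :: "real \<Rightarrow> (real \<Rightarrow> complex) \<Rightarrow> real"
  where "Lp_norm p f = (LINT t|half_line. norm (f t) powr p) powr (1 / p)"

text \<open>
  The derivative on \<open>[0, \<infinity>)\<close>; it is one-sided at \<open>0\<close> and the ordinary derivative at \<open>t > 0\<close>.
\<close>

definition half_deriv :: "(real \<Rightarrow> complex) \<Rightarrow> real \<Rightarrow> complex"
  where "half_deriv f t = vector_derivative f (at t within {0..})"

definition schwartz_half :: "(real \<Rightarrow> complex) set"
  where "schwartz_half = {f.
    (\<forall>n. \<forall>t\<ge>0. (half_deriv ^^ n) f differentiable (at t within {0..})) \<and>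
    (\<forall>m n. bounded ((\<lambda>t. t ^ m *\<^sub>R (half_deriv ^^ n) f t) ` {0..}))}"

text \<open>\<open>weyl_int \<alpha>\<close> is \<open>W\<^sub>+\<close> of order \<open>-\<alpha>\<close> and \<open>weyl_deriv \<alpha>\<close> is \<open>W\<^sub>+\<close> of order \<open>\<alpha>\<close>.\<close>

definition weyl_int :: "real \<Rightarrow> (real \<Rightarrow> complex) \<Rightarrow> real \<Rightarrow> complex"
  where "weyl_int \<alpha> f t =
    (1 / Gamma \<alpha>) *\<^sub>R (LINT s:{t<..}|lebesgue. ((s - t) powr (\<alpha> - 1)) *\<^sub>R f s)"

definition weyl_deriv :: "real \<Rightarrow> (real \<Rightarrow> complex) \<Rightarrow> real \<Rightarrow> complex"
  where "weyl_deriv \<alpha> f =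
    (if \<alpha> = 0 then f
     else let n = nat \<lfloor>\<alpha>\<rfloor> + 1
          in (\<lambda>t. (-1) ^ n * (half_deriv ^^ n) (weyl_int (real n - \<alpha>) f) t))"

definition schwartz_norm :: "real \<Rightarrow> real \<Rightarrow> (real \<Rightarrow> complex) \<Rightarrow> real"
  where "schwartz_norm \<alpha> p f =
    1 / Gamma (\<alpha> + 1) *
      (LINT t|half_line. norm (weyl_deriv \<alpha> f t) powr p * t powr (\<alpha> * p)) powr (1 / p)"

definition schwartz_D :: "real \<Rightarrow> (real \<Rightarrow> complex) \<Rightarrow> real \<Rightarrow> complex"
  where "schwartz_D \<alpha> f t = (t powr \<alpha> / Gamma (\<alpha> + 1)) *\<^sub>R weyl_deriv \<alpha> f t"

text \<open>
  The completion of the Schwartz class is realised inside \<open>L\<^sup>p\<close>: the class of a Cauchy sequence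
  is identified with the limit of that sequence in \<open>L\<^sup>p\<close>.
\<close>

definition represents :: "real \<Rightarrow> real \<Rightarrow> (nat \<Rightarrow> real \<Rightarrow> complex) \<Rightarrow> (real \<Rightarrow> complex) \<Rightarrow> bool"
  where "represents \<alpha> p F f \<longleftrightarrow>
    (\<forall>n. F n \<in> schwartz_half) \<and>
    (\<forall>e>0. \<exists>N. \<forall>m\<ge>N. \<forall>n\<ge>N. schwartz_norm \<alpha> p (\<lambda>t. F m t - F n t) < e) \<and>
    f \<in> Lp p \<and> (\<lambda>n. Lp_norm p (\<lambda>t. F n t - f t)) \<longlonglongrightarrow> 0"

definition T_space :: "real \<Rightarrow> real \<Rightarrow> (real \<Rightarrow> complex) set"
  where "T_space \<alpha> p = (if \<alpha> = 0 then Lp p else {f. \<exists>F. represents \<alpha> p F f})"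

definition T_norm :: "real \<Rightarrow> real \<Rightarrow> (real \<Rightarrow> complex) \<Rightarrow> real"
  where "T_norm \<alpha> p f =
    (if \<alpha> = 0 then Lp_norm p f
     else THE c. \<exists>F. represents \<alpha> p F f \<and> (\<lambda>n. schwartz_norm \<alpha> p (F n)) \<longlonglongrightarrow> c)"

text \<open>
  The continuous extension of \<open>schwartz_D\<close> to \<open>T_space\<close>; the choice only selects a representative
  of an almost everywhere class.
\<close>

definition D_plus :: "real \<Rightarrow> real \<Rightarrow> (real \<Rightarrow> complex) \<Rightarrow> real \<Rightarrow> complex"
  where "D_plus \<alpha> p f =
    (if \<alpha> = 0 then f
     else SOME h. h \<in> Lp p \<and>
       (\<exists>F. represents \<alpha> p F f \<and> (\<lambda>n. Lp_norm p (\<lambda>t. schwartz_D \<alpha> (F n) t - h t)) \<longlonglongrightarrow> 0))"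

definition D_plus_inv :: "real \<Rightarrow> (real \<Rightarrow> complex) \<Rightarrow> real \<Rightarrow> complex"
  where "D_plus_inv \<alpha> h =
    (if \<alpha> = 0 then h
     else (\<lambda>t. \<alpha> *\<^sub>R (LINT s:{t<..}|lebesgue. ((s - t) powr (\<alpha> - 1) / s powr \<alpha>) *\<^sub>R h s)))"

text \<open>
  The principal value exists for almost every \<open>t > 0\<close> when \<open>f\<close> is in \<open>L\<^sup>p\<close> with \<open>1 < p < \<infinity>\<close>;
  where it does not exist the value below is arbitrary.
\<close>

definition H_plus :: "(real \<Rightarrow> complex) \<Rightarrow> real \<Rightarrow> complex"
  where "H_plus f t =
    \<i> / of_real pi *
      Lim (at_right 0) (\<lambda>\<epsilon>. LINT s:{0<..<t - \<epsilon>} \<union> {t + \<epsilon><..}|lebesgue. f s / of_real (t - s))"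

definition S_op :: "real \<Rightarrow> real \<Rightarrow> (real \<Rightarrow> complex) \<Rightarrow> real \<Rightarrow> complex"
  where "S_op \<beta> \<mu> f t =
    (t powr (\<mu> - \<beta>)) *\<^sub>R
      (LINT s:{0<..}|lebesgue. (s powr (\<beta> - 1) / (s + t) powr \<mu>) *\<^sub>R f s)"

text \<open>
  Counterparts of \<open>bounded_linear\<close> and \<open>onorm\<close> for an operator on a space \<open>V\<close> of almost everywhere
  classes with norm \<open>N\<close>.
\<close>

definition bounded_op ::
    "(real \<Rightarrow> complex) set \<Rightarrow> ((real \<Rightarrow> complex) \<Rightarrow> real) \<Rightarrow>
     ((real \<Rightarrow> complex) \<Rightarrow> real \<Rightarrow> complex) \<Rightarrow> bool"
  where "bounded_op V N A \<longleftrightarrow>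
    (\<forall>f\<in>V. A f \<in> V) \<and>
    (\<forall>f\<in>V. \<forall>g\<in>V. ae_eq (A (\<lambda>t. f t + g t)) (\<lambda>t. A f t + A g t)) \<and>
    (\<forall>f\<in>V. \<forall>c. ae_eq (A (\<lambda>t. c * f t)) (\<lambda>t. c * A f t)) \<and>
    (\<exists>C. \<forall>f\<in>V. N (A f) \<le> C * N f)"

definition op_norm ::
    "(real \<Rightarrow> complex) set \<Rightarrow> ((real \<Rightarrow> complex) \<Rightarrow> real) \<Rightarrow>
     ((real \<Rightarrow> complex) \<Rightarrow> real \<Rightarrow> complex) \<Rightarrow> real"
  where "op_norm V N A = (SUP f\<in>V. N (A f) / N f)"

end

theory Submission
  imports Defs "HOL-Complex_Analysis.Complex_Analysis" "HOL-Real_Asymp.Real_Asymp"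
begin

text \<open>
  The inverse of \<open>D_plus\<close> and \<open>S_op\<close> are dilation averages \<open>K f(t) = \<integral> k(r) f(r t) dr\<close> with
  \<open>k(r) r powr (-1/p)\<close> integrable. The Hilbert transform commutes with dilations, hence with all such averages.
  For \<open>\<alpha> > 0\<close> the space \<open>T_space \<alpha> p\<close> is the image of \<open>L\<^sup>p\<close> under the inverse of \<open>D_plus\<close>: this operator is
  injective, since integrating an Abel equation against \<open>exp (-j/t) t powr (-1-\<alpha>)\<close> yields all moments in
  \<open>exp (-1/s)\<close>, and the images of exponential polynomials \<open>\<Sum> c\<^sub>j exp (-j t)\<close> are dense in \<open>L\<^sup>p\<close>. So boundedness and
  norm are those on \<open>L\<^sup>p\<close>. There the upper bound is Pichorides' argument, which integrates a subharmonic
  function of the Poisson integral and its conjugate over horizontal lines, and the lower bound comes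
  from truncations of \<open>\<bar>s\<bar> powr (-g)\<close> with \<open>g < 1/p\<close>, translated into the half line.
\<close>

text \<open>\<open>H_plus\<close> is a pointwise limit whose existence is not given in advance, so
  the principal value has to come out of the same argument as the bound. At every height y the
  conjugate Poisson integral Q_y f satisfies the sharp bound; by the semigroup identity with the
  Poisson integrals P_y these functions form a Cauchy family as y tends to 0, and the limit
  \<open>g\<close> satisfies Q_y f = P_y g. Lebesgue points of \<open>g\<close> and of
  \<open>f\<close> then give convergence almost everywhere. Pichorides' argument covers real
  functions and p <= 2; duality reaches p > 2 and averaging over rotations reaches complex values,
  both with the same constant. Functions on the half line are extended by zero. Restricting the
  transform back can only lower the norm, so sharpness needs functions whose transform is large
  inside the half line; this is possible because a single local singularity dominates both
  norms.\<close>

abbreviation nnint :: "(real => ennreal) => ennreal" (binder "NN " [10] 10) where "nnint f == integral\<^sup>N lborel f"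
abbreviation lint :: "(real => 'b::{banach, second_countable_topology}) => 'b" (binder "LI " [60] 60) where "lint f == integral\<^sup>L lborel f"
abbreviation scaleR_infix :: "real => 'b::real_vector => 'b" (infixr "*R" 75) where "x *R y == scaleR x y"
abbreviation bm :: "('a::topological_space => 'b::topological_space) => bool" where "bm f == f \<in> borel_measurable borel"
abbreviation en :: "real => ennreal" where "en == ennreal"
abbreviation intg :: "(real => 'b::{banach, second_countable_topology}) => bool" where "intg f == integrable lborel f"
abbreviation ael :: "(real => bool) => bool" (binder "AEL " [10] 10) where "ael P == (AE x in lborel. P x)"
abbreviation seq_lim :: "(nat => 'b::topological_space) => 'b => bool" (infix "-->>" 60) where "X -->> L == X \<longlonglongrightarrow> L"
abbreviation fun_lim :: "('a => 'b::topological_space) => 'b => 'a filter => bool" (infixr "->>" 55) where "(f ->> l) F == (f \<longlongrightarrow> l) F"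
lemmas b_integrable_add = Bochner_Integration.integrable_add
lemmas b_integrable_bound = Bochner_Integration.integrable_bound
lemmas b_integrable_diff = Bochner_Integration.integrable_diff
lemmas b_integral_add = Bochner_Integration.integral_add
lemmas b_integral_cong = Bochner_Integration.integral_cong
lemmas b_integral_diff = Bochner_Integration.integral_diff
lemmas b_integral_nonneg = Bochner_Integration.integral_nonneg
lemmas b_integral_norm_bound_integral = Bochner_Integration.integral_norm_bound_integral
lemmas b_integral_sum = Bochner_Integration.integral_sum

section \<open>Integrals of p-th powers\<close>

text \<open>Without p-th root and with values in \<open>ennreal\<close>: infinite norms cause no
  case distinctions, Tonelli and Fatou apply directly, and the triangle inequality is replaced by
  convexity estimates with explicit constants.\<close>

definition pint :: "'a measure => real => ('a => 'b::real_normed_vector) => ennreal"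
 where "pint M p f = (\<integral>\<^sup>+x. en (norm (f x) powr p) \<partial>M)"

abbreviation pL :: "real => (real => 'b::real_normed_vector) => ennreal" where "pL == pint lborel"

text \<open>The tangent of x powr p at \<open>m\<close> lies below the graph; this is p times
  Young's inequality for \<open>g\<close> and m powr (p - 1). In this form it can be multiplied by
  weights and integrated.\<close>

lemma powr_tangent:
 fixes g m p :: real
 assumes "1 < p" "0 <= g" "0 <= m"
 shows "p * g * m powr (p - 1) <= g powr p + (p - 1) * m powr p"
proof -
 define q where "q = p / (p - 1)"
 have q: "1 < q" "1 / p + 1 / q = 1" using assms by (auto simp: q_def field_simps)
 have "g * m powr (p - 1) <= g powr p / p + (m powr (p - 1)) powr q / q"
 using Youngs_inequality[of p q g "m powr (p - 1)"] q assms by simp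
 also have "(m powr (p - 1)) powr q = m powr p" using assms by (simp add: powr_powr q_def)
 also have "g powr p / p + m powr p / q = (g powr p + (p - 1) * m powr p) / p"
 using assms by (simp add: q_def field_simps)
 finally show ?thesis using assms by (simp add: field_simps)
qed

text \<open>Convexity of x powr p at a + b = (1 - l) (a / (1 - l)) + l (b / l). The coefficient of a
  powr p tends to 1 as \<open>l\<close> tends to 0, unlike in the symmetric bound with 2 powr p. The
  proof adds two tangent inequalities at the common point a + b, with weights 1 - l and l.\<close>

lemma powr_split:
 fixes a b p l :: real
 assumes "1 < p" "0 < l" "l < 1" "0 <= a" "0 <= b"
 shows "(a + b) powr p <= (1 - l) powr (1 - p) * a powr p + l powr (1 - p) * b powr p"
proof -
 define m where "m = a + b"
 have A: "p * (x / s) * m powr (p - 1) <= (x / s) powr p + (p - 1) * m powr p" if "0 <= x" "0 < s" for x s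
 using powr_tangent[of p "x / s" m] assms that by (auto simp: m_def)
 have B: "p * x * m powr (p - 1) <= s powr (1 - p) * x powr p + s * ((p - 1) * m powr p)"
 if "0 <= x" "0 < s" for x s
 proof -
 have "s * (p * (x / s) * m powr (p - 1)) <= s * ((x / s) powr p + (p - 1) * m powr p)"
 by (rule mult_left_mono[OF A[OF that]]) (use that in auto)
 also have "s * ((x / s) powr p + (p - 1) * m powr p) = s powr (1 - p) * x powr p + s * ((p - 1) * m powr p)"
 using that by (simp add: powr_divide powr_diff field_simps)
 finally show ?thesis using that by simp
 qed
 have "p * m powr p = p * a * m powr (p - 1) + p * b * m powr (p - 1)"
 proof -
 have "m powr p = m * m powr (p - 1)" using assms by (cases "m = 0") (auto simp: m_def powr_diff)
 then show ?thesis by (simp add: m_def algebra_simps)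
 qed
 also have "... <= ((1 - l) powr (1 - p) * a powr p + (1 - l) * ((p - 1) * m powr p)) +
 (l powr (1 - p) * b powr p + l * ((p - 1) * m powr p))"
 using assms by (intro add_mono B) auto
 also have "... = (1 - l) powr (1 - p) * a powr p + l powr (1 - p) * b powr p + (p - 1) * m powr p"
 by (simp add: algebra_simps)
 finally show ?thesis by (simp add: m_def algebra_simps)
qed

lemma norm_add_powr_le:
 fixes a b :: "'b::real_normed_vector"
 assumes "1 < p" "0 < l" "l < 1"
 shows "norm (a + b) powr p <= (1 - l) powr (1 - p) * norm a powr p + l powr (1 - p) * norm b powr p"
proof -
 have "norm (a + b) powr p <= (norm a + norm b) powr p"
 using assms by (intro powr_mono2 norm_triangle_ineq) auto
 also have "... <= (1 - l) powr (1 - p) * norm a powr p + l powr (1 - p) * norm b powr p"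
 using assms by (intro powr_split) auto
 finally show ?thesis .
qed

lemma pint_cong_AE: "AE x in M. f x = g x ==> pint M p f = pint M p g"
 unfolding pint_def by (rule nn_integral_cong_AE) auto

lemma pint_mono_AE: "0 <= p ==> AE x in M. norm (f x) <= norm (g x) ==> pint M p f <= pint M p g"
 unfolding pint_def by (rule nn_integral_mono_AE) (auto intro!: powr_mono2 ennreal_leI)

lemma pint_mono: "0 <= p ==> (!!x. norm (f x) <= norm (g x)) ==> pint M p f <= pint M p g"
 by (rule pint_mono_AE) auto

lemma pint_zero [simp]: "pint M p (%x. 0) = 0"
 by (simp add: pint_def)

lemma pint_uminus [simp]: "pint M p (%x. - f x) = pint M p f"
 by (simp add: pint_def)

lemma pint_norm [simp]: "pint M p (%x. norm (f x)) = pint M p f"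
 by (simp add: pint_def)

lemma pint_diff_commute: "pint M p (%x. f x - g x) = pint M p (%x. g x - f x)"
 by (simp add: pint_def norm_minus_commute)

lemma pint_cmult:
 fixes f :: "'a => 'b::real_normed_field"
 assumes [measurable]: "f \<in> borel_measurable M"
 shows "pint M p (%x. c * f x) = en (norm c powr p) * pint M p f"
 unfolding pint_def by (simp add: norm_mult powr_mult ennreal_mult nn_integral_cmult)

lemma pint_add_le:
 fixes f g :: "'a => 'b::{real_normed_vector, second_countable_topology}"
 assumes [measurable]: "f \<in> borel_measurable M" "g \<in> borel_measurable M"
 and l: "1 < p" "0 < l" "l < 1"
 shows "pint M p (%x. f x + g x) <=
 en ((1 - l) powr (1 - p)) * pint M p f + en (l powr (1 - p)) * pint M p g"
proof -
 have "pint M p (%x. f x + g x) <= (\<integral>\<^sup>+x. en ((1 - l) powr (1 - p)) * en (norm (f x) powr p) +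
 en (l powr (1 - p)) * en (norm (g x) powr p) \<partial>M)"
 unfolding pint_def
 by (rule nn_integral_mono) (use norm_add_powr_le[OF l] in \<open>simp flip: ennreal_mult ennreal_plus\<close>)
 then show ?thesis unfolding pint_def by (simp add: nn_integral_add nn_integral_cmult)
qed

lemma pint_add_le2:
 fixes f g :: "'a => 'b::{real_normed_vector, second_countable_topology}"
 assumes [measurable]: "f \<in> borel_measurable M" "g \<in> borel_measurable M" and p: "1 < p"
 shows "pint M p (%x. f x + g x) <= en (2 powr p) * (pint M p f + pint M p g)"
proof -
 have "pint M p (%x. f x + g x) <=
 en ((1 - 1/2) powr (1 - p)) * pint M p f + en ((1/2) powr (1 - p)) * pint M p g"
 using p by (intro pint_add_le) auto
 also have "... = en (2 powr (p - 1)) * (pint M p f + pint M p g)"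
 proof -
 have "(1/2) powr (1 - p) = 2 powr (p - 1)" for p :: real
 by (simp add: powr_divide powr_diff)
 then show ?thesis by (simp add: distrib_left)
 qed
 also have "... <= en (2 powr p) * (pint M p f + pint M p g)"
 by (intro mult_right_mono ennreal_leI) auto
 finally show ?thesis .
qed

lemma pint_diff_le2:
 fixes f g :: "'a => 'b::{real_normed_vector, second_countable_topology}"
 assumes [measurable]: "f \<in> borel_measurable M" "g \<in> borel_measurable M" and p: "1 < p"
 shows "pint M p (%x. f x - g x) <= en (2 powr p) * (pint M p f + pint M p g)"
 using pint_add_le2[of f M "%x. - g x" p] assms by simp

lemma pint_diff_finite:
 fixes f g :: "'a => 'b::{real_normed_vector, second_countable_topology}"
 assumes "f \<in> borel_measurable M" "g \<in> borel_measurable M" "1 < p"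
 "pint M p f < \<infinity>" "pint M p g < \<infinity>"
 shows "pint M p (%x. f x - g x) < \<infinity>"
 using pint_diff_le2[OF assms(1-3)] assms(4,5)
 by (metis ennreal_add_less_top ennreal_less_top ennreal_mult_less_top infinity_ennreal_def le_less_trans)

lemma pint_add_finite:
 fixes f g :: "'a => 'b::{real_normed_vector, second_countable_topology}"
 assumes "f \<in> borel_measurable M" "g \<in> borel_measurable M" "1 < p"
 "pint M p f < \<infinity>" "pint M p g < \<infinity>"
 shows "pint M p (%x. f x + g x) < \<infinity>"
 using pint_add_le2[OF assms(1-3)] assms(4,5)
 by (metis ennreal_add_less_top ennreal_less_top ennreal_mult_less_top infinity_ennreal_def le_less_trans)

lemma pint_triangle3:
 fixes f g h :: "'a => 'b::{real_normed_vector, second_countable_topology}"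
 assumes [measurable]: "f \<in> borel_measurable M" "g \<in> borel_measurable M" "h \<in> borel_measurable M" and p: "1 < p"
 shows "pint M p (%x. f x - h x) <= en (2 powr p) * (pint M p (%x. f x - g x) + pint M p (%x. g x - h x))"
 using pint_add_le2[of "%x. f x - g x" M "%x. g x - h x" p] p by simp

lemma pint_eq_0_iff:
 assumes [measurable]: "f \<in> borel_measurable M"
 shows "pint M p f = 0 \<longleftrightarrow> (AE x in M. f x = 0)"
proof -
 have "pint M p f = 0 \<longleftrightarrow> (AE x in M. en (norm (f x) powr p) = 0)"
 unfolding pint_def by (rule nn_integral_0_iff_AE) measurable
 also have "... \<longleftrightarrow> (AE x in M. f x = 0)"
 by (intro AE_cong) (auto simp: ennreal_eq_0_iff)
 finally show ?thesis .
qed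

text \<open>Stands in for the reverse triangle inequality: each of the two integrals is at most (1 -
  l) powr (1 - p) times the other plus a multiple of the distance. For a given margin
  \<open>l\<close> is fixed close to 0, and large \<open>n\<close> then makes the second term
  small.\<close>

lemma pint_tendsto:
 fixes F :: "nat => 'a => 'b::{real_normed_vector, second_countable_topology}"
 assumes [measurable]: "!!n. F n \<in> borel_measurable M" "f \<in> borel_measurable M"
 and p: "1 < p" and fin: "pint M p f < \<infinity>"
 and lim: "(%n. pint M p (%x. F n x - f x)) -->> 0"
 shows "(%n. pint M p (F n)) -->> pint M p f"
proof -
 define N where "N = enn2real (pint M p f)"
 have N: "pint M p f = en N" "0 <= N" using fin by (auto simp: N_def)
 have fe: "\<forall>\<^sub>F n in sequentially. pint M p (%x. F n x - f x) < 1"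
 using order_tendstoD(2)[OF lim] by simp
 define d where "d n = enn2real (pint M p (%x. F n x - f x))" for n
 have d0: "d -->> 0" unfolding d_def using tendsto_enn2real[of _ 0] lim by simp
 have df: "\<forall>\<^sub>F n in sequentially. pint M p (%x. F n x - f x) = en (d n)"
 using fe by eventually_elim (auto simp: d_def less_top[symmetric] dest: order_less_trans[of _ 1 top])
 define e where "e n = enn2real (pint M p (F n))" for n
 have ef: "\<forall>\<^sub>F n in sequentially. pint M p (F n) = en (e n)"
 using fe
 proof eventually_elim
 case (elim n)
 have "pint M p (%x. (F n x - f x) + f x) < \<infinity>"
 proof (rule pint_add_finite)
 show "pint M p (%x. F n x - f x) < \<infinity>" using elim order_less_trans[of _ 1] by fastforce
 qed (use p fin in auto)
 then show ?case by (simp add: e_def)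
 qed
 have U: "\<forall>\<^sub>F n in sequentially. e n <= (1 - l) powr (1 - p) * N + l powr (1 - p) * d n"
 if l: "0 < l" "l < 1" for l
 using df ef
 proof eventually_elim
 case (elim n)
 have "pint M p (%x. f x + (F n x - f x)) <= en ((1 - l) powr (1 - p)) * pint M p f +
 en (l powr (1 - p)) * pint M p (%x. F n x - f x)"
 using l p by (intro pint_add_le) auto
 then have "en (e n) <= en ((1 - l) powr (1 - p)) * en N + en (l powr (1 - p)) * en (d n)"
 unfolding elim(1) N(1) using elim(2) by simp
 then show ?case using N by (simp add: d_def flip: ennreal_mult ennreal_plus)
 qed
 have L: "\<forall>\<^sub>F n in sequentially. N <= (1 - l) powr (1 - p) * e n + l powr (1 - p) * d n"
 if l: "0 < l" "l < 1" for l
 using df ef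
 proof eventually_elim
 case (elim n)
 have "pint M p (%x. F n x + (f x - F n x)) <= en ((1 - l) powr (1 - p)) * pint M p (F n) +
 en (l powr (1 - p)) * pint M p (%x. f x - F n x)"
 using l p by (intro pint_add_le) auto
 then have "en N <= en ((1 - l) powr (1 - p)) * en (e n) + en (l powr (1 - p)) * en (d n)"
 using elim(1) elim(2) N(1) pint_diff_commute[of M p f "F n"] by simp
 then show ?case using N by (simp add: d_def e_def flip: ennreal_mult ennreal_plus)
 qed
 have "e -->> N"
 proof (rule order_tendstoI)
 fix a assume "a < N"
 have "((%l::real. (1 - l) powr (1 - p) * a) ->> (1 - 0) powr (1 - p) * a) (at_right 0)"
 by (intro tendsto_intros) auto
 then have "\<forall>\<^sub>F l in at_right 0. (1 - l) powr (1 - p) * a < N"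
 using \<open>a < N\<close> by (intro order_tendstoD(2)) auto
 moreover have "\<forall>\<^sub>F l in at_right 0. 0 < l & l < (1::real)"
 using eventually_at_right_real[of 0 "1::real"] by (auto elim: eventually_mono)
 ultimately have "\<forall>\<^sub>F l in at_right 0. (1 - l) powr (1 - p) * a < N & 0 < l & l < (1::real)"
 by eventually_elim auto
 then obtain l :: real where l: "(1 - l) powr (1 - p) * a < N" "0 < l" "l < 1"
 using eventually_happens'[OF trivial_limit_at_right_real] by blast
 have "(%n. l powr (1 - p) * d n) -->> l powr (1 - p) * 0" by (intro tendsto_intros d0)
 from order_tendstoD(2)[OF this, of "N - (1 - l) powr (1 - p) * a"]
 have "\<forall>\<^sub>F n in sequentially. l powr (1 - p) * d n < N - (1 - l) powr (1 - p) * a"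
 using l by simp
 with L[OF l(2,3)] show "\<forall>\<^sub>F n in sequentially. a < e n"
 proof eventually_elim
 case (elim n)
 have "(1 - l) powr (1 - p) * a < (1 - l) powr (1 - p) * e n" using elim by linarith
 then show ?case using l by (metis mult_less_cancel_left_pos powr_gt_zero diff_gt_0_iff_gt less_irrefl)
 qed
 next
 fix a assume "N < a"
 have "((%l::real. (1 - l) powr (1 - p) * N) ->> (1 - 0) powr (1 - p) * N) (at_right 0)"
 by (intro tendsto_intros) auto
 then have "\<forall>\<^sub>F l in at_right 0. (1 - l) powr (1 - p) * N < a"
 using \<open>N < a\<close> by (intro order_tendstoD(2)) auto
 moreover have "\<forall>\<^sub>F l in at_right 0. 0 < l & l < (1::real)"
 using eventually_at_right_real[of 0 "1::real"] by (auto elim: eventually_mono)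
 ultimately have "\<forall>\<^sub>F l in at_right 0. (1 - l) powr (1 - p) * N < a & 0 < l & l < (1::real)"
 by eventually_elim auto
 then obtain l :: real where l: "(1 - l) powr (1 - p) * N < a" "0 < l" "l < 1"
 using eventually_happens'[OF trivial_limit_at_right_real] by blast
 have "(%n. l powr (1 - p) * d n) -->> l powr (1 - p) * 0" by (intro tendsto_intros d0)
 from order_tendstoD(2)[OF this, of "a - (1 - l) powr (1 - p) * N"]
 have "\<forall>\<^sub>F n in sequentially. l powr (1 - p) * d n < a - (1 - l) powr (1 - p) * N"
 using l by simp
 with U[OF l(2,3)] show "\<forall>\<^sub>F n in sequentially. e n < a"
 by eventually_elim linarith
 qed
 then have "(%n. en (e n)) -->> en N" by (rule tendsto_ennrealI)
 then show ?thesis unfolding N(1) using ef by (simp add: tendsto_cong)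
qed

text \<open>Jensen for the unnormalised density \<open>w\<close>: the tangent inequality at the
  weighted mean is integrated against \<open>w\<close>. Where \<open>w * g\<close> has no integral,
  the Bochner integral on the left is 0 by convention.\<close>

lemma jensen_weight:
 fixes w g :: "'a => real"
 assumes [measurable]: "g \<in> borel_measurable M" and w: "integrable M w"
 and pos: "!!x. 0 <= w x" "!!x. 0 <= g x" and p: "1 < p"
 shows "en ((LINT x|M. w x * g x) powr p) <=
 en ((LINT x|M. w x) powr (p - 1)) * (\<integral>\<^sup>+x. en (w x * g x powr p) \<partial>M)"
proof -
 note [measurable] = borel_measurable_integrable[OF w]
 define A where "A = (LINT x|M. w x)"
 define S where "S = (LINT x|M. w x * g x)"
 have A0: "0 <= A" unfolding A_def by (simp add: pos)
 have S0: "0 <= S" unfolding S_def by (simp add: pos)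
 show ?thesis
 proof (cases "A = 0 \<or> \<not> integrable M (%x. w x * g x)")
 case True
 then have "S = 0"
 proof
 assume "A = 0"
 then have "AE x in M. w x = 0" using integral_nonneg_eq_0_iff_AE[OF w] pos by (simp add: A_def)
 then have "AE x in M. w x * g x = 0" by auto
 then show "S = 0" unfolding S_def by (rule integral_eq_zero_AE)
 qed (simp add: S_def not_integrable_integral_eq)
 then show ?thesis by (simp add: S_def)
 next
 case False
 then have A: "0 < A" and wg: "integrable M (%x. w x * g x)" using A0 by auto
 show ?thesis
 proof (cases "(\<integral>\<^sup>+x. en (w x * g x powr p) \<partial>M) = \<infinity>")
 case True
 then show ?thesis using A by (simp add: A_def[symmetric] ennreal_mult_top)
 next
 case False
 have wgp: "integrable M (%x. w x * g x powr p)"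
 by (rule integrableI_nonneg) (use pos False in \<open>auto simp: less_top\<close>)
 define m where "m = S / A"
 have m: "0 <= m" "S = m * A" using S0 A by (auto simp: m_def)
 have "(LINT x|M. p * m powr (p - 1) * (w x * g x) - (p - 1) * m powr p * w x) <= (LINT x|M. w x * g x powr p)"
 proof (rule integral_mono)
 fix x
 have "w x * (p * g x * m powr (p - 1)) <= w x * (g x powr p + (p - 1) * m powr p)"
 using powr_tangent[OF p pos(2) m(1), of x] by (intro mult_left_mono) (auto simp: pos)
 then show "p * m powr (p - 1) * (w x * g x) - (p - 1) * m powr p * w x <= w x * g x powr p"
 by (simp add: algebra_simps)
 qed (use wg w wgp in auto)
 also have "(LINT x|M. p * m powr (p - 1) * (w x * g x) - (p - 1) * m powr p * w x) =
 p * m powr (p - 1) * S - (p - 1) * m powr p * A"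
 using wg w by (simp add: S_def A_def)
 also have "p * m powr (p - 1) * S - (p - 1) * m powr p * A = m powr p * A"
 proof -
 have "m powr (p - 1) * S = m powr p * A"
 using m p by (cases "m = 0") (auto simp: powr_diff)
 then have "p * m powr (p - 1) * S = p * (m powr p * A)" by (simp add: mult.assoc)
 then show ?thesis by (simp add: algebra_simps)
 qed
 finally have "m powr p * A <= (LINT x|M. w x * g x powr p)" .
 then have "A powr (p - 1) * (m powr p * A) <= A powr (p - 1) * (LINT x|M. w x * g x powr p)"
 by (intro mult_left_mono) auto
 moreover have "A powr (p - 1) * (m powr p * A) = S powr p"
 using m A by (simp add: powr_mult powr_diff)
 ultimately have "S powr p <= A powr (p - 1) * (LINT x|M. w x * g x powr p)" by simp
 then have "en (S powr p) <= en (A powr (p - 1) * (LINT x|M. w x * g x powr p))" by (rule ennreal_leI)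
 also have "... = en (A powr (p - 1)) * (\<integral>\<^sup>+x. en (w x * g x powr p) \<partial>M)"
 using nn_integral_eq_integral[OF wgp] pos by (simp add: ennreal_mult'')
 finally show ?thesis by (simp add: S_def A_def)
 qed
 qed
qed

lemma holder:
 fixes f g :: "'a => real"
 assumes [measurable]: "f \<in> borel_measurable M" "g \<in> borel_measurable M"
 and pq: "1 < p" "1 / p + 1 / q = 1" and fin: "pint M p f <= en A" "pint M q g <= en B" "0 <= A" "0 <= B"
 shows "integrable M (%x. f x * g x)" "(LINT x|M. \<bar>f x * g x\<bar>) <= A powr (1 / p) * B powr (1 / q)"
proof -
 have "1 / q = 1 - 1 / p" using pq by simp
 moreover have "0 < 1 / p" "1 / p < 1" using pq by auto
 ultimately have "0 < 1 / q" "1 / q < 1" by linarith+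
 then have q: "1 < q" by (simp add: zero_less_divide_iff divide_less_eq split: if_splits)
 have e: "(\<integral>\<^sup>+x. en \<bar>f x * g x\<bar> \<partial>M) <= en (s powr p / p * A + s powr (- q) / q * B)" if s: "0 < s" for s
 proof -
 have "(\<integral>\<^sup>+x. en \<bar>f x * g x\<bar> \<partial>M) <=
 (\<integral>\<^sup>+x. en (s powr p / p) * en (norm (f x) powr p) + en (s powr (- q) / q) * en (norm (g x) powr q) \<partial>M)"
 proof (rule nn_integral_mono)
 fix x
 have "(s * \<bar>f x\<bar>) * (\<bar>g x\<bar> / s) <= (s * \<bar>f x\<bar>) powr p / p + (\<bar>g x\<bar> / s) powr q / q"
 using pq q s by (intro Youngs_inequality) auto
 then have "\<bar>f x * g x\<bar> <= s powr p / p * \<bar>f x\<bar> powr p + s powr (- q) / q * \<bar>g x\<bar> powr q"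
 using s by (simp add: powr_mult powr_divide powr_minus abs_mult field_simps)
 then show "en \<bar>f x * g x\<bar> <= en (s powr p / p) * en (norm (f x) powr p) +
 en (s powr (- q) / q) * en (norm (g x) powr q)"
 using pq q by (simp flip: ennreal_mult ennreal_plus)
 qed
 also have "... = en (s powr p / p) * pint M p f + en (s powr (- q) / q) * pint M q g"
 unfolding pint_def by (simp add: nn_integral_add nn_integral_cmult)
 also have "... <= en (s powr p / p) * en A + en (s powr (- q) / q) * en B"
 by (intro add_mono mult_left_mono fin) auto
 also have "... = en (s powr p / p * A + s powr (- q) / q * B)"
 using pq q fin by (simp flip: ennreal_mult ennreal_plus)
 finally show ?thesis .
 qed
 show i: "integrable M (%x. f x * g x)"
 using e[of 1] by (intro integrableI_bounded) (auto simp: le_less_trans[OF _ ennreal_less_top])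
 have E: "(LINT x|M. \<bar>f x * g x\<bar>) <= s powr p / p * A + s powr (- q) / q * B" if "0 < s" for s
 proof -
 have "0 <= s powr p / p * A + s powr (- q) / q * B" using fin pq q by simp
 moreover have "(\<integral>\<^sup>+x. en \<bar>f x * g x\<bar> \<partial>M) = en (LINT x|M. \<bar>f x * g x\<bar>)"
 using i by (intro nn_integral_eq_integral) auto
 ultimately show ?thesis using e[OF that] by simp
 qed
 show "(LINT x|M. \<bar>f x * g x\<bar>) <= A powr (1 / p) * B powr (1 / q)"
 proof (cases "A = 0 \<or> B = 0")
 case False
 then have AB: "0 < A" "0 < B" using fin by auto
 \<comment> \<open>The minimiser of the bound in \<open>E\<close>; it makes s powr p * A and s powr
   (- q) * B both equal to A powr (1 / p) * B powr (1 / q).\<close>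
 define s where "s = B powr (1 / (p * q)) * A powr (- 1 / (p * q))"
 have s: "0 < s" using AB by (simp add: s_def)
 have p1: "1 / q = 1 - 1 / p" "1 / p = 1 - 1 / q" using pq by auto
 have "1 / (p * q) * p = 1 / q" "- 1 / (p * q) * p = - 1 / q"
 "1 / (p * q) * (- q) = - 1 / p" "- 1 / (p * q) * (- q) = 1 / p"
 using pq q by simp_all
 then have sp: "s powr p = B powr (1 / q) * A powr (- 1 / q)" "s powr (- q) = B powr (- 1 / p) * A powr (1 / p)"
 using AB unfolding s_def by (simp_all only: powr_mult powr_powr)
 have "s powr p * A = B powr (1 / q) * A powr (1 - 1 / q)"
 using AB by (simp add: sp powr_diff powr_minus field_simps)
 also have "... = A powr (1 / p) * B powr (1 / q)" by (simp flip: p1)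
 finally have 1: "s powr p * A = A powr (1 / p) * B powr (1 / q)" .
 have "s powr (- q) * B = B powr (1 - 1 / p) * A powr (1 / p)"
 unfolding sp(2) using AB by (simp add: powr_diff powr_minus field_simps)
 also have "... = A powr (1 / p) * B powr (1 / q)" by (simp flip: p1)
 finally have 2: "s powr (- q) * B = A powr (1 / p) * B powr (1 / q)" .
 have "(LINT x|M. \<bar>f x * g x\<bar>) <= (s powr p * A) * (1 / p) + (s powr (- q) * B) * (1 / q)"
 using E[OF s] by simp
 also have "... = A powr (1 / p) * B powr (1 / q) * (1 / p + 1 / q)"
 unfolding 1 2 by (simp add: distrib_left)
 finally show ?thesis using pq by simp
 next
 case True
 have z: "pint M r h = 0 ==> AE x in M. h x = 0" if [measurable]: "h \<in> borel_measurable M" for h :: "'a => real" and r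
 using pint_eq_0_iff[of h M r] by simp
 have "AE x in M. f x * g x = 0"
 using True fin z[of f p] z[of g q] by auto
 then have "(LINT x|M. \<bar>f x * g x\<bar>) = 0" by (intro integral_eq_zero_AE) auto
 then show ?thesis by simp
 qed
qed

text \<open>Completeness: a subsequence with fast decaying increments converges almost everywhere, and
 Fatou's lemma controls the distance to the limit.\<close>

lemma riesz_fischer:
 fixes F :: "nat => 'a => 'b::{banach, second_countable_topology}"
 assumes [measurable]: "!!n. F n \<in> borel_measurable M" and p: "1 < p"
 and fin: "!!n. pint M p (F n) < \<infinity>"
 and cauchy: "!!e. 0 < e ==> EX N. ALL m>=N. ALL n>=N. pint M p (%x. F m x - F n x) <= en e"
 obtains f where "f \<in> borel_measurable M" "pint M p f < \<infinity>" "(%n. pint M p (%x. F n x - f x)) -->> 0"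
proof -
 \<comment> \<open>The first factor compensates the weight 2 powr (p * k) in \<open>h\<close>, and
   the second leaves a convergent geometric series. Finiteness of the weighted sum at a point then
   bounds the increments there by a multiple of (1/2) ^ k.\<close>
 define c :: "nat => real" where "c k = 2 powr (- (p * k)) * (1/2) ^ k" for k
 have c: "0 < c k" for k by (simp add: c_def)
 have "EX N. ALL k. (ALL m>=N k. ALL n>=N k. pint M p (%x. F m x - F n x) <= en (c k))"
 using cauchy[OF c] by metis
 then obtain N0 where N0: "!!k m n. m >= N0 k ==> n >= N0 k ==> pint M p (%x. F m x - F n x) <= en (c k)"
 by metis
 define N where "N k = (\<Sum>i\<le>k. N0 i) + k" for k
 have N: "N0 k <= N k" "N k <= N (Suc k)" "k <= N k" for k
 unfolding N_def by (auto intro: order.trans[OF member_le_sum[of k "{..k}" N0]])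
 have G: "pint M p (%x. F (N (Suc k)) x - F (N k) x) <= en (c k)" for k
 using N[of k] by (intro N0) auto
 define h where "h k x = 2 powr (p * k) * norm (F (N (Suc k)) x - F (N k) x) powr p" for k x
 have "(\<integral>\<^sup>+x. (\<Sum>k. en (h k x)) \<partial>M) = (\<Sum>k. \<integral>\<^sup>+x. en (h k x) \<partial>M)"
 unfolding h_def by (intro nn_integral_suminf) measurable
 also have "... <= (\<Sum>k. en ((1/2) ^ k))"
 proof (rule suminf_le)
 fix k
 have "(\<integral>\<^sup>+x. en (h k x) \<partial>M) = en (2 powr (p * k)) * pint M p (%x. F (N (Suc k)) x - F (N k) x)"
 unfolding h_def pint_def by (simp add: ennreal_mult nn_integral_cmult)
 also have "... <= en (2 powr (p * k)) * en (c k)" by (intro mult_left_mono G) auto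
 also have "... = en ((1/2) ^ k)" by (simp add: c_def powr_minus flip: ennreal_mult)
 finally show "(\<integral>\<^sup>+x. en (h k x) \<partial>M) <= en ((1/2) ^ k)" .
 qed auto
 also have "... = en (\<Sum>k. (1/2) ^ k)" by (rule suminf_ennreal2) auto
 also have "... < \<infinity>" by simp
 finally have "(\<integral>\<^sup>+x. (\<Sum>k. en (h k x)) \<partial>M) < \<infinity>" .
 then have "AE x in M. (\<Sum>k. en (h k x)) ~= \<infinity>"
 by (intro nn_integral_PInf_AE) (auto simp: h_def)
 then have conv: "AE x in M. convergent (%k. F (N k) x)"
 proof eventually_elim
 case (elim x)
 define B where "B = enn2real (\<Sum>k. en (h k x))"
 have hB: "h k x <= B" for k
 proof -
 have "en (h k x) <= (\<Sum>k. en (h k x))"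
 using sum_le_suminf[of "%k. en (h k x)" "{k}"] by simp
 also have "... = en B" using elim by (simp add: B_def less_top)
 finally show ?thesis by (simp add: B_def)
 qed
 have B0: "0 <= B" by (simp add: B_def)
 have le: "norm (F (N (Suc k)) x - F (N k) x) <= B powr (1 / p) * (1 / 2) ^ k" for k
 proof -
 have "norm (F (N (Suc k)) x - F (N k) x) powr p <= 2 powr (- (p * k)) * B"
 using hB[of k] by (simp add: h_def powr_minus field_simps)
 then have "(norm (F (N (Suc k)) x - F (N k) x) powr p) powr (1 / p) <= (2 powr (- (p * k)) * B) powr (1 / p)"
 using p by (intro powr_mono2) auto
 also have "(2 powr (- (p * k)) * B) powr (1 / p) = 2 powr (- real k) * B powr (1 / p)"
 using p B0 by (simp add: powr_mult powr_powr)
 finally show ?thesis using p by (simp add: powr_powr powr_minus powr_realpow field_simps)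
 qed
 have "summable (%k. F (N (Suc k)) x - F (N k) x)"
 by (rule summable_comparison_test'[OF _ le]) (auto intro: summable_mult)
 then have "convergent (%n. \<Sum>k<n. F (N (Suc k)) x - F (N k) x)" by (simp add: summable_iff_convergent)
 then have "convergent (%n. (F (N n) x - F (N 0) x) + F (N 0) x)"
 unfolding sum_lessThan_telescope[of "%k. F (N k) x"] by (intro convergent_add convergent_const)
 then show ?case by simp
 qed
 define f where "f x = lim (%k. F (N k) x)" for x
 have [measurable]: "f \<in> borel_measurable M" unfolding f_def by measurable
 have lim: "AE x in M. (%k. F (N k) x) -->> f x"
 using conv by eventually_elim (simp add: f_def convergent_LIMSEQ_iff)
 have F: "pint M p (%x. F m x - f x) <= en e"
 if "ALL m>=N'. ALL n>=N'. pint M p (%x. F m x - F n x) <= en e" "m >= N'" for m e N'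
 proof -
 have "pint M p (%x. F m x - f x) <= (\<integral>\<^sup>+x. liminf (%k. en (norm (F m x - F (N k) x) powr p)) \<partial>M)"
 unfolding pint_def
 proof (rule nn_integral_mono_AE)
 show "AE x in M. en (norm (F m x - f x) powr p) <= liminf (%k. en (norm (F m x - F (N k) x) powr p))"
 using lim
 proof eventually_elim
 case (elim x)
 have "(%k. en (norm (F m x - F (N k) x) powr p)) -->> en (norm (F m x - f x) powr p)"
 using p by (intro tendsto_ennrealI tendsto_powr2 tendsto_intros elim) auto
 from lim_imp_Liminf[OF _ this] show ?case by simp
 qed
 qed
 also have "... <= liminf (%k. pint M p (%x. F m x - F (N k) x))"
 unfolding pint_def by (intro nn_integral_liminf) simp
 also have "... <= en e"
 proof (intro Liminf_le)
 show "\<forall>\<^sub>F k in sequentially. pint M p (%x. F m x - F (N k) x) <= en e"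
 using eventually_ge_at_top[of N']
 proof eventually_elim
 case (elim k)
 then show ?case using that N(3)[of k] by (meson order_trans)
 qed
 qed simp
 finally show ?thesis .
 qed
 have lim0: "(%n. pint M p (%x. F n x - f x)) -->> 0"
 proof (rule order_tendstoI)
 fix a :: ennreal assume "0 < a"
 have "EX e::real. 0 < e & en e < a"
 proof (cases a)
 case (real r)
 then show ?thesis using \<open>0 < a\<close> by (intro exI[of _ "r / 2"]) (auto simp: ennreal_less_iff)
 next
 case top
 then show ?thesis by (intro exI[of _ 1]) auto
 qed
 then obtain e :: real where e: "0 < e" "en e < a" by blast
 obtain N' where "ALL m>=N'. ALL n>=N'. pint M p (%x. F m x - F n x) <= en e" using cauchy[OF e(1)] by blast
 from F[OF this] e(2) show "\<forall>\<^sub>F n in sequentially. pint M p (%x. F n x - f x) < a"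
 unfolding eventually_sequentially by (meson le_less_trans)
 qed auto
 moreover have "pint M p f < \<infinity>"
 proof -
 have "\<forall>\<^sub>F n in sequentially. pint M p (%x. F n x - f x) < 1"
 using order_tendstoD(2)[OF lim0] by simp
 then obtain n where n: "pint M p (%x. F n x - f x) < 1" by (auto simp: eventually_sequentially)
 have "pint M p (%x. F n x - (F n x - f x)) < \<infinity>"
 proof (rule pint_diff_finite)
 show "pint M p (%x. F n x - f x) < \<infinity>" using n order_less_trans[of _ 1] by fastforce
 qed (use p fin in auto)
 then show ?thesis by simp
 qed
 ultimately show ?thesis using that[of f] by simp
qed

section \<open>Fundamental theorem and Fubini on the line\<close>

lemma integral_FTC_real_line:
 fixes f F :: "real => 'a::euclidean_space"
 assumes "!!x. (F has_vector_derivative f x) (at x)" "!!x. isCont f x" "intg f"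
 and "(F ->> A) at_bot" "(F ->> B) at_top"
 shows "(LI x. f x) = B - A"
proof -
 have "(LBINT x=-\<infinity>..\<infinity>. f x) = B - A"
 by (rule interval_integral_FTC_integrable)
 (use assms in \<open>auto simp: ereal_tendsto_simps set_integrable_def\<close>)
 then show ?thesis by (simp add: interval_lebesgue_integral_def set_lebesgue_integral_def)
qed

lemma fubini_lborel:
 fixes f :: "real => real => 'b::{banach, second_countable_topology}"
 assumes [measurable]: "case_prod f \<in> borel_measurable (lborel \<Otimes>\<^sub>M lborel)"
 and fin: "(NN x. (NN y. en (norm (f x y)))) < \<infinity>"
 shows "(LI y. LI x. f x y) = (LI x. LI y. f x y)"
 "AEL x. intg (f x)"
 "AEL y. intg (%x. f x y)"
 "intg (%x. LI y. f x y)"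
 "intg (%y. LI x. f x y)"
proof -
 have "integrable (lborel \<Otimes>\<^sub>M lborel) (case_prod f)"
 proof (rule integrableI_bounded)
 have "(\<integral>\<^sup>+z. en (norm (case_prod f z)) \<partial>(lborel \<Otimes>\<^sub>M lborel)) =
 (NN x. (NN y. en (norm (f x y))))"
 by (subst lborel.nn_integral_fst[symmetric]) auto
 then show "(\<integral>\<^sup>+z. en (norm (case_prod f z)) \<partial>(lborel \<Otimes>\<^sub>M lborel)) < \<infinity>" using fin by simp
 qed simp
 then show "(LI y. LI x. f x y) = (LI x. LI y. f x y)"
 "AEL x. intg (f x)"
 "AEL y. intg (%x. f x y)"
 "intg (%x. LI y. f x y)"
 "intg (%y. LI x. f x y)"
 by (rule lborel_pair.Fubini_integral lborel_pair.AE_integrable_fst lborel_pair.AE_integrable_snd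
 lborel_pair.integrable_fst lborel_pair.integrable_snd)+
qed

lemma tonelli_lborel:
 fixes f :: "real => real => ennreal"
 assumes [measurable]: "case_prod f \<in> borel_measurable (lborel \<Otimes>\<^sub>M lborel)"
 shows "(NN y. (NN x. f x y)) = (NN x. (NN y. f x y))"
 by (rule lborel_pair.Fubini') simp

section \<open>Poisson and conjugate Poisson kernels of the upper half plane\<close>

text \<open>Real and imaginary part of i / (pi (s + i y)). As \<open>y\<close> tends to 0,
  convolution with \<open>Pk y\<close> approaches the identity and convolution with
  \<open>Qk y\<close> the Hilbert transform.\<close>

definition Pk :: "real => real => real" where "Pk y s = y / (pi * (s^2 + y^2))"
definition Qk :: "real => real => real" where "Qk y s = s / (pi * (s^2 + y^2))"
definition conv :: "(real => real) => (real => 'b::{banach, second_countable_topology}) => real => 'b"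
 where "conv k f x = (LI t. k (x - t) *R f t)"

text \<open>The weight 1 / (1 + |t|) matches the slowest decay among the kernels in use, so
  convolutions with \<open>Pk\<close>, \<open>Qk\<close> and the truncated Hilbert kernel converge
  at every point. By \<open>Lp_hadm\<close> this covers every exponent p > 1.\<close>

definition hadm :: "(real => 'b::{banach, second_countable_topology}) => bool"
 where "hadm f \<longleftrightarrow> f \<in> borel_measurable borel & intg (%t. (1 / (1 + \<bar>t\<bar>)) *R f t)"

lemma Pk_measurable [measurable]: "bm (Pk y)" unfolding Pk_def by measurable
lemma Qk_measurable [measurable]: "bm (Qk y)" unfolding Qk_def by measurable

lemma Pk_nonneg [simp]: "0 <= y ==> 0 <= Pk y s" by (simp add: Pk_def)

lemma sq_pos: "0 < y ==> 0 < s^2 + y^2" for y s :: real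
 by (simp add: add_nonneg_pos)

lemma Pk_FTC: assumes y: "0 < y"
 shows "((%s. arctan (s / y) / pi) has_real_derivative Pk y s) (at s)"
proof -
 have "((%s. arctan (s / y) / pi) has_real_derivative inverse (1 + (s / y)^2) * (1 / y) / pi) (at s)"
 using y by (auto intro!: derivative_eq_intros)
 moreover have "inverse (1 + (s / y)^2) * (1 / y) / pi = Pk y s"
 using y sq_pos[OF y, of s] by (simp add: Pk_def divide_simps power2_eq_square)
 ultimately show ?thesis by simp
qed

lemma Pk_nn_integral: assumes y: "0 < y" shows "(NN s. en (Pk y s)) = 1"
proof -
 have lim: "((%s. arctan (s / y) / pi) ->> (pi / 2) / pi) at_top"
 by (intro tendsto_divide tendsto_const filterlim_compose[OF tendsto_arctan_at_top]
 filterlim_at_top_mult_tendsto_pos[of "%x. 1 / y" "1 / y" _ "%x. x", simplified]) (use y in \<open>auto simp: filterlim_ident\<close>)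
 have h: "(NN s. en (Pk y s) * indicator {0..} s) = en (1 / 2)"
 using nn_integral_FTC_atLeast[where F="%s. arctan (s / y) / pi" and f="Pk y" and a=0, OF _ Pk_FTC[OF y] _ lim] y by simp
 have "(NN s. en (Pk y s)) =
 (NN s. en (Pk y s) * indicator {0..} s) + (NN s. en (Pk y s) * indicator {..<0} s)"
 by (subst nn_integral_add[symmetric]) (auto intro!: nn_integral_cong split: split_indicator)
 also have "(NN s. en (Pk y s) * indicator {..<0} s) = (NN s. en (Pk y (0 + (-1) * s)) * indicator {..<0} (0 + (-1) * s))"
 by (subst nn_integral_real_affine[where c="-1" and t=0]) auto
 also have "... = en (1 / 2)"
 unfolding h[symmetric] by (rule nn_integral_cong_AE) (use AE_lborel_singleton[of "0::real"] in \<open>eventually_elim, auto simp: Pk_def split: split_indicator\<close>)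
 finally show ?thesis unfolding h by (metis add_divide_distrib ennreal_1 ennreal_plus field_sum_of_halves zero_le_divide_1_iff zero_le_numeral)
qed

lemma Pk_integrable: assumes y: "0 < y" shows "intg (Pk y)"
 by (rule integrableI_nonneg) (use y Pk_nn_integral[OF y] in auto)

lemma Pk_integral: assumes y: "0 < y" shows "(LI s. Pk y s) = 1"
 using Pk_nn_integral[OF y] nn_integral_eq_integral[OF Pk_integrable[OF y]] y by simp

lemma integral_reflect_shift:
 fixes f :: "real => 'b::{banach, second_countable_topology}"
 shows "(LI t. f (x - t)) = (LI t. f t)"
 using lborel_integral_real_affine[of "-1" f x] by simp

lemma integrable_reflect_shift:
 fixes f :: "real => 'b::{banach, second_countable_topology}"
 shows "intg f ==> intg (%t. f (x - t))"
 using lborel_integrable_real_affine[of f "-1" x] by simp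

lemma nn_integral_reflect_shift:
 fixes x :: real
 assumes [measurable]: "bm f"
 shows "(NN t. f (x - t)) = (NN t. f t)"
 using nn_integral_real_affine[of f "-1" x] by simp

lemma nn_integral_shift:
 fixes x :: real
 assumes [measurable]: "bm f"
 shows "(NN t. f (t - x)) = (NN t. f t)"
 using nn_integral_real_affine[of f 1 "-x"] by simp

lemma kernel_bound:
 fixes x y t :: real
 assumes "0 < y"
 shows "1 / sqrt ((x - t)^2 + y^2) <= ((1 + \<bar>x\<bar>) / y + 1) * (1 / (1 + \<bar>t\<bar>))"
proof -
 define d where "d = sqrt ((x - t)^2 + y^2)"
 have d: "y <= d" "\<bar>x - t\<bar> <= d" unfolding d_def using assms by (auto intro!: real_le_rsqrt)
 have "1 + \<bar>t\<bar> <= (1 + \<bar>x\<bar>) + \<bar>x - t\<bar>" by linarith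
 also have "... <= (1 + \<bar>x\<bar>) / y * d + d"
 proof -
 have "(1 + \<bar>x\<bar>) * 1 <= (1 + \<bar>x\<bar>) * (d / y)"
 using d assms by (intro mult_left_mono) (auto simp: field_simps)
 then show ?thesis using d by simp
 qed
 finally have "1 + \<bar>t\<bar> <= ((1 + \<bar>x\<bar>) / y + 1) * d" by (simp add: algebra_simps)
 moreover have "1 / d <= c * (1 / u)" if "u <= c * d" "0 < u" for c u
 using that d assms by (simp add: field_simps)
 ultimately show ?thesis unfolding d_def[symmetric] by simp
qed

lemma Qk_bound: assumes "0 < y" shows "\<bar>Qk y s\<bar> <= 1 / sqrt (s^2 + y^2)"
proof -
 define d where "d = sqrt (s^2 + y^2)"
 have d: "d^2 = s^2 + y^2" "\<bar>s\<bar> <= d" "0 < d" using sq_pos[OF assms, of s] by (auto simp: d_def intro!: real_le_rsqrt)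
 have "\<bar>Qk y s\<bar> = \<bar>s\<bar> / (pi * d^2)" by (simp add: Qk_def d(1) abs_mult)
 also have "... <= d / (1 * d^2)"
 using d(2,3) pi_ge_two by (intro frac_le mult_mono) auto
 also have "d / (1 * d^2) = 1 / d" using d(3) by (simp add: power2_eq_square)
 finally show ?thesis by (simp add: d_def)
qed

lemma Pk_bound: assumes "0 < y" shows "\<bar>Pk y s\<bar> <= 1 / sqrt (s^2 + y^2)"
proof -
 define d where "d = sqrt (s^2 + y^2)"
 have d: "d^2 = s^2 + y^2" "\<bar>y\<bar> <= d" "0 < d" using sq_pos[OF assms, of s] by (auto simp: d_def intro!: real_le_rsqrt)
 have "\<bar>Pk y s\<bar> = \<bar>y\<bar> / (pi * d^2)" by (simp add: Pk_def d(1) abs_mult)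
 also have "... <= d / (1 * d^2)"
 using d(2,3) pi_ge_two by (intro frac_le mult_mono) auto
 also have "d / (1 * d^2) = 1 / d" using d(3) by (simp add: power2_eq_square)
 finally show ?thesis by (simp add: d_def)
qed

lemma hadm_integrable:
 fixes f :: "real => 'b::{banach, second_countable_topology}"
 assumes f: "hadm f" and [measurable]: "bm k" and k: "!!t. \<bar>k t\<bar> <= C * (1 / (1 + \<bar>t\<bar>))"
 shows "intg (%t. k t *R f t)"
proof (rule b_integrable_bound)
 show "intg (%t. C *R ((1 / (1 + \<bar>t\<bar>)) *R f t))" using f unfolding hadm_def by (intro integrable_scaleR_right) auto
 have [measurable]: "bm f" using f by (simp add: hadm_def)
 show "(%t. k t *R f t) \<in> borel_measurable lborel" by measurable
 have "norm (k t *R f t) <= norm (C *R ((1 / (1 + \<bar>t\<bar>)) *R f t))" for t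
 proof -
 have "norm (k t *R f t) <= (C * (1 / (1 + \<bar>t\<bar>))) * norm (f t)" unfolding norm_scaleR real_norm_def by (intro mult_right_mono k) auto
 also have "... <= \<bar>C * (1 / (1 + \<bar>t\<bar>))\<bar> * norm (f t)" by (intro mult_right_mono abs_ge_self) auto
 finally show ?thesis by (simp add: abs_mult)
 qed
 then show "AEL t. norm (k t *R f t) <= norm (C *R ((1 / (1 + \<bar>t\<bar>)) *R f t))" by simp
qed

lemma hadm_Qk: "hadm f ==> 0 < y ==> intg (%t. Qk y (x - t) *R f t)"
 by (rule hadm_integrable[OF _ _ order.trans[OF Qk_bound kernel_bound]]) auto

lemma hadm_Pk: "hadm f ==> 0 < y ==> intg (%t. Pk y (x - t) *R f t)"
 by (rule hadm_integrable[OF _ _ order.trans[OF Pk_bound kernel_bound]]) auto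

lemma hadm_measurable: "hadm f ==> f \<in> borel_measurable borel" by (simp add: hadm_def)

lemma hadm_norm:
 assumes "hadm f" shows "hadm (%t. norm (f t))"
 using integrable_norm[of lborel "%t. (1 / (1 + \<bar>t\<bar>)) *R f t"] assms unfolding hadm_def by (auto simp: abs_mult)

lemma hadm_cmult: "hadm f ==> hadm (%t. c * f t)" for f :: "real => 'b::{real_normed_field, banach, second_countable_topology}"
proof -
 have "(1 / (1 + \<bar>t\<bar>)) *R (c * f t) = c * ((1 / (1 + \<bar>t\<bar>)) *R f t)" for t by simp
 then show "hadm f ==> hadm (%t. c * f t)" unfolding hadm_def by (auto simp del: mult_scaleR_right)
qed

lemma hadm_bounded_linear: "bounded_linear L ==> hadm f ==> hadm (%t. L (f t))"
proof -
 assume L: "bounded_linear L" and f: "hadm f"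
 have [measurable]: "bm L"
 by (intro borel_measurable_continuous_onI linear_continuous_on L)
 have "intg (%t. L ((1 / (1 + \<bar>t\<bar>)) *R f t))"
 using f unfolding hadm_def by (intro integrable_bounded_linear[OF L]) auto
 then show ?thesis using f unfolding hadm_def linear_cmul[OF bounded_linear.linear[OF L]] by auto
qed

lemma Re_conv:
 assumes "intg (%t. k (x - t) *R f t)"
 shows "Re (conv k f x) = conv k (%t. Re (f t)) x"
 unfolding conv_def using integral_Re[OF assms] by simp

lemma conv_cmult: "conv k (%t. c * f t) x = c * conv k f x"
 for f :: "real => 'b::{real_normed_field, banach, second_countable_topology}"
proof -
 have "conv k (%t. c * f t) x = (LI t. c * (k (x - t) *R f t))" by (simp add: conv_def)
 also have "... = c * conv k f x" unfolding conv_def by (rule integral_mult_right_zero)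
 finally show ?thesis .
qed

lemma conv_measurable [measurable]:
 fixes f :: "real => 'b::{banach, second_countable_topology}"
 assumes [measurable]: "bm k" "bm f"
 shows "bm (conv k f)"
 unfolding conv_def by measurable

lemma nn_integral_one_plus_powr:
 assumes q: "1 < q"
 shows "(NN t. en ((1 + \<bar>t\<bar>) powr (- q))) < \<infinity>"
proof -
 have lim: "((%s. (1 + s) powr (1 - q) / (1 - q)) ->> 0 / (1 - q)) at_top"
 proof (intro tendsto_divide tendsto_const)
 show "((%s. (1 + s) powr (1 - q)) ->> 0) at_top"
 by (rule tendsto_neg_powr) (use q in \<open>auto intro!: filterlim_tendsto_add_at_top[OF tendsto_const] filterlim_ident\<close>)
 qed (use q in auto)
 have h: "(NN s. en ((1 + s) powr (- q)) * indicator {0..} s) = en (0 / (1 - q) - (1 + 0) powr (1 - q) / (1 - q))"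
 by (rule nn_integral_FTC_atLeast[OF _ _ _ lim])
 (use q in \<open>auto intro!: derivative_eq_intros\<close>)
 have "(NN t. en ((1 + \<bar>t\<bar>) powr (- q))) <=
 (NN s. en ((1 + s) powr (- q)) * indicator {0..} s + en ((1 + (- s)) powr (- q)) * indicator {0..} (- s))"
 by (rule nn_integral_mono) (auto split: split_indicator)
 also have "... = (NN s. en ((1 + s) powr (- q)) * indicator {0..} s) +
 (NN s. en ((1 + (- s)) powr (- q)) * indicator {0..} (- s))"
 by (rule nn_integral_add) auto
 also have "(NN s. en ((1 + (- s)) powr (- q)) * indicator {0..} (- s)) =
 (NN s. en ((1 + s) powr (- q)) * indicator {0..} s)"
 using nn_integral_reflect_shift[of "%s. en ((1 + s) powr (- q)) * indicator {0..} s" 0] by simp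
 also have "... + ... < \<infinity>" unfolding h by simp
 finally show ?thesis .
qed

lemma conj_exponent:
 fixes p :: real assumes "1 < p"
 obtains q where "1 < q" "1 / p + 1 / q = 1" "q = p / (p - 1)"
 using assms by (intro that[of "p / (p - 1)"]) (auto simp: field_simps)

lemma Lp_hadm:
 fixes f :: "real => 'b::{banach, second_countable_topology}"
 assumes p: "1 < p" and [measurable]: "bm f" and fin: "pL p f < \<infinity>"
 shows "hadm f"
proof -
 obtain q where q: "1 < q" "1 / p + 1 / q = 1" using conj_exponent[OF p] by metis
 have "pL q (%t. 1 / (1 + \<bar>t\<bar>) :: real) = (NN t. en ((1 + \<bar>t\<bar>) powr (- q)))"
 unfolding pint_def by (rule nn_integral_cong) (simp add: powr_divide powr_minus field_simps)
 then have 1: "pL q (%t. 1 / (1 + \<bar>t\<bar>) :: real) < \<infinity>" using nn_integral_one_plus_powr[OF q(1)] by simp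
 have "intg (%t. norm (f t) * (1 / (1 + \<bar>t\<bar>)))"
 by (rule holder(1)[OF _ _ p q(2), where A="enn2real (pL p f)" and B="enn2real (pL q (%t. 1 / (1 + \<bar>t\<bar>) :: real))"])
 (use fin 1 in auto)
 then have "intg (%t. (1 / (1 + \<bar>t\<bar>)) *R f t)"
 by (rule b_integrable_bound) auto
 then show ?thesis by (simp add: hadm_def)
qed

text \<open>The kernel \<open>k'\<close> may change sign and is only dominated by \<open>k\<close>.
  Jensen is applied pointwise with weight k (x - t), and Tonelli integrates out \<open>x\<close>. As
  \<open>J\<close> is claimed at every point, points with a divergent integral are settled either by
  the default value 0 of the convolution or by an infinite right-hand side.\<close>

lemma young:
 fixes f :: "real => 'b::{banach, second_countable_topology}"
 assumes p: "1 < p" and [measurable]: "bm f"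
 and k: "intg k" "!!s. 0 <= k s" and k' [measurable]: "bm k'" "!!s. \<bar>k' s\<bar> <= k s"
 shows "pL p (conv k' f) <= en ((LI s. k s) powr p) * pL p f"
proof -
 have [measurable]: "bm k" using k by auto
 define A where "A = (LI s. k s)"
 have A: "0 <= A" unfolding A_def using k by simp
 have J: "en (norm (conv k' f x) powr p) <= en (A powr (p - 1)) * (NN t. en (k (x - t) * norm (f t) powr p))" for x
 proof -
 have B1: "norm (conv k' f x) <= (LI t. k (x - t) * norm (f t))" if "intg (%t. k (x - t) * norm (f t))"
 unfolding conv_def
 by (rule order.trans[OF integral_norm_bound integral_mono_AE'[OF that]])
 (use k k' in \<open>auto intro!: mult_right_mono\<close>)
 have B2: "norm (conv k' f x) = 0" if "\<not> intg (%t. k' (x - t) *R f t)"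
 using that by (simp add: conv_def not_integrable_integral_eq)
 have B3: "(NN t. en (k (x - t) * norm (f t) powr p)) = \<infinity> & A ~= 0"
 if ni: "\<not> intg (%t. k (x - t) * norm (f t))" and "intg (%t. k' (x - t) *R f t)"
 proof
 have kx: "intg (%t. k (x - t))" by (rule integrable_reflect_shift[OF k(1)])
 show "A ~= 0"
 proof
 assume "A = 0"
 then have "(LI t. k (x - t)) = 0" by (simp add: A_def integral_reflect_shift)
 then have "AEL t. k (x - t) = 0" using integral_nonneg_eq_0_iff_AE[OF kx] k by simp
 then have "AEL t. k (x - t) * norm (f t) = 0" by auto
 then have "intg (%t. k (x - t) * norm (f t)) \<longleftrightarrow> intg (%t::real. 0::real)"
 by (intro integrable_cong_AE) auto
 then show False using ni by simp
 qed
 show "(NN t. en (k (x - t) * norm (f t) powr p)) = \<infinity>"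
 proof (rule ccontr)
 assume fin: "(NN t. en (k (x - t) * norm (f t) powr p)) ~= \<infinity>"
 have "intg (%t. k (x - t) * norm (f t) powr p)"
 by (rule integrableI_nonneg) (use fin k in \<open>auto simp: less_top\<close>)
 then have "intg (%t. k (x - t) + k (x - t) * norm (f t) powr p)" using kx by simp
 then have "intg (%t. k (x - t) * norm (f t))"
 proof (rule b_integrable_bound)
 have "norm (k (x - t) * norm (f t)) <= norm (k (x - t) + k (x - t) * norm (f t) powr p)" for t
 proof -
 have "norm (f t) <= 1 + norm (f t) powr p"
 proof (cases "norm (f t) <= 1")
 case False
 then have "norm (f t) powr 1 <= norm (f t) powr p" using p by (intro powr_mono) auto
 then show ?thesis by simp
 qed (simp add: add_increasing2)
 then have "k (x - t) * norm (f t) <= k (x - t) * (1 + norm (f t) powr p)" using k by (intro mult_left_mono) auto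
 then show ?thesis using k by (simp add: distrib_left)
 qed
 then show "AEL t. norm (k (x - t) * norm (f t)) <= norm (k (x - t) + k (x - t) * norm (f t) powr p)" by simp
 qed simp
 then show False using ni by simp
 qed
 qed
 have "en ((LI t. k (x - t) * norm (f t)) powr p) <=
 en ((LI t. k (x - t)) powr (p - 1)) * (NN t. en (k (x - t) * norm (f t) powr p))"
 by (rule jensen_weight) (use k p integrable_reflect_shift in auto)
 note J0 = this[unfolded integral_reflect_shift A_def[symmetric]]
 show ?thesis
 proof (cases "intg (%t. k (x - t) * norm (f t))")
 case True
 have "norm (conv k' f x) powr p <= (LI t. k (x - t) * norm (f t)) powr p"
 using B1[OF True] p by (intro powr_mono2) auto
 then show ?thesis using J0 ennreal_leI order.trans by blast
 next
 case False
 then show ?thesis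
 using B2 B3 by (cases "intg (%t. k' (x - t) *R f t)") (auto simp: ennreal_mult_top)
 qed
 qed
 have "pL p (conv k' f) <= (NN x. en (A powr (p - 1)) * (NN t. en (k (x - t) * norm (f t) powr p)))"
 unfolding pint_def by (rule nn_integral_mono[OF J])
 also have "... = en (A powr (p - 1)) * (NN x. (NN t. en (k (x - t) * norm (f t) powr p)))"
 by (rule nn_integral_cmult) measurable
 also have "(NN x. (NN t. en (k (x - t) * norm (f t) powr p))) =
 (NN t. (NN x. en (k (x - t) * norm (f t) powr p)))"
 by (rule tonelli_lborel[symmetric]) measurable
 also have "... = (NN t. en A * en (norm (f t) powr p))"
 proof (rule nn_integral_cong)
 fix t
 have "(NN x. en (k (x - t) * norm (f t) powr p)) = (NN x. en (k (x - t))) * en (norm (f t) powr p)"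
 using k by (simp add: ennreal_mult nn_integral_multc)
 also have "(NN x. en (k (x - t))) = en A"
 using nn_integral_shift[of "%x. en (k x)" t] nn_integral_eq_integral[OF k(1)] k(2) by (simp add: A_def)
 finally show "(NN x. en (k (x - t) * norm (f t) powr p)) = en A * en (norm (f t) powr p)" .
 qed
 also have "... = en A * pL p f" unfolding pint_def by (rule nn_integral_cmult) measurable
 also have "en (A powr (p - 1)) * (en A * pL p f) = en (A powr p) * pL p f"
 proof -
 have "A powr (p - 1) * A = A powr p" using A p by (cases "A = 0") (auto simp: powr_diff)
 then have "en (A powr (p - 1)) * en A = en (A powr p)" using A by (simp flip: ennreal_mult)
 then show ?thesis by (simp flip: mult.assoc)
 qed
 finally show ?thesis by (simp add: A_def)
qed

lemma pint_Pk_le: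
 fixes f :: "real => 'b::{banach, second_countable_topology}"
 assumes "1 < p" "bm f" "0 < y"
 shows "pL p (conv (Pk y) f) <= pL p f"
 using young[OF assms(1,2) Pk_integrable[OF assms(3)], of "Pk y"] assms by (simp add: Pk_integral)

section \<open>Pichorides' inequality in the right half plane\<close>

text \<open>\<open>B\<close> is chosen so that (sin t powr p + B cos (p t)) / cos t powr p has a
  critical point at c = pi / (2 p), where cos (p c) = 0 and the quotient equals tan c powr p. That
  this point is the maximum comes from the monotonicity of (p - 1) ln (sin x) - ln (sin ((p - 1)
  x)), whose derivative is p - 1 times the difference of the cotangents at x and (p - 1) x <=
  x.\<close>

lemma pichorides_trig_aux:
 fixes p t :: real
 assumes p: "1 < p" "p <= 2" and t: "0 < t" "t < pi / 2"
 shows "sin t powr p <= tan (pi / (2 * p)) powr p * cos t powr p -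
 (sin (pi / (2 * p)) powr (p - 1) / cos (pi / (2 * p))) * cos (p * t)"
proof -
 define c where "c = pi / (2 * p)"
 define B where "B = sin c powr (p - 1) / cos c"
 have c: "0 < c" "c < pi / 2" "p * c = pi / 2" using p by (auto simp: c_def field_simps)
 have sc: "0 < sin c" "0 < cos c" using c by (auto intro: sin_gt_zero cos_gt_zero)
 have B: "0 < B" using sc by (simp add: B_def)
 define g where "g x = (p - 1) * ln (sin x) - ln (sin ((p - 1) * x))" for x
 have s1: "0 < sin x" "0 < sin ((p - 1) * x)" if "0 < x" "x < pi / 2" for x
 proof -
 have "(p - 1) * x <= 1 * x" using p that by (intro mult_right_mono) auto
 then have "(p - 1) * x <= x" by simp
 then have "(p - 1) * x < pi" using that by linarith
 then show "0 < sin x" "0 < sin ((p - 1) * x)" using p that by (auto intro!: sin_gt_zero)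
 qed
 have gd: "(g has_real_derivative (p - 1) * (cos x / sin x - cos ((p - 1) * x) / sin ((p - 1) * x))) (at x)"
 if "0 < x" "x < pi / 2" for x
 unfolding g_def using s1[OF that] by (auto intro!: derivative_eq_intros simp: field_simps)
 have gn: "(p - 1) * (cos x / sin x - cos ((p - 1) * x) / sin ((p - 1) * x)) <= 0" if x: "0 < x" "x < pi / 2" for x
 proof -
 have "(p - 1) * x <= 1 * x" "0 < (p - 1) * x" using p that by (auto intro!: mult_right_mono)
 then have "0 <= sin (x - (p - 1) * x)" using x by (intro sin_ge_zero) auto
 moreover have "cos x / sin x <= cos y / sin y" if "0 <= sin (x - y)" "0 < sin x" "0 < sin y" for y
 using that by (simp add: sin_diff field_simps)
 ultimately have "cos x / sin x <= cos ((p - 1) * x) / sin ((p - 1) * x)"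
 using s1[OF x] by blast
 then show ?thesis using p by (simp add: mult_nonneg_nonpos)
 qed
 have gmono: "g y <= g x" if "0 < x" "x <= y" "y < pi / 2" for x y
 by (rule DERIV_nonpos_imp_nonincreasing[OF that(2)])
 (use gd gn that in \<open>meson less_le_trans le_less_trans\<close>)
 have cmp: "sin x powr (p - 1) * sin ((p - 1) * y) >= sin y powr (p - 1) * sin ((p - 1) * x)"
 if "0 < x" "x <= y" "y < pi / 2" for x y
 proof -
 note sx = s1[of x] and sy = s1[of y]
 have "(p - 1) * ln (sin y) + ln (sin ((p - 1) * x)) <= (p - 1) * ln (sin x) + ln (sin ((p - 1) * y))"
 using gmono[OF that] by (simp add: g_def)
 then have "exp ((p - 1) * ln (sin y) + ln (sin ((p - 1) * x))) <= exp ((p - 1) * ln (sin x) + ln (sin ((p - 1) * y)))"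
 by (rule exp_le_cancel_iff[THEN iffD2])
 then have "exp ((p - 1) * ln (sin y)) * sin ((p - 1) * x) <= exp ((p - 1) * ln (sin x)) * sin ((p - 1) * y)"
 using sx sy that by (simp add: exp_add)
 then show ?thesis using sx sy that by (simp add: powr_def)
 qed
 have sp1: "sin ((p - 1) * c) = cos c"
 proof -
 have "(p - 1) * c = pi / 2 - c" using c(3) by (simp add: algebra_simps)
 then show ?thesis by (simp add: sin_diff)
 qed
 define h where "h x = (sin x powr p + B * cos (p * x)) / cos x powr p" for x
 define h' where "h' x = p / cos x powr (p + 1) * (sin x powr (p - 1) - B * sin ((p - 1) * x))" for x
 have hd: "(h has_real_derivative h' x) (at x)" if x: "0 < x" "x < pi / 2" for x
 proof -
 have S: "0 < sin x" "0 < cos x" using x by (auto intro: sin_gt_zero cos_gt_zero)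
 define a b where "a = sin x powr (p - 1)" and "b = cos x powr (p - 1)"
 have ab: "sin x powr p = a * sin x" "cos x powr p = b * cos x" "cos x powr (p + 1) = b * cos x * cos x" "0 < b"
 using S by (simp_all add: a_def b_def powr_diff powr_add)
 have "(h has_real_derivative
 ((p * sin x powr (p - 1) * cos x - B * (p * sin (p * x))) * cos x powr p -
 (sin x powr p + B * cos (p * x)) * (p * cos x powr (p - 1) * (- sin x))) / (cos x powr p * cos x powr p)) (at x)"
 unfolding h_def using S
 by (auto intro!: derivative_eq_intros simp: powr_diff field_simps)
 also have "((p * sin x powr (p - 1) * cos x - B * (p * sin (p * x))) * cos x powr p -
 (sin x powr p + B * cos (p * x)) * (p * cos x powr (p - 1) * (- sin x))) / (cos x powr p * cos x powr p)
 = p * (a * ((cos x)^2 + (sin x)^2) - B * (sin (p * x) * cos x - cos (p * x) * sin x)) / (b * cos x * cos x)"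
 proof -
 have alg: "((p * a * c - B * (p * q)) * (b * c) - (a * s + B * r) * (p * b * (- s))) / (b * c * (b * c)) =
 p * (a * (c^2 + s^2) - B * (q * c - r * s)) / (b * c * c)" if "b ~= 0" "c ~= 0" for a b c s q r :: real
 using that by (simp add: divide_simps) (simp add: algebra_simps power2_eq_square)
 show ?thesis
 unfolding ab a_def[symmetric] b_def[symmetric] by (rule alg) (use S ab(4) in auto)
 qed
 also have "sin (p * x) * cos x - cos (p * x) * sin x = sin ((p - 1) * x)"
 using sin_diff[of "p * x" x] by (simp add: left_diff_distrib)
 also have "p * (a * ((cos x)^2 + (sin x)^2) - B * sin ((p - 1) * x)) / (b * cos x * cos x) = h' x"
 by (simp add: h'_def ab a_def)
 finally show ?thesis .
 qed
 have h'p: "0 <= h' x" if "0 < x" "x <= c" for x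
 proof -
 have "sin c powr (p - 1) * sin ((p - 1) * x) <= sin x powr (p - 1) * cos c"
 using cmp[of x c] that c sp1 by simp
 then have "B * sin ((p - 1) * x) <= sin x powr (p - 1)" using sc by (simp add: B_def field_simps)
 then show ?thesis using p by (simp add: h'_def)
 qed
 have h'n: "h' x <= 0" if "c <= x" "x < pi / 2" for x
 proof -
 have "sin x powr (p - 1) * cos c <= sin c powr (p - 1) * sin ((p - 1) * x)"
 using cmp[of c x] that c sp1 by simp
 then have "sin x powr (p - 1) <= B * sin ((p - 1) * x)" using sc by (simp add: B_def field_simps)
 then show ?thesis unfolding h'_def using p by (intro mult_nonneg_nonpos) auto
 qed
 have "h t <= h c"
 proof (cases "t <= c")
 case True
 show ?thesis
 by (rule DERIV_nonneg_imp_nondecreasing[OF True]) (use hd h'p t c in \<open>meson less_le_trans le_less_trans\<close>)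
 next
 case False
 show ?thesis
 proof (rule DERIV_nonpos_imp_nonincreasing[where f=h and a=c and b=t])
 show "c <= t" using False by simp
 show "EX y. (h has_real_derivative y) (at x) & y <= 0" if "c <= x" "x <= t" for x
 using hd[of x] h'n[of x] t c that by (intro exI[of _ "h' x"]) auto
 qed
 qed
 also have "h c = tan c powr p" unfolding h_def c(3) using sc by (simp add: tan_def powr_divide)
 finally have "sin t powr p + B * cos (p * t) <= tan c powr p * cos t powr p"
 using cos_gt_zero[of t] t by (simp add: h_def field_simps)
 then show ?thesis by (simp add: B_def c_def)
qed

definition pich_B :: "real => real" where
 "pich_B p = sin (pi / (2 * p)) powr (p - 1) / cos (pi / (2 * p))"

lemma pich_B_nonneg: "1 < p ==> 0 <= pich_B p"
 unfolding pich_B_def by (intro divide_nonneg_nonneg powr_ge_zero cos_ge_zero) (auto simp: field_simps intro: order.trans[of _ 0])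

lemma pichorides_trig:
 fixes p t :: real
 assumes p: "1 < p" "p <= 2" and t: "\<bar>t\<bar> < pi / 2"
 shows "\<bar>sin t\<bar> powr p <= tan (pi / (2 * p)) powr p * cos t powr p - pich_B p * cos (p * t)"
proof -
 have pos: "sin t powr p <= tan (pi / (2 * p)) powr p * cos t powr p - pich_B p * cos (p * t)" if "0 < t" "t < pi / 2" for t
 using pichorides_trig_aux[OF p that] by (simp add: pich_B_def)
 consider "t = 0" | "0 < t" | "t < 0" by linarith
 then show ?thesis
 proof cases
 case 1
 have "((%t. tan (pi / (2 * p)) powr p * cos t powr p - pich_B p * cos (p * t) - sin t powr p) ->>
 tan (pi / (2 * p)) powr p * cos 0 powr p - pich_B p * cos (p * 0) - sin 0 powr p) (at_right 0)"
 using p by (intro tendsto_intros tendsto_powr2) (auto simp: eventually_at_right_field intro!: exI[of _ pi] sin_ge_zero)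
 moreover have "\<forall>\<^sub>F t in at_right 0. 0 <= tan (pi / (2 * p)) powr p * cos t powr p - pich_B p * cos (p * t) - sin t powr p"
 using pos by (auto simp: eventually_at_right_field intro!: exI[of _ "pi / 2"])
 ultimately have "0 <= tan (pi / (2 * p)) powr p * cos 0 powr p - pich_B p * cos (p * 0) - sin 0 powr p"
 by (rule tendsto_lowerbound) simp
 then show ?thesis using 1 p by simp
 next
 case 2
 then show ?thesis using pos[of t] t sin_gt_zero[of t] by auto
 next
 case 3
 then have "sin t < 0" using t sin_gt_zero[of "- t"] by simp
 then show ?thesis using pos[of "- t"] t 3 by simp
 qed
qed

lemma Re_powr_polar:
 assumes "0 < Re z"
 shows "Re (z powr of_real q) = norm z powr q * cos (q * Im (Ln z))"
 "Im (z powr of_real q) = norm z powr q * sin (q * Im (Ln z))"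
 "Re z = norm z * cos (Im (Ln z))" "Im z = norm z * sin (Im (Ln z))"
proof -
 have z: "z ~= 0" using assms by auto
 show "Re (z powr of_real q) = norm z powr q * cos (q * Im (Ln z))"
 "Im (z powr of_real q) = norm z powr q * sin (q * Im (Ln z))"
 using z by (simp_all add: powr_def Re_exp Im_exp)
 have "Re (exp (Ln z)) = norm z * cos (Im (Ln z))" "Im (exp (Ln z)) = norm z * sin (Im (Ln z))"
 using z by (simp_all add: Re_exp Im_exp del: exp_Ln)
 then show "Re z = norm z * cos (Im (Ln z))" "Im z = norm z * sin (Im (Ln z))" using z by simp_all
qed

text \<open>All terms are homogeneous of degree p, so this is \<open>pichorides_trig\<close>
  multiplied by norm z powr p. The last term is the one without a sign: it is integrated along
  horizontal lines, where subharmonicity bounds it from below by a quantity that tends to 0.\<close>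

lemma pichorides_pointwise:
 fixes p :: real
 assumes p: "1 < p" "p <= 2" and z: "0 < Re z"
 shows "\<bar>Im z\<bar> powr p <= tan (pi / (2 * p)) powr p * Re z powr p - pich_B p * Re (z powr of_real p)"
proof -
 define r t where "r = norm z" and "t = Im (Ln z)"
 have t: "\<bar>t\<bar> < pi / 2" using Re_Ln_pos_lt_imp[OF z] by (simp add: t_def)
 have c: "0 < cos t" using t by (intro cos_gt_zero_pi) auto
 have r: "0 < r" using z by (auto simp: r_def)
 have "r powr p * \<bar>sin t\<bar> powr p <= r powr p * (tan (pi / (2 * p)) powr p * cos t powr p - pich_B p * cos (p * t))"
 by (rule mult_left_mono[OF pichorides_trig[OF p t]]) simp
 moreover have "\<bar>Im z\<bar> powr p = r powr p * \<bar>sin t\<bar> powr p"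
 using r by (subst Re_powr_polar(4)[OF z]) (simp add: abs_mult powr_mult r_def t_def)
 moreover have "Re z powr p = r powr p * cos t powr p"
 using r c by (subst Re_powr_polar(3)[OF z]) (simp add: powr_mult r_def t_def)
 ultimately show ?thesis
 unfolding Re_powr_polar(1)[OF z, of p] by (simp add: r_def t_def algebra_simps)
qed

section \<open>The subharmonic function built from Re (z powr p)\<close>

text \<open>\<open>zeta e w\<close> is a smooth substitute for \<open>\<bar>Re w\<bar> + \<i> Im w\<close> that stays in the right half plane;
 \<open>zeta1\<close> and \<open>zeta2\<close> are its first two derivatives along a curve with velocity \<open>d\<close> and
 acceleration \<open>d'\<close>, and \<open>phi1\<close>, \<open>phi2\<close> those of \<open>phi\<close>.\<close>

definition zeta :: "real => complex => complex" where
 "zeta e w = Complex (sqrt ((Re w)^2 + e^2)) (Im w)"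
definition zeta1 :: "real => complex => complex => complex" where
 "zeta1 e w d = Complex (Re w * Re d / sqrt ((Re w)^2 + e^2)) (Im d)"
definition zeta2 :: "real => complex => complex => complex => complex" where
 "zeta2 e w d d' = Complex (e^2 * (Re d)^2 / sqrt ((Re w)^2 + e^2) ^ 3 + Re w * Re d' / sqrt ((Re w)^2 + e^2)) (Im d')"
definition phi :: "real => real => complex => real" where
 "phi e p w = Re (zeta e w powr of_real p)"
definition phi1 :: "real => real => complex => complex => real" where
 "phi1 e p w d = Re (of_real p * zeta e w powr of_real (p - 1) * zeta1 e w d)"
definition phi2 :: "real => real => complex => complex => complex => real" where
 "phi2 e p w d d' = Re (of_real p * (of_real (p - 1) * zeta e w powr of_real (p - 2) * zeta1 e w d * zeta1 e w d
 + zeta e w powr of_real (p - 1) * zeta2 e w d d'))"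

lemma zeta_pos: "0 < e ==> 0 < Re (zeta e w)"
 by (simp add: zeta_def sq_pos)

lemma zeta_slit: "0 < e ==> zeta e w \<notin> \<real>\<^sub>\<le>\<^sub>0"
 using zeta_pos[of e w] by (auto simp: complex_nonpos_Reals_iff)

lemma sqrt_deriv_aux:
 fixes u :: "real => real"
 assumes e: "0 < e" and u: "(u has_real_derivative u') (at s)"
 shows "((%s. sqrt ((u s)^2 + e^2)) has_real_derivative u s * u' / sqrt ((u s)^2 + e^2)) (at s)"
 using u sq_pos[OF e, of "u s"] by (auto intro!: derivative_eq_intros simp: field_simps)

lemma has_vector_derivative_Complex:
 assumes "(f has_real_derivative f') (at s)" "(g has_real_derivative g') (at s)"
 shows "((%s. Complex (f s) (g s)) has_vector_derivative Complex f' g') (at s)"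
proof -
 have "((%s. complex_of_real (f s) + \<i> * complex_of_real (g s)) has_vector_derivative (of_real f' + \<i> * of_real g')) (at s)"
 using assms by (intro derivative_intros) (auto intro!: has_vector_derivative_of_real derivative_eq_intros)
 then show ?thesis by (simp add: complex_eq_iff Complex_eq)
qed

lemma Re_has_real_derivative: "(G has_vector_derivative G') F ==> ((%s. Re (G s)) has_real_derivative Re G') F"
 and Im_has_real_derivative: "(G has_vector_derivative G') F ==> ((%s. Im (G s)) has_real_derivative Im G') F"
 by (auto simp: has_real_derivative_iff_has_vector_derivative intro: bounded_linear.has_vector_derivative[OF bounded_linear_Re]
 bounded_linear.has_vector_derivative[OF bounded_linear_Im])

lemma zeta_deriv:
 assumes e: "0 < e" and G: "(G has_vector_derivative G1) (at s)"
 shows "((%s. zeta e (G s)) has_vector_derivative zeta1 e (G s) G1) (at s)"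
 unfolding zeta_def zeta1_def
 by (intro has_vector_derivative_Complex sqrt_deriv_aux[OF e] Re_has_real_derivative[OF G] Im_has_real_derivative[OF G])

lemma zeta1_deriv:
 assumes e: "0 < e" and G: "(G has_vector_derivative G1 s) (at s)" "(G1 has_vector_derivative G2) (at s)"
 shows "((%s. zeta1 e (G s) (G1 s)) has_vector_derivative zeta2 e (G s) (G1 s) G2) (at s)"
 unfolding zeta1_def zeta2_def
proof (intro has_vector_derivative_Complex Im_has_real_derivative[OF G(2)])
 define W where "W = sqrt ((Re (G s))^2 + e^2)"
 have W: "W^2 = (Re (G s))^2 + e^2" "0 < W" using sq_pos[OF e, of "Re (G s)"] by (auto simp: W_def)
 define u u1 u2 where "u = Re (G s)" and "u1 = Re (G1 s)" and "u2 = Re G2"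
 have "((%s. Re (G s) * Re (G1 s) / sqrt ((Re (G s))^2 + e^2)) has_real_derivative
 ((u1 * u1 + u * u2) * W - u * u1 * (u * u1 / W)) / (W * W)) (at s)"
 using DERIV_divide[OF DERIV_mult[OF Re_has_real_derivative[OF G(1)] Re_has_real_derivative[OF G(2)]]
 sqrt_deriv_aux[OF e Re_has_real_derivative[OF G(1)]]] W(2) e
 unfolding W_def u_def u1_def u2_def by (simp add: mult.commute[of "Re G2"])
 also have "((u1 * u1 + u * u2) * W - u * u1 * (u * u1 / W)) / (W * W) = ((u1 * u1 + u * u2) * W^2 - u^2 * u1^2) / W ^ 3"
 using W(2) by (simp add: field_simps power2_eq_square power3_eq_cube)
 also have "(u1 * u1 + u * u2) * W^2 - u^2 * u1^2 = e^2 * u1^2 + u * u2 * W^2"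
 unfolding W(1) u_def[symmetric] by (simp add: algebra_simps power2_eq_square)
 also have "(e^2 * u1^2 + u * u2 * W^2) / W ^ 3 = e^2 * u1^2 / W ^ 3 + u * u2 / W"
 using W(2) by (simp add: field_simps power2_eq_square power3_eq_cube)
 finally show "((%s. Re (G s) * Re (G1 s) / sqrt ((Re (G s))^2 + e^2)) has_real_derivative
 e^2 * (Re (G1 s))^2 / sqrt ((Re (G s))^2 + e^2) ^ 3 + Re (G s) * Re G2 / sqrt ((Re (G s))^2 + e^2)) (at s)"
 by (simp add: W_def u_def u1_def u2_def)
qed

lemma zeta_powr_deriv:
 assumes e: "0 < e" and G: "(G has_vector_derivative G1) (at s)"
 shows "((%s. zeta e (G s) powr of_real q) has_vector_derivative
 of_real q * zeta e (G s) powr of_real (q - 1) * zeta1 e (G s) G1) (at s)"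
 using field_vector_diff_chain_at[OF zeta_deriv[OF e G] has_field_derivative_powr[OF zeta_slit[OF e], of "of_real q"]]
 by (simp add: o_def mult_ac)

lemma phi_deriv:
 assumes e: "0 < e" and G: "(G has_vector_derivative G1) (at s)"
 shows "((%s. phi e p (G s)) has_real_derivative phi1 e p (G s) G1) (at s)"
 unfolding phi_def phi1_def by (rule Re_has_real_derivative[OF zeta_powr_deriv[OF e G]])

lemma phi1_deriv:
 assumes e: "0 < e" and G: "(G has_vector_derivative G1 s) (at s)" "(G1 has_vector_derivative G2) (at s)"
 shows "((%s. phi1 e p (G s) (G1 s)) has_real_derivative phi2 e p (G s) (G1 s) G2) (at s)"
 unfolding phi1_def phi2_def
proof (rule Re_has_real_derivative)
 note d = has_vector_derivative_mult[OF zeta_powr_deriv[OF e G(1), of "p - 1"] zeta1_deriv[where ?G1.0=G1, OF e G]]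
 from has_vector_derivative_mult_right[OF d, of "of_real p"]
 show "((%s. of_real p * zeta e (G s) powr of_real (p - 1) * zeta1 e (G s) (G1 s)) has_vector_derivative
 of_real p * (of_real (p - 1) * zeta e (G s) powr of_real (p - 2) * zeta1 e (G s) (G1 s) * zeta1 e (G s) (G1 s)
 + zeta e (G s) powr of_real (p - 1) * zeta2 e (G s) (G1 s) G2)) (at s)"
 by (simp add: algebra_simps)
qed

text \<open>By the Cauchy-Riemann equations the second derivatives in x and y belong to the pairs
  (d, d') and (i d, - d'). The two \<open>zeta2\<close> terms add up to a real k >= 0 and the
  squares of the \<open>zeta1\<close> terms to - W k with W = Re Z. So the Laplacian is p k Re (Z
  powr (p - 2) * (Z - (p - 1) W)). In polar form this splits into two terms, both nonnegative
  because 1 < p <= 2 and the argument of Z stays below pi / 2 in absolute value.\<close>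

lemma phi_laplacian:
 assumes e: "0 < e" and p: "1 < p" "p <= 2"
 shows "0 <= phi2 e p w d d' + phi2 e p w (\<i> * d) (- d')"
proof -
 define W where "W = sqrt ((Re w)^2 + e^2)"
 have W: "W^2 = (Re w)^2 + e^2" "0 < W" using sq_pos[OF e, of "Re w"] by (auto simp: W_def)
 define Z where "Z = zeta e w"
 have Z: "Re Z = W" "Im Z = Im w" "0 < Re Z" by (use zeta_pos[OF e, of w] in \<open>auto simp: Z_def zeta_def W_def\<close>)
 then have Z0: "Z ~= 0" by auto
 define k where "k = e^2 * (norm d)^2 / W ^ 3"
 have k: "0 <= k" using W by (simp add: k_def)
 have z2: "zeta2 e w d d' + zeta2 e w (\<i> * d) (- d') = of_real k"
 unfolding zeta2_def W_def[symmetric] k_def cmod_power2 by (simp add: complex_eq_iff add_divide_distrib distrib_left)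
 have eW: "(Re w)^2 / W^2 - 1 = - (e^2 / W^2)"
 proof -
 have "(Re w)^2 = W^2 - e^2" using W(1) by simp
 then show ?thesis using W(2) by (simp add: diff_divide_distrib)
 qed
 have z1: "zeta1 e w d * zeta1 e w d + zeta1 e w (\<i> * d) * zeta1 e w (\<i> * d) = of_real (- (W * k))"
 proof -
 have "Re (zeta1 e w d * zeta1 e w d + zeta1 e w (\<i> * d) * zeta1 e w (\<i> * d)) = ((Re w)^2 / W^2 - 1) * ((Re d)^2 + (Im d)^2)"
 unfolding zeta1_def W_def[symmetric] using W(2) by (simp add: field_simps power2_eq_square)
 also have "... = - (W * k)" unfolding eW k_def cmod_power2 using W(2) by (simp add: power2_eq_square power3_eq_cube)
 finally show ?thesis unfolding zeta1_def W_def[symmetric] by (simp add: complex_eq_iff)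
 qed
 have zp: "Z powr of_real (p - 1) = Z powr of_real (p - 2) * Z"
 using Z0 powr_add[of Z "of_real (p - 2)" 1] by (simp add: algebra_simps)
 have "phi2 e p w d d' + phi2 e p w (\<i> * d) (- d') =
 Re (of_real p * (of_real (p - 1) * Z powr of_real (p - 2) * (zeta1 e w d * zeta1 e w d + zeta1 e w (\<i> * d) * zeta1 e w (\<i> * d))
 + Z powr of_real (p - 1) * (zeta2 e w d d' + zeta2 e w (\<i> * d) (- d'))))"
 unfolding phi2_def Z_def by (simp only: plus_complex.sel(1)[symmetric] ring_distribs mult.assoc) (simp only: add_ac)
 also have "... = p * k * Re (Z powr of_real (p - 2) * (Z - of_real ((p - 1) * W)))"
 unfolding z1 z2 zp by (simp add: algebra_simps)
 also have "Re (Z powr of_real (p - 2) * (Z - of_real ((p - 1) * W))) =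
 norm Z powr (p - 2) * ((2 - p) * W * cos ((p - 2) * Im (Ln Z)) + (norm Z * sin (Im (Ln Z))) * sin ((2 - p) * Im (Ln Z)))"
 using Re_powr_polar(1,2)[OF Z(3), of "p - 2"] Re_powr_polar(4)[OF Z(3)] sin_minus[of "(2 - p) * Im (Ln Z)"]
 by (simp add: Z(1) algebra_simps)
 also have "0 <= p * k * ..."
 proof -
 define t where "t = Im (Ln Z)"
 have t: "\<bar>t\<bar> < pi / 2" using Re_Ln_pos_lt_imp[OF Z(3)] by (simp add: t_def)
 have tt: "\<bar>(2 - p) * t\<bar> <= 1 * \<bar>t\<bar>" unfolding abs_mult using p by (intro mult_right_mono) auto
 have 1: "0 <= cos ((p - 2) * t)"
 proof (rule cos_ge_zero)
 have "\<bar>(p - 2) * t\<bar> = \<bar>(2 - p) * t\<bar>" by (simp add: abs_mult abs_minus_commute)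
 then have "\<bar>(p - 2) * t\<bar> < pi / 2" using tt t by linarith
 then show "- (pi / 2) <= (p - 2) * t" "(p - 2) * t <= pi / 2" by (simp_all add: abs_less_iff)
 qed
 have 2: "0 <= sin t * sin ((2 - p) * t)"
 proof -
 have *: "0 <= sin s * sin ((2 - p) * s)" if s: "0 <= s" "s < pi / 2" for s
 proof -
 have "0 <= (2 - p) * s" "(2 - p) * s <= 1 * s" using p s by (simp, intro mult_right_mono, auto)
 then have "(2 - p) * s <= pi" "s <= pi" using s by linarith+
 then show ?thesis using s \<open>0 \<le> (2 - p) * s\<close> by (intro mult_nonneg_nonneg[OF sin_ge_zero sin_ge_zero])
 qed
 show ?thesis using *[of t] *[of "- t"] t by (cases "0 <= t") auto
 qed
 have "0 <= (2 - p) * W * cos ((p - 2) * t) + norm Z * (sin t * sin ((2 - p) * t))"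
 using p W(2) 1 2 by (intro add_nonneg_nonneg mult_nonneg_nonneg[OF mult_nonneg_nonneg] mult_nonneg_nonneg[OF norm_ge_zero]) auto
 then show ?thesis using p k unfolding t_def[symmetric] by (simp add: mult.assoc)
 qed
 finally show ?thesis .
qed

lemma zeta_norm_le: "0 < e ==> norm (zeta e w) <= 2 * norm w + e"
proof -
 assume e: "0 < e"
 have "norm (zeta e w) <= \<bar>sqrt ((Re w)^2 + e^2)\<bar> + \<bar>Im w\<bar>" using cmod_le[of "zeta e w"] by (simp add: zeta_def)
 also have "\<bar>sqrt ((Re w)^2 + e^2)\<bar> <= \<bar>Re w\<bar> + e"
 using sqrt_add_le_add_sqrt[of "(Re w)^2" "e^2"] e by simp
 finally show ?thesis using abs_Re_le_cmod[of w] abs_Im_le_cmod[of w] by linarith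
qed

lemma zeta1_norm_le: "0 < e ==> norm (zeta1 e w d) <= 2 * norm d"
proof -
 assume e: "0 < e"
 define W where "W = sqrt ((Re w)^2 + e^2)"
 have W: "0 < W" "\<bar>Re w\<bar> <= W" using sq_pos[OF e, of "Re w"] by (auto simp: W_def intro!: real_le_rsqrt)
 have "\<bar>Re w * Re d / W\<bar> = \<bar>Re w\<bar> / W * \<bar>Re d\<bar>" using W by (simp add: abs_mult)
 also have "... <= 1 * \<bar>Re d\<bar>" using W by (intro mult_right_mono) auto
 finally have "\<bar>Re w * Re d / W\<bar> <= \<bar>Re d\<bar>" by simp
 then show ?thesis
 using cmod_le[of "zeta1 e w d"] abs_Re_le_cmod[of d] abs_Im_le_cmod[of d] by (simp add: zeta1_def W_def)
qed

lemma phi_abs_le: "0 < e ==> 0 <= p ==> \<bar>phi e p w\<bar> <= (2 * norm w + e) powr p"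
proof -
 assume e: "0 < e" "0 <= p"
 have "\<bar>phi e p w\<bar> <= norm (zeta e w) powr p"
 unfolding phi_def by (rule order.trans[OF abs_Re_le_cmod]) (simp add: norm_powr_real_powr')
 also have "... <= (2 * norm w + e) powr p" using e zeta_norm_le by (intro powr_mono2) auto
 finally show ?thesis .
qed

lemma phi1_abs_le: "0 < e ==> 1 <= p ==> \<bar>phi1 e p w d\<bar> <= p * (2 * norm w + e) powr (p - 1) * (2 * norm d)"
proof -
 assume e: "0 < e" "1 <= p"
 have "\<bar>phi1 e p w d\<bar> <= p * norm (zeta e w) powr (p - 1) * norm (zeta1 e w d)"
 unfolding phi1_def by (rule order.trans[OF abs_Re_le_cmod]) (use e norm_powr_real_powr'[of "of_real (p - 1)"] in \<open>simp add: norm_mult\<close>)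
 also have "... <= p * (2 * norm w + e) powr (p - 1) * (2 * norm d)"
 using e zeta_norm_le zeta1_norm_le by (intro mult_mono powr_mono2) auto
 finally show ?thesis .
qed

lemma zeta_continuous [continuous_intros]:
 assumes "continuous_on A g" shows "continuous_on A (%z. zeta e (g z))"
 unfolding zeta_def Complex_eq by (intro continuous_intros assms)

lemma zeta1_continuous:
 assumes e: "0 < e" and "continuous_on A g" "continuous_on A d" shows "continuous_on A (%z. zeta1 e (g z) (d z))"
proof -
 have "sqrt ((Re w)^2 + e^2) ~= 0" for w using sq_pos[OF e, of "Re w"] by (metis less_irrefl real_sqrt_eq_zero_cancel_iff)
 then show ?thesis unfolding zeta1_def Complex_eq by (intro continuous_intros assms) auto
qed

lemma zeta2_continuous:
 assumes e: "0 < e" and "continuous_on A g" "continuous_on A d" "continuous_on A d'"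
 shows "continuous_on A (%z. zeta2 e (g z) (d z) (d' z))"
proof -
 have "sqrt ((Re w)^2 + e^2) ~= 0" for w using sq_pos[OF e, of "Re w"] by (metis less_irrefl real_sqrt_eq_zero_cancel_iff)
 then show ?thesis unfolding zeta2_def Complex_eq by (intro continuous_intros assms) auto
qed

lemma zeta_powr_continuous:
 assumes e: "0 < e" and g: "continuous_on A g" shows "continuous_on A (%z. zeta e (g z) powr of_real q)"
proof (rule continuous_on_powr_complex)
 show "A \<subseteq> {z. 0 <= Re (zeta e (g z)) \<or> Im (zeta e (g z)) ~= 0}" using zeta_pos[OF e] by (auto intro: less_imp_le)
 show "zeta e (g z) = 0 ==> 0 < Re (complex_of_real q)" for z using zeta_pos[OF e, of "g z"] by auto
qed (intro continuous_intros g)+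

lemma phi_continuous:
 assumes e: "0 < e" and "continuous_on A g" shows "continuous_on A (%z. phi e p (g z))"
 unfolding phi_def by (intro continuous_intros zeta_powr_continuous assms)

lemma phi1_continuous:
 assumes e: "0 < e" and "continuous_on A g" "continuous_on A d" shows "continuous_on A (%z. phi1 e p (g z) (d z))"
 unfolding phi1_def by (intro continuous_intros zeta_powr_continuous zeta1_continuous assms)

lemma phi2_continuous:
 assumes e: "0 < e" and "continuous_on A g" "continuous_on A d" "continuous_on A d'"
 shows "continuous_on A (%z. phi2 e p (g z) (d z) (d' z))"
 unfolding phi2_def by (intro continuous_intros zeta_powr_continuous zeta1_continuous zeta2_continuous assms)

section \<open>The Cauchy integral and its energy on horizontal lines\<close>

definition cauchyF :: "(real => real) => complex => complex" where
 "cauchyF f z = \<i> / of_real pi * (LI t. of_real (f t) / (z - of_real t))"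
definition cauchyF1 :: "(real => real) => complex => complex" where
 "cauchyF1 f z = - (\<i> / of_real pi) * (LI t. of_real (f t) / (z - of_real t)^2)"

lemma norm_kernel: "norm (z - of_real t) = sqrt ((Re z - t)^2 + (Im z)^2)"
 by (simp add: cmod_def)

lemma kernel_lower: "Im z <= norm (z - of_real t)"
 using abs_Im_le_cmod[of "z - of_real t"] by simp

lemma hadm_integrable_complex:
 fixes f :: "real => real"
 assumes f: "hadm f" and [measurable]: "bm k" and k: "!!t. norm (k t) <= C * (1 / (1 + \<bar>t\<bar>))"
 shows "intg (%t. of_real (f t) * k t :: complex)"
proof (rule b_integrable_bound)
 show "intg (%t. C * ((1 / (1 + \<bar>t\<bar>)) *R f t))" using f unfolding hadm_def by (intro integrable_mult_right) auto
 have [measurable]: "bm f" using f by (simp add: hadm_def)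
 show "(%t. of_real (f t) * k t :: complex) \<in> borel_measurable lborel" by measurable
 have "norm (of_real (f t) * k t) <= norm (C * ((1 / (1 + \<bar>t\<bar>)) *R f t))" for t
 proof -
 have "norm (of_real (f t) * k t) <= \<bar>f t\<bar> * (C * (1 / (1 + \<bar>t\<bar>)))" unfolding norm_mult norm_of_real by (intro mult_left_mono k) auto
 also have "... <= \<bar>f t * (C * (1 / (1 + \<bar>t\<bar>)))\<bar>" by (subst abs_mult, intro mult_left_mono abs_ge_self, auto)
 finally show ?thesis by (simp add: abs_mult mult_ac)
 qed
 then show "AEL t. norm (of_real (f t) * k t) <= norm (C * ((1 / (1 + \<bar>t\<bar>)) *R f t))" by simp
qed

lemma cauchyF_integrable:
 assumes f: "hadm f" and z: "0 < Im z"
 shows "intg (%t. of_real (f t) / (z - of_real t))"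
 "intg (%t. of_real (f t) / (z - of_real t)^2)"
proof -
 obtain C where C: "!!t. 1 / norm (z - of_real t) <= C * (1 / (1 + \<bar>t\<bar>))"
 using kernel_bound[OF z] unfolding norm_kernel by blast
 have "intg (%t. of_real (f t) * (1 / (z - of_real t)))"
 by (rule hadm_integrable_complex[OF f]) (use C in \<open>auto simp: norm_divide\<close>)
 then show "intg (%t. of_real (f t) / (z - of_real t))" by simp
 have "intg (%t. of_real (f t) * (1 / (z - of_real t)^2))"
 proof (rule hadm_integrable_complex[OF f])
 fix t
 have n: "0 < norm (z - of_real t)" "Im z <= norm (z - of_real t)" using kernel_lower[of z t] z by auto
 have "norm (1 / (z - of_real t)^2) = (1 / norm (z - of_real t)) * (1 / norm (z - of_real t))"
 by (simp add: norm_divide norm_power norm_mult power2_eq_square)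
 also have "... <= (1 / Im z) * (C * (1 / (1 + \<bar>t\<bar>)))"
 using n z C by (intro mult_mono) (auto simp: field_simps)
 finally show "norm (1 / (z - of_real t)^2) <= (C / Im z) * (1 / (1 + \<bar>t\<bar>))" by simp
 qed simp
 then show "intg (%t. of_real (f t) / (z - of_real t)^2)" by simp
qed

lemma cauchyF_Complex:
 assumes f: "hadm f" and y: "0 < y"
 shows "cauchyF f (Complex x y) = Complex (conv (Pk y) f x) (conv (Qk y) f x)"
proof -
 have i: "intg (%t. \<i> / of_real pi * (of_real (f t) / (Complex x y - of_real t)))"
 using cauchyF_integrable(1)[OF f, of "Complex x y"] y by (intro integrable_mult_right) auto
 have e: "\<i> / of_real pi * (of_real (f t) / (Complex x y - of_real t)) = Complex (Pk y (x - t) * f t) (Qk y (x - t) * f t)" for t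
 proof -
 define D where "D = (x - t)^2 + y^2"
 have D: "0 < D" using sq_pos[OF y] by (simp add: D_def)
 have nz: "Complex (x - t) y ~= 0" using y by (auto simp: complex_eq_iff)
 have "Complex (Pk y (x - t) * f t) (Qk y (x - t) * f t) * Complex (x - t) y = \<i> / of_real pi * of_real (f t)"
 proof -
 have "Pk y (x - t) * f t * (x - t) - Qk y (x - t) * f t * y = 0" by (simp add: Pk_def Qk_def)
 moreover have "Pk y (x - t) * f t * y + Qk y (x - t) * f t * (x - t) = f t / pi * (((x - t)^2 + y^2) / D)"
 proof -
 have "y / (pi * D) * g * y + s / (pi * D) * g * s = g / pi * ((s^2 + y^2) / D)" for s g
 using D by (simp add: divide_simps) (simp add: power2_eq_square algebra_simps)
 from this[of "f t" "x - t"] show ?thesis unfolding Pk_def Qk_def D_def .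
 qed
 ultimately show ?thesis using D by (simp add: complex_eq_iff D_def[symmetric])
 qed
 then have "Complex (Pk y (x - t) * f t) (Qk y (x - t) * f t) = \<i> / of_real pi * of_real (f t) / Complex (x - t) y"
 using nz by (simp add: field_simps)
 moreover have "Complex x y - of_real t = Complex (x - t) y" by (simp add: complex_eq_iff)
 ultimately show ?thesis by simp
 qed
 have F: "cauchyF f (Complex x y) = (LI t. \<i> / of_real pi * (of_real (f t) / (Complex x y - of_real t)))"
 unfolding cauchyF_def by (rule integral_mult_right_zero[symmetric])
 show ?thesis
 unfolding F e using integral_Re[OF i[unfolded e]] integral_Im[OF i[unfolded e]] by (simp add: complex_eq_iff conv_def)
qed

text \<open>The error of the difference quotient is the integral of \<open>f\<close> against h / ((z
  - t)^2 (z + h - t)) up to a constant factor, hence at most a constant times norm h. The constant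
  uses that Im (z + h) >= y / 2 for small h.\<close>

lemma cauchyF_deriv:
 assumes f: "hadm f" and z: "0 < Im z"
 shows "(cauchyF f has_field_derivative cauchyF1 f z) (at z)"
proof -
 define y where "y = Im z"
 have y: "0 < y" using z by (simp add: y_def)
 obtain C where C: "!!t. 1 / norm (z - of_real t) <= C * (1 / (1 + \<bar>t\<bar>))"
 using kernel_bound[OF z] unfolding norm_kernel by blast
 define N where "N = (LI t. norm ((1 / (1 + \<bar>t\<bar>)) *R f t))"
 have C0: "0 <= C" using C[of 0] by (simp add: order.trans[OF zero_le_divide_1_iff[THEN iffD2, OF norm_ge_zero]])
 have b: "norm ((cauchyF f (z + h) - cauchyF f z) / h - cauchyF1 f z) <= norm h * (2 / y^2 * C * N / pi)"
 if h: "h ~= 0" "norm h < y / 2" for h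
 proof -
 have zh: "0 < Im (z + h)" "y / 2 <= Im (z + h)" using abs_Im_le_cmod[of h] h y by (auto simp: y_def)
 have i1: "intg (%t. of_real (f t) / (z + h - of_real t))" using cauchyF_integrable(1)[OF f zh(1)] .
 note i2 = cauchyF_integrable[OF f z]
 define g where "g t = of_real (f t) / (z + h - of_real t) - of_real (f t) / (z - of_real t) + h * (of_real (f t) / (z - of_real t)^2)" for t
 have ig: "intg g" unfolding g_def
 by (intro b_integrable_add b_integrable_diff integrable_mult_right i1 i2)
 have "(LI t. g t) = (LI t. of_real (f t) / (z + h - of_real t) - of_real (f t) / (z - of_real t)) +
 (LI t. h * (of_real (f t) / (z - of_real t)^2))"
 unfolding g_def
 by (intro b_integral_add b_integrable_diff integrable_mult_right i1 i2)
 also have "(LI t. of_real (f t) / (z + h - of_real t) - of_real (f t) / (z - of_real t)) =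
 (LI t. of_real (f t) / (z + h - of_real t)) - (LI t. of_real (f t) / (z - of_real t))"
 by (rule b_integral_diff[OF i1 i2(1)])
 also have "(LI t. h * (of_real (f t) / (z - of_real t)^2)) = h * (LI t. of_real (f t) / (z - of_real t)^2)"
 by (rule integral_mult_right_zero)
 finally have Ig: "(LI t. g t) = (LI t. of_real (f t) / (z + h - of_real t)) -
 (LI t. of_real (f t) / (z - of_real t)) + h * (LI t. of_real (f t) / (z - of_real t)^2)" .
 have "(cauchyF f (z + h) - cauchyF f z) / h - cauchyF1 f z = (\<i> / of_real pi) / h * (LI t. g t)"
 unfolding Ig cauchyF_def cauchyF1_def using h by (simp add: field_simps)
 also have "norm ... <= (1 / pi) / norm h * (LI t. norm (g t))"
 by (simp add: norm_mult norm_divide divide_right_mono)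
 also have "... <= (1 / pi) / norm h * (LI t. (norm h)^2 * (2 / y^2) * C * norm ((1 / (1 + \<bar>t\<bar>)) *R f t))"
 proof (intro mult_left_mono integral_mono)
 show "intg (%t. (norm h)^2 * (2 / y^2) * C * norm ((1 / (1 + \<bar>t\<bar>)) *R f t))"
 using f unfolding hadm_def by (intro integrable_mult_right integrable_norm) auto
 fix t
 have nz: "z - of_real t ~= 0" "z + h - of_real t ~= 0" using z zh by (auto simp: complex_eq_iff)
 have "g t = of_real (f t) * (h^2 / ((z - of_real t)^2 * (z + h - of_real t)))"
 proof -
 define w where "w = z - of_real t"
 have w: "w ~= 0" "w + h ~= 0" "z + h - of_real t = w + h" using nz by (auto simp: w_def algebra_simps)
 have "g t = of_real (f t) * (1 / (w + h) - 1 / w + h / w^2)"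
 unfolding g_def w(3) w_def[symmetric] by (simp add: distrib_left right_diff_distrib)
 also have "1 / (w + h) - 1 / w + h / w^2 = h^2 / (w^2 * (w + h))"
 using w by (simp add: divide_simps) (simp add: algebra_simps power2_eq_square)
 finally show ?thesis by (simp only: w_def[symmetric] w(3))
 qed
 then have "norm (g t) = \<bar>f t\<bar> * ((norm h)^2 * (1 / norm (z - of_real t)) * (1 / norm (z - of_real t)) * (1 / norm (z + h - of_real t)))"
 by (simp add: norm_mult norm_divide norm_power power2_eq_square)
 also have "... <= \<bar>f t\<bar> * ((norm h)^2 * (C * (1 / (1 + \<bar>t\<bar>))) * (1 / y) * (2 / y))"
 proof (intro mult_left_mono mult_mono C)
 show "1 / norm (z - of_real t) <= 1 / y" using kernel_lower[of z t] y by (simp add: y_def frac_le)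
 have "1 / norm (z + h - of_real t) <= 1 / (y / 2)"
 using kernel_lower[of "z + h" t] y zh by (intro frac_le) auto
 then show "1 / norm (z + h - of_real t) <= 2 / y" by simp
 qed (use C0 y in auto)
 finally show "norm (g t) <= (norm h)^2 * (2 / y^2) * C * norm ((1 / (1 + \<bar>t\<bar>)) *R f t)"
 by (simp add: abs_mult power2_eq_square mult_ac)
 qed (use ig in auto)
 also have "... = (1 / pi) / norm h * ((norm h)^2 * (2 / y^2) * C * N)"
 unfolding N_def by (subst integral_mult_right_zero) (rule refl)
 also have "... = norm h * (2 / y^2 * C * N / pi)" using h by (simp add: power2_eq_square mult_ac)
 finally show ?thesis .
 qed
 have "((%h. (cauchyF f (z + h) - cauchyF f z) / h - cauchyF1 f z) ->> 0) (at 0)"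
 proof (rule tendsto_0_le[where f="%h::complex. h" and K="2 / y^2 * C * N / pi"])
 show "\<forall>\<^sub>F h in at 0. norm ((cauchyF f (z + h) - cauchyF f z) / h - cauchyF1 f z) <= norm h * (2 / y^2 * C * N / pi)"
 using y b by (auto simp: eventually_at intro!: exI[of _ "y / 2"])
 qed simp
 then show ?thesis unfolding DERIV_def by (subst LIM_zero_iff[symmetric]) simp
qed

lemma Complex_has_vector_derivative_x: "((%x. Complex x y) has_vector_derivative 1) (at x)"
 using has_vector_derivative_Complex[of "%x. x" 1 x "%x. y" 0] by (simp add: one_complex.code)

lemma Complex_has_vector_derivative_y: "((%y. Complex x y) has_vector_derivative \<i>) (at y)"
 using has_vector_derivative_Complex[of "%y. x" 0 y "%y. y" 1] by (simp add: imaginary_unit.code)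

lemma along_x: "(F has_field_derivative F1) (at (Complex x y)) ==> ((%x. F (Complex x y)) has_vector_derivative F1) (at x)"
 using field_vector_diff_chain_at[OF Complex_has_vector_derivative_x, of F F1] by (simp add: o_def)

lemma along_y: "(F has_field_derivative F1) (at (Complex x y)) ==> ((%y. F (Complex x y)) has_vector_derivative \<i> * F1) (at y)"
 using field_vector_diff_chain_at[OF Complex_has_vector_derivative_y, of F F1] by (simp add: o_def)

text \<open>Since \<open>phi\<close> composed with a holomorphic function is subharmonic, its integral over a horizontal
 segment is a convex function of the height, up to boundary terms that are controlled by the
 decay of \<open>F\<close>.\<close>

lemma phi_energy:
 fixes F F1 F2 :: "complex => complex"
 assumes F: "!!z. 0 < Im z ==> (F has_field_derivative F1 z) (at z)"
 "!!z. 0 < Im z ==> (F1 has_field_derivative F2 z) (at z)" "continuous_on {z. 0 < Im z} F2"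
 and p: "1 < p" "p <= 2" and R: "0 < R" and y0: "0 < y0" and c: "0 <= c"
 and bnd: "!!z. 0 < Im z ==> R <= norm z ==> norm (F z) <= c / R"
 "!!z. 0 < Im z ==> R <= norm z ==> norm (F1 z) <= 2 * c / R^2"
 shows "- (2 * (2 * c + 1) powr p + 16 * p * c * (2 * c + 1) powr (p - 1)) * R powr (1 - p) <=
 integral {-R..R} (%x. phi (1 / R) p (F (Complex x y0)))"
proof -
 \<comment> \<open>The smoothing parameter is tied to \<open>R\<close> so that it has the order of
   the bound c / R for \<open>F\<close>; all boundary terms then become multiples of powers of
   \<open>R\<close>.\<close>
 define e where "e = 1 / R"
 have e: "0 < e" using R by (simp add: e_def)
 define I :: "real => real" where "I = (%y. integral (cbox (-R) R) (%x. phi e p (F (Complex x y))))"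
 define I1 :: "real => real" where "I1 = (%y. integral (cbox (-R) R) (%x. phi1 e p (F (Complex x y)) (\<i> * F1 (Complex x y))))"
 define I2 :: "real => real" where "I2 = (%y. integral (cbox (-R) R) (%x. phi2 e p (F (Complex x y)) (\<i> * F1 (Complex x y)) (- F2 (Complex x y))))"
 define M where "M = 4 * p * c * (2 * c + 1) powr (p - 1) * R powr (- p - 1)"
 have cF: "continuous_on {z. 0 < Im z} F" "continuous_on {z. 0 < Im z} F1"
 by (rule DERIV_continuous_on, rule has_field_derivative_at_within, rule F, simp)+
 have cC: "continuous_on ({0<..} \<times> A) (%z. G (Complex (snd z) (fst z)))" if "continuous_on {z. 0 < Im z} G"
 for A :: "real set" and G :: "complex => complex"
 proof -
 have "continuous_on ({0<..} \<times> A) (%z. Complex (snd z) (fst z))" unfolding Complex_eq by (intro continuous_intros)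
 then show ?thesis by (rule continuous_on_compose2[OF that]) auto
 qed
 have cx: "continuous_on A (%x. G (Complex x y))" if "continuous_on {z. 0 < Im z} G" "0 < y"
 for A :: "real set" and G :: "complex => complex" and y
 proof -
 have "continuous_on A (%x. Complex x y)" unfolding Complex_eq by (intro continuous_intros)
 then show ?thesis by (rule continuous_on_compose2[OF that(1)]) (use that(2) in auto)
 qed
 have dy1: "((%y. phi e p (F (Complex x y))) has_real_derivative phi1 e p (F (Complex x y)) (\<i> * F1 (Complex x y))) (at y)"
 if "0 < y" for x y by (rule phi_deriv[OF e along_y[OF F(1)]]) (use that in simp)
 have dy2: "((%y. phi1 e p (F (Complex x y)) (\<i> * F1 (Complex x y))) has_real_derivative
 phi2 e p (F (Complex x y)) (\<i> * F1 (Complex x y)) (- F2 (Complex x y))) (at y)"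
 if "0 < y" for x y
 proof (rule phi1_deriv[OF e along_y[OF F(1)]])
 have "((%y. \<i> * F1 (Complex x y)) has_vector_derivative \<i> * (\<i> * F2 (Complex x y))) (at y)"
 by (intro has_vector_derivative_mult_right along_y F(2)) (use that in simp)
 then show "((%y. \<i> * F1 (Complex x y)) has_vector_derivative - F2 (Complex x y)) (at y)"
 by (simp flip: mult.assoc)
 qed (use that in simp)
 have dx1: "((%x. phi1 e p (F (Complex x y)) (F1 (Complex x y))) has_real_derivative
 phi2 e p (F (Complex x y)) (F1 (Complex x y)) (F2 (Complex x y))) (at x)"
 if "0 < y" for x y
 by (rule phi1_deriv[OF e along_x[OF F(1)] along_x[OF F(2)]]) (use that in auto)
 have dI: "(I has_real_derivative I1 y) (at y)" if y: "0 < y" for y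
 proof -
 have "(I has_vector_derivative I1 y) (at y within {0<..})"
 unfolding I_def I1_def
 proof (rule leibniz_rule_vector_derivative)
 show "((%y. phi e p (F (Complex x y))) has_vector_derivative phi1 e p (F (Complex x y)) (\<i> * F1 (Complex x y))) (at y within {0<..})"
 if "y \<in> {0<..}" for x y
 using dy1[of y x] that by (simp add: has_real_derivative_iff_has_vector_derivative has_vector_derivative_at_within)
 show "(%x. phi e p (F (Complex x y))) integrable_on cbox (- R) R" if "y \<in> {0<..}" for y
 by (intro integrable_continuous phi_continuous e cx cF) (use that in auto)
 show "continuous_on ({0<..} \<times> cbox (- R) R) (%(y, x). phi1 e p (F (Complex x y)) (\<i> * F1 (Complex x y)))"
 unfolding split_beta by (intro phi1_continuous e cC cF continuous_intros)
 qed (use y in auto)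
 then show ?thesis using y by (simp add: at_within_open[of y "{0<..}"] has_real_derivative_iff_has_vector_derivative)
 qed
 have dI1: "(I1 has_real_derivative I2 y) (at y)" if y: "0 < y" for y
 proof -
 have "(I1 has_vector_derivative I2 y) (at y within {0<..})"
 unfolding I1_def I2_def
 proof (rule leibniz_rule_vector_derivative)
 show "((%y. phi1 e p (F (Complex x y)) (\<i> * F1 (Complex x y))) has_vector_derivative
 phi2 e p (F (Complex x y)) (\<i> * F1 (Complex x y)) (- F2 (Complex x y))) (at y within {0<..})"
 if "y \<in> {0<..}" for x y
 using dy2[of y x] that by (simp add: has_real_derivative_iff_has_vector_derivative has_vector_derivative_at_within)
 show "(%x. phi1 e p (F (Complex x y)) (\<i> * F1 (Complex x y))) integrable_on cbox (- R) R" if "y \<in> {0<..}" for y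
 by (intro integrable_continuous phi1_continuous e cx cF continuous_intros) (use that in auto)
 show "continuous_on ({0<..} \<times> cbox (- R) R) (%(y, x). phi2 e p (F (Complex x y)) (\<i> * F1 (Complex x y)) (- F2 (Complex x y)))"
 unfolding split_beta by (intro phi2_continuous e cC cF F(3) continuous_intros)
 qed (use y in auto)
 then show ?thesis using y by (simp add: at_within_open[of y "{0<..}"] has_real_derivative_iff_has_vector_derivative)
 qed
 have far1: "\<bar>phi1 e p (F z) d\<bar> <= M" if z: "0 < Im z" "R <= norm z" "norm d = norm (F1 z)" for z d
 proof -
 have "\<bar>phi1 e p (F z) d\<bar> <= p * (2 * norm (F z) + e) powr (p - 1) * (2 * norm d)"
 using phi1_abs_le[OF e] p by simp
 also have "... <= p * ((2 * c + 1) / R) powr (p - 1) * (2 * (2 * c / R^2))"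
 proof (intro mult_mono mult_left_mono powr_mono2)
 show "2 * norm (F z) + e <= (2 * c + 1) / R" using bnd(1)[OF z(1,2)] by (simp add: e_def add_divide_distrib)
 show "norm d <= 2 * c / R^2" using bnd(2)[OF z(1,2)] z(3) by simp
 qed (use p e c R in auto)
 also have "... = 4 * p * c * (2 * c + 1) powr (p - 1) * (R powr (- (p - 1)) * R powr (- 2))"
 proof -
 have "((2 * c + 1) / R) powr (p - 1) = (2 * c + 1) powr (p - 1) * R powr (- (p - 1))"
 proof -
 have "((2 * c + 1) / R) powr (p - 1) = (2 * c + 1) powr (p - 1) / R powr (p - 1)"
 by (rule powr_divide)
 then show ?thesis by (simp only: powr_minus divide_inverse)
 qed
 moreover have "2 * (2 * c / R^2) = 4 * c * R powr (- 2)"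
 using R by (simp add: powr_minus divide_inverse powr_numeral)
 ultimately show ?thesis by (simp only: mult_ac)
 qed
 also have "R powr (- (p - 1)) * R powr (- 2) = R powr (- p - 1)" unfolding powr_add[symmetric] by (rule arg_cong[where f="(powr) R"]) simp
 finally show ?thesis by (simp add: M_def)
 qed
 have far0: "\<bar>phi e p (F z)\<bar> <= (2 * c + 1) powr p * R powr (- p)" if z: "0 < Im z" "R <= norm z" for z
 proof -
 have "\<bar>phi e p (F z)\<bar> <= (2 * norm (F z) + e) powr p" using phi_abs_le[OF e] p by simp
 also have "... <= ((2 * c + 1) / R) powr p"
 using bnd(1)[OF z(1,2)] p e by (intro powr_mono2) (auto simp: e_def add_divide_distrib)
 also have "... = (2 * c + 1) powr p * R powr (- p)" using R c by (simp add: powr_divide powr_minus field_simps)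
 finally show ?thesis .
 qed
 have M0: "0 <= M" using p c R by (simp add: M_def)
 \<comment> \<open>Subharmonicity bounds \<open>I2\<close> below by minus the integral of the second
   derivative in x. The fundamental theorem turns that integral into two end point values of
   \<open>phi1\<close>, each at most \<open>M\<close> in absolute value.\<close>
 have I2: "- (2 * M) <= I2 y" if y: "0 < y" for y
 proof -
 have hx: "((%x. phi2 e p (F (Complex x y)) (F1 (Complex x y)) (F2 (Complex x y))) has_integral
 (phi1 e p (F (Complex R y)) (F1 (Complex R y)) - phi1 e p (F (Complex (- R) y)) (F1 (Complex (- R) y)))) {-R..R}"
 by (rule fundamental_theorem_of_calculus)
 (use R y dx1 in \<open>auto simp flip: has_real_derivative_iff_has_vector_derivative intro: has_field_derivative_at_within\<close>)
 have "0 <= integral {-R..R} (%x. phi2 e p (F (Complex x y)) (F1 (Complex x y)) (F2 (Complex x y)) +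
 phi2 e p (F (Complex x y)) (\<i> * F1 (Complex x y)) (- F2 (Complex x y)))"
 by (intro integral_nonneg integrable_continuous_real continuous_intros phi2_continuous e cx cF F(3) y phi_laplacian p)
 also have "... = (phi1 e p (F (Complex R y)) (F1 (Complex R y)) - phi1 e p (F (Complex (- R) y)) (F1 (Complex (- R) y))) + I2 y"
 unfolding I2_def integral_unique[OF hx, symmetric] cbox_interval
 by (intro integral_add integrable_continuous_real continuous_intros phi2_continuous e cx cF F(3) y)
 finally have "- I2 y <= phi1 e p (F (Complex R y)) (F1 (Complex R y)) - phi1 e p (F (Complex (- R) y)) (F1 (Complex (- R) y))"
 by simp
 also have "... <= M + M"
 proof -
 have n: "R <= norm (Complex R y)" "R <= norm (Complex (- R) y)"
 using abs_Re_le_cmod[of "Complex R y"] abs_Re_le_cmod[of "Complex (- R) y"] R by auto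
 show ?thesis
 using far1[of "Complex R y" "F1 (Complex R y)"] far1[of "Complex (-R) y" "F1 (Complex (-R) y)"] n y by (simp add: abs_le_iff)
 qed
 finally show ?thesis by simp
 qed
 \<comment> \<open>At this height the whole segment lies outside the disc of radius
   \<open>R\<close>, so \<open>I Y\<close> and \<open>I1 Y\<close> are small by decay. The near
   monotonicity of \<open>I1\<close> and the mean value theorem carry the bound down to
   \<open>y0\<close>.\<close>
 define Y where "Y = y0 + R"
 have Y: "y0 < Y" "R <= Y" using R y0 by (auto simp: Y_def)
 have I1mono: "I1 y + 2 * M * y <= I1 Y + 2 * M * Y" if y: "y0 <= y" "y <= Y" for y
 proof (rule DERIV_nonneg_imp_nondecreasing[OF y(2), where f="%y. I1 y + 2 * M * y"])
 fix x assume "y <= x"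
 then have x: "0 < x" using y y0 by simp
 have "((%y. I1 y + 2 * M * y) has_real_derivative I2 x + 2 * M) (at x)"
 by (auto intro!: derivative_eq_intros dI1[OF x])
 then show "EX z. ((%y. I1 y + 2 * M * y) has_real_derivative z) (at x) & 0 <= z"
 using I2[OF x] by force
 qed
 have "EX x>y0. x < Y & I Y - I y0 = (Y - y0) * I1 x"
 by (rule MVT2) (use Y y0 dI in auto)
 then obtain x where x: "y0 < x" "x < Y" "I Y - I y0 = (Y - y0) * I1 x" by blast
 have "I1 x <= I1 Y + 2 * M * (Y - x)" using I1mono[of x] x by (simp add: algebra_simps)
 also have "... <= I1 Y + 2 * M * R" using M0 x by (auto simp: Y_def intro!: mult_left_mono)
 finally have "R * I1 x <= R * (I1 Y + 2 * M * R)" using R by (intro mult_left_mono) auto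
 then have A: "I Y - R * I1 Y - 2 * M * R^2 <= I y0"
 using x by (simp add: Y_def algebra_simps power2_eq_square)
 have nY: "0 < Im (Complex x Y)" "R <= norm (Complex x Y)" for x
 using abs_Im_le_cmod[of "Complex x Y"] Y y0 by auto
 have B1: "\<bar>I1 Y\<bar> <= M * (2 * R)"
 proof -
 have "norm (I1 Y) <= M * measure lborel (cbox (-R) R)"
 unfolding I1_def
 proof (rule Henstock_Kurzweil_Integration.integrable_bound)
 show "(%x. phi1 e p (F (Complex x Y)) (\<i> * F1 (Complex x Y))) integrable_on cbox (- R) R"
 by (intro integrable_continuous phi1_continuous e cx cF continuous_intros) (use Y y0 in auto)
 qed (use M0 far1[OF nY] in \<open>auto simp: norm_mult\<close>)
 then show ?thesis using R by simp
 qed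
 have B0: "\<bar>I Y\<bar> <= (2 * c + 1) powr p * R powr (- p) * (2 * R)"
 proof -
 have "norm (I Y) <= (2 * c + 1) powr p * R powr (- p) * measure lborel (cbox (-R) R)"
 unfolding I_def
 proof (rule Henstock_Kurzweil_Integration.integrable_bound)
 show "(%x. phi e p (F (Complex x Y))) integrable_on cbox (- R) R"
 by (intro integrable_continuous phi_continuous e cx cF) (use Y y0 in auto)
 qed (use far0[OF nY] in auto)
 then show ?thesis using R by simp
 qed
 have "R * I1 Y <= R * (M * (2 * R))" using B1 R by (intro mult_left_mono) auto
 then have L: "- ((2 * c + 1) powr p * R powr (- p) * (2 * R)) - 4 * M * R^2 <= I y0"
 using A B0 by (simp add: power2_eq_square algebra_simps abs_le_iff)
 have "R powr (- p) * R = R powr (1 - p)" "R powr (- p - 1) * R^2 = R powr (1 - p)"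
 using R by (simp_all add: powr_diff powr_minus power2_eq_square field_simps)
 then have X: "(2 * c + 1) powr p * R powr (- p) * (2 * R) = 2 * (2 * c + 1) powr p * R powr (1 - p)"
 "4 * M * R^2 = 16 * p * c * (2 * c + 1) powr (p - 1) * R powr (1 - p)"
 by (simp_all add: M_def mult.assoc)
 have "- (2 * (2 * c + 1) powr p + 16 * p * c * (2 * c + 1) powr (p - 1)) * R powr (1 - p) <= I y0"
 using L unfolding X by (simp only: minus_mult_left[symmetric] distrib_right)
 then show ?thesis unfolding I_def e_def cbox_interval .
qed

lemma powr_add_subadd:
 fixes a b q :: real
 assumes "0 <= a" "0 <= b" "0 < q" "q <= 1"
 shows "(a + b) powr q <= a powr q + b powr q"
proof (cases "a + b = 0")
 case False
 then have ab: "0 < a + b" using assms by auto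
 have le: "x <= x powr q" if "0 <= x" "x <= 1" for x using powr_mono'[of q 1 x] that assms by simp
 have "(a + b) powr q * (a / (a + b) + b / (a + b)) <= (a + b) powr q * ((a / (a + b)) powr q + (b / (a + b)) powr q)"
 using ab assms by (intro mult_left_mono add_mono le) auto
 moreover have "a / (a + b) + b / (a + b) = 1" using ab by (simp flip: add_divide_distrib)
 moreover have "(a + b) powr q * (x / (a + b)) powr q = x powr q" if "0 <= x" for x
 using ab that by (simp add: powr_divide)
 ultimately show ?thesis using assms by (simp add: distrib_left)
qed (use assms in auto)

text \<open>Integrability and bounded support supply the decay of the Cauchy integral and its
  derivative that \<open>phi_energy\<close> asks for. Integrating the pointwise inequality over
  -R..R leaves the claim up to a multiple of R powr (1 - p), which vanishes as R grows because p >
  1.\<close>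

lemma pichorides_real_nice:
 fixes f :: "real => real"
 assumes p: "1 < p" "p <= 2" and y0: "0 < y0" and f: "intg f" "!!t. a < \<bar>t\<bar> ==> f t = 0" "0 < a"
 shows "pL p (conv (Qk y0) f) <= en (tan (pi / (2 * p)) powr p) * pL p (conv (Pk y0) f)"
proof -
 have [measurable]: "bm f" using f by auto
 have h: "hadm f" unfolding hadm_def
 using b_integrable_bound[OF f(1), of "%t. (1 / (1 + \<bar>t\<bar>)) *R f t"]
 by (auto simp: abs_mult divide_le_eq mult_le_cancel_left1)
 define c where "c = (LI t. \<bar>f t\<bar>)"
 have c: "0 <= c" unfolding c_def by simp
 define F where "F = cauchyF f"
 have Fd: "(F has_field_derivative cauchyF1 f z) (at z)" if "0 < Im z" for z
 unfolding F_def by (rule cauchyF_deriv[OF h that])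
 have op: "open {z. 0 < Im z}" by (rule open_halfspace_Im_gt)
 have hol: "F holomorphic_on {z. 0 < Im z}"
 using Fd by (auto simp: holomorphic_on_open[OF op])
 have dF: "deriv F z = cauchyF1 f z" if "0 < Im z" for z by (rule DERIV_imp_deriv[OF Fd[OF that]])
 have hol1: "deriv F holomorphic_on {z. 0 < Im z}" by (rule holomorphic_deriv[OF hol op])
 have hol2: "deriv (deriv F) holomorphic_on {z. 0 < Im z}" by (rule holomorphic_deriv[OF hol1 op])
 have d1: "(F has_field_derivative deriv F z) (at z)" "(deriv F has_field_derivative deriv (deriv F) z) (at z)" if "0 < Im z" for z
 using holomorphic_derivI[OF hol op, of z] holomorphic_derivI[OF hol1 op, of z] that by auto
 define A where "A = tan (pi / (2 * p)) powr p"
 define B where "B = pich_B p"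
 have AB: "0 <= A" "0 <= B" using pich_B_nonneg[OF p(1)] by (auto simp: A_def B_def)
 define K where "K = 2 * (2 * c + 1) powr p + 16 * p * c * (2 * c + 1) powr (p - 1)"
 define u v where "u = conv (Pk y0) f" and "v = conv (Qk y0) f"
 have [measurable]: "bm u" "bm v" unfolding u_def v_def by measurable
 have Fuv: "F (Complex x y0) = Complex (u x) (v x)" for x
 unfolding F_def u_def v_def by (rule cauchyF_Complex[OF h y0])
 have cont: "continuous_on S (%x. F (Complex x y0))" for S :: "real set"
 proof -
 have "continuous_on S (%x. Complex x y0)" unfolding Complex_eq by (intro continuous_intros)
 then show ?thesis by (rule continuous_on_compose2[OF holomorphic_on_imp_continuous_on[OF hol]]) (use y0 in auto)
 qed
 have cu: "continuous_on S u" "continuous_on S v" for S :: "real set"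
 using continuous_on_Re[OF cont[of S]] continuous_on_Im[OF cont[of S]] by (simp_all add: Fuv)
 have R: "(NN x. en (norm (v x) powr p) * indicator {-R..R} x) <=
 en A * pL p u + en ((2 * A + B * K) * R powr (1 - p))" if R: "2 * a <= R" for R
 proof -
 have R0: "0 < R" using R f(3) by simp
 have nb: "norm (F z) <= c / R & norm (deriv F z) <= 2 * c / R^2" if z: "0 < Im z" "R <= norm z" for z
 proof -
 have far: "R / 2 <= norm (z - of_real t)" if "f t ~= 0" for t
 using f(2)[of t] that norm_triangle_ineq2[of z "of_real t"] R z by fastforce
 have g1: "norm (LI t. of_real (f t) / (z - of_real t)) <= 2 / R * c"
 proof -
 have "norm (LI t. of_real (f t) / (z - of_real t)) <= (LI t. 2 / R * \<bar>f t\<bar>)"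
 proof (rule b_integral_norm_bound_integral)
 show "norm (of_real (f t) / (z - of_real t)) <= 2 / R * \<bar>f t\<bar>" for t
 proof (cases "f t = 0")
 case False
 have "\<bar>f t\<bar> / norm (z - of_real t) <= \<bar>f t\<bar> / (R / 2)" using far[OF False] R0 by (intro frac_le) auto
 then show ?thesis by (simp add: norm_divide mult.commute)
 qed simp
 qed (use cauchyF_integrable[OF h z(1)] f in auto)
 then show ?thesis by (simp add: c_def)
 qed
 have g2: "norm (LI t. of_real (f t) / (z - of_real t)^2) <= 4 / R^2 * c"
 proof -
 have "norm (LI t. of_real (f t) / (z - of_real t)^2) <= (LI t. 4 / R^2 * \<bar>f t\<bar>)"
 proof (rule b_integral_norm_bound_integral)
 show "norm (of_real (f t) / (z - of_real t)^2) <= 4 / R^2 * \<bar>f t\<bar>" for t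
 proof (cases "f t = 0")
 case False
 have "\<bar>f t\<bar> / (norm (z - of_real t))^2 <= \<bar>f t\<bar> / (R / 2)^2" using far[OF False] R0 by (intro frac_le power_mono) auto
 then show ?thesis by (simp add: norm_divide norm_power power_divide mult.commute)
 qed simp
 qed (use cauchyF_integrable[OF h z(1)] f in auto)
 then show ?thesis by (simp add: c_def)
 qed
 have "norm (F z) = 1 / pi * norm (LI t. of_real (f t) / (z - of_real t))"
 by (simp add: F_def cauchyF_def norm_mult norm_divide)
 also have "... <= 1 / pi * (2 / R * c)" by (intro mult_left_mono g1) simp
 also have "... <= 1 / 2 * (2 / R * c)" using pi_ge_two R0 c by (intro mult_right_mono frac_le) auto
 finally have n1: "norm (F z) <= c / R" by simp
 have "norm (deriv F z) = 1 / pi * norm (LI t. of_real (f t) / (z - of_real t)^2)"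
 by (simp add: dF[OF z(1)] cauchyF1_def norm_mult norm_divide)
 also have "... <= 1 / pi * (4 / R^2 * c)" by (intro mult_left_mono g2) simp
 also have "... <= 1 / 2 * (4 / R^2 * c)" using pi_ge_two R0 c by (intro mult_right_mono frac_le) auto
 finally show ?thesis using n1 by simp
 qed
 have e9: "- K * R powr (1 - p) <= integral {-R..R} (%x. phi (1 / R) p (F (Complex x y0)))"
 unfolding K_def minus_add_distrib[symmetric]
 by (rule order.trans[OF _ phi_energy[OF d1 holomorphic_on_imp_continuous_on[OF hol2] p R0 y0 c]]) (use nb in auto)
 have i1: "(%x. \<bar>u x\<bar> powr p) integrable_on {-R..R}" "(%x. \<bar>v x\<bar> powr p) integrable_on {-R..R}"
 "(%x. phi (1 / R) p (F (Complex x y0))) integrable_on {-R..R}"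
 proof -
 have "continuous_on {-R..R} (%x. \<bar>w x\<bar> powr p)" if "continuous_on {-R..R} w" for w :: "real => real"
 by (rule continuous_on_powr') (use p that in \<open>auto intro: continuous_on_rabs\<close>)
 then show "(%x. \<bar>u x\<bar> powr p) integrable_on {-R..R}" "(%x. \<bar>v x\<bar> powr p) integrable_on {-R..R}"
 by (auto intro!: integrable_continuous_real cu)
 show "(%x. phi (1 / R) p (F (Complex x y0))) integrable_on {-R..R}"
 using R0 by (auto intro!: integrable_continuous_real phi_continuous cont)
 qed
 \<comment> \<open>\<open>zeta\<close> replaces |u| by the root of u^2 + 1 / R^2. As p / 2 <= 1,
   subadditivity of x powr (p / 2) keeps the cost at the constant (1 / R) powr p, which integrates
   to 2 * R powr (1 - p).\<close>
 have pw: "\<bar>v x\<bar> powr p <= A * (\<bar>u x\<bar> powr p + (1 / R) powr p) - B * phi (1 / R) p (F (Complex x y0))" for x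
 proof -
 define Z where "Z = zeta (1 / R) (F (Complex x y0))"
 have Z: "0 < Re Z" "Im Z = v x" "Re Z = sqrt ((u x)^2 + (1 / R)^2)"
 using sq_pos[of "1 / R" "u x"] R0 by (simp_all add: Z_def zeta_def Fuv)
 have "(Re Z) powr p = ((u x)^2 + (1 / R)^2) powr (p / 2)"
 unfolding Z(3) by (simp add: powr_half_sqrt[symmetric] powr_powr)
 also have "... <= ((u x)^2) powr (p / 2) + ((1 / R)^2) powr (p / 2)" using p by (intro powr_add_subadd) auto
 also have "... = \<bar>u x\<bar> powr p + (1 / R) powr p"
 proof -
 have "(s^2) powr (p / 2) = \<bar>s\<bar> powr p" for s :: real
 proof -
 have "(s^2) powr (p / 2) = (\<bar>s\<bar> powr 2) powr (p / 2)" by simp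
 then show ?thesis by (simp add: powr_powr del: powr_numeral)
 qed
 then show ?thesis using R0 by simp
 qed
 finally have "A * (Re Z) powr p <= A * (\<bar>u x\<bar> powr p + (1 / R) powr p)" using AB by (intro mult_left_mono) auto
 moreover have "\<bar>Im Z\<bar> powr p <= A * Re Z powr p - B * Re (Z powr of_real p)"
 using pichorides_pointwise[OF p Z(1)] by (simp add: A_def B_def)
 ultimately show ?thesis unfolding Z(2) phi_def Z_def[symmetric] by linarith
 qed
 have "integral {-R..R} (%x. \<bar>v x\<bar> powr p) <=
 integral {-R..R} (%x. A * (\<bar>u x\<bar> powr p + (1 / R) powr p) - B * phi (1 / R) p (F (Complex x y0)))"
 by (rule integral_le) (use i1 pw in \<open>auto intro!: integrable_diff integrable_add integrable_on_mult_right\<close>)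
 also have "... = A * (integral {-R..R} (%x. \<bar>u x\<bar> powr p) + (2 * R) * (1 / R) powr p) - B * integral {-R..R} (%x. phi (1 / R) p (F (Complex x y0)))"
 proof -
 have "((%x. A * (\<bar>u x\<bar> powr p + (1 / R) powr p) - B * phi (1 / R) p (F (Complex x y0))) has_integral
 A * (integral {-R..R} (%x. \<bar>u x\<bar> powr p) + (1 / R) powr p * (R - (- R))) - B * integral {-R..R} (%x. phi (1 / R) p (F (Complex x y0)))) {-R..R}"
 using i1 R0 has_integral_const_real[of "(1 / R) powr p" "-R" R]
 by (intro has_integral_diff has_integral_mult_right has_integral_add integrable_integral) (auto simp: mult.commute)
 from integral_unique[OF this] show ?thesis by (simp add: mult.commute)
 qed
 also have "... <= A * (integral {-R..R} (%x. \<bar>u x\<bar> powr p) + 2 * R powr (1 - p)) - B * (- K * R powr (1 - p))"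
 proof (intro diff_mono mult_left_mono add_mono e9 AB order_refl)
 show "2 * R * (1 / R) powr p <= 2 * R powr (1 - p)" using R0 by (simp add: powr_divide powr_diff)
 qed
 finally have le: "integral {-R..R} (%x. \<bar>v x\<bar> powr p) <= A * integral {-R..R} (%x. \<bar>u x\<bar> powr p) + (2 * A + B * K) * R powr (1 - p)"
 by (simp add: algebra_simps)
 have nn: "(NN x. en (\<bar>g x\<bar> powr p) * indicator {-R..R} x) = en (integral {-R..R} (%x. \<bar>g x\<bar> powr p))"
 if [measurable]: "bm g" and "(%x. \<bar>g x\<bar> powr p) integrable_on {-R..R}" for g :: "real => real"
 by (rule nn_integral_has_integral_lebesgue') (use that in \<open>auto intro: integrable_integral\<close>)
 have K0: "0 <= (2 * A + B * K) * R powr (1 - p)" using AB c p by (auto simp: K_def)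
 have "(NN x. en (norm (v x) powr p) * indicator {-R..R} x) <=
 en (A * integral {-R..R} (%x. \<bar>u x\<bar> powr p) + (2 * A + B * K) * R powr (1 - p))"
 using nn[of v] i1 le by (auto intro!: ennreal_leI)
 also have "... = en A * (NN x. en (\<bar>u x\<bar> powr p) * indicator {-R..R} x) + en ((2 * A + B * K) * R powr (1 - p))"
 using nn[of u] i1 AB K0 integral_nonneg[OF i1(1)] by (simp add: ennreal_plus ennreal_mult)
 also have "... <= en A * pL p u + en ((2 * A + B * K) * R powr (1 - p))"
 unfolding pint_def by (intro add_right_mono mult_left_mono nn_integral_mono) (auto split: split_indicator)
 finally show ?thesis .
 qed
 have "pL p v <= liminf (%n. (NN x. en (norm (v x) powr p) * indicator {- real n..real n} x))"
 proof -
 have "pL p v <= (NN x. liminf (%n. en (norm (v x) powr p) * indicator {- real n..real n} x))"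
 unfolding pint_def
 proof (rule nn_integral_mono)
 fix x
 have ev: "\<forall>\<^sub>F n in sequentially. en (norm (v x) powr p) * indicator {- real n..real n} x = en (norm (v x) powr p)"
 using eventually_ge_at_top[of "nat \<lceil>\<bar>x\<bar>\<rceil>"]
 proof eventually_elim
 case (elim n)
 then have "- real n <= x" "x <= real n" by linarith+
 then show ?case by simp
 qed
 then have "(%n. en (norm (v x) powr p) * indicator {- real n..real n} x) -->> en (norm (v x) powr p)"
 by (rule tendsto_eventually)
 from lim_imp_Liminf[OF _ this]
 show "en (norm (v x) powr p) <= liminf (%n. en (norm (v x) powr p) * indicator {- real n..real n} x)" by simp
 qed
 also have "... <= liminf (%n. (NN x. en (norm (v x) powr p) * indicator {- real n..real n} x))"
 by (intro nn_integral_liminf) simp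
 finally show ?thesis .
 qed
 also have "... <= liminf (%n. en A * pL p u + en ((2 * A + B * K) * real n powr (1 - p)))"
 proof (rule Liminf_mono)
 show "\<forall>\<^sub>F n in sequentially. (NN x. en (norm (v x) powr p) * indicator {- real n..real n} x) <=
 en A * pL p u + en ((2 * A + B * K) * real n powr (1 - p))"
 using eventually_ge_at_top[of "nat \<lceil>2 * a\<rceil>"]
 proof eventually_elim
 case (elim n)
 then have "2 * a <= real n" by linarith
 then show ?case by (rule R)
 qed
 qed
 also have "... = en A * pL p u + en ((2 * A + B * K) * 0)"
 proof (rule lim_imp_Liminf)
 have "(%n. real n powr (1 - p)) -->> 0" by (rule tendsto_neg_powr) (use p in \<open>auto intro: filterlim_real_sequentially\<close>)
 then show "(%n. en A * pL p u + en ((2 * A + B * K) * real n powr (1 - p))) -->>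
 en A * pL p u + en ((2 * A + B * K) * 0)"
 by (intro tendsto_add tendsto_const tendsto_ennrealI tendsto_mult)
 qed simp
 finally show ?thesis by (simp add: A_def u_def v_def)
qed

section \<open>The sharp bound for conjugate Poisson integrals of real functions\<close>

text \<open>The constant cot (pi / (2 * max p p')) in a form free of p'; \<open>hc_cot\<close> makes
  the identification. The first branch is what Pichorides' inequality yields directly.\<close>

definition hc :: "real => real" where
 "hc p = (if p <= 2 then tan (pi / (2 * p)) else cot (pi / (2 * p)))"

lemma hc_nonneg: assumes p: "1 < p" shows "0 < hc p"
proof -
 have "0 < pi / (2 * p)" "pi / (2 * p) < pi / 2" using p by (auto simp: field_simps)
 then show ?thesis by (simp add: hc_def tan_gt_zero cot_gt_zero)
qed

lemma hc_conj:
 assumes "2 < p" shows "hc (p / (p - 1)) = hc p"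
proof -
 have "p / (p - 1) <= 2" using assms by (simp add: field_simps)
 moreover have "pi / (2 * (p / (p - 1))) = pi / 2 - pi / (2 * p)" using assms by (simp add: field_simps)
 moreover have "tan (pi / 2 - x) = cot x" for x :: real by (simp add: tan_def cot_def sin_diff cos_diff)
 ultimately show ?thesis using assms by (simp add: hc_def)
qed

text \<open>Truncating both argument and value gives a bounded function with bounded support. It is
  p-integrable for all exponents at once, as the duality argument with exponents p and 2
  requires.\<close>

definition cutoff :: "nat => (real => 'b::real_normed_vector) => real => 'b" where
 "cutoff n f t = (if \<bar>t\<bar> <= real n & norm (f t) <= real n then f t else 0)"

lemma cutoff_measurable [measurable]:
 fixes f :: "real => 'b::{real_normed_vector, second_countable_topology}"
 assumes [measurable]: "bm f"
 shows "bm (cutoff n f)"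
 unfolding cutoff_def by measurable

lemma cutoff_le: "norm (cutoff n f t) <= norm (f t)" "norm (cutoff n f t) <= real n"
 by (auto simp: cutoff_def)

lemma cutoff_tendsto: "(%n. cutoff n f t) -->> f t"
proof (rule tendsto_eventually)
 show "\<forall>\<^sub>F n in sequentially. cutoff n f t = f t"
 using eventually_ge_at_top[of "nat \<lceil>\<bar>t\<bar> + norm (f t)\<rceil>"]
 proof eventually_elim
 case (elim n)
 have "\<bar>t\<bar> + norm (f t) <= real n" using elim by linarith
 then have "\<bar>t\<bar> <= real n" "norm (f t) <= real n" using norm_ge_zero[of "f t"] abs_ge_zero[of t] by linarith+
 then show ?case by (simp add: cutoff_def)
 qed
qed

lemma cutoff_integrable:
 fixes f :: "real => 'b::{banach, second_countable_topology}"
 assumes [measurable]: "bm f"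
 shows "intg (cutoff n f)"
proof (rule b_integrable_bound)
 show "intg (%t. real n * indicator {- real n..real n} t)" by simp
 have "norm (cutoff n f t) <= norm (real n * indicator {- real n..real n} t :: real)" for t
 by (cases "t \<in> {- real n..real n}") (auto simp: cutoff_def)
 then show "AEL t. norm (cutoff n f t) <= norm (real n * indicator {- real n..real n} t :: real)" by simp
qed simp

lemma pint_fatou:
 fixes f :: "'a => 'b::{real_normed_vector, second_countable_topology}"
 assumes [measurable]: "!!n. F n \<in> borel_measurable M" and p: "0 < p"
 and lim: "AE x in M. (%n. F n x) -->> f x" and le: "!!n. pint M p (F n) <= B"
 shows "pint M p f <= B"
proof -
 have "pint M p f <= (\<integral>\<^sup>+x. liminf (%n. en (norm (F n x) powr p)) \<partial>M)"
 unfolding pint_def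
 proof (rule nn_integral_mono_AE)
 show "AE x in M. en (norm (f x) powr p) <= liminf (%n. en (norm (F n x) powr p))"
 using lim
 proof eventually_elim
 case (elim x)
 have "(%n. en (norm (F n x) powr p)) -->> en (norm (f x) powr p)"
 using p by (intro tendsto_ennrealI tendsto_powr2 tendsto_intros elim) auto
 from lim_imp_Liminf[OF _ this] show ?case by simp
 qed
 qed
 also have "... <= liminf (%n. pint M p (F n))"
 unfolding pint_def by (intro nn_integral_liminf) simp
 also have "... <= B" by (intro Liminf_le) (use le in auto)
 finally show ?thesis .
qed

lemma conv_cutoff_tendsto:
 fixes f :: "real => 'b::{banach, second_countable_topology}"
 assumes [measurable]: "bm f" "bm k"
 and i: "intg (%t. k (x - t) *R f t)"
 shows "(%n. conv k (cutoff n f) x) -->> conv k f x"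
 unfolding conv_def
 by (rule integral_dominated_convergence[where w="%t. norm (k (x - t) *R f t)"])
 (use i integrable_norm[OF i] in \<open>auto intro!: tendsto_intros cutoff_tendsto mult_left_mono cutoff_le\<close>)

text \<open>At each point the convolutions of the cutoffs converge by domination, so Fatou extends
  the bound from the cutoffs to \<open>f\<close>.\<close>

lemma Q_bound_density:
 fixes f :: "real => 'b::{banach, second_countable_topology}"
 assumes p: "1 < p" and y: "0 < y" and [measurable]: "bm f" and fin: "pL p f < \<infinity>"
 and nice: "!!n. pL p (conv (Qk y) (cutoff n f)) <= en C * pL p (cutoff n f)"
 shows "pL p (conv (Qk y) f) <= en C * pL p f"
proof (rule pint_fatou)
 have "hadm f" by (rule Lp_hadm[OF p _ fin]) simp
 then show "AEL x. (%n. conv (Qk y) (cutoff n f) x) -->> conv (Qk y) f x"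
 using y by (intro AE_I2 conv_cutoff_tendsto hadm_Qk) auto
 show "pL p (conv (Qk y) (cutoff n f)) <= en C * pL p f" for n
 by (rule order.trans[OF nice mult_left_mono[OF pint_mono]]) (use p in \<open>auto intro: cutoff_le\<close>)
qed (use p in auto)

lemma Q_bound_le2:
 fixes f :: "real => real"
 assumes p: "1 < p" "p <= 2" and y: "0 < y" and [measurable]: "bm f" and fin: "pL p f < \<infinity>"
 shows "pL p (conv (Qk y) f) <= en (hc p powr p) * pL p f"
proof (rule Q_bound_density[OF p(1) y _ fin])
 fix n
 have "pL p (conv (Qk y) (cutoff n f)) <= en (tan (pi / (2 * p)) powr p) * pL p (conv (Pk y) (cutoff n f))"
 by (rule pichorides_real_nice[OF p y, of _ "real n + 1"]) (auto intro: cutoff_integrable simp: cutoff_def)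
 also have "... <= en (tan (pi / (2 * p)) powr p) * pL p (cutoff n f)"
 by (intro mult_left_mono pint_Pk_le p y) auto
 finally show "pL p (conv (Qk y) (cutoff n f)) <= en (hc p powr p) * pL p (cutoff n f)"
 using p by (simp add: hc_def)
qed simp

lemma Qk_pint_finite:
 assumes p: "1 < p" and y: "0 < y" shows "pL p (%s. Qk y (s - t)) < \<infinity>"
proof -
 obtain C where C: "!!s. 1 / sqrt ((0 - s)^2 + y^2) <= C * (1 / (1 + \<bar>s\<bar>))" using kernel_bound[OF y, of 0] by blast
 have C0: "0 <= C" using order.trans[OF _ C[of 0], of 0] y by simp
 have "pL p (%s. Qk y (s - t)) = (NN s. en (norm (Qk y s) powr p))"
 unfolding pint_def by (rule nn_integral_shift[where f="%s. en (norm (Qk y s) powr p)"]) measurable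
 also have "... <= (NN s. en (C powr p) * en ((1 + \<bar>s\<bar>) powr (- p)))"
 proof (rule nn_integral_mono)
 fix s
 have "norm (Qk y s) powr p <= (C * (1 / (1 + \<bar>s\<bar>))) powr p"
 using Qk_bound[OF y, of s] C[of s] p by (intro powr_mono2) auto
 also have "... = C powr p * (1 + \<bar>s\<bar>) powr (- p)" using C0 by (simp add: powr_divide powr_minus_divide)
 finally show "en (norm (Qk y s) powr p) <= en (C powr p) * en ((1 + \<bar>s\<bar>) powr (- p))"
 by (simp flip: ennreal_mult add: ennreal_leI)
 qed
 also have "... = en (C powr p) * (NN s. en ((1 + \<bar>s\<bar>) powr (- p)))" by (rule nn_integral_cmult) simp
 also have "... < \<infinity>" using nn_integral_one_plus_powr[OF p] by (simp add: ennreal_mult_less_top)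
 finally show ?thesis .
qed

text \<open>\<open>Qk y\<close> is odd, so exchanging the integrals moves it to the other factor
  with a minus sign. The double integral converges absolutely because Hoelder bounds the integral
  over \<open>x\<close> uniformly in \<open>t\<close> and \<open>f\<close> is integrable.\<close>

lemma Q_skew:
 fixes f g :: "real => real"
 assumes p: "1 < p" and pq: "1 / p + 1 / q = 1" and y: "0 < y"
 and f: "intg f" and [measurable]: "bm g" and fin: "pL q g < \<infinity>"
 shows "(LI x. conv (Qk y) f x * g x) = - (LI t. f t * conv (Qk y) g t)"
proof -
 have [measurable]: "bm f" using f by auto
 have odd: "Qk y (a - b) = - Qk y (b - a)" for a b unfolding Qk_def power2_commute[of a b] by (simp add: minus_divide_left)
 define K where "K = enn2real (pL p (Qk y)) powr (1 / p) * enn2real (pL q g) powr (1 / q)"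
 have K: "(NN x. en (norm (f t * Qk y (x - t) * g x))) <= en \<bar>f t\<bar> * en K" for t
 proof -
 have sh: "pL p (%x. Qk y (x - t)) = pL p (Qk y)"
 unfolding pint_def by (rule nn_integral_shift[where f="%s. en (norm (Qk y s) powr p)"]) measurable
 have fp: "pL p (Qk y) < \<infinity>" using Qk_pint_finite[OF p y, of t] sh by simp
 note h = holder[of "%x. Qk y (x - t)" lborel g p q "enn2real (pL p (Qk y))" "enn2real (pL q g)"]
 have i: "intg (%x. Qk y (x - t) * g x)" "(LI x. \<bar>Qk y (x - t) * g x\<bar>) <= K"
 using h p pq fp fin sh by (simp_all add: K_def)
 have "(NN x. en (norm (f t * Qk y (x - t) * g x))) = (NN x. en \<bar>f t\<bar> * en \<bar>Qk y (x - t) * g x\<bar>)"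
 by (intro nn_integral_cong) (simp add: abs_mult ennreal_mult mult.assoc)
 also have "... = en \<bar>f t\<bar> * (NN x. en \<bar>Qk y (x - t) * g x\<bar>)" by (rule nn_integral_cmult) simp
 also have "(NN x. en \<bar>Qk y (x - t) * g x\<bar>) = en (LI x. \<bar>Qk y (x - t) * g x\<bar>)"
 by (rule nn_integral_eq_integral) (use i(1) in auto)
 also have "en \<bar>f t\<bar> * ... <= en \<bar>f t\<bar> * en K" by (intro mult_left_mono ennreal_leI i) auto
 finally show ?thesis .
 qed
 have "(NN t. (NN x. en (norm (f t * Qk y (x - t) * g x)))) <= (NN t. en \<bar>f t\<bar> * en K)"
 by (rule nn_integral_mono[OF K])
 also have "... = (NN t. en \<bar>f t\<bar>) * en K" by (rule nn_integral_multc) simp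
 also have "... < \<infinity>" using f by (simp add: integrable_iff_bounded ennreal_mult_less_top)
 finally have fub: "(LI x. LI t. f t * Qk y (x - t) * g x) = (LI t. LI x. f t * Qk y (x - t) * g x)"
 by (intro fubini_lborel(1)) measurable
 have e1: "(LI t. f t * Qk y (x - t) * g x) = conv (Qk y) f x * g x" for x
 proof -
 have "(LI t. f t * Qk y (x - t) * g x) = (LI t. Qk y (x - t) *R f t) * g x"
 by (subst integral_mult_left_zero[symmetric]) (simp add: mult_ac)
 then show ?thesis by (simp add: conv_def)
 qed
 have e2: "(LI x. f t * Qk y (x - t) * g x) = - (f t * conv (Qk y) g t)" for t
 proof -
 have "(LI x. f t * Qk y (x - t) * g x) = (LI x. (- f t) * (Qk y (t - x) *R g x))"
 by (intro b_integral_cong refl) (simp add: odd[of _ t])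
 then show ?thesis by (simp add: conv_def)
 qed
 show ?thesis using fub unfolding e1 e2 by simp
qed

text \<open>For p > 2 by duality: \<open>w\<close> is tested against sgn w * |w| powr (p - 1), whose
  q-th power integral is the p-th power integral of \<open>w\<close>. Skew symmetry moves
  \<open>Qk\<close> onto this test function, where the exponent q <= 2 is already covered, and
  \<open>hc_conj\<close> says that the two constants agree.\<close>

lemma Q_bound_real:
 fixes f :: "real => real"
 assumes p: "1 < p" and y: "0 < y" and [measurable]: "bm f" and fin: "pL p f < \<infinity>"
 shows "pL p (conv (Qk y) f) <= en (hc p powr p) * pL p f"
proof (cases "p <= 2")
 case True
 then show ?thesis using Q_bound_le2[OF p _ y _ fin] by simp
next
 case False
 then have p2: "2 < p" by simp
 define q where "q = p / (p - 1)"
 have q: "1 < q" "q <= 2" "1 / p + 1 / q = 1" "1 / q + 1 / p = 1" "(p - 1) * q = p" using p2 by (auto simp: q_def field_simps)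
 show ?thesis
 proof (rule Q_bound_density[OF p y _ fin])
 fix n
 define F where "F = cutoff n f"
 have [measurable]: "bm F" unfolding F_def by measurable
 have Fi: "intg F" unfolding F_def by (rule cutoff_integrable) simp
 have Ffin: "pL r F < \<infinity>" if "1 < r" for r
 proof -
 have "pL r F <= (NN t. en (real n powr r) * indicator {- real n..real n} t)"
 unfolding pint_def
 proof (rule nn_integral_mono)
 fix t
 show "en (norm (F t) powr r) <= en (real n powr r) * indicator {- real n..real n} t"
 using that by (cases "t \<in> {- real n..real n}") (auto simp: F_def cutoff_def intro!: ennreal_leI powr_mono2)
 qed
 also have "... < \<infinity>" by (simp add: nn_integral_cmult ennreal_mult_less_top)
 finally show ?thesis .
 qed
 define w where "w = conv (Qk y) F"
 have [measurable]: "bm w" unfolding w_def by measurable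
 define W where "W = 1 / y * (LI t. \<bar>F t\<bar>)"
 have wW: "\<bar>w x\<bar> <= W" for x
 proof -
 have "norm (w x) <= (LI t. 1 / y * \<bar>F t\<bar>)"
 unfolding w_def conv_def
 proof (rule b_integral_norm_bound_integral)
 show "intg (%t. Qk y (x - t) *R F t)" using Lp_hadm[OF p _ Ffin[OF p]] y by (intro hadm_Qk) auto
 fix t
 have "\<bar>Qk y (x - t)\<bar> <= 1 / y"
 proof (rule order.trans[OF Qk_bound[OF y]])
 show "1 / sqrt ((x - t)^2 + y^2) <= 1 / y" using y by (intro frac_le) (auto intro: real_le_rsqrt)
 qed
 then show "norm (Qk y (x - t) *R F t) <= 1 / y * \<bar>F t\<bar>" by (simp only: real_norm_def real_scaleR_def abs_mult) (intro mult_right_mono, auto)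
 qed (use Fi in auto)
 then show ?thesis by (simp add: W_def)
 qed
 \<comment> \<open>Finiteness of the p-th power integral of \<open>w\<close> must be known before a
   power of it can be cancelled. It follows because \<open>w\<close> is bounded by \<open>W\<close>
   and square integrable by the case of exponent 2.\<close>
 have w2: "pL 2 w < \<infinity>"
 unfolding w_def by (rule le_less_trans[OF Q_bound_le2[OF _ _ y _ Ffin]]) (use Ffin[of 2] in \<open>auto simp: ennreal_mult_less_top\<close>)
 have wp: "pL p w < \<infinity>"
 proof -
 have "pL p w <= (NN x. en (W powr (p - 2)) * en (norm (w x) powr 2))"
 unfolding pint_def
 proof (rule nn_integral_mono)
 fix x
 have "norm (w x) powr p = norm (w x) powr (p - 2) * norm (w x) powr 2" unfolding powr_add[symmetric] by simp
 also have "... <= W powr (p - 2) * norm (w x) powr 2"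
 using wW[of x] p2 by (intro mult_right_mono powr_mono2) auto
 finally show "en (norm (w x) powr p) <= en (W powr (p - 2)) * en (norm (w x) powr 2)"
 by (simp flip: ennreal_mult add: ennreal_leI)
 qed
 also have "... = en (W powr (p - 2)) * pL 2 w" unfolding pint_def by (rule nn_integral_cmult) measurable
 also have "... < \<infinity>" using w2 by (simp add: ennreal_mult_less_top)
 finally show ?thesis .
 qed
 define g where "g x = sgn (w x) * \<bar>w x\<bar> powr (p - 1)" for x
 have [measurable]: "bm g" unfolding g_def by measurable
 have gq: "pL q g = pL p w"
 unfolding pint_def g_def using q by (intro nn_integral_cong) (auto simp: abs_mult abs_sgn_eq powr_powr)
 have wg: "w x * g x = norm (w x) powr p" for x
 proof -
 have "w x * sgn (w x) = \<bar>w x\<bar>" by (simp add: abs_sgn)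
 then have "w x * g x = \<bar>w x\<bar> * \<bar>w x\<bar> powr (p - 1)" by (simp add: g_def flip: mult.assoc)
 then show ?thesis by (cases "w x = 0") (auto simp: powr_diff)
 qed
 define N where "N = enn2real (pL p w)"
 define A where "A = enn2real (pL p F)"
 have N: "pL p w = en N" "0 <= N" and A: "pL p F = en A" "0 <= A"
 using wp Ffin[OF p] by (auto simp: N_def A_def)
 have Qg: "pL q (conv (Qk y) g) <= en (hc p powr q * N)"
 using Q_bound_le2[OF q(1,2) y, of g] hc_conj[OF p2] gq N by (simp add: q_def ennreal_mult)
 have "N = (LI x. norm (w x) powr p)"
 unfolding N_def pint_def by (rule integral_eq_nn_integral[symmetric]) auto
 also have "... = (LI x. conv (Qk y) F x * g x)" by (simp only: wg[symmetric]) (simp only: w_def)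
 also have "... = - (LI t. F t * conv (Qk y) g t)"
 by (rule Q_skew[OF p q(3) y Fi]) (use gq wp in auto)
 also have "... <= (LI t. \<bar>F t * conv (Qk y) g t\<bar>)"
 using integral_abs_bound[of lborel "%t. F t * conv (Qk y) g t"] by linarith
 also have "... <= A powr (1 / p) * (hc p powr q * N) powr (1 / q)"
 by (rule holder(2)[OF _ _ p q(3)]) (use A N Qg in auto)
 also have "... = A powr (1 / p) * hc p * N powr (1 / q)"
 using q N hc_nonneg[OF p] by (simp add: powr_mult powr_powr)
 finally have N9: "N <= A powr (1 / p) * hc p * N powr (1 / q)" .
 have "N <= hc p powr p * A"
 proof (cases "N = 0")
 case False
 then have N0: "0 < N" using N by simp
 have "N powr (1 / p) * N powr (1 / q) = N" unfolding powr_add[symmetric] q(3) using N0 by simp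
 then have "N powr (1 / p) * N powr (1 / q) <= (A powr (1 / p) * hc p) * N powr (1 / q)" using N9 by simp
 then have "N powr (1 / p) <= A powr (1 / p) * hc p" using N0 by simp
 then have "(N powr (1 / p)) powr p <= (A powr (1 / p) * hc p) powr p" using p by (intro powr_mono2) auto
 then show ?thesis using p N0 A hc_nonneg[OF p] by (simp add: powr_powr powr_mult mult.commute)
 qed (use A hc_nonneg[OF p] in auto)
 then show "pL p (conv (Qk y) (cutoff n f)) <= en (hc p powr p) * pL p (cutoff n f)"
 using A N unfolding F_def[symmetric] w_def[symmetric] by (simp flip: ennreal_mult add: ennreal_leI)
 qed simp
qed

section \<open>From real to complex functions\<close>

definition cos_avg :: "real => ennreal" where
 "cos_avg p = (\<integral>\<^sup>+th. en (\<bar>cos th\<bar> powr p) * indicator {0..<2 * pi} th \<partial>lborel)"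

lemma cos_avg_shift:
 assumes psi: "0 <= \<psi>" "\<psi> < 2 * pi"
 shows "(\<integral>\<^sup>+th. en (\<bar>cos (th - \<psi>)\<bar> powr p) * indicator {0..<2 * pi} th \<partial>lborel) = cos_avg p"
proof -
 define h where "h th = en (\<bar>cos th\<bar> powr p)" for th
 have [measurable]: "bm h" unfolding h_def by measurable
 have per: "h (th - 2 * pi) = h th" for th unfolding h_def by (simp add: cos_diff)
 have "(\<integral>\<^sup>+th. h (th - \<psi>) * indicator {0..<2 * pi} th \<partial>lborel) = (\<integral>\<^sup>+th. (%th. h th * indicator {- \<psi>..<2 * pi - \<psi>} th) (th - \<psi>) \<partial>lborel)"
 by (intro nn_integral_cong) (auto split: split_indicator)
 also have "... = (\<integral>\<^sup>+th. h th * indicator {- \<psi>..<2 * pi - \<psi>} th \<partial>lborel)" by (rule nn_integral_shift) measurable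
 also have "... = (\<integral>\<^sup>+th. h th * indicator {- \<psi>..<0} th + h th * indicator {0..<2 * pi - \<psi>} th \<partial>lborel)"
 using psi by (intro nn_integral_cong) (auto split: split_indicator)
 also have "... = (\<integral>\<^sup>+th. h th * indicator {- \<psi>..<0} th \<partial>lborel) + (\<integral>\<^sup>+th. h th * indicator {0..<2 * pi - \<psi>} th \<partial>lborel)"
 by (rule nn_integral_add) auto
 also have "(\<integral>\<^sup>+th. h th * indicator {- \<psi>..<0} th \<partial>lborel) = (\<integral>\<^sup>+th. (%th. h th * indicator {- \<psi>..<0} th) (th - 2 * pi) \<partial>lborel)"
 by (rule nn_integral_shift[symmetric]) measurable
 also have "... = (\<integral>\<^sup>+th. h th * indicator {2 * pi - \<psi>..<2 * pi} th \<partial>lborel)"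
 by (intro nn_integral_cong) (auto simp: per split: split_indicator)
 also have "... + (\<integral>\<^sup>+th. h th * indicator {0..<2 * pi - \<psi>} th \<partial>lborel) =
 (\<integral>\<^sup>+th. h th * indicator {2 * pi - \<psi>..<2 * pi} th + h th * indicator {0..<2 * pi - \<psi>} th \<partial>lborel)"
 by (rule nn_integral_add[symmetric]) auto
 also have "... = (\<integral>\<^sup>+th. h th * indicator {0..<2 * pi} th \<partial>lborel)"
 using psi by (intro nn_integral_cong) (auto split: split_indicator)
 finally show ?thesis by (simp add: h_def cos_avg_def)
qed

text \<open>Rotating \<open>z\<close> shifts the phase of a cosine, and an integral over a full
  period does not see the shift; only norm z remains.\<close>

lemma rotation_average:
 "(\<integral>\<^sup>+th. en (\<bar>Re (cis (- th) * z)\<bar> powr p) * indicator {0..<2 * pi} th \<partial>lborel) = cos_avg p * en (norm z powr p)"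
proof -
 define \<psi> where "\<psi> = Arg2pi z"
 have psi: "0 <= \<psi>" "\<psi> < 2 * pi" "z = norm z * cis \<psi>"
 using Arg2pi[of z] by (auto simp: \<psi>_def cis_conv_exp mult.commute is_Arg_def)
 have "Re (cis (- th) * z) = norm z * cos (th - \<psi>)" for th
 by (subst psi(3)) (simp add: cos_diff algebra_simps)
 then have "(\<integral>\<^sup>+th. en (\<bar>Re (cis (- th) * z)\<bar> powr p) * indicator {0..<2 * pi} th \<partial>lborel) =
 (\<integral>\<^sup>+th. (en (\<bar>cos (th - \<psi>)\<bar> powr p) * indicator {0..<2 * pi} th) * en (norm z powr p) \<partial>lborel)"
 by (intro nn_integral_cong) (simp add: abs_mult powr_mult ennreal_mult mult_ac split: split_indicator)
 also have "... = (\<integral>\<^sup>+th. en (\<bar>cos (th - \<psi>)\<bar> powr p) * indicator {0..<2 * pi} th \<partial>lborel) * en (norm z powr p)"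
 by (rule nn_integral_multc) measurable
 finally show ?thesis using cos_avg_shift[OF psi(1,2)] by simp
qed

lemma cos_avg_finite: assumes "0 < p" shows "cos_avg p < \<infinity>" "0 < cos_avg p"
proof -
 have "cos_avg p <= (\<integral>\<^sup>+th. 1 * indicator {0..<2 * pi} th \<partial>lborel)"
 unfolding cos_avg_def using assms by (intro nn_integral_mono mult_right_mono) (auto simp: powr_le1)
 also have "... < \<infinity>" by simp
 finally show "cos_avg p < \<infinity>" .
 have "en ((1 / 2) powr p) * en (pi / 3) = (\<integral>\<^sup>+th. en ((1 / 2) powr p) * indicator {0..<pi / 3} th \<partial>lborel)"
 by (simp add: nn_integral_cmult)
 also have "... <= cos_avg p"
 unfolding cos_avg_def
 proof (rule nn_integral_mono)
 fix th :: real
 show "en ((1 / 2) powr p) * indicator {0..<pi / 3} th <= en (\<bar>cos th\<bar> powr p) * indicator {0..<2 * pi} th"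
 proof (cases "th \<in> {0..<pi / 3}")
 case True
 then have "cos (pi / 3) <= cos th" by (intro cos_monotone_0_pi_le) auto
 then have "(1 / 2) powr p <= \<bar>cos th\<bar> powr p" using assms by (intro powr_mono2) (auto simp: cos_60)
 moreover have "th \<in> {0..<2 * pi}" using True pi_gt_zero by auto
 ultimately show ?thesis using True by (simp add: ennreal_leI)
 qed simp
 qed
 finally show "0 < cos_avg p" by (rule less_le_trans[rotated]) (simp flip: ennreal_mult)
qed

text \<open>The kernel is real, so the real bound holds for Re (cis (- th) * f) at every angle.
  Integrating over \<open>th\<close> turns both sides into \<open>cos_avg p\<close> times the
  integrals for the complex functions, and this factor, finite and positive, cancels.\<close>

theorem Q_bound:
 fixes f :: "real => complex"
 assumes p: "1 < p" and y: "0 < y" and [measurable]: "bm f" and fin: "pL p f < \<infinity>"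
 shows "pL p (conv (Qk y) f) <= en (hc p powr p) * pL p f"
proof -
 have h: "hadm f" by (rule Lp_hadm[OF p _ fin]) simp
 have av: "cos_avg p * pL p g = (\<integral>\<^sup>+th. pL p (%x. Re (cis (- th) * g x)) * indicator {0..<2 * pi} th \<partial>lborel)"
 if [measurable]: "bm g" for g :: "real => complex"
 proof -
 have "cos_avg p * pL p g = (NN x. cos_avg p * en (norm (g x) powr p))"
 unfolding pint_def by (rule nn_integral_cmult[symmetric]) measurable
 also have "... = (\<integral>\<^sup>+x. \<integral>\<^sup>+th. en (\<bar>Re (cis (- th) * g x)\<bar> powr p) * indicator {0..<2 * pi} th \<partial>lborel \<partial>lborel)"
 by (simp only: rotation_average)
 also have "... = (\<integral>\<^sup>+th. (NN x. en (\<bar>Re (cis (- th) * g x)\<bar> powr p) * indicator {0..<2 * pi} th) \<partial>lborel)"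
 by (rule tonelli_lborel[symmetric]) (simp add: cis_conv_exp, measurable)
 also have "... = (\<integral>\<^sup>+th. pL p (%x. Re (cis (- th) * g x)) * indicator {0..<2 * pi} th \<partial>lborel)"
 unfolding pint_def by (intro nn_integral_cong) (simp add: nn_integral_multc)
 finally show ?thesis .
 qed
 have "cos_avg p * pL p (conv (Qk y) f) =
 (\<integral>\<^sup>+th. pL p (%x. Re (cis (- th) * conv (Qk y) f x)) * indicator {0..<2 * pi} th \<partial>lborel)"
 by (rule av) measurable
 also have "... <= (\<integral>\<^sup>+th. en (hc p powr p) * (pL p (%x. Re (cis (- th) * f x)) * indicator {0..<2 * pi} th) \<partial>lborel)"
 proof (rule nn_integral_mono)
 fix th :: real
 have "Re (cis (- th) * conv (Qk y) f x) = conv (Qk y) (%t. Re (cis (- th) * f t)) x" for x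
 unfolding conv_cmult[symmetric] by (rule Re_conv[OF hadm_Qk[OF hadm_cmult[OF h] y]])
 then have "pL p (%x. Re (cis (- th) * conv (Qk y) f x)) = pL p (conv (Qk y) (%t. Re (cis (- th) * f t)))" by simp
 also have "... <= en (hc p powr p) * pL p (%t. Re (cis (- th) * f t))"
 proof (rule Q_bound_real[OF p y])
 have "pL p (%t. Re (cis (- th) * f t)) <= pL p f"
 proof (rule pint_mono)
 show "norm (Re (cis (- th) * f x)) <= norm (f x)" for x
 using abs_Re_le_cmod[of "cis (- th) * f x"] by (simp add: norm_mult)
 qed (use p in auto)
 then show "pL p (%t. Re (cis (- th) * f t)) < \<infinity>" using fin by (rule le_less_trans)
 qed measurable
 finally show "pL p (%x. Re (cis (- th) * conv (Qk y) f x)) * indicator {0..<2 * pi} th <=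
 en (hc p powr p) * (pL p (%x. Re (cis (- th) * f x)) * indicator {0..<2 * pi} th)"
 by (simp split: split_indicator)
 qed
 also have "... = en (hc p powr p) * (\<integral>\<^sup>+th. pL p (%x. Re (cis (- th) * f x)) * indicator {0..<2 * pi} th \<partial>lborel)"
 unfolding pint_def by (rule nn_integral_cmult) (simp add: cis_conv_exp, measurable)
 also have "... = cos_avg p * (en (hc p powr p) * pL p f)"
 unfolding av[OF assms(3), symmetric] by (simp add: mult_ac)
 finally have le: "cos_avg p * pL p (conv (Qk y) f) <= cos_avg p * (en (hc p powr p) * pL p f)" .
 obtain c where c: "cos_avg p = en c" "0 < c"
 using cos_avg_finite[of p] p by (cases "cos_avg p") auto
 show ?thesis using le c by (simp add: ennreal_mult_le_mult_iff)
qed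

section \<open>The semigroup identity for the kernels\<close>

text \<open>The Poisson integral reproduces 1 / (z - w), holomorphic above its pole w = t - i y, at
  the point x + i et. Partial fractions at the poles x + i et, x - i et and w give the
  antiderivative \<open>F\<close>, where \<open>L c b\<close> is log (s - (c + i b)) up to a
  constant. The hypothesis \<open>ne\<close> keeps the two lower poles x - i et and w apart.\<close>

lemma integral_FTC_arctan_kernel:
 fixes x t y et :: real
 assumes y: "0 < y" and et: "0 < et" and ne: "x ~= t \<or> et ~= y"
 shows "(LI s. of_real (Pk et (x - s)) / (of_real s - Complex t (- y))) = 1 / (Complex x et - Complex t (- y))"
proof -
 define L where "L c b s = Complex (ln ((s - c)^2 + b^2) / 2) (arctan ((s - c) / b))" for c b s :: real
 have Ld: "((%s. L c b s) has_vector_derivative 1 / (of_real s - Complex c b)) (at s)" if b: "b ~= 0" for c b s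
 proof -
 have pos: "0 < (s - c)^2 + b^2" using b by (simp add: add_nonneg_pos)
 have "((%s. ln ((s - c)^2 + b^2) / 2) has_real_derivative (s - c) / ((s - c)^2 + b^2)) (at s)"
 proof -
 have g: "((%s. (s - c)^2 + b^2) has_real_derivative 2 * (s - c)) (at s)"
 by (auto intro!: derivative_eq_intros)
 have e: "inverse X * (2 * r) / 2 = r / X" for X r :: real by (cases "X = 0") (auto simp: field_simps)
 show ?thesis
 using DERIV_cdivide[OF DERIV_chain2[OF DERIV_ln[OF pos] g], of 2] unfolding e .
 qed
 moreover have "((%s. arctan ((s - c) / b)) has_real_derivative inverse (1 + ((s - c) / b)^2) * (1 / b)) (at s)"
 using b by (auto intro!: derivative_eq_intros)
 moreover have "inverse (1 + ((s - c) / b)^2) * (1 / b) = b / ((s - c)^2 + b^2)"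
 proof -
 have "1 + ((s - c) / b)^2 = ((s - c)^2 + b^2) / b^2" using b by (simp add: power_divide add_divide_distrib)
 then show ?thesis using b pos by (simp add: power2_eq_square)
 qed
 ultimately have "((%s. L c b s) has_vector_derivative Complex ((s - c) / ((s - c)^2 + b^2)) (b / ((s - c)^2 + b^2))) (at s)"
 unfolding L_def by (intro has_vector_derivative_Complex) auto
 also have "Complex ((s - c) / ((s - c)^2 + b^2)) (b / ((s - c)^2 + b^2)) = 1 / (of_real s - Complex c b)"
 by (simp add: complex_eq_iff Re_divide Im_divide cmod_power2)
 finally show ?thesis .
 qed
 have Llim: "((%s. L c b s - L c' b' s) ->> Complex 0 ((sgn b - sgn b') * (pi / 2))) at_top"
 "((%s. L c b s - L c' b' s) ->> Complex 0 (- (sgn b - sgn b') * (pi / 2))) at_bot"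
 if b: "b ~= 0" "b' ~= 0" for c b c' b'
 proof -
 have q: "((%s. ((s - c)^2 + b^2) / ((s - c')^2 + b'^2)) ->> 1) at_top"
 "((%s. ((s - c)^2 + b^2) / ((s - c')^2 + b'^2)) ->> 1) at_bot"
 by real_asymp+
 have pos: "0 < (s - c)^2 + b^2" "0 < (s - c')^2 + b'^2" for s using b by (simp_all add: add_nonneg_pos)
 have re: "ln ((s - c)^2 + b^2) / 2 - ln ((s - c')^2 + b'^2) / 2 = ln (((s - c)^2 + b^2) / ((s - c')^2 + b'^2)) / 2" for s
 using ln_divide_pos[OF pos(1)[of s] pos(2)[of s]] by (simp add: diff_divide_distrib)
 have r: "((%s. ln ((s - c)^2 + b^2) / 2 - ln ((s - c')^2 + b'^2) / 2) ->> ln 1 / 2) at_top"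
 "((%s. ln ((s - c)^2 + b^2) / 2 - ln ((s - c')^2 + b'^2) / 2) ->> ln 1 / 2) at_bot"
 unfolding re by (intro tendsto_divide tendsto_ln q tendsto_const, simp, simp)+
 have at: "((%s. arctan ((s - c) / b)) ->> sgn b * (pi / 2)) at_top"
 "((%s. arctan ((s - c) / b)) ->> - (sgn b * (pi / 2))) at_bot" if "b ~= 0" for c b :: real
 proof -
 consider "0 < b" | "b < 0" using \<open>b \<noteq> 0\<close> by linarith
 then have "((%s. arctan ((s - c) / b)) ->> sgn b * (pi / 2)) at_top &
 ((%s. arctan ((s - c) / b)) ->> - (sgn b * (pi / 2))) at_bot"
 proof cases
 case 1
 have "((%s. arctan ((s - c) / b)) ->> pi / 2) at_top" "((%s. arctan ((s - c) / b)) ->> - (pi / 2)) at_bot"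
 using 1 by real_asymp+
 then show ?thesis using 1 by simp
 next
 case 2
 have "((%s. arctan ((s - c) / b)) ->> - (pi / 2)) at_top" "((%s. arctan ((s - c) / b)) ->> pi / 2) at_bot"
 using 2 by real_asymp+
 then show ?thesis using 2 by simp
 qed
 then show "((%s. arctan ((s - c) / b)) ->> sgn b * (pi / 2)) at_top"
 "((%s. arctan ((s - c) / b)) ->> - (sgn b * (pi / 2))) at_bot" by auto
 qed
 have "((%s. Complex (ln ((s - c)^2 + b^2) / 2 - ln ((s - c')^2 + b'^2) / 2) (arctan ((s - c) / b) - arctan ((s - c') / b'))) ->>
 Complex (ln 1 / 2) (sgn b * (pi / 2) - sgn b' * (pi / 2))) at_top"
 by (intro tendsto_Complex r tendsto_diff at b)
 moreover have "Complex (ln 1 / 2) (sgn b * (pi / 2) - sgn b' * (pi / 2)) = Complex 0 ((sgn b - sgn b') * (pi / 2))"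
 by (simp only: left_diff_distrib ln_one div_0)
 ultimately show "((%s. L c b s - L c' b' s) ->> Complex 0 ((sgn b - sgn b') * (pi / 2))) at_top"
 by (simp only: L_def complex_diff)
 have "((%s. Complex (ln ((s - c)^2 + b^2) / 2 - ln ((s - c')^2 + b'^2) / 2) (arctan ((s - c) / b) - arctan ((s - c') / b'))) ->>
 Complex (ln 1 / 2) (- (sgn b * (pi / 2)) - - (sgn b' * (pi / 2)))) at_bot"
 by (intro tendsto_Complex r tendsto_diff at b)
 moreover have "Complex (ln 1 / 2) (- (sgn b * (pi / 2)) - - (sgn b' * (pi / 2))) = Complex 0 (- (sgn b - sgn b') * (pi / 2))"
 by (simp only: left_diff_distrib ln_one div_0 minus_mult_left[symmetric]) simp
 ultimately show "((%s. L c b s - L c' b' s) ->> Complex 0 (- (sgn b - sgn b') * (pi / 2))) at_bot"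
 by (simp only: L_def complex_diff)
 qed
 define z1 z2 w where "z1 = Complex x et" and "z2 = Complex x (- et)" and "w = Complex t (- y)"
 have nw: "z1 ~= w" "z2 ~= w"
 using y et ne by (auto simp: z1_def z2_def w_def complex_eq_iff)
 have nz: "of_real s - z1 ~= 0" "of_real s - z2 ~= 0" "of_real s - w ~= 0" for s
 using y et ne by (auto simp: z1_def z2_def w_def complex_eq_iff)
 define f where "f s = of_real (Pk et (x - s)) / (of_real s - w)" for s
 define F where "F s = 1 / (2 * of_real pi * \<i>) * ((L x et s - L t (- y) s) / (z1 - w) - (L x (- et) s - L t (- y) s) / (z2 - w))" for s
 have pf: "1 / (2 * of_real pi * \<i>) * ((1 / (of_real s - z1) - 1 / (of_real s - w)) / (z1 - w) - (1 / (of_real s - z2) - 1 / (of_real s - w)) / (z2 - w)) = f s" for s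
 proof -
 have a: "(1 / (s' - z) - 1 / (s' - w)) / (z - w) = 1 / ((s' - z) * (s' - w))" if "s' - z ~= 0" "s' - w ~= 0" "z ~= w" for s' z :: complex
 using that by (simp add: divide_simps)
 have "1 / (of_real s - z1) - 1 / (of_real s - z2) = (z1 - z2) / ((of_real s - z1) * (of_real s - z2))"
 using nz[of s] by (simp add: divide_simps)
 also have "z1 - z2 = 2 * \<i> * of_real et" by (simp add: z1_def z2_def complex_eq_iff)
 also have "(of_real s - z1) * (of_real s - z2) = of_real ((x - s)^2 + et^2)"
 by (simp add: z1_def z2_def complex_eq_iff power2_eq_square algebra_simps)
 finally have "1 / (2 * of_real pi * \<i>) * (1 / (of_real s - z1) - 1 / (of_real s - z2)) = of_real (Pk et (x - s))"
 by (simp add: Pk_def)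
 then have "f s = 1 / (2 * of_real pi * \<i>) * (1 / (of_real s - z1) - 1 / (of_real s - z2)) / (of_real s - w)"
 by (simp add: f_def)
 also have "... = 1 / (2 * of_real pi * \<i>) * (1 / ((of_real s - z1) * (of_real s - w)) - 1 / ((of_real s - z2) * (of_real s - w)))"
 using nz[of s] by (simp add: diff_divide_distrib mult_ac)
 finally show ?thesis using a[where s'="of_real s" and z=z1] a[where s'="of_real s" and z=z2] nz[of s] nw by simp
 qed
 have Fd: "(F has_vector_derivative f s) (at s)" for s
 proof -
 have "(F has_vector_derivative (1 / (2 * of_real pi * \<i>) * ((1 / (of_real s - z1) - 1 / (of_real s - w)) / (z1 - w) -
 (1 / (of_real s - z2) - 1 / (of_real s - w)) / (z2 - w)))) (at s)"
 unfolding F_def z1_def z2_def w_def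
 by (intro has_vector_derivative_mult_right has_vector_derivative_diff has_vector_derivative_divide Ld) (use y et in auto)
 then show ?thesis unfolding pf .
 qed
 have fc: "isCont f s" for s unfolding f_def Pk_def using nz[of s] sq_pos[OF et, of "x - s"] by (intro continuous_intros) auto
 have fi: "intg f"
 proof (rule b_integrable_bound)
 show "intg (%s. 1 / y * Pk et (x - s))" using integrable_reflect_shift[OF Pk_integrable[OF et]] by auto
 show "f \<in> borel_measurable lborel" unfolding f_def by measurable
 have "norm (f s) <= norm (1 / y * Pk et (x - s))" for s
 proof -
 have "y <= norm (of_real s - w)" using abs_Im_le_cmod[of "of_real s - w"] y by (simp add: w_def)
 then have "norm (f s) <= \<bar>Pk et (x - s)\<bar> / y" unfolding f_def norm_divide norm_of_real using y by (intro frac_le) auto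
 then show ?thesis using y by (simp add: abs_mult)
 qed
 then show "AEL s. norm (f s) <= norm (1 / y * Pk et (x - s))" by simp
 qed
 have T: "(F ->> 1 / (2 * of_real pi * \<i>) * (Complex 0 ((sgn et - sgn (- y)) * (pi / 2)) / (z1 - w) - Complex 0 ((sgn (- et) - sgn (- y)) * (pi / 2)) / (z2 - w))) at_top"
 unfolding F_def by (intro tendsto_intros Llim) (use y et nw in auto)
 have Bt: "(F ->> 1 / (2 * of_real pi * \<i>) * (Complex 0 (- (sgn et - sgn (- y)) * (pi / 2)) / (z1 - w) - Complex 0 (- (sgn (- et) - sgn (- y)) * (pi / 2)) / (z2 - w))) at_bot"
 unfolding F_def by (intro tendsto_intros Llim) (use y et nw in auto)
 have s2: "(1 + 1) * (pi / 2) = pi" "- (1 + 1) * (pi / 2) = - pi" by auto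
 have "(LI s. f s) = 1 / (2 * of_real pi * \<i>) * (Complex 0 pi / (z1 - w)) - 1 / (2 * of_real pi * \<i>) * (Complex 0 (- pi) / (z1 - w))"
 using integral_FTC_real_line[OF Fd fc fi Bt T] y et by (simp add: s2 zero_complex.code[symmetric])
 also have "... = 1 / (z1 - w)"
 proof -
 have e: "Complex 0 pi = of_real pi * \<i>" "Complex 0 (- pi) = - (of_real pi * \<i>)" by (simp_all add: complex_eq_iff)
 have "1 / (2 * P) * (P / d) - 1 / (2 * P) * (- P / d) = 1 / d" if "P ~= 0" "d ~= 0" for P d :: complex
 using that by (simp add: divide_simps)
 from this[of "of_real pi * \<i>" "z1 - w"] show ?thesis unfolding e using nw by (simp add: mult.assoc)
 qed
 finally show ?thesis by (simp add: f_def z1_def w_def)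
qed

text \<open>Real and imaginary part of the preceding reproducing formula.\<close>

lemma Pk_Qk_conv:
 assumes y: "0 < y" and et: "0 < et" and ne: "x ~= t \<or> et ~= y"
 shows "(LI s. Pk et (x - s) * Qk y (s - t)) = Qk (y + et) (x - t)"
 "(LI s. Pk et (x - s) * Pk y (s - t)) = Pk (y + et) (x - t)"
proof -
 define f where "f s = of_real (Pk et (x - s)) / (of_real s - Complex t (- y))" for s
 have fe: "f s = Complex (pi * (Pk et (x - s) * Qk y (s - t))) (- pi * (Pk et (x - s) * Pk y (s - t)))" for s
 proof -
 have "of_real s - Complex t (- y) = Complex (s - t) y" by (simp add: complex_eq_iff)
 then show ?thesis using sq_pos[OF y, of "s - t"]
 by (simp add: f_def Qk_def Pk_def[of y] complex_eq_iff Re_divide Im_divide cmod_power2)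
 qed
 have fi: "intg f"
 proof (rule b_integrable_bound)
 show "intg (%s. 1 / y * Pk et (x - s))" using integrable_reflect_shift[OF Pk_integrable[OF et]] by auto
 show "f \<in> borel_measurable lborel" unfolding f_def by measurable
 have "norm (f s) <= norm (1 / y * Pk et (x - s))" for s
 proof -
 have "y <= norm (of_real s - Complex t (- y))" using abs_Im_le_cmod[of "of_real s - Complex t (- y)"] y by simp
 then have "norm (f s) <= \<bar>Pk et (x - s)\<bar> / y" unfolding f_def norm_divide norm_of_real using y by (intro frac_le) auto
 then show ?thesis using y by (simp add: abs_mult)
 qed
 then show "AEL s. norm (f s) <= norm (1 / y * Pk et (x - s))" by simp
 qed
 have I: "integral\<^sup>L lborel f = 1 / Complex (x - t) (y + et)"
 proof -
 have "Complex x et - Complex t (- y) = Complex (x - t) (y + et)" by (simp add: complex_eq_iff)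
 then show ?thesis using integral_FTC_arctan_kernel[OF y et ne] by (simp add: f_def[abs_def])
 qed
 have "Re (integral\<^sup>L lborel f) = (LI s. pi * (Pk et (x - s) * Qk y (s - t)))"
 by (subst integral_Re[OF fi, symmetric]) (simp only: fe complex.sel)
 moreover have "Re (integral\<^sup>L lborel f) = pi * Qk (y + et) (x - t)" unfolding I by (simp add: Re_divide Qk_def cmod_power2)
 ultimately show "(LI s. Pk et (x - s) * Qk y (s - t)) = Qk (y + et) (x - t)" by simp
 have "Im (integral\<^sup>L lborel f) = (LI s. - pi * (Pk et (x - s) * Pk y (s - t)))"
 by (subst integral_Im[OF fi, symmetric]) (simp only: fe complex.sel)
 moreover have "Im (integral\<^sup>L lborel f) = - pi * Pk (y + et) (x - t)" unfolding I by (simp add: Im_divide Pk_def cmod_power2) (simp add: minus_divide_left)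
 ultimately show "(LI s. Pk et (x - s) * Pk y (s - t)) = Pk (y + et) (x - t)" by simp
qed

text \<open>Fubini and \<open>Pk_Qk_conv\<close>. Absolute convergence has two reasons: in the first
  identity Hoelder bounds the inner integral uniformly; in the second the Poisson integral of |f| is
  again p-integrable, hence admissible for \<open>Qk\<close>.\<close>

lemma Q_semigroup:
 fixes f :: "real => complex"
 assumes p: "1 < p" and [measurable]: "bm f" and fin: "pL p f < \<infinity>"
 and y: "0 < y" and et: "0 < et"
 shows "conv (Pk et) (conv (Qk y) f) x = conv (Qk (y + et)) f x"
 "conv (Qk y) (conv (Pk et) f) x = conv (Qk (y + et)) f x"
proof -
 obtain q where q: "1 < q" "1 / p + 1 / q = 1" "1 / q + 1 / p = 1" using conj_exponent[OF p] by (metis add.commute)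
 have nf: "pL p (%t. norm (f t)) < \<infinity>" using fin by simp
 define K where "K = enn2real (pL p f) powr (1 / p) * enn2real (pL q (Qk y)) powr (1 / q)"
 have Kb: "(NN t. en (\<bar>Qk y (s - t)\<bar> * norm (f t))) <= en K" for s
 proof -
 have sh: "pL q (%t. Qk y (s - t)) = pL q (Qk y)"
 unfolding pint_def by (rule nn_integral_reflect_shift[where f="%s. en (norm (Qk y s) powr q)"]) measurable
 have fq: "pL q (Qk y) < \<infinity>" using Qk_pint_finite[OF q(1) y, of 0] by simp
 note h = holder[of "%t. norm (f t)" lborel "%t. Qk y (s - t)" p q "enn2real (pL p f)" "enn2real (pL q (Qk y))"]
 have i: "intg (%t. norm (f t) * Qk y (s - t))" "(LI t. \<bar>norm (f t) * Qk y (s - t)\<bar>) <= K"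
 using h p q fq fin sh by (simp_all add: K_def)
 have "(NN t. en (\<bar>Qk y (s - t)\<bar> * norm (f t))) = (NN t. en \<bar>norm (f t) * Qk y (s - t)\<bar>)"
 by (intro nn_integral_cong) (simp add: abs_mult mult.commute)
 also have "... = en (LI t. \<bar>norm (f t) * Qk y (s - t)\<bar>)"
 by (rule nn_integral_eq_integral) (use i(1) in auto)
 finally show ?thesis using i(2) by (simp add: ennreal_leI)
 qed
 \<comment> \<open>The kernel identity may be missing at the one point t = x, a null set for the
   outer integral.\<close>
 have AEt: "AEL t. x ~= t \<or> et ~= y" by (rule eventually_mono[OF AE_lborel_singleton[of x]]) auto
 {
 have "(NN s. (NN t. en (norm ((Pk et (x - s) * Qk y (s - t)) *R f t)))) <= (NN s. en (Pk et (x - s)) * en K)"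
 proof (rule nn_integral_mono)
 fix s
 have "(NN t. en (norm ((Pk et (x - s) * Qk y (s - t)) *R f t))) = (NN t. en (Pk et (x - s)) * en (\<bar>Qk y (s - t)\<bar> * norm (f t)))"
 using et by (intro nn_integral_cong) (simp add: abs_mult ennreal_mult mult.assoc)
 also have "... = en (Pk et (x - s)) * (NN t. en (\<bar>Qk y (s - t)\<bar> * norm (f t)))" by (rule nn_integral_cmult) measurable
 also have "... <= en (Pk et (x - s)) * en K" by (intro mult_left_mono Kb) auto
 finally show "(NN t. en (norm ((Pk et (x - s) * Qk y (s - t)) *R f t))) <= en (Pk et (x - s)) * en K" .
 qed
 also have "... = (NN s. en (Pk et (x - s))) * en K" by (rule nn_integral_multc) measurable
 also have "... < \<infinity>" by (subst nn_integral_reflect_shift) (use et in \<open>auto simp: Pk_nn_integral\<close>)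
 finally have "(LI t. LI s. (Pk et (x - s) * Qk y (s - t)) *R f t) = (LI s. LI t. (Pk et (x - s) * Qk y (s - t)) *R f t)"
 by (intro fubini_lborel(1)) measurable
 moreover have "(LI t. (Pk et (x - s) * Qk y (s - t)) *R f t) = Pk et (x - s) *R conv (Qk y) f s" for s
 unfolding conv_def scaleR_scaleR[symmetric] by (rule integral_scaleR_right)
 moreover have "(LI t. LI s. (Pk et (x - s) * Qk y (s - t)) *R f t) = (LI t. Qk (y + et) (x - t) *R f t)"
 proof (rule integral_cong_AE)
 show "AEL t. (LI s. (Pk et (x - s) * Qk y (s - t)) *R f t) = Qk (y + et) (x - t) *R f t"
 using AEt
 proof eventually_elim
 case (elim t)
 have i: "intg (%s. Pk et (x - s) * Qk y (s - t))"
 proof (rule b_integrable_bound)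
 show "intg (%s. 1 / y * Pk et (x - s))" using integrable_reflect_shift[OF Pk_integrable[OF et]] by auto
 have "norm (Pk et (x - s) * Qk y (s - t)) <= norm (1 / y * Pk et (x - s))" for s
 proof -
 have "\<bar>Qk y (s - t)\<bar> <= 1 / y"
 by (rule order.trans[OF Qk_bound[OF y]]) (use y in \<open>auto intro!: frac_le real_le_rsqrt\<close>)
 then have "\<bar>Pk et (x - s)\<bar> * \<bar>Qk y (s - t)\<bar> <= \<bar>Pk et (x - s)\<bar> * (1 / y)" by (intro mult_left_mono) auto
 then show ?thesis using y by (simp add: abs_mult)
 qed
 then show "AEL s. norm (Pk et (x - s) * Qk y (s - t)) <= norm (1 / y * Pk et (x - s))" by simp
 qed simp
 show ?case using Pk_Qk_conv(1)[OF y et elim] by (simp add: integral_scaleR_left[OF i])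
 qed
 qed measurable
 ultimately show "conv (Pk et) (conv (Qk y) f) x = conv (Qk (y + et)) f x" by (simp add: conv_def)
 }
 have Pd: "conv (Pk et) f s = conv (Pk et) f s" for s ..
 {
 define g where "g s = (LI t. Pk et (s - t) *R f t)" for s
 define Kp where "Kp = enn2real (pL p (conv (Pk et) (%t. norm (f t)))) powr (1 / p) * enn2real (pL q (Qk y)) powr (1 / q)"
 have Pn: "intg (%t. Pk et (s - t) * norm (f t))" for s
 using hadm_Pk[OF Lp_hadm[OF p _ nf] et] by simp
 have gn: "pL p (conv (Pk et) (%t. norm (f t))) < \<infinity>"
 by (rule le_less_trans[OF pint_Pk_le[OF p _ et] nf]) measurable
 have "(NN s. (NN t. en (norm ((Qk y (x - s) * Pk et (s - t)) *R f t)))) = (NN s. en \<bar>Qk y (x - s) * conv (Pk et) (%t. norm (f t)) s\<bar>)"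
 proof (rule nn_integral_cong)
 fix s
 have "(NN t. en (norm ((Qk y (x - s) * Pk et (s - t)) *R f t))) = (NN t. en \<bar>Qk y (x - s)\<bar> * en (Pk et (s - t) * norm (f t)))"
 using et by (intro nn_integral_cong) (simp add: abs_mult ennreal_mult mult.assoc)
 also have "... = en \<bar>Qk y (x - s)\<bar> * (NN t. en (Pk et (s - t) * norm (f t)))" by (rule nn_integral_cmult) measurable
 also have "(NN t. en (Pk et (s - t) * norm (f t))) = en (conv (Pk et) (%t. norm (f t)) s)"
 using nn_integral_eq_integral[OF Pn[of s]] et by (simp add: conv_def)
 also have "en \<bar>Qk y (x - s)\<bar> * ... = en \<bar>Qk y (x - s) * conv (Pk et) (%t. norm (f t)) s\<bar>"
 proof -
 have "0 <= conv (Pk et) (%t. norm (f t)) s" unfolding conv_def using et by (intro b_integral_nonneg) simp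
 then show ?thesis by (simp add: abs_mult ennreal_mult)
 qed
 finally show "(NN t. en (norm ((Qk y (x - s) * Pk et (s - t)) *R f t))) = en \<bar>Qk y (x - s) * conv (Pk et) (%t. norm (f t)) s\<bar>" .
 qed
 also have "... < \<infinity>"
 using hadm_Qk[OF Lp_hadm[OF p _ gn] y, of x] by (simp add: integrable_iff_bounded)
 finally have "(LI t. LI s. (Qk y (x - s) * Pk et (s - t)) *R f t) = (LI s. LI t. (Qk y (x - s) * Pk et (s - t)) *R f t)"
 by (intro fubini_lborel(1)) measurable
 moreover have "(LI t. (Qk y (x - s) * Pk et (s - t)) *R f t) = Qk y (x - s) *R conv (Pk et) f s" for s
 unfolding conv_def scaleR_scaleR[symmetric] by (rule integral_scaleR_right)
 moreover have "(LI t. LI s. (Qk y (x - s) * Pk et (s - t)) *R f t) = (LI t. Qk (y + et) (x - t) *R f t)"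
 proof (rule integral_cong_AE)
 show "AEL t. (LI s. (Qk y (x - s) * Pk et (s - t)) *R f t) = Qk (y + et) (x - t) *R f t"
 using AEt
 proof eventually_elim
 case (elim t)
 have r: "Qk y (x - s) * Pk et (s - t) = Pk et (x - (x + t - s)) * Qk y ((x + t - s) - t)" for s
 by (simp add: mult.commute)
 have i: "intg (%s. Qk y (x - s) * Pk et (s - t))"
 proof (rule b_integrable_bound)
 show "intg (%s. 1 / y * Pk et (t - s))" using integrable_reflect_shift[OF Pk_integrable[OF et]] by auto
 have "norm (Qk y (x - s) * Pk et (s - t)) <= norm (1 / y * Pk et (t - s))" for s
 proof -
 have "\<bar>Qk y (x - s)\<bar> <= 1 / y"
 by (rule order.trans[OF Qk_bound[OF y]]) (use y in \<open>auto intro!: frac_le real_le_rsqrt\<close>)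
 then have "\<bar>Qk y (x - s)\<bar> * \<bar>Pk et (t - s)\<bar> <= (1 / y) * \<bar>Pk et (t - s)\<bar>" by (intro mult_right_mono) auto
 moreover have "Pk et (s - t) = Pk et (t - s)" by (simp add: Pk_def power2_commute)
 ultimately show ?thesis using y by (simp add: abs_mult)
 qed
 then show "AEL s. norm (Qk y (x - s) * Pk et (s - t)) <= norm (1 / y * Pk et (t - s))" by simp
 qed simp
 have "(LI s. Qk y (x - s) * Pk et (s - t)) = (LI s. (%s. Pk et (x - s) * Qk y (s - t)) (x + t - s))"
 by (intro b_integral_cong refl) (simp only: r)
 also have "... = Qk (y + et) (x - t)"
 using integral_reflect_shift[of "%s. Pk et (x - s) * Qk y (s - t)" "x + t"] Pk_Qk_conv(1)[OF y et elim] by simp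
 finally show ?case by (simp add: integral_scaleR_left[OF i])
 qed
 qed measurable
 ultimately show "conv (Qk y) (conv (Pk et) f) x = conv (Qk (y + et)) f x" by (simp add: conv_def)
 }
qed

section \<open>Lebesgue points and boundary limits\<close>

text \<open>Lebesgue points in the strong sense, obtained by differentiating the indefinite integrals of
 \<open>\<bar>f - q\<bar>\<close> for the countably many \<open>q\<close> with rational coordinates.\<close>

lemma set_integrable_const_Icc: "set_integrable lborel {a..b::real} (%t. c :: 'b::{banach, second_countable_topology})"
proof -
 have "intg (%t. indicator {a..b} t :: real)" by (rule integrable_real_indicator) (auto simp: emeasure_lborel_Icc_eq)
 then show ?thesis unfolding set_integrable_def by (rule integrable_scaleR_left)
qed

lemma hadm_integrable_on_cbox:
 fixes f :: "real => complex"
 assumes "hadm f"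
 shows "set_integrable lborel {a..b} f"
proof -
 have [measurable]: "bm f" using assms by (simp add: hadm_def)
 have "intg (%t. indicator {a..b} t *R f t)"
 by (rule hadm_integrable[OF assms, where C="1 + \<bar>a\<bar> + \<bar>b\<bar>"]) (auto simp: field_simps split: split_indicator)
 then show ?thesis by (simp add: set_integrable_def)
qed

lemma hadm_diff_const_integrable:
 fixes f :: "real => complex"
 assumes "hadm f"
 shows "(%t. norm (f t - c)) integrable_on cbox a b"
 "integral (cbox a b) (%t. norm (f t - c)) = (LINT t:{a..b}|lborel. norm (f t - c))"
proof -
 have "set_integrable lborel {a..b} (%t. f t - c)"
 by (rule set_integral_diff(1)[OF hadm_integrable_on_cbox[OF assms]]) (rule set_integrable_const_Icc)
 then have i: "set_integrable lborel {a..b} (%t. norm (f t - c))" by (rule set_integrable_norm)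
 show "(%t. norm (f t - c)) integrable_on cbox a b" "integral (cbox a b) (%t. norm (f t - c)) = (LINT t:{a..b}|lborel. norm (f t - c))"
 using set_borel_integral_eq_integral[OF i] by auto
qed

lemma right_lebesgue_point:
 fixes f :: "real => complex"
 assumes f: "hadm f"
 shows "AEL x. ALL e>0. EX d>0. ALL h. 0 < h & h < d --> (LINT t:{x..x+h}|lborel. norm (f t - f x)) <= e * h"
proof -
 define D :: "complex set" where "D = (%(a, b). Complex (of_rat a) (of_rat b)) ` UNIV"
 have cD: "countable D" unfolding D_def by auto
 have dense: "\<exists>q\<in>D. norm (z - q) < e" if e: "0 < e" for z e
 proof -
 obtain a where a: "Re z - e / 2 < of_rat a" "of_rat a < Re z" using of_rat_dense[of "Re z - e / 2" "Re z"] e by auto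
 obtain b where b: "Im z - e / 2 < of_rat b" "of_rat b < Im z" using of_rat_dense[of "Im z - e / 2" "Im z"] e by auto
 have "norm (z - Complex (of_rat a) (of_rat b)) <= \<bar>Re z - of_rat a\<bar> + \<bar>Im z - of_rat b\<bar>"
 using cmod_le[of "z - Complex (of_rat a) (of_rat b)"] by simp
 also have "... < e" using a b by linarith
 finally have "norm (z - Complex (of_rat a) (of_rat b)) < e" .
 moreover have "Complex (of_rat a) (of_rat b) \<in> D" unfolding D_def by (rule image_eqI[of _ _ "(a, b)"]) auto
 ultimately show ?thesis by blast
 qed
 have q: "AEL x. ALL e>0. EX d>0. ALL h. 0 < h & h < d --> (LINT t:{x..x+h}|lborel. norm (f t - q)) < (norm (f x - q) + e) * h" for q
 proof -
 obtain N where N: "negligible N" "!!x e. x \<notin> N ==> 0 < e ==>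
 EX d>0. ALL h. 0 < h & h < d --> norm (integral (cbox x (x + h *R One)) (%t. norm (f t - q)) /\<^sub>R h ^ DIM(real) - norm (f x - q)) < e"
 using integrable_ccontinuous_explicit[of "%t. norm (f t - q)", OF hadm_diff_const_integrable(1)[OF f]] by metis
 have "AE x in lebesgue. x \<notin> N" using N(1) by (simp add: negligible_iff_null_sets AE_not_in)
 then have "AEL x. x \<notin> N" by (simp add: AE_completion_iff)
 then show ?thesis
 proof eventually_elim
 case (elim x)
 show ?case
 proof (intro allI impI)
 fix e :: real assume "0 < e"
 from N(2)[OF elim this] obtain d where d: "0 < d" "!!h. 0 < h ==> h < d ==>
 \<bar>(LINT t:{x..x+h}|lborel. norm (f t - q)) / h - norm (f x - q)\<bar> < e"
 unfolding hadm_diff_const_integrable(2)[OF f] by (auto simp: divide_inverse mult.commute)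
 have "(LINT t:{x..x+h}|lborel. norm (f t - q)) < (norm (f x - q) + e) * h" if h: "0 < h" "h < d" for h
 proof -
 have "(LINT t:{x..x+h}|lborel. norm (f t - q)) / h < norm (f x - q) + e" using d(2)[OF h] by (simp add: abs_less_iff)
 then show ?thesis using h by (simp add: divide_less_eq)
 qed
 then show "EX d>0. ALL h. 0 < h & h < d --> (LINT t:{x..x+h}|lborel. norm (f t - q)) < (norm (f x - q) + e) * h" using d(1) by blast
 qed
 qed
 qed
 have "AEL x. \<forall>q\<in>D. ALL e>0. EX d>0. ALL h. 0 < h & h < d --> (LINT t:{x..x+h}|lborel. norm (f t - q)) < (norm (f x - q) + e) * h"
 using q by (subst AE_ball_countable[OF cD]) blast
 then show ?thesis
 proof eventually_elim
 case (elim x)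
 show ?case
 proof (intro allI impI)
 fix e :: real assume e: "0 < e"
 obtain q where qD: "q \<in> D" "norm (f x - q) < e / 3" using dense[of "e / 3" "f x"] e by auto
 have "0 < e / 3" using e by simp
 with elim qD(1) have "EX d>0. ALL h. 0 < h & h < d --> (LINT t:{x..x+h}|lborel. norm (f t - q)) < (norm (f x - q) + e / 3) * h"
 by blast
 then obtain d where d: "0 < d" "!!h. 0 < h ==> h < d ==> (LINT t:{x..x+h}|lborel. norm (f t - q)) < (norm (f x - q) + e / 3) * h"
 by blast
 have "(LINT t:{x..x+h}|lborel. norm (f t - f x)) <= e * h" if h: "0 < h" "h < d" for h
 proof -
 have i: "set_integrable lborel {x..x+h} (%t. norm (f t - c))" for c
 proof (rule set_integrable_norm)
 show "set_integrable lborel {x..x+h} (%t. f t - c)"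
 by (rule set_integral_diff(1)[OF hadm_integrable_on_cbox[OF f]]) (rule set_integrable_const_Icc)
 qed
 have ic: "set_integrable lborel {x..x+h} (%t. norm (f x - q))" by (rule set_integrable_const_Icc)
 have "(LINT t:{x..x+h}|lborel. norm (f t - f x)) <= (LINT t:{x..x+h}|lborel. norm (f t - q) + norm (f x - q))"
 by (rule set_integral_mono[OF i set_integral_add(1)[OF i ic]]) (use norm_triangle_ineq4[of "f _ - q" "f x - q"] in simp)
 also have "... = (LINT t:{x..x+h}|lborel. norm (f t - q)) + (LINT t:{x..x+h}|lborel. norm (f x - q))"
 by (rule set_integral_add(2)[OF i ic])
 also have "(LINT t:{x..x+h}|lborel. norm (f x - q)) = norm (f x - q) * h"
 using h by (simp add: set_lebesgue_integral_def mult.commute)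
 also have "(LINT t:{x..x+h}|lborel. norm (f t - q)) + norm (f x - q) * h <= (norm (f x - q) + e / 3) * h + norm (f x - q) * h"
 using d(2)[OF h] by simp
 also have "... = (2 * norm (f x - q) + e / 3) * h" by (simp add: algebra_simps)
 also have "... <= e * h" using qD(2) h by (intro mult_right_mono) auto
 finally show ?thesis .
 qed
 then show "EX d>0. ALL h. 0 < h & h < d --> (LINT t:{x..x+h}|lborel. norm (f t - f x)) <= e * h" using d(1) by blast
 qed
 qed
qed

definition lebesgue_point :: "(real => complex) => real => bool" where
 "lebesgue_point f x \<longleftrightarrow> (ALL e>0. EX d>0. ALL h. 0 < h & h < d --> (LINT t:{x-h..x+h}|lborel. norm (f t - f x)) <= e * h)"

lemma hadm_reflect:
 fixes f :: "real => complex" shows "hadm f ==> hadm (%t. f (- t))"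
 unfolding hadm_def using integrable_reflect_shift[of "%t. (1 / (1 + \<bar>t\<bar>)) *R f t" 0] by auto

lemma AE_lborel_reflect:
 fixes P :: "real => bool"
 assumes "AEL x. P x" shows "AEL x. P (- x)"
proof -
 obtain N where N: "{x. \<not> P x} \<subseteq> N" "N \<in> null_sets lborel" using assms by (auto simp: eventually_ae_filter)
 have [measurable]: "N \<in> sets borel" using N(2) by auto
 have V: "uminus -` N \<in> sets borel" by (rule measurable_sets_borel[of uminus borel N]) auto
 have "emeasure lborel (uminus -` N) = (NN x. indicator (uminus -` N) x)"
 using V by simp
 also have "... = (NN x. indicator N (0 - x))"
 by (intro nn_integral_cong) (auto split: split_indicator)
 also have "... = (NN x. indicator N x)" by (rule nn_integral_reflect_shift) measurable
 also have "... = 0" using N(2) by (auto simp: null_sets_def)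
 finally have "emeasure lborel (uminus -` N) = 0" .
 moreover have "uminus -` N \<in> sets lborel" using V by simp
 ultimately show ?thesis using N(1) by (intro AE_I'[of "uminus -` N"]) auto
qed

text \<open>A symmetric interval is a right interval for \<open>f\<close> together with a right
  interval for the reflected function at the reflected point.\<close>

lemma AE_lebesgue_point:
 assumes f: "hadm f" shows "AEL x. lebesgue_point f x"
proof -
 have L: "AEL x. ALL e>0. EX d>0. ALL h. 0 < h & h < d --> (LINT t:{-x..-x+h}|lborel. norm (f (- t) - f (- (- x)))) <= e * h"
 by (rule AE_lborel_reflect[OF right_lebesgue_point[OF hadm_reflect[OF f]]])
 from right_lebesgue_point[OF f] L show ?thesis
 proof eventually_elim
 case (elim x)
 show ?case unfolding lebesgue_point_def
 proof (intro allI impI)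
 fix e :: real assume e: "0 < e"
 obtain d where d: "0 < d" "!!h. 0 < h ==> h < d ==> (LINT t:{x..x+h}|lborel. norm (f t - f x)) <= e / 2 * h"
 using elim(1) e by (meson half_gt_zero)
 obtain d' where d': "0 < d'" "!!h. 0 < h ==> h < d' ==> (LINT t:{-x..-x+h}|lborel. norm (f (- t) - f (- (- x)))) <= e / 2 * h"
 using elim(2) e by (meson half_gt_zero)
 have "(LINT t:{x-h..x+h}|lborel. norm (f t - f x)) <= e * h" if h: "0 < h" "h < min d d'" for h
 proof -
 have i: "set_integrable lborel {a..b} (%t. norm (f t - f x))" for a b
 proof (rule set_integrable_norm)
 show "set_integrable lborel {a..b} (%t. f t - f x)"
 by (rule set_integral_diff(1)[OF hadm_integrable_on_cbox[OF f]]) (rule set_integrable_const_Icc)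
 qed
 have r: "(LINT t:{-x..-x+h}|lborel. norm (f (- t) - f (- (- x)))) = (LINT t:{x-h..x}|lborel. norm (f t - f x))"
 proof -
 have "(LINT t:{-x..-x+h}|lborel. norm (f (- t) - f (- (- x)))) = (LI t. (%t. indicator {x-h..x} t *R norm (f t - f x)) (0 - t))"
 unfolding set_lebesgue_integral_def by (intro b_integral_cong refl) (auto split: split_indicator)
 also have "... = (LINT t:{x-h..x}|lborel. norm (f t - f x))"
 unfolding set_lebesgue_integral_def by (rule integral_reflect_shift)
 finally show ?thesis .
 qed
 have "(LINT t:{x-h..x+h}|lborel. norm (f t - f x)) = (LINT t:{x-h..x}|lborel. norm (f t - f x)) + (LINT t:{x..x+h}|lborel. norm (f t - f x))"
 proof -
 have u: "{x-h..x+h} = {x-h..x} \<union> {x..x+h}" using h by auto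
 show ?thesis unfolding u
 by (rule set_integral_Un_AE[OF _ _ _ i i]) (use AE_lborel_singleton[of x] in auto)
 qed
 also have "... <= e / 2 * h + e / 2 * h" using d(2)[of h] d'(2)[of h] h unfolding r by (intro add_mono) auto
 finally show ?thesis by simp
 qed
 then show "EX d>0. ALL h. 0 < h & h < d --> (LINT t:{x-h..x+h}|lborel. norm (f t - f x)) <= e * h"
 using d(1) d'(1) by (intro exI[of _ "min d d'"]) auto
 qed
 qed
qed

text \<open>Layer cake representation of the Poisson kernel: \<open>Pk y\<close> is a superposition of indicators of
 intervals around the origin.\<close>

lemma Pk_layer_cake:
 assumes y: "0 < y"
 shows "en (Pk y s) = (NN h. en (2 * y * h / (pi * (h^2 + y^2)^2)) * indicator {\<bar>s\<bar>..} h)"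
proof -
 have d: "((%h. - y / (pi * (h^2 + y^2))) has_real_derivative 2 * y * h / (pi * (h^2 + y^2)^2)) (at h)" for h
 using sq_pos[OF y, of h] by (auto intro!: derivative_eq_intros simp: divide_simps power2_eq_square)
 have l: "((%h. - y / (pi * (h^2 + y^2))) ->> 0) at_top" using y by real_asymp
 have "(NN h. en (2 * y * h / (pi * (h^2 + y^2)^2)) * indicator {\<bar>s\<bar>..} h) = en (0 - (- y / (pi * (\<bar>s\<bar>^2 + y^2))))"
 by (rule nn_integral_FTC_atLeast[OF _ d _ l]) (use y in \<open>auto intro!: divide_nonneg_nonneg mult_nonneg_nonneg order.trans[OF abs_ge_zero]\<close>)
 then show ?thesis by (simp add: Pk_def)
qed

text \<open>Near \<open>x\<close> the layer cake formula turns the integral into a superposition of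
  integrals over intervals around \<open>x\<close>, which the Lebesgue point property controls. Far
  from \<open>x\<close> the kernel is at most \<open>y\<close> times a fixed integrable weight, so
  that part vanishes with \<open>y\<close>.\<close>

lemma lebesgue_point_Pk:
 assumes f: "hadm f" and x: "lebesgue_point f x"
 shows "((%y. (NN t. en (Pk y (x - t) * norm (f t - f x)))) ->> 0) (at_right 0)"
proof (rule order_tendstoI)
 have [measurable]: "bm f" using f by (simp add: hadm_def)
 fix a :: ennreal assume "0 < a"
 have "EX e::real. 0 < e & en e < a"
 proof (cases a)
 case (real r)
 then show ?thesis using \<open>0 < a\<close> by (intro exI[of _ "r / 2"]) (auto simp: ennreal_less_iff)
 next
 case top
 then show ?thesis by (intro exI[of _ 1]) auto
 qed
 then obtain e :: real where e: "0 < e" "en e < a" by blast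
 define e1 where "e1 = e / 4"
 have e1: "0 < e1" using e by (simp add: e1_def)
 obtain d where d: "0 < d" "!!h. 0 < h ==> h < d ==> (LINT t:{x-h..x+h}|lborel. norm (f t - f x)) <= e1 * h"
 using x e1 unfolding lebesgue_point_def by meson
 define b where "b = d / 2"
 have b: "0 < b" "b < d" using d by (auto simp: b_def)
 define g where "g t = norm (f t - f x)" for t
 have [measurable]: "bm g" unfolding g_def by measurable
 have g0: "0 <= g t" for t by (simp add: g_def)
 have ig: "set_integrable lborel {u..v} g" for u v unfolding g_def
 proof (rule set_integrable_norm)
 show "set_integrable lborel {u..v} (%t. f t - f x)"
 by (rule set_integral_diff(1)[OF hadm_integrable_on_cbox[OF f]]) (rule set_integrable_const_Icc)
 qed
 have near: "(NN t. en (Pk y (x - t)) * (en (g t) * indicator {x-b..x+b} t)) <= en (e1 * 2)" if y: "0 < y" for y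
 proof -
 define k where "k h = en (2 * y * h / (pi * (h^2 + y^2)^2))" for h
 have [measurable]: "bm k" unfolding k_def by measurable
 define G where "G t = en (g t) * indicator {x-b..x+b} t" for t
 have [measurable]: "bm G" unfolding G_def by measurable
 have "(NN t. en (Pk y (x - t)) * G t) = (NN t. (NN h. k h * indicator {\<bar>x - t\<bar>..} h * G t))"
 proof (rule nn_integral_cong)
 fix t
 show "en (Pk y (x - t)) * G t = (NN h. k h * indicator {\<bar>x - t\<bar>..} h * G t)"
 unfolding Pk_layer_cake[OF y] k_def by (rule nn_integral_multc[symmetric]) measurable
 qed
 also have "... = (NN t. (NN h. k h * (if \<bar>x - t\<bar> <= h then G t else 0)))"
 by (intro nn_integral_cong) (auto split: split_indicator)
 also have "... = (NN h. (NN t. k h * (if \<bar>x - t\<bar> <= h then G t else 0)))"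
 by (rule tonelli_lborel[symmetric]) measurable
 also have "... <= (NN h. en (2 * e1) * en (Pk y h))"
 proof (rule nn_integral_mono)
 fix h :: real
 show "(NN t. k h * (if \<bar>x - t\<bar> <= h then G t else 0)) <= en (2 * e1) * en (Pk y h)"
 proof (cases "0 < h")
 case False
 have "(NN t. k h * (if \<bar>x - t\<bar> <= h then G t else 0)) = (\<integral>\<^sup>+t. 0 \<partial>(lborel :: real measure))"
 proof (rule nn_integral_cong)
 fix t
 have "k h = 0 \<or> \<not> \<bar>x - t\<bar> <= h"
 proof (cases "h = 0")
 case False
 then show ?thesis using \<open>\<not> 0 < h\<close> by linarith
 qed (simp add: k_def)
 then show "k h * (if \<bar>x - t\<bar> <= h then G t else 0) = 0" by auto
 qed
 then show ?thesis by simp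
 next
 case True
 define m where "m = min h b"
 have m: "0 < m" "m < d" "m <= h" using True b by (auto simp: m_def)
 have "(NN t. k h * (if \<bar>x - t\<bar> <= h then G t else 0)) = k h * (NN t. (if \<bar>x - t\<bar> <= h then G t else 0))"
 by (rule nn_integral_cmult) measurable
 also have "(NN t. (if \<bar>x - t\<bar> <= h then G t else 0)) = (NN t. en (indicator {x-m..x+m} t *R g t))"
 by (intro nn_integral_cong) (auto simp: G_def m_def min_def split: split_indicator)
 also have "... = en (LINT t:{x-m..x+m}|lborel. g t)"
 unfolding set_lebesgue_integral_def
 by (rule nn_integral_eq_integral) (use ig[unfolded set_integrable_def] g0 in auto)
 also have "k h * ... <= k h * en (e1 * h)"
 proof (intro mult_left_mono ennreal_leI)
 have "(LINT t:{x-m..x+m}|lborel. g t) <= e1 * m" using d(2)[OF m(1,2)] by (simp add: g_def)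
 also have "... <= e1 * h" using e1 m by (intro mult_left_mono) auto
 finally show "(LINT t:{x-m..x+m}|lborel. g t) <= e1 * h" .
 qed simp
 \<comment> \<open>The layer weight times the interval bound e1 * h is 2 e1 times a Poisson kernel
   times a factor at most 1, and the Poisson kernel has total mass 1.\<close>
 also have "... = en (2 * e1 * (Pk y h * (h^2 / (h^2 + y^2))))"
 proof -
 have "2 * y * h / (pi * (h^2 + y^2)^2) * (e1 * h) = 2 * e1 * (Pk y h * (h^2 / (h^2 + y^2)))"
 by (simp add: Pk_def power2_eq_square mult_ac)
 moreover have "k h * en (e1 * h) = en (2 * y * h / (pi * (h^2 + y^2)^2) * (e1 * h))"
 unfolding k_def using True y e1 by (intro ennreal_mult[symmetric]) auto
 ultimately show ?thesis by simp
 qed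
 also have "... <= en (2 * e1 * (Pk y h * 1))"
 using y e1 sq_pos[OF y, of h] by (intro ennreal_leI mult_left_mono) (auto simp: divide_le_eq)
 also have "... = en (2 * e1) * en (Pk y h)" using e1 y by (simp add: ennreal_mult)
 finally show ?thesis .
 qed
 qed
 also have "... = en (2 * e1) * (NN h. en (Pk y h))" by (rule nn_integral_cmult) measurable
 also have "... = en (e1 * 2)" by (simp add: Pk_nn_integral[OF y] mult.commute)
 finally show ?thesis by (simp add: G_def)
 qed
 define S where "S = (NN t. en (g t / (1 + (x - t)^2)))"
 have Sfin: "S < \<infinity>"
 proof -
 have 1: "intg (%t. (pi * Pk 1 (x - t)) *R f t)" using hadm_Pk[OF f, of 1 x] by (simp flip: scaleR_scaleR)
 have 2: "intg (%t. (pi * Pk 1 (x - t)) *R f x)"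
 using integrable_reflect_shift[OF Pk_integrable[of 1], of x] by (intro integrable_scaleR_left integrable_mult_right) auto
 have "intg (%t. norm ((pi * Pk 1 (x - t)) *R f t - (pi * Pk 1 (x - t)) *R f x))"
 using 1 2 by (intro integrable_norm b_integrable_diff)
 moreover have "norm ((pi * Pk 1 (x - t)) *R f t - (pi * Pk 1 (x - t)) *R f x) = g t / (1 + (x - t)^2)" for t
 unfolding scaleR_diff_right[symmetric] norm_scaleR g_def using sq_pos[of 1 "x - t"] by (simp add: Pk_def add.commute)
 ultimately have "intg (%t. g t / (1 + (x - t)^2))" by simp
 then show ?thesis unfolding S_def using g0 by (subst nn_integral_eq_integral) (auto simp: add_nonneg_nonneg)
 qed
 have far: "(NN t. en (Pk y (x - t)) * (en (g t) * indicator (- {x-b..x+b}) t)) <= en (y * ((1 + 1 / b^2) / pi)) * S" if y: "0 < y" for y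
 proof -
 have "(NN t. en (Pk y (x - t)) * (en (g t) * indicator (- {x-b..x+b}) t)) <=
 (NN t. en (y * ((1 + 1 / b^2) / pi)) * en (g t / (1 + (x - t)^2)))"
 proof (rule nn_integral_mono)
 fix t
 show "en (Pk y (x - t)) * (en (g t) * indicator (- {x-b..x+b}) t) <= en (y * ((1 + 1 / b^2) / pi)) * en (g t / (1 + (x - t)^2))"
 proof (cases "t \<in> {x-b..x+b}")
 case False
 define s where "s = x - t"
 have "b < \<bar>s\<bar>" using False b unfolding s_def by auto
 then have s2: "b^2 <= s^2" "0 < s^2" using b power_mono[of b "\<bar>s\<bar>" 2] by auto
 have "1 + s^2 <= (1 + 1 / b^2) * s^2"
 using s2 b by (simp add: distrib_right divide_simps)
 also have "... <= (1 + 1 / b^2) * (s^2 + y^2)" by (intro mult_left_mono) auto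
 finally have "1 / (s^2 + y^2) <= (1 + 1 / b^2) / (1 + s^2)"
 using sq_pos[OF y, of s] sq_pos[of 1 s] by (simp add: divide_simps mult.commute add.commute)
 then have "y / pi * (1 / (s^2 + y^2)) <= y / pi * ((1 + 1 / b^2) / (1 + s^2))" using y by (intro mult_left_mono) auto
 then have "Pk y s <= y * ((1 + 1 / b^2) / pi) * (1 / (1 + s^2))" by (simp add: Pk_def mult.commute)
 then have "Pk y s * g t <= y * ((1 + 1 / b^2) / pi) * (1 / (1 + s^2)) * g t" using g0 by (rule mult_right_mono)
 then have "en (Pk y s * g t) <= en (y * ((1 + 1 / b^2) / pi) * (g t / (1 + s^2)))" by (intro ennreal_leI) simp
 moreover have "en (Pk y s * g t) = en (Pk y s) * en (g t)" using y g0 by (intro ennreal_mult) auto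
 moreover have "en (y * ((1 + 1 / b^2) / pi) * (g t / (1 + s^2))) = en (y * ((1 + 1 / b^2) / pi)) * en (g t / (1 + s^2))"
 using y g0 by (intro ennreal_mult) (auto intro!: divide_nonneg_nonneg add_nonneg_nonneg)
 ultimately show ?thesis using False unfolding s_def by simp
 qed simp
 qed
 also have "... = en (y * ((1 + 1 / b^2) / pi)) * S" unfolding S_def by (rule nn_integral_cmult) measurable
 finally show ?thesis .
 qed
 have tot: "(NN t. en (Pk y (x - t) * norm (f t - f x))) <= en (e1 * 2) + en (y * ((1 + 1 / b^2) / pi)) * S" if y: "0 < y" for y
 proof -
 have "(NN t. en (Pk y (x - t) * norm (f t - f x))) =
 (NN t. en (Pk y (x - t)) * (en (g t) * indicator {x-b..x+b} t) + en (Pk y (x - t)) * (en (g t) * indicator (- {x-b..x+b}) t))"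
 using y by (intro nn_integral_cong) (auto simp: g_def ennreal_mult split: split_indicator)
 also have "... = (NN t. en (Pk y (x - t)) * (en (g t) * indicator {x-b..x+b} t)) + (NN t. en (Pk y (x - t)) * (en (g t) * indicator (- {x-b..x+b}) t))"
 by (rule nn_integral_add) measurable
 also have "... <= en (e1 * 2) + en (y * ((1 + 1 / b^2) / pi)) * S" by (intro add_mono near far y)
 finally show ?thesis .
 qed
 define r where "r = enn2real S"
 have r: "S = en r" "0 <= r" using Sfin by (auto simp: r_def)
 have "((%y. y * ((1 + 1 / b^2) / pi) * r) ->> 0 * ((1 + 1 / b^2) / pi) * r) (at_right 0)" by (intro tendsto_intros)
 from order_tendstoD(2)[OF this, of e1] e1 have "\<forall>\<^sub>F y in at_right 0. y * ((1 + 1 / b^2) / pi) * r < e1" by simp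
 then show "\<forall>\<^sub>F y in at_right 0. (NN t. en (Pk y (x - t) * norm (f t - f x))) < a"
 using eventually_at_right_less[of "0::real"]
 proof eventually_elim
 case (elim y)
 have "(NN t. en (Pk y (x - t) * norm (f t - f x))) <= en (e1 * 2) + en (y * ((1 + 1 / b^2) / pi)) * en r"
 using tot[OF elim(2)] by (simp add: r)
 also have "... = en (e1 * 2 + y * ((1 + 1 / b^2) / pi) * r)"
 using e1 elim r by (simp add: ennreal_mult'[symmetric] ennreal_plus[symmetric] del: ennreal_plus)
 also have "... <= en e" using elim(1) e(1) unfolding e1_def by (intro ennreal_leI) linarith
 finally show ?case using e(2) by simp
 qed
qed auto

definition hker :: "real => real => real" where
 "hker ep s = (if ep < \<bar>s\<bar> then 1 / (pi * s) else 0)"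

lemma hker_measurable [measurable]: "hker ep \<in> borel_measurable borel"
 unfolding hker_def by measurable

lemma hker_bound:
 fixes x t :: real
 assumes "0 < ep"
 shows "\<bar>hker ep (x - t)\<bar> <= 2 * ((1 + \<bar>x\<bar>) / ep + 1) * (1 / (1 + \<bar>t\<bar>))"
proof (cases "ep < \<bar>x - t\<bar>")
 case True
 have "sqrt ((x - t)^2 + ep^2) <= \<bar>x - t\<bar> + ep"
 using sqrt_add_le_add_sqrt[of "(x - t)^2" "ep^2"] assms by simp
 also have "... <= \<bar>x - t\<bar> + \<bar>x - t\<bar>" using True by (intro add_left_mono) simp
 finally have le: "sqrt ((x - t)^2 + ep^2) <= 2 * \<bar>x - t\<bar>" by simp
 have p: "0 < sqrt ((x - t)^2 + ep^2)" using sq_pos[OF assms, of "x - t"] by simp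
 have "\<bar>hker ep (x - t)\<bar> = 1 / (pi * \<bar>x - t\<bar>)" using True by (simp add: hker_def abs_mult)
 also have "... <= 1 / (1 * \<bar>x - t\<bar>)" using True assms pi_ge_two by (intro frac_le mult_right_mono) auto
 also have "... <= 2 * (1 / sqrt ((x - t)^2 + ep^2))"
 proof -
 have "1 / d <= 2 * (1 / r)" if "0 < r" "r <= 2 * d" for d r :: real using that by (simp add: divide_simps)
 from this[OF p le] show ?thesis by simp
 qed
 also have "... <= 2 * (((1 + \<bar>x\<bar>) / ep + 1) * (1 / (1 + \<bar>t\<bar>)))" by (intro mult_left_mono kernel_bound assms) auto
 finally show ?thesis by (simp only: mult.assoc)
next
 case False
 then show ?thesis using assms by (simp add: hker_def)
qed

lemma hadm_hker: "hadm f ==> 0 < ep ==> intg (%t. hker ep (x - t) *R f t)"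
 by (rule hadm_integrable[OF _ _ hker_bound]) auto

text \<open>The truncated Hilbert kernel and the conjugate Poisson kernel at the same scale differ
  by at most a Poisson kernel. This carries boundary limits from conjugate Poisson integrals to
  principal values.\<close>

lemma hker_Qk_diff: assumes e: "0 < ep" shows "\<bar>hker ep s - Qk ep s\<bar> <= Pk ep s"
proof -
 define D where "D = s^2 + ep^2"
 have D: "0 < D" using sq_pos[OF e] by (simp add: D_def)
 show ?thesis
 proof (cases "ep < \<bar>s\<bar>")
 case True
 then have s: "s ~= 0" using e by auto
 have "hker ep s - Qk ep s = ep^2 / (pi * s * D)"
 proof -
 have "1 / (pi * s) - s / (pi * D) = (D - s * s) / (pi * s * D)" using s D by (simp add: divide_simps)
 then show ?thesis using True by (simp add: hker_def Qk_def D_def power2_eq_square)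
 qed
 then have "\<bar>hker ep s - Qk ep s\<bar> = (ep / \<bar>s\<bar>) * (ep / (pi * D))"
 using D e by (simp add: abs_mult power2_eq_square)
 also have "... <= 1 * (ep / (pi * D))" using True e D by (intro mult_right_mono) (auto simp: divide_le_eq)
 finally show ?thesis by (simp add: Pk_def D_def)
 next
 case False
 then have "\<bar>s\<bar> / (pi * D) <= ep / (pi * D)" using D by (intro divide_right_mono) auto
 then show ?thesis using False D by (simp add: hker_def Qk_def Pk_def D_def abs_mult)
 qed
qed

text \<open>Both kernels are dominated by \<open>Pk y\<close>. Subtracting f x inside the integral
  leaves an error controlled by \<open>lebesgue_point_Pk\<close>, plus f x times the total mass of
  the kernel. That mass is 1 for \<open>Pk y\<close> and 0 for the odd kernel hker y - Qk y.\<close>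

lemma lebesgue_point_limits:
 fixes f :: "real => complex"
 assumes f: "hadm f" and x: "lebesgue_point f x"
 shows "((%y. conv (Pk y) f x) ->> f x) (at_right 0)"
 "((%y. conv (hker y) f x - conv (Qk y) f x) ->> 0) (at_right 0)"
proof -
 have [measurable]: "bm f" using f by (simp add: hadm_def)
 define E where "E y = (NN t. en (Pk y (x - t) * norm (f t - f x)))" for y
 have E0: "(E ->> 0) (at_right 0)" unfolding E_def by (rule lebesgue_point_Pk[OF f x])
 have r0: "((%y. enn2real (E y)) ->> 0) (at_right 0)" using tendsto_enn2real[of E 0] E0 by simp
 have Ef: "\<forall>\<^sub>F y in at_right 0. E y < 1" using order_tendstoD(2)[OF E0, of 1] by simp
 have key: "norm (LI t. d (x - t) *R (f t - f x)) <= enn2real (E y)"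
 if d: "!!s. \<bar>d s\<bar> <= Pk y s" and [measurable]: "bm d" and "E y < 1" for d y
 proof -
 have le: "(NN t. en (norm (d (x - t) *R (f t - f x)))) <= E y"
 unfolding E_def by (intro nn_integral_mono ennreal_leI) (simp add: mult_right_mono d)
 have Ef: "E y < \<infinity>" using \<open>E y < 1\<close> by (rule order_less_trans) simp
 have i: "intg (%t. d (x - t) *R (f t - f x))"
 by (rule integrableI_bounded) (use le Ef in \<open>auto intro: le_less_trans\<close>)
 have "norm (LI t. d (x - t) *R (f t - f x)) <= (LI t. norm (d (x - t) *R (f t - f x)))"
 by (rule integral_norm_bound)
 also have "... = enn2real (NN t. en (norm (d (x - t) *R (f t - f x))))"
 by (rule integral_eq_nn_integral) auto
 also have "... <= enn2real (E y)" using le Ef by (intro enn2real_mono) auto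
 finally show ?thesis .
 qed
 have split: "conv d f x = (LI t. d (x - t) *R (f t - f x)) + (LI s. d s) *R f x"
 if "intg (%t. d (x - t) *R f t)" "intg d" for d
 proof -
 have i: "intg (%t. d (x - t) *R f x)" using integrable_reflect_shift[OF that(2)] by auto
 have "conv d f x = (LI t. d (x - t) *R (f t - f x) + d (x - t) *R f x)" unfolding conv_def by (simp add: scaleR_diff_right)
 also have "... = (LI t. d (x - t) *R (f t - f x)) + (LI t. d (x - t) *R f x)"
 by (rule b_integral_add) (use that(1) i in \<open>auto simp: scaleR_diff_right\<close>)
 also have "(LI t. d (x - t) *R f x) = (LI s. d s) *R f x"
 using integrable_reflect_shift[OF that(2), of x] by (simp add: integral_reflect_shift)
 finally show ?thesis .
 qed
 have ev0: "\<forall>\<^sub>F y in at_right 0. (0::real) < y" by (rule eventually_at_right_less)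
 have "((%y. conv (Pk y) f x - f x) ->> 0) (at_right 0)"
 proof (rule Lim_null_comparison[OF _ r0])
 show "\<forall>\<^sub>F y in at_right 0. norm (conv (Pk y) f x - f x) <= enn2real (E y)"
 using Ef ev0
 proof eventually_elim
 case (elim y)
 show ?case using split[of "Pk y"] hadm_Pk[OF f elim(2)] Pk_integrable[OF elim(2)] key[of "Pk y" y] elim
 by (simp add: Pk_integral)
 qed
 qed
 then show "((%y. conv (Pk y) f x) ->> f x) (at_right 0)" by (simp add: LIM_zero_iff)
 show "((%y. conv (hker y) f x - conv (Qk y) f x) ->> 0) (at_right 0)"
 proof (rule Lim_null_comparison[OF _ r0])
 show "\<forall>\<^sub>F y in at_right 0. norm (conv (hker y) f x - conv (Qk y) f x) <= enn2real (E y)"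
 using Ef ev0
 proof eventually_elim
 case (elim y)
 define d where "d s = hker y s - Qk y s" for s
 have [measurable]: "bm d" unfolding d_def by measurable
 have di: "intg d"
 by (rule b_integrable_bound[OF Pk_integrable[OF elim(2)]]) (use hker_Qk_diff[OF elim(2)] elim(2) in \<open>auto simp: d_def\<close>)
 have "d (- s) = - d s" for s by (simp add: d_def hker_def Qk_def)
 then have "(LI s. d s) = - (LI s. d s)" using integral_reflect_shift[of d 0] by simp
 then have d0: "(LI s. d s) = 0" by simp
 have "conv (hker y) f x - conv (Qk y) f x = conv d f x"
 unfolding conv_def d_def scaleR_diff_left
 by (rule b_integral_diff[symmetric]) (use hadm_hker[OF f elim(2)] hadm_Qk[OF f elim(2)] in auto)
 moreover have "intg (%t. d (x - t) *R f t)"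
 unfolding d_def scaleR_diff_left using hadm_hker[OF f elim(2)] hadm_Qk[OF f elim(2)] by auto
 ultimately show ?case using split[of d] di d0 key[of d y] hker_Qk_diff[OF elim(2)] elim(1) by (simp add: d_def[symmetric])
 qed
 qed
qed

section \<open>Existence of the Hilbert transform\<close>

text \<open>A Riesz-Scheffe argument: Fatou's lemma for
 \<open>2\<^sup>p (\<bar>F\<^sub>n\<bar>\<^sup>p + \<bar>f\<bar>\<^sup>p) - \<bar>F\<^sub>n - f\<bar>\<^sup>p \<ge> 0\<close>.\<close>

lemma pint_scheffe:
 fixes F :: "nat => 'a => 'b::{real_normed_vector, second_countable_topology}"
 assumes [measurable]: "!!n. F n \<in> borel_measurable M" "f \<in> borel_measurable M"
 and p: "1 < p" and fin: "pint M p f < \<infinity>" and le: "!!n. pint M p (F n) <= pint M p f"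
 and lim: "AE x in M. (%n. F n x) -->> f x"
 shows "(%n. pint M p (%x. F n x - f x)) -->> 0"
proof -
 define C where "C = 2 powr p"
 have C: "0 < C" by (simp add: C_def)
 define h where "h n x = C * (norm (F n x) powr p + norm (f x) powr p) - norm (F n x - f x) powr p" for n x
 have [measurable]: "h n \<in> borel_measurable M" for n unfolding h_def by measurable
 have h0: "0 <= h n x" for n x
 proof -
 have "norm (F n x + (- f x)) powr p <= (1 - 1/2) powr (1 - p) * norm (F n x) powr p + (1/2) powr (1 - p) * norm (- f x) powr p"
 using p by (intro norm_add_powr_le) auto
 also have "... = 2 powr (p - 1) * (norm (F n x) powr p + norm (f x) powr p)"
 proof -
 have "(1/2) powr (1 - p) = 2 powr (p - 1)" for p :: real by (simp add: powr_divide powr_diff)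
 then show ?thesis by (simp add: distrib_left)
 qed
 also have "... <= C * (norm (F n x) powr p + norm (f x) powr p)" unfolding C_def by (intro mult_right_mono powr_mono) auto
 finally show ?thesis by (simp add: h_def)
 qed
 define A where "A = enn2real (pint M p f)"
 have A: "pint M p f = en A" "0 <= A" using fin by (auto simp: A_def)
 have sum: "(\<integral>\<^sup>+x. en (h n x) \<partial>M) + pint M p (%x. F n x - f x) <= en (2 * C * A)" for n
 proof -
 have "(\<integral>\<^sup>+x. en (h n x) \<partial>M) + pint M p (%x. F n x - f x) = (\<integral>\<^sup>+x. en (h n x) + en (norm (F n x - f x) powr p) \<partial>M)"
 unfolding pint_def by (rule nn_integral_add[symmetric]) measurable
 also have "... = (\<integral>\<^sup>+x. en C * (en (norm (F n x) powr p) + en (norm (f x) powr p)) \<partial>M)"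
 using h0 C by (intro nn_integral_cong) (simp add: h_def ennreal_plus[symmetric] ennreal_mult[symmetric] del: ennreal_plus)
 also have "... = en C * (pint M p (F n) + pint M p f)"
 unfolding pint_def by (simp add: nn_integral_cmult nn_integral_add)
 also have "... <= en C * (pint M p f + pint M p f)" by (intro mult_left_mono add_mono le) auto
 also have "... = en (2 * C * A)" unfolding A(1) using A C by (simp add: ennreal_plus[symmetric] ennreal_mult[symmetric] del: ennreal_plus)
 finally show ?thesis .
 qed
 have fatou: "en (2 * C * A) <= liminf (%n. \<integral>\<^sup>+x. en (h n x) \<partial>M)"
 proof -
 have "en (2 * C * A) = en (2 * C) * pint M p f"
 unfolding A(1) using C A by (intro ennreal_mult) auto
 also have "... = (\<integral>\<^sup>+x. en (2 * C) * en (norm (f x) powr p) \<partial>M)"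
 unfolding pint_def by (rule nn_integral_cmult[symmetric]) measurable
 also have "... <= (\<integral>\<^sup>+x. liminf (%n. en (h n x)) \<partial>M)"
 proof (rule nn_integral_mono_AE)
 show "AE x in M. en (2 * C) * en (norm (f x) powr p) <= liminf (%n. en (h n x))"
 using lim
 proof eventually_elim
 case (elim x)
 have "(%n. h n x) -->> C * (norm (f x) powr p + norm (f x) powr p) - norm (f x - f x) powr p"
 unfolding h_def using p by (intro tendsto_intros tendsto_powr2 elim) auto
 then have "(%n. en (h n x)) -->> en (2 * C * norm (f x) powr p)"
 by (intro tendsto_ennrealI) (simp add: mult.assoc mult.left_commute)
 from lim_imp_Liminf[OF _ this] show ?case using C by (simp add: ennreal_mult)
 qed
 qed
 also have "... <= liminf (%n. \<integral>\<^sup>+x. en (h n x) \<partial>M)" by (intro nn_integral_liminf) simp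
 finally show ?thesis .
 qed
 show ?thesis
 proof (rule order_tendstoI)
 fix a :: ennreal assume "0 < a"
 have "EX e::real. 0 < e & en e < a"
 proof (cases a)
 case (real r)
 then show ?thesis using \<open>0 < a\<close> by (intro exI[of _ "r / 2"]) (auto simp: ennreal_less_iff)
 next
 case top
 then show ?thesis by (intro exI[of _ 1]) auto
 qed
 then obtain e :: real where e: "0 < e" "en e < a" by blast
 show "\<forall>\<^sub>F n in sequentially. pint M p (%x. F n x - f x) < a"
 proof (cases "2 * C * A < e")
 case True
 have "pint M p (%x. F n x - f x) < a" for n
 proof -
 have "pint M p (%x. F n x - f x) <= en (2 * C * A)" by (rule order.trans[OF _ sum[of n]]) (simp add: add_increasing)
 also have "... <= en e" using True by (intro ennreal_leI) auto
 finally show ?thesis using e(2) by simp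
 qed
 then show ?thesis by simp
 next
 case False
 have "en (2 * C * A - e) < en (2 * C * A)" using e(1) False by (intro ennreal_lessI) linarith+
 then have "en (2 * C * A - e) < liminf (%n. \<integral>\<^sup>+x. en (h n x) \<partial>M)" using fatou by (rule less_le_trans)
 then have "\<forall>\<^sub>F n in sequentially. en (2 * C * A - e) < (\<integral>\<^sup>+x. en (h n x) \<partial>M)"
 by (rule less_LiminfD)
 then show ?thesis
 proof eventually_elim
 case (elim n)
 define d where "d = pint M p (%x. F n x - f x)"
 have "en (2 * C * A - e) + d <= en (2 * C * A)"
 unfolding d_def by (rule order.trans[OF add_right_mono[OF less_imp_le[OF elim]] sum])
 moreover have "en (2 * C * A) = en (2 * C * A - e) + en e"
 using e False by (simp add: ennreal_plus[symmetric] del: ennreal_plus)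
 ultimately have "d <= en e" by (simp add: ennreal_add_left_cancel_le)
 then show ?case using e(2) unfolding d_def by (rule le_less_trans)
 qed
 qed
 qed auto
qed

lemma conv_diff:
 fixes f g :: "real => complex"
 assumes "intg (%t. k (x - t) *R f t)" "intg (%t. k (x - t) *R g t)"
 shows "conv k (%t. f t - g t) x = conv k f x - conv k g x"
 unfolding conv_def scaleR_diff_right by (rule b_integral_diff[OF assms])

text \<open>Above the height \<open>et\<close> the kernel depends on the height in a Lipschitz way,
  with differences dominated by one Poisson kernel. The constant blows up as \<open>et\<close> tends
  to 0, which is why \<open>hilb_exists\<close> smooths \<open>f\<close> before it compares
  heights.\<close>

lemma Qk_Lipschitz:
 assumes h: "0 < et" and y: "et <= a" "et <= b"
 shows "\<bar>Qk a s - Qk b s\<bar> <= (\<bar>b^2 - a^2\<bar> / (2 * et^2)) * Pk et s"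
proof -
 define X where "X c = s^2 + c^2" for c
 have X: "0 < X et" "X et <= X a" "X et <= X b"
 using sq_pos[OF h, of s] h y by (auto simp: X_def intro!: power_mono)
 have "Qk a s - Qk b s = s * (X b - X a) / (pi * X a * X b)"
 unfolding Qk_def X_def[symmetric] using X by (simp add: divide_simps) (simp add: algebra_simps)
 then have "\<bar>Qk a s - Qk b s\<bar> = \<bar>s\<bar> * \<bar>b^2 - a^2\<bar> / (pi * X a * X b)"
 using X by (simp add: abs_mult X_def)
 also have "... <= \<bar>s\<bar> * \<bar>b^2 - a^2\<bar> / (pi * X et * X et)"
 using X by (intro divide_left_mono mult_mono mult_pos_pos) auto
 also have "... = (\<bar>s\<bar> / X et) * (\<bar>b^2 - a^2\<bar> / (pi * X et))" by simp
 also have "... <= (1 / (2 * et)) * (\<bar>b^2 - a^2\<bar> / (pi * X et))"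
 proof (rule mult_right_mono)
 have "0 <= (\<bar>s\<bar> - et)^2" by simp
 then have "2 * et * \<bar>s\<bar> <= X et" by (simp add: X_def power2_diff mult_ac)
 then show "\<bar>s\<bar> / X et <= 1 / (2 * et)" using X(1) h by (simp add: divide_simps mult.commute)
 qed (use X in auto)
 also have "... = (\<bar>b^2 - a^2\<bar> / (2 * et^2)) * Pk et s"
 using h by (simp add: Pk_def X_def power2_eq_square)
 finally show ?thesis .
qed

lemma pint_Q_Lipschitz:
 fixes f :: "real => complex"
 assumes p: "1 < p" and [measurable]: "bm f" and fin: "pL p f < \<infinity>"
 and h: "0 < et" and y: "et <= a" "et <= b"
 shows "pL p (%x. conv (Qk a) f x - conv (Qk b) f x) <= en ((\<bar>b^2 - a^2\<bar> / (2 * et^2)) powr p) * pL p f"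
proof -
 have hf: "hadm f" by (rule Lp_hadm[OF p _ fin]) simp
 define c where "c = \<bar>b^2 - a^2\<bar> / (2 * et^2)"
 have c0: "0 <= c" by (simp add: c_def)
 have e: "conv (Qk a) f x - conv (Qk b) f x = conv (%s. Qk a s - Qk b s) f x" for x
 unfolding conv_def scaleR_diff_left using hadm_Qk[OF hf] h y by (intro b_integral_diff[symmetric]) auto
 have "pL p (conv (%s. Qk a s - Qk b s) f) <= en ((LI s. c * Pk et s) powr p) * pL p f"
 by (rule young[OF p]) (use h c0 Qk_Lipschitz[OF h y] Pk_integrable[OF h] in \<open>auto simp: c_def\<close>)
 then show ?thesis unfolding e using Pk_integral[OF h] by (simp add: c_def)
qed

text \<open>Convergence at Lebesgue points together with the contraction bound
  \<open>pint_Pk_le\<close> gives convergence in the p-norm by \<open>pint_scheffe\<close>.\<close>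

lemma Pk_approx_identity:
 fixes f :: "real => complex"
 assumes p: "1 < p" and [measurable]: "bm f" and fin: "pL p f < \<infinity>" and e: "0 < e"
 obtains et where "0 < et" "pL p (%x. conv (Pk et) f x - f x) < en e"
proof -
 have hf: "hadm f" by (rule Lp_hadm[OF p _ fin]) simp
 have fl: "filterlim (%n. 1 / real (Suc n)) (at_right 0) sequentially" by real_asymp
 have "(%n. pL p (%x. conv (Pk (1 / real (Suc n))) f x - f x)) -->> 0"
 proof (rule pint_scheffe)
 show "AEL x. (%n. conv (Pk (1 / real (Suc n))) f x) -->> f x"
 using AE_lebesgue_point[OF hf]
 by eventually_elim (rule filterlim_compose[OF lebesgue_point_limits(1)[OF hf] fl])
 show "pL p (conv (Pk (1 / real (Suc n))) f) <= pL p f" for n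
 by (rule pint_Pk_le[OF p]) auto
 qed (use p fin in auto)
 then have "\<forall>\<^sub>F n in sequentially. pL p (%x. conv (Pk (1 / real (Suc n))) f x - f x) < en e"
 using e by (intro order_tendstoD(2)) auto
 then obtain n where "pL p (%x. conv (Pk (1 / real (Suc n))) f x - f x) < en e"
 by (auto simp: eventually_sequentially)
 then show ?thesis using that[of "1 / real (Suc n)"] by auto
qed

text \<open>A relation, since \<open>g\<close> is determined only up to null sets. Convergence in
  p-norm serves the commutation with dilation averages, the truncated kernels match the principal
  value, and the conjugate Poisson limits are what the lower bound evaluates. The factor i of
  \<open>H_plus\<close> is left out here.\<close>

definition is_hilb :: "real => (real => complex) => (real => complex) => bool" where
 "is_hilb p f g \<longleftrightarrow> g \<in> borel_measurable borel & pL p g <= en (hc p powr p) * pL p f &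
 (ALL e>0. EX d>0. ALL y. 0 < y & y < d --> pL p (%x. conv (Qk y) f x - g x) <= en e) &
 (AEL x. ((%ep. conv (hker ep) f x) ->> g x) (at_right 0)) &
 (AEL x. ((%y. conv (Qk y) f x) ->> g x) (at_right 0))"

text \<open>Jensen together with Pk y <= 1 / (pi y). Evaluating a Poisson integral at a point is
  therefore continuous in the p-norm, so that limits in p-norm pass inside.\<close>

lemma conv_Pk_pointwise:
 fixes f :: "real => complex"
 assumes p: "1 < p" and [measurable]: "bm f" and y: "0 < y"
 shows "en (norm (conv (Pk y) f x) powr p) <= en (1 / (pi * y)) * pL p f"
proof (cases "pL p f < \<infinity>")
 case fin: True
 have hf: "hadm f" by (rule Lp_hadm[OF p _ fin]) simp
 have "norm (conv (Pk y) f x) <= (LI t. norm (Pk y (x - t) *R f t))" unfolding conv_def by (rule integral_norm_bound)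
 also have "... = (LI t. Pk y (x - t) * norm (f t))" using y by simp
 finally have "norm (conv (Pk y) f x) powr p <= (LI t. Pk y (x - t) * norm (f t)) powr p"
 using p by (intro powr_mono2) auto
 then have "en (norm (conv (Pk y) f x) powr p) <= en ((LI t. Pk y (x - t) * norm (f t)) powr p)" by (rule ennreal_leI)
 also have "... <= en ((LI t. Pk y (x - t)) powr (p - 1)) * (NN t. en (Pk y (x - t) * norm (f t) powr p))"
 by (rule jensen_weight) (use y p integrable_reflect_shift[OF Pk_integrable[OF y]] in auto)
 also have "(LI t. Pk y (x - t)) = 1" by (simp add: integral_reflect_shift Pk_integral[OF y])
 also have "(NN t. en (Pk y (x - t) * norm (f t) powr p)) <= (NN t. en (1 / (pi * y)) * en (norm (f t) powr p))"
 proof (rule nn_integral_mono)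
 fix t
 have "Pk y (x - t) <= y / (pi * (0 + y^2))" unfolding Pk_def using y by (intro divide_left_mono mult_left_mono add_right_mono) (auto simp: sq_pos add_nonneg_pos)
 also have "... = 1 / (pi * y)" using y by (simp add: power2_eq_square)
 finally have "Pk y (x - t) * norm (f t) powr p <= 1 / (pi * y) * norm (f t) powr p" by (rule mult_right_mono) simp
 then show "en (Pk y (x - t) * norm (f t) powr p) <= en (1 / (pi * y)) * en (norm (f t) powr p)"
 using y by (simp flip: ennreal_mult add: ennreal_leI)
 qed
 also have "... = en (1 / (pi * y)) * pL p f" unfolding pint_def by (rule nn_integral_cmult) measurable
 finally show ?thesis by (simp add: mult_left_mono)
next
 case False
 then have "pL p f = \<infinity>" by (metis infinity_ennreal_def top.not_eq_extremum)
 then show ?thesis using y by (simp add: ennreal_mult_top)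
qed

text \<open>The Cauchy estimate has three pieces. At either end \<open>f\<close> is replaced by its
  Poisson integral of height \<open>et\<close>, at a cost that \<open>Q_bound\<close> makes uniform
  in y; by the semigroup this raises the height to y + et. In between all heights exceed
  \<open>et\<close>, and \<open>pint_Q_Lipschitz\<close> applies.\<close>

theorem hilb_exists:
 fixes f :: "real => complex"
 assumes p: "1 < p" and [measurable]: "bm f" and fin: "pL p f < \<infinity>"
 shows "EX g. is_hilb p f g"
proof -
 have hf: "hadm f" by (rule Lp_hadm[OF p _ fin]) simp
 define A where "A = enn2real (pL p f)"
 have A: "pL p f = en A" "0 <= A" using fin by (auto simp: A_def)
 have hcp: "0 < hc p" by (rule hc_nonneg[OF p])
 have Qfin: "pL p (conv (Qk y) f) < \<infinity>" if "0 < y" for y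
 using Q_bound[OF p that _ fin] fin by (auto intro: le_less_trans simp: ennreal_mult_less_top)
 have cauchy: "EX d>0. ALL y y'. 0 < y & y < d & 0 < y' & y' < d --> pL p (%x. conv (Qk y) f x - conv (Qk y') f x) <= en e"
 if e: "0 < e" for e
 proof -
 \<comment> \<open>The triangle inequality is used twice, each time with factor 2 powr p; three
   pieces of size \<open>e1\<close> then cost at most 3 * K * e1 = e.\<close>
 define K where "K = 2 powr p * (2 powr p) + 2 powr p + 1"
 have K: "0 < K" unfolding K_def by (intro add_nonneg_pos) auto
 define e1 where "e1 = e / (3 * K)"
 have e1: "0 < e1" using e K by (simp add: e1_def)
 obtain et where h: "0 < et" "pL p (%x. conv (Pk et) f x - f x) < en (e1 / hc p powr p)"
 using Pk_approx_identity[OF p _ fin, of "e1 / hc p powr p"] e1 hcp by auto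
 have Pfin: "pL p (conv (Pk et) f) < \<infinity>" using pint_Pk_le[OF p _ h(1), of f] fin by (auto intro: le_less_trans)
 have hP: "hadm (conv (Pk et) f)" by (rule Lp_hadm[OF p _ Pfin]) simp
 have sm: "pL p (%x. conv (Qk y) f x - conv (Qk (y + et)) f x) <= en e1" if y: "0 < y" for y
 proof -
 have "conv (Qk y) f x - conv (Qk (y + et)) f x = conv (Qk y) (%t. f t - conv (Pk et) f t) x" for x
 unfolding Q_semigroup(2)[OF p _ fin y h(1), symmetric, simplified]
 by (rule conv_diff[symmetric]) (use hadm_Qk[OF hf y] hadm_Qk[OF hP y] in auto)
 then have "pL p (%x. conv (Qk y) f x - conv (Qk (y + et)) f x) = pL p (conv (Qk y) (%t. f t - conv (Pk et) f t))" by simp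
 also have "... <= en (hc p powr p) * pL p (%t. f t - conv (Pk et) f t)"
 proof (rule Q_bound[OF p y])
 show "pL p (%t. f t - conv (Pk et) f t) < \<infinity>"
 unfolding pint_diff_commute[of lborel p f] using h(2) by (rule order_less_trans) simp
 qed measurable
 also have "... <= en (hc p powr p) * en (e1 / hc p powr p)"
 unfolding pint_diff_commute[of lborel p f] using h(2) by (intro mult_left_mono) auto
 also have "... = en e1" using hcp e1 by (simp flip: ennreal_mult)
 finally show ?thesis .
 qed
 have "((%d. (d * (2 * d + 2 * et) / (2 * et^2)) powr p * A) ->> (0 * (2 * 0 + 2 * et) / (2 * et^2)) powr p * A) (at_right 0)"
 using p h(1) by (intro tendsto_intros tendsto_powr2) (auto simp: eventually_at_right_field intro!: exI[of _ 1])
 then have "\<forall>\<^sub>F d in at_right 0. (d * (2 * d + 2 * et) / (2 * et^2)) powr p * A < e1"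
 using e1 p by (intro order_tendstoD(2)) auto
 then have "\<forall>\<^sub>F d in at_right 0. (d * (2 * d + 2 * et) / (2 * et^2)) powr p * A < e1 & 0 < d"
 using eventually_at_right_less[of "0::real"] by eventually_elim auto
 then obtain d where d: "(d * (2 * d + 2 * et) / (2 * et^2)) powr p * A < e1" "0 < d"
 using eventually_happens'[OF trivial_limit_at_right_real] by blast
 have "pL p (%x. conv (Qk y) f x - conv (Qk y') f x) <= en e" if y: "0 < y" "y < d" "0 < y'" "y' < d" for y y'
 proof -
 have mid: "pL p (%x. conv (Qk (y + et)) f x - conv (Qk (y' + et)) f x) <= en e1"
 proof -
 have "\<bar>(y' + et)^2 - (y + et)^2\<bar> = \<bar>y' - y\<bar> * (y' + y + 2 * et)"
 proof -
 have "(y' + et)^2 - (y + et)^2 = (y' - y) * (y' + y + 2 * et)" by (simp add: power2_eq_square algebra_simps)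
 then show ?thesis using y h(1) by (simp add: abs_mult)
 qed
 also have "... <= d * (2 * d + 2 * et)" using y h(1) by (intro mult_mono) auto
 finally have "(\<bar>(y' + et)^2 - (y + et)^2\<bar> / (2 * et^2)) powr p <= (d * (2 * d + 2 * et) / (2 * et^2)) powr p"
 using p by (intro powr_mono2 divide_right_mono) auto
 then have "en ((\<bar>(y' + et)^2 - (y + et)^2\<bar> / (2 * et^2)) powr p) * pL p f <= en ((d * (2 * d + 2 * et) / (2 * et^2)) powr p) * en A"
 unfolding A(1) by (intro mult_right_mono ennreal_leI) auto
 also have "... <= en e1"
 unfolding ennreal_mult[OF powr_ge_zero A(2), symmetric] using d(1) by (intro ennreal_leI) simp
 finally have X: "en ((\<bar>(y' + et)^2 - (y + et)^2\<bar> / (2 * et^2)) powr p) * pL p f <= en e1" .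
 show ?thesis by (rule order.trans[OF pint_Q_Lipschitz[OF p _ fin h(1)] X]) (use y in auto)
 qed
 have t1: "pL p (%x. conv (Qk y) f x - conv (Qk (y' + et)) f x) <= en (2 powr p) * (en e1 + en e1)"
 by (rule order.trans[OF pint_triangle3[of _ _ "conv (Qk (y + et)) f"] mult_left_mono[OF add_mono]]) (use p sm[OF y(1)] mid in auto)
 have "pL p (%x. conv (Qk y) f x - conv (Qk y') f x) <= en (2 powr p) * (en (2 powr p) * (en e1 + en e1) + en e1)"
 by (rule order.trans[OF pint_triangle3[of _ _ "conv (Qk (y' + et)) f"] mult_left_mono[OF add_mono[OF t1]]])
 (use p sm[OF y(3)] in \<open>auto simp: pint_diff_commute[of lborel p "conv (Qk (y' + et)) f"]\<close>)
 also have "... = en (2 powr p * (2 powr p * (e1 + e1) + e1))"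
 using e1 by (simp add: ennreal_plus[symmetric] ennreal_mult[symmetric] del: ennreal_plus)
 also have "... <= en e"
 proof (rule ennreal_leI)
 have "2 powr p * (2 powr p * (e1 + e1) + e1) <= 3 * K * e1"
 using e1 by (simp add: K_def algebra_simps)
 then show "2 powr p * (2 powr p * (e1 + e1) + e1) <= e" using K by (simp add: e1_def)
 qed
 finally show ?thesis .
 qed
 then show ?thesis using d(2) by blast
 qed
 define F where "F n = conv (Qk (1 / real (Suc n))) f" for n
 have [measurable]: "bm (F n)" for n unfolding F_def by measurable
 have fl: "filterlim (%n. 1 / real (Suc n)) (at_right 0) sequentially" by real_asymp
 have small: "EX N. ALL n>=N. 1 / real (Suc n) < d" if "0 < d" for d
 proof -
 have "\<forall>\<^sub>F y in at_right 0. y < d" using that eventually_at_right_real[OF that] by (auto elim: eventually_mono)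
 then have "\<forall>\<^sub>F n in sequentially. 1 / real (Suc n) < d" using fl by (rule filterlim_iff[THEN iffD1, rule_format, rotated])
 then show ?thesis by (simp add: eventually_sequentially)
 qed
 obtain g where g: "g \<in> borel_measurable lborel" "pL p g < \<infinity>" "(%n. pL p (%x. F n x - g x)) -->> 0"
 proof (rule riesz_fischer[of F lborel p])
 show "EX N. ALL m>=N. ALL n>=N. pL p (%x. F m x - F n x) <= en e" if e: "0 < e" for e
 proof -
 obtain d where d: "0 < d" "!!y y'. 0 < y ==> y < d ==> 0 < y' ==> y' < d ==> pL p (%x. conv (Qk y) f x - conv (Qk y') f x) <= en e"
 using cauchy[OF e] by blast
 obtain N where "ALL n>=N. 1 / real (Suc n) < d" using small[OF d(1)] by blast
 then show ?thesis unfolding F_def using d(2) by (intro exI[of _ N]) (auto simp del: of_nat_Suc)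
 qed
 show "pL p (F n) < \<infinity>" for n unfolding F_def by (rule Qfin) simp
 qed (use p in auto)
 have [measurable]: "bm g" using g(1) by simp
 have hg: "hadm g" by (rule Lp_hadm[OF p _ g(2)]) simp
 have conv_g: "EX d>0. ALL y. 0 < y & y < d --> pL p (%x. conv (Qk y) f x - g x) <= en e" if e: "0 < e" for e
 proof -
 define e1 where "e1 = e / (2 * 2 powr p)"
 have e1: "0 < e1" using e by (simp add: e1_def)
 obtain d where d: "0 < d" "!!y y'. 0 < y ==> y < d ==> 0 < y' ==> y' < d ==> pL p (%x. conv (Qk y) f x - conv (Qk y') f x) <= en e1"
 using cauchy[OF e1] by blast
 obtain N where N: "ALL n>=N. 1 / real (Suc n) < d" using small[OF d(1)] by blast
 have "\<forall>\<^sub>F n in sequentially. pL p (%x. F n x - g x) < en e1" using g(3) e1 by (intro order_tendstoD(2)) auto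
 then have "\<forall>\<^sub>F n in sequentially. pL p (%x. F n x - g x) < en e1 & N <= n"
 using eventually_ge_at_top[of N] by eventually_elim auto
 then obtain n where n: "pL p (%x. F n x - g x) < en e1" "N <= n" by (auto simp: eventually_sequentially)
 have "pL p (%x. conv (Qk y) f x - g x) <= en e" if y: "0 < y" "y < d" for y
 proof -
 have "pL p (%x. conv (Qk y) f x - g x) <= en (2 powr p) * (en e1 + en e1)"
 by (rule order.trans[OF pint_triangle3[of _ _ "F n"] mult_left_mono[OF add_mono]])
 (use p d(2)[OF y, of "1 / real (Suc n)"] N n in \<open>auto simp: F_def simp del: of_nat_Suc\<close>)
 also have "... = en e" using e1 by (simp add: ennreal_plus[symmetric] ennreal_mult[symmetric] e1_def del: ennreal_plus)
 finally show ?thesis .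
 qed
 then show ?thesis using d(1) by blast
 qed
 have bound: "pL p g <= en (hc p powr p) * pL p f"
 proof (rule LIMSEQ_le_const2)
 show "(%n. pL p (F n)) -->> pL p g" by (rule pint_tendsto) (use p g in auto)
 show "EX N. ALL n>=N. pL p (F n) <= en (hc p powr p) * pL p f"
 unfolding F_def using Q_bound[OF p _ _ fin] by auto
 qed
 \<comment> \<open>The semigroup at the heights 1 / (n + 1) and y, with \<open>n\<close> to infinity
   on both sides. Every conjugate Poisson integral of \<open>f\<close> is thus a Poisson integral of
   \<open>g\<close>, whose boundary values are read off at Lebesgue points of
   \<open>g\<close>.\<close>
 have QP: "conv (Qk y) f x = conv (Pk y) g x" if y: "0 < y" for x y
 proof -
 have FF: "hadm (F n)" for n unfolding F_def by (rule Lp_hadm[OF p _ Qfin]) auto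
 have 1: "(%n. conv (Pk y) (F n) x - conv (Pk y) g x) -->> 0"
 proof -
 define u where "u n = conv (Pk y) (F n) x - conv (Pk y) g x" for n
 have uc: "u n = conv (Pk y) (%t. F n t - g t) x" for n
 unfolding u_def by (rule conv_diff[symmetric]) (use hadm_Pk[OF FF y] hadm_Pk[OF hg y] in auto)
 have "(%n. en (norm (u n) powr p)) -->> 0"
 proof (rule tendsto_sandwich[of "%n. 0" _ _ "%n. en (1 / (pi * y)) * pL p (%x. F n x - g x)"])
 show "\<forall>\<^sub>F n in sequentially. en (norm (u n) powr p) <= en (1 / (pi * y)) * pL p (%x. F n x - g x)"
 unfolding uc by (intro always_eventually allI conv_Pk_pointwise p y) measurable
 show "(%n. en (1 / (pi * y)) * pL p (%x. F n x - g x)) -->> 0"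
 using ennreal_tendsto_cmult[OF _ g(3), of "en (1 / (pi * y))"] by simp
 qed auto
 then have "(%n. norm (u n) powr p) -->> 0"
 using tendsto_ennreal_iff[of "%n. norm (u n) powr p" sequentially 0] by simp
 then have "(%n. (norm (u n) powr p) powr (1 / p)) -->> 0 powr (1 / p)"
 by (rule tendsto_powr2) (use p in auto)
 then have "(%n. norm (u n)) -->> 0" using p by (simp add: powr_powr)
 then show ?thesis unfolding u_def by (rule tendsto_norm_zero_cancel)
 qed
 have 2: "(%n. conv (Pk y) (F n) x) -->> conv (Qk y) f x"
 proof -
 have e: "conv (Pk y) (F n) x = conv (Qk (1 / real (Suc n) + y)) f x" for n
 unfolding F_def by (rule Q_semigroup(1)[OF p _ fin _ y]) auto
 have b: "norm (conv (Qk (r + y)) f x - conv (Qk y) f x) <= (\<bar>y^2 - (r + y)^2\<bar> / (2 * y^2)) * conv (Pk y) (%t. norm (f t)) x" if r: "0 < r" for r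
 proof -
 have "conv (Qk (r + y)) f x - conv (Qk y) f x = (LI t. (Qk (r + y) (x - t) - Qk y (x - t)) *R f t)"
 unfolding conv_def scaleR_diff_left using hadm_Qk[OF hf] r y by (intro b_integral_diff[symmetric]) auto
 also have "norm ... <= (LI t. (\<bar>y^2 - (r + y)^2\<bar> / (2 * y^2)) * (Pk y (x - t) * norm (f t)))"
 proof (rule b_integral_norm_bound_integral)
 show "intg (%t. (Qk (r + y) (x - t) - Qk y (x - t)) *R f t)"
 unfolding scaleR_diff_left using hadm_Qk[OF hf] r y by auto
 show "intg (%t. (\<bar>y^2 - (r + y)^2\<bar> / (2 * y^2)) * (Pk y (x - t) * norm (f t)))"
 using hadm_Pk[OF hadm_norm[OF hf] y, of x] by (intro integrable_mult_right) auto
 fix t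
 have "\<bar>Qk (r + y) (x - t) - Qk y (x - t)\<bar> * norm (f t) <= (\<bar>y^2 - (r + y)^2\<bar> / (2 * y^2) * Pk y (x - t)) * norm (f t)"
 using Qk_Lipschitz[OF y, of "r + y" y] r by (intro mult_right_mono) auto
 then show "norm ((Qk (r + y) (x - t) - Qk y (x - t)) *R f t) <= (\<bar>y^2 - (r + y)^2\<bar> / (2 * y^2)) * (Pk y (x - t) * norm (f t))"
 by (simp add: mult.assoc)
 qed
 also have "... = (\<bar>y^2 - (r + y)^2\<bar> / (2 * y^2)) * conv (Pk y) (%t. norm (f t)) x"
 by (simp add: conv_def)
 finally show ?thesis .
 qed
 have "(%n. conv (Qk (1 / real (Suc n) + y)) f x - conv (Qk y) f x) -->> 0"
 proof (rule Lim_null_comparison)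
 show "\<forall>\<^sub>F n in sequentially. norm (conv (Qk (1 / real (Suc n) + y)) f x - conv (Qk y) f x) <=
 (\<bar>y^2 - (1 / real (Suc n) + y)^2\<bar> / (2 * y^2)) * conv (Pk y) (%t. norm (f t)) x"
 by (intro always_eventually allI b) simp
 have z: "(%n. 1 / real (Suc n)) -->> 0" by real_asymp
 have "(%n. (\<bar>y^2 - (1 / real (Suc n) + y)^2\<bar> / (2 * y^2)) * conv (Pk y) (%t. norm (f t)) x) -->>
 (\<bar>y^2 - (0 + y)^2\<bar> / (2 * y^2)) * conv (Pk y) (%t. norm (f t)) x"
 using y by (intro tendsto_intros z) auto
 then show "(%n. (\<bar>y^2 - (1 / real (Suc n) + y)^2\<bar> / (2 * y^2)) * conv (Pk y) (%t. norm (f t)) x) -->> 0" by simp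
 qed
 then show ?thesis unfolding e by (simp add: LIM_zero_iff)
 qed
 have "(%n. conv (Pk y) (F n) x) -->> conv (Pk y) g x" using 1 by (simp add: LIM_zero_iff)
 with 2 show ?thesis by (rule LIMSEQ_unique)
 qed
 have ae: "AEL x. ((%y. conv (Qk y) f x) ->> g x) (at_right 0)"
 using AE_lebesgue_point[OF hg]
 proof eventually_elim
 case (elim x)
 have "\<forall>\<^sub>F y in at_right 0. conv (Pk y) g x = conv (Qk y) f x" using eventually_at_right_less[of "0::real"] by eventually_elim (simp add: QP)
 with lebesgue_point_limits(1)[OF hg elim] show ?case by (rule Lim_transform_eventually)
 qed
 have "AEL x. ((%ep. conv (hker ep) f x) ->> g x) (at_right 0)"
 using AE_lebesgue_point[OF hf] ae
 proof eventually_elim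
 case (elim x)
 from tendsto_add[OF lebesgue_point_limits(2)[OF hf elim(1)] elim(2)] show ?case by simp
 qed
 with ae bound conv_g show ?thesis unfolding is_hilb_def by (intro exI[of _ g]) auto
qed

section \<open>Dilation averages\<close>

text \<open>Dilation averages \<open>K f(t) = \<integral> k(r) f(r t) dr\<close>; both \<open>D_plus_inv\<close> and \<open>S_op\<close> are of this form.\<close>

definition dil_avg :: "(real => real) => (real => 'b::{banach, second_countable_topology}) => real => 'b" where
 "dil_avg k f t = (LI r. k r *R f (r * t))"

text \<open>Passing from f t to f (r t) multiplies the p-norm by r powr (- (1 / p)), so the last
  clause says that the norms of the dilations are integrable against \<open>k\<close>. Vanishing for
  r <= 0 keeps the two half lines from mixing.\<close>

definition dil_kernel :: "real => (real => real) => bool" where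
 "dil_kernel p k \<longleftrightarrow> k \<in> borel_measurable borel & (ALL r. 0 <= k r) & (ALL r<=0. k r = 0) &
 intg (%r. k r * r powr (- (1 / p)))"

definition dil_norm :: "real => (real => real) => real" where
 "dil_norm p k = (LI r. k r * r powr (- (1 / p)))"

lemma dil_avg_measurable [measurable]:
 fixes f :: "real => 'b::{banach, second_countable_topology}"
 assumes [measurable]: "bm k" "bm f"
 shows "bm (dil_avg k f)"
 unfolding dil_avg_def by measurable

lemma pint_dilate:
 fixes f :: "real => 'b::{real_normed_vector, second_countable_topology}"
 assumes [measurable]: "bm f" and r: "0 < r"
 shows "(NN t. en (r * norm (f (r * t)) powr p)) = pL p f"
proof -
 have "pL p f = en \<bar>r\<bar> * (NN t. en (norm (f (0 + r * t)) powr p))"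
 unfolding pint_def by (rule nn_integral_real_affine) (use r in auto)
 also have "... = (NN t. en \<bar>r\<bar> * en (norm (f (0 + r * t)) powr p))"
 by (rule nn_integral_cmult[symmetric]) measurable
 also have "... = (NN t. en (r * norm (f (r * t)) powr p))"
 using r by (intro nn_integral_cong) (simp add: ennreal_mult)
 finally show ?thesis by simp
qed

lemma dil_weighted_nn:
 fixes G :: "real => real => 'b::{real_normed_vector, second_countable_topology}"
 assumes k: "dil_kernel p k" and [measurable]: "case_prod G \<in> borel_measurable (borel \<Otimes>\<^sub>M borel)" and p: "1 < p"
 shows "(NN t. (NN r. en ((k r * r powr (- (1 / p))) * (r powr (1 / p) * norm (G r (r * t))) powr p))) =
 (NN r. en (k r * r powr (- (1 / p))) * pL p (G r))"
proof -
 have [measurable]: "bm k" using k by (simp add: dil_kernel_def)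
 have k0: "0 <= k r" "r <= 0 ==> k r = 0" for r using k by (auto simp: dil_kernel_def)
 have "(NN t. (NN r. en ((k r * r powr (- (1 / p))) * (r powr (1 / p) * norm (G r (r * t))) powr p))) =
 (NN r. (NN t. en ((k r * r powr (- (1 / p))) * (r powr (1 / p) * norm (G r (r * t))) powr p)))"
 by (rule tonelli_lborel) measurable
 also have "... = (NN r. en (k r * r powr (- (1 / p))) * pL p (G r))"
 proof (rule nn_integral_cong)
 fix r :: real
 show "(NN t. en ((k r * r powr (- (1 / p))) * (r powr (1 / p) * norm (G r (r * t))) powr p)) =
 en (k r * r powr (- (1 / p))) * pL p (G r)"
 proof (cases "0 < r")
 case True
 have [measurable]: "bm (G r)" by measurable
 have "(NN t. en ((k r * r powr (- (1 / p))) * (r powr (1 / p) * norm (G r (r * t))) powr p)) =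
 (NN t. en (k r * r powr (- (1 / p))) * en (r * norm (G r (r * t)) powr p))"
 using True p k0 by (intro nn_integral_cong) (simp add: powr_mult powr_powr ennreal_mult)
 also have "... = en (k r * r powr (- (1 / p))) * (NN t. en (r * norm (G r (r * t)) powr p))"
 by (rule nn_integral_cmult) measurable
 finally show ?thesis by (simp add: pint_dilate True)
 next
 case False
 then show ?thesis using k0(2)[of r] by simp
 qed
 qed
 finally show ?thesis .
qed

text \<open>Minkowski's integral inequality in p-th power form. With w = k r * r powr (- (1 / p)) as
  Jensen weight, the remaining factor r powr (1 / p) makes each dilation norm preserving. The family
  \<open>G\<close> varies with \<open>r\<close> because it is later applied to conjugate Poisson
  integrals at height r * y.\<close>

lemma dil_minkowski:
 fixes G :: "real => real => 'b::{banach, second_countable_topology}"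
 assumes k: "dil_kernel p k" and G [measurable]: "case_prod G \<in> borel_measurable (borel \<Otimes>\<^sub>M borel)" and p: "1 < p"
 shows "pL p (%t. LI r. k r *R G r (r * t)) <=
 en (dil_norm p k powr (p - 1)) * (NN r. en (k r * r powr (- (1 / p))) * pL p (G r))"
proof -
 have [measurable]: "bm k" using k by (simp add: dil_kernel_def)
 have k0: "0 <= k r" "r <= 0 ==> k r = 0" for r using k by (auto simp: dil_kernel_def)
 define w where "w r = k r * r powr (- (1 / p))" for r
 have w: "intg w" "!!r. 0 <= w r" using k k0 by (auto simp: dil_kernel_def w_def[abs_def])
 have [measurable]: "bm w" unfolding w_def by measurable
 have pt: "en (norm (LI r. k r *R G r (r * t)) powr p) <=
 en (dil_norm p k powr (p - 1)) * (NN r. en (w r * (r powr (1 / p) * norm (G r (r * t))) powr p))" for t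
 proof -
 have e: "norm (k r *R G r (r * t)) = w r * (r powr (1 / p) * norm (G r (r * t)))" for r
 proof (cases "0 < r")
 case True
 then have "r powr (- (1 / p)) * r powr (1 / p) = 1" by (simp flip: powr_add)
 then show ?thesis using k0(1)[of r] by (simp add: w_def mult.assoc)
 qed (use k0(2)[of r] in \<open>simp add: w_def\<close>)
 have "norm (LI r. k r *R G r (r * t)) <= (LI r. w r * (r powr (1 / p) * norm (G r (r * t))))"
 using integral_norm_bound[of lborel "%r. k r *R G r (r * t)"] unfolding e .
 then have "norm (LI r. k r *R G r (r * t)) powr p <= (LI r. w r * (r powr (1 / p) * norm (G r (r * t)))) powr p"
 using p by (intro powr_mono2) auto
 then have "en (norm (LI r. k r *R G r (r * t)) powr p) <= en ((LI r. w r * (r powr (1 / p) * norm (G r (r * t)))) powr p)"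
 by (rule ennreal_leI)
 also have "... <= en ((LI r. w r) powr (p - 1)) * (NN r. en (w r * (r powr (1 / p) * norm (G r (r * t))) powr p))"
 by (rule jensen_weight) (use w p in auto)
 finally show ?thesis by (simp add: dil_norm_def w_def)
 qed
 have "pL p (%t. LI r. k r *R G r (r * t)) <=
 (NN t. en (dil_norm p k powr (p - 1)) * (NN r. en (w r * (r powr (1 / p) * norm (G r (r * t))) powr p)))"
 unfolding pint_def by (rule nn_integral_mono[OF pt])
 also have "... = en (dil_norm p k powr (p - 1)) * (NN t. (NN r. en (w r * (r powr (1 / p) * norm (G r (r * t))) powr p)))"
 by (rule nn_integral_cmult) measurable
 also have "(NN t. (NN r. en (w r * (r powr (1 / p) * norm (G r (r * t))) powr p))) =
 (NN r. en (k r * r powr (- (1 / p))) * pL p (G r))"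
 unfolding w_def by (rule dil_weighted_nn[OF k G p])
 finally show ?thesis .
qed

lemma dil_kernel_nn: "dil_kernel p k ==> (NN r. en (k r * r powr (- (1 / p)))) = en (dil_norm p k)"
 unfolding dil_norm_def dil_kernel_def by (intro nn_integral_eq_integral) auto

lemma pint_dil_avg:
 fixes f :: "real => 'b::{banach, second_countable_topology}"
 assumes k: "dil_kernel p k" and [measurable]: "bm f" and p: "1 < p"
 shows "pL p (dil_avg k f) <= en (dil_norm p k powr p) * pL p f"
proof -
 have [measurable]: "bm k" using k by (simp add: dil_kernel_def)
 have n0: "0 <= dil_norm p k" using k unfolding dil_norm_def dil_kernel_def by (intro b_integral_nonneg) auto
 have "pL p (dil_avg k f) <= en (dil_norm p k powr (p - 1)) * (NN r. en (k r * r powr (- (1 / p))) * pL p f)"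
 unfolding dil_avg_def by (rule dil_minkowski[OF k _ p, where G="%r. f"]) measurable
 also have "(NN r. en (k r * r powr (- (1 / p))) * pL p f) = en (dil_norm p k) * pL p f"
 unfolding dil_kernel_nn[OF k, symmetric] by (rule nn_integral_multc) measurable
 also have "en (dil_norm p k powr (p - 1)) * (en (dil_norm p k) * pL p f) = en (dil_norm p k powr p) * pL p f"
 proof -
 have "dil_norm p k powr (p - 1) * dil_norm p k = dil_norm p k powr p"
 using n0 p by (cases "dil_norm p k = 0") (auto simp: powr_diff)
 then have "en (dil_norm p k powr (p - 1)) * en (dil_norm p k) = en (dil_norm p k powr p)"
 using n0 by (metis ennreal_mult powr_ge_zero)
 then show ?thesis by (simp flip: mult.assoc)
 qed
 finally show ?thesis .
qed

lemma pint_dil_avg_finite: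
 fixes f :: "real => 'b::{banach, second_countable_topology}"
 assumes "dil_kernel p k" "bm f" "1 < p" "pL p f < \<infinity>"
 shows "pL p (dil_avg k f) < \<infinity>"
 using pint_dil_avg[OF assms(1-3)] assms(4) by (auto intro: le_less_trans simp: ennreal_mult_less_top)

lemma dil_avg_integrable:
 fixes f :: "real => 'b::{banach, second_countable_topology}"
 assumes k: "dil_kernel p k" and [measurable]: "bm f" and p: "1 < p" and fin: "pL p f < \<infinity>"
 shows "AEL t. intg (%r. k r *R f (r * t))"
proof -
 have [measurable]: "bm k" using k by (simp add: dil_kernel_def)
 have k0: "0 <= k r" "r <= 0 ==> k r = 0" for r using k by (auto simp: dil_kernel_def)
 define w where "w r = k r * r powr (- (1 / p))" for r
 have w: "intg w" "!!r. 0 <= w r" using k k0 by (auto simp: dil_kernel_def w_def[abs_def])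
 have [measurable]: "bm w" unfolding w_def by measurable
 have "(NN t. (NN r. en (w r * (r powr (1 / p) * norm (f (r * t))) powr p))) =
 (NN r. en (k r * r powr (- (1 / p))) * pL p f)"
 unfolding w_def by (rule dil_weighted_nn[OF k _ p, where G="%r. f"]) measurable
 also have "... = en (dil_norm p k) * pL p f"
 unfolding dil_kernel_nn[OF k, symmetric] by (rule nn_integral_multc) measurable
 also have "... < \<infinity>" using fin by (simp add: ennreal_mult_less_top)
 finally have "AEL t. (NN r. en (w r * (r powr (1 / p) * norm (f (r * t))) powr p)) ~= \<infinity>"
 by (intro nn_integral_PInf_AE) auto
 then show ?thesis
 proof eventually_elim
 case (elim t)
 have i: "intg (%r. w r * (r powr (1 / p) * norm (f (r * t))) powr p)"
 by (rule integrableI_nonneg) (use elim w in \<open>auto simp: less_top\<close>)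
 show ?case
 proof (rule b_integrable_bound)
 show "intg (%r. w r + w r * (r powr (1 / p) * norm (f (r * t))) powr p)" using w i by auto
 have "norm (k r *R f (r * t)) <= norm (w r + w r * (r powr (1 / p) * norm (f (r * t))) powr p)" for r
 proof (cases "0 < r")
 case True
 define g where "g = r powr (1 / p) * norm (f (r * t))"
 have "g <= 1 + g powr p"
 proof (cases "g <= 1")
 case False
 then have "g powr 1 <= g powr p" using p by (intro powr_mono) auto
 then show ?thesis using False by simp
 qed (simp add: add_increasing2)
 then have "w r * g <= w r * (1 + g powr p)" using w by (intro mult_left_mono) auto
 moreover have eq: "norm (k r *R f (r * t)) = w r * g"
 proof -
 have "r powr (- (1 / p)) * r powr (1 / p) = 1" using True by (simp flip: powr_add)
 then show ?thesis using k0(1)[of r] by (simp add: w_def g_def mult.assoc)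
 qed
 ultimately show ?thesis unfolding eq using w(2)[of r] by (simp add: g_def distrib_left)
 qed (use k0(2)[of r] in simp)
 then show "AEL r. norm (k r *R f (r * t)) <= norm (w r + w r * (r powr (1 / p) * norm (f (r * t))) powr p)" by simp
 qed measurable
 qed
qed

lemma Qk_dilate: "0 < r ==> Qk y (t - s / r) = r * Qk (r * y) (r * t - s)"
proof -
 assume r: "0 < r"
 have "(t - s / r) = (r * t - s) / r" using r by (simp add: field_simps)
 moreover have "Qk y (u / r) = r * Qk (r * y) u" for u
 proof -
 have "(u / r)^2 + y^2 = (u^2 + (r * y)^2) / r^2" using r by (simp add: field_simps power_mult_distrib)
 then show ?thesis using r by (simp add: Qk_def power2_eq_square)
 qed
 ultimately show ?thesis by simp
qed

text \<open>Dilating by \<open>r\<close> changes the height of the kernel from y to r * y.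
  Commutation at a fixed height is therefore not exact: each \<open>r\<close> contributes with its
  own height, and the discrepancy disappears only in the limit.\<close>

lemma Q_dil_avg:
 fixes f :: "real => complex"
 assumes k: "dil_kernel p k" and [measurable]: "bm f" and p: "1 < p" and fin: "pL p f < \<infinity>"
 and y: "0 < y"
 shows "conv (Qk y) (dil_avg k f) t = (LI r. k r *R conv (Qk (r * y)) f (r * t))"
 "intg (%r. k r *R conv (Qk (r * y)) f (r * t))"
proof -
 have [measurable]: "bm k" using k by (simp add: dil_kernel_def)
 have k0: "0 <= k r" "r <= 0 ==> k r = 0" for r using k by (auto simp: dil_kernel_def)
 have nf: "pL p (%t. norm (f t)) < \<infinity>" using fin by simp
 define N where "N = dil_avg k (%t. norm (f t))"
 have [measurable]: "bm N" unfolding N_def by measurable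
 have hN: "hadm N" unfolding N_def by (rule Lp_hadm[OF p _ pint_dil_avg_finite[OF k _ p nf]]) measurable
 have AEi: "AEL s. intg (%r. k r * norm (f (r * s)))"
 using dil_avg_integrable[OF k _ p nf] by simp
 have "(NN s. (NN r. en (norm (Qk y (t - s) *R (k r *R f (r * s)))))) = (NN s. en (norm (Qk y (t - s) *R N s)))"
 proof (rule nn_integral_cong_AE)
 show "AEL s. (NN r. en (norm (Qk y (t - s) *R (k r *R f (r * s))))) = en (norm (Qk y (t - s) *R N s))"
 using AEi
 proof eventually_elim
 case (elim s)
 have N0: "0 <= N s" unfolding N_def dil_avg_def using k0 by (intro b_integral_nonneg) auto
 have "(NN r. en (norm (Qk y (t - s) *R (k r *R f (r * s))))) = (NN r. en \<bar>Qk y (t - s)\<bar> * en (k r * norm (f (r * s))))"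
 using k0 by (intro nn_integral_cong) (simp add: ennreal_mult abs_mult mult.assoc)
 also have "... = en \<bar>Qk y (t - s)\<bar> * (NN r. en (k r * norm (f (r * s))))" by (rule nn_integral_cmult) measurable
 also have "(NN r. en (k r * norm (f (r * s)))) = en (N s)"
 unfolding N_def dil_avg_def using nn_integral_eq_integral[OF elim] k0 by simp
 finally show ?case using N0 by (simp add: abs_mult ennreal_mult)
 qed
 qed
 also have "... < \<infinity>" using hadm_Qk[OF hN y, of t] by (simp add: integrable_iff_bounded)
 finally have fub: "(NN s. (NN r. en (norm (Qk y (t - s) *R (k r *R f (r * s)))))) < \<infinity>" .
 have m: "case_prod (%s r. Qk y (t - s) *R (k r *R f (r * s))) \<in> borel_measurable (lborel \<Otimes>\<^sub>M lborel)" by measurable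
 have inner: "(LI s. Qk y (t - s) *R (k r *R f (r * s))) = k r *R conv (Qk (r * y)) f (r * t)" for r
 proof (cases "0 < r")
 case True
 have "(LI s. Qk y (t - s) *R (k r *R f (r * s))) = (LI s. k r *R (Qk y (t - s) *R f (r * s)))"
 by (simp add: mult.commute)
 also have "... = k r *R (LI s. Qk y (t - s) *R f (r * s))" by (rule integral_scaleR_right)
 also have "(LI s. Qk y (t - s) *R f (r * s)) = \<bar>1 / r\<bar> *R (LI u. Qk y (t - (0 + 1 / r * u)) *R f (r * (0 + 1 / r * u)))"
 by (rule lborel_integral_real_affine) (use True in auto)
 also have "(LI u. Qk y (t - (0 + 1 / r * u)) *R f (r * (0 + 1 / r * u))) = (LI u. r *R (Qk (r * y) (r * t - u) *R f u))"
 using True by (intro b_integral_cong refl) (simp add: Qk_dilate)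
 also have "... = r *R conv (Qk (r * y)) f (r * t)" unfolding conv_def by (rule integral_scaleR_right)
 finally show ?thesis using True by simp
 qed (use k0(2)[of r] in simp)
 have outer: "(LI r. Qk y (t - s) *R (k r *R f (r * s))) = Qk y (t - s) *R dil_avg k f s" for s
 unfolding dil_avg_def by (rule integral_scaleR_right)
 show "conv (Qk y) (dil_avg k f) t = (LI r. k r *R conv (Qk (r * y)) f (r * t))"
 using fubini_lborel(1)[OF m fub] unfolding inner outer by (simp add: conv_def)
 show "intg (%r. k r *R conv (Qk (r * y)) f (r * t))"
 using fubini_lborel(5)[OF m fub] unfolding inner .
qed

text \<open>By \<open>Q_dil_avg\<close> the difference to be estimated is a dilation average of
  conjugate Poisson integrals at height r * Y n, minus \<open>g\<close>. Its size N (r * Y n) tends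
  to 0 for each r > 0 and is bounded by \<open>B\<close> at every height, so dominated convergence
  in \<open>r\<close> applies even though large \<open>r\<close> means large heights.\<close>

theorem hilb_dil_avg:
 fixes f g g' :: "real => complex"
 assumes k: "dil_kernel p k" and fm [measurable]: "bm f" and p: "1 < p" and fin: "pL p f < \<infinity>"
 and g: "is_hilb p f g" and g': "is_hilb p (dil_avg k f) g'"
 shows "AEL t. g' t = dil_avg k g t"
proof -
 have km [measurable]: "bm k" using k by (simp add: dil_kernel_def)
 have k0: "0 <= k r" "r <= 0 ==> k r = 0" for r using k by (auto simp: dil_kernel_def)
 have [measurable]: "bm g" "bm g'" using g g' by (auto simp: is_hilb_def)
 have gfin: "pL p g < \<infinity>" using g fin by (auto simp: is_hilb_def intro: le_less_trans simp: ennreal_mult_less_top)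
 define B where "B = en (2 powr p) * (en (hc p powr p) * pL p f + pL p g)"
 have Bfin: "B < \<infinity>" using fin gfin by (simp add: B_def ennreal_mult_less_top)
 define N where "N y = pL p (%t. conv (Qk y) f t - g t)" for y
 have NB: "N y <= B" if "0 < y" for y
 unfolding N_def B_def
 by (rule order.trans[OF pint_diff_le2 mult_left_mono[OF add_right_mono[OF Q_bound]]]) (use p fin that in auto)
 have Nlim: "(N ->> 0) (at_right 0)"
 proof (rule order_tendstoI)
 fix a :: ennreal assume "0 < a"
 have "EX e::real. 0 < e & en e < a"
 proof (cases a)
 case (real r)
 then show ?thesis using \<open>0 < a\<close> by (intro exI[of _ "r / 2"]) (auto simp: ennreal_less_iff)
 next
 case top
 then show ?thesis by (intro exI[of _ 1]) auto
 qed
 then obtain e :: real where e: "0 < e" "en e < a" by blast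
 obtain d where d: "0 < d" "!!y. 0 < y ==> y < d ==> N y <= en e"
 using g e(1) unfolding is_hilb_def N_def by blast
 have "\<forall>\<^sub>F y in at_right 0. y \<in> {0<..<d}" by (rule eventually_at_right_real[OF d(1)])
 then show "\<forall>\<^sub>F y in at_right 0. N y < a" by eventually_elim (use d(2) e(2) le_less_trans in auto)
 qed auto
 define Y where "Y n = 1 / real (Suc n)" for n
 have Y: "0 < Y n" for n by (simp add: Y_def)
 have Yl: "filterlim Y (at_right 0) sequentially" unfolding Y_def by real_asymp
 define I where "I n = (NN r. en (k r * r powr (- (1 / p))) * N (r * Y n))" for n
 have Nm [measurable]: "(%r. N (r * y)) \<in> borel_measurable borel" for y
 unfolding N_def pint_def conv_def Qk_def by measurable
 have I0: "I -->> 0"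
 proof -
 have "I -->> (\<integral>\<^sup>+r. 0 \<partial>(lborel :: real measure))"
 unfolding I_def
 proof (rule nn_integral_dominated_convergence[where w="%r. en (k r * r powr (- (1 / p))) * B"])
 show "AEL r. en (k r * r powr (- (1 / p))) * N (r * Y j) <= en (k r * r powr (- (1 / p))) * B" for j
 proof (rule AE_I2)
 fix r :: real
 show "en (k r * r powr (- (1 / p))) * N (r * Y j) <= en (k r * r powr (- (1 / p))) * B"
 using NB[of "r * Y j"] Y[of j] k0(2)[of r] by (cases "0 < r") (auto intro: mult_left_mono)
 qed
 have "(NN r. en (k r * r powr (- (1 / p))) * B) = en (dil_norm p k) * B"
 unfolding dil_kernel_nn[OF k, symmetric] by (rule nn_integral_multc) measurable
 then show "(NN r. en (k r * r powr (- (1 / p))) * B) < \<infinity>" using Bfin by (simp add: ennreal_mult_less_top)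
 show "AEL r. (%n. en (k r * r powr (- (1 / p))) * N (r * Y n)) -->> 0"
 proof (rule AE_I2)
 fix r :: real
 show "(%n. en (k r * r powr (- (1 / p))) * N (r * Y n)) -->> 0"
 proof (cases "0 < r")
 case True
 have "filterlim (%n. r * Y n) (at_right 0) sequentially" unfolding Y_def using True by real_asymp
 from ennreal_tendsto_cmult[OF _ filterlim_compose[OF Nlim this], of "en (k r * r powr (- (1 / p)))"]
 show ?thesis by simp
 qed (use k0(2)[of r] in simp)
 qed
 qed measurable
 then show ?thesis by simp
 qed
 have le: "pL p (%t. conv (Qk (Y n)) (dil_avg k f) t - dil_avg k g t) <= en (dil_norm p k powr (p - 1)) * I n" for n
 proof -
 define G where "G r t = conv (Qk (r * Y n)) f t - g t" for r t
 have Gm: "case_prod G \<in> borel_measurable (borel \<Otimes>\<^sub>M borel)" unfolding G_def conv_def Qk_def by measurable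
 have "pL p (%t. conv (Qk (Y n)) (dil_avg k f) t - dil_avg k g t) = pL p (%t. LI r. k r *R G r (r * t))"
 proof (rule pint_cong_AE)
 show "AEL t. conv (Qk (Y n)) (dil_avg k f) t - dil_avg k g t = (LI r. k r *R G r (r * t))"
 using dil_avg_integrable[OF k _ p gfin, simplified]
 proof eventually_elim
 case (elim t)
 show ?case
 unfolding Q_dil_avg(1)[OF k fm p fin Y] dil_avg_def G_def scaleR_diff_right
 by (rule b_integral_diff[symmetric, OF Q_dil_avg(2)[OF k fm p fin Y] elim])
 qed
 qed
 also have "... <= en (dil_norm p k powr (p - 1)) * (NN r. en (k r * r powr (- (1 / p))) * pL p (G r))"
 by (rule dil_minkowski[OF k Gm p])
 finally show ?thesis by (simp add: I_def N_def G_def[abs_def])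
 qed
 define M where "M n = pL p (%t. conv (Qk (Y n)) (dil_avg k f) t - g' t)" for n
 have M0: "M -->> 0"
 proof (rule order_tendstoI)
 fix a :: ennreal assume "0 < a"
 have "EX e::real. 0 < e & en e < a"
 proof (cases a)
 case (real r)
 then show ?thesis using \<open>0 < a\<close> by (intro exI[of _ "r / 2"]) (auto simp: ennreal_less_iff)
 next
 case top
 then show ?thesis by (intro exI[of _ 1]) auto
 qed
 then obtain e :: real where e: "0 < e" "en e < a" by blast
 obtain d where d: "0 < d" "!!y. 0 < y ==> y < d ==> pL p (%t. conv (Qk y) (dil_avg k f) t - g' t) <= en e"
 using g' e(1) unfolding is_hilb_def by blast
 have "\<forall>\<^sub>F y in at_right 0. y \<in> {0<..<d}" by (rule eventually_at_right_real[OF d(1)])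
 then have "\<forall>\<^sub>F n in sequentially. Y n \<in> {0<..<d}" using Yl by (rule filterlim_iff[THEN iffD1, rule_format, rotated])
 then show "\<forall>\<^sub>F n in sequentially. M n < a" unfolding M_def by eventually_elim (use d(2) e(2) le_less_trans in auto)
 qed auto
 have fin2: "pL p (%t. g' t - dil_avg k g t) <= en (2 powr p) * (M n + en (dil_norm p k powr (p - 1)) * I n)" for n
 unfolding M_def
 by (subst pint_diff_commute[of _ _ _ g'], rule order.trans[OF pint_triangle3[of _ _ "conv (Qk (Y n)) (dil_avg k f)"] mult_left_mono[OF add_mono[OF order_refl le]]])
 (use p in auto)
 have "(%n. en (2 powr p) * (M n + en (dil_norm p k powr (p - 1)) * I n)) -->> en (2 powr p) * (0 + en (dil_norm p k powr (p - 1)) * 0)"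
 by (intro ennreal_tendsto_cmult tendsto_add M0 I0) auto
 then have "pL p (%t. g' t - dil_avg k g t) <= en (2 powr p) * (0 + en (dil_norm p k powr (p - 1)) * 0)"
 by (rule LIMSEQ_le_const) (use fin2 in auto)
 then have "pL p (%t. g' t - dil_avg k g t) = 0" by simp
 then show ?thesis by (subst (asm) pint_eq_0_iff) auto
qed

section \<open>Sharpness of the constant\<close>

text \<open>The extremal functions are truncations of \<open>\<bar>s\<bar>\<^sup>-\<^sup>g\<close> and \<open>sgn s \<bar>s\<bar>\<^sup>-\<^sup>g\<close>
 with \<open>g < 1 / p\<close> close to \<open>1 / p\<close>. The Cauchy integral of a homogeneous function is
 homogeneous and holomorphic, hence a multiple of \<open>z\<^sup>-\<^sup>g\<close>; its boundary values give the
 Hilbert transform.\<close>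

definition hfun :: "bool => real => real => real" where
 "hfun ev g s = (if ev then 1 else sgn s) * \<bar>s\<bar> powr (- g)"

lemma hfun_measurable [measurable]: "bm (hfun ev g)"
 unfolding hfun_def by measurable

lemma hfun_abs: "\<bar>hfun ev g s\<bar> = (if s = 0 then 0 else \<bar>s\<bar> powr (- g))"
 by (auto simp: hfun_def abs_mult abs_sgn_eq)

lemma hfun_minus: "hfun ev g (- s) = (if ev then 1 else - 1) * hfun ev g s"
 by (simp add: hfun_def sgn_minus)

lemma hfun_scale: "0 < r ==> hfun ev g (r * s) = r powr (- g) * hfun ev g s"
 by (simp add: hfun_def abs_mult powr_mult sgn_mult)

lemma nn_integral_abs_powr:
 fixes a b :: real
 assumes a: "a < 1" and b: "0 < b"
 shows "(NN x. en (\<bar>x\<bar> powr (- a)) * indicator {-b<..<b} x) = en (2 * b powr (1 - a) / (1 - a))"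
proof -
 define h where "h x = en (\<bar>x\<bar> powr (- a)) * indicator {0..b} x" for x
 have [measurable]: "bm h" unfolding h_def by measurable
 have 1: "(NN x. h x) = en (b powr (1 - a) / (1 - a))"
 proof -
 have "(NN x. h x) = (NN x. en (x powr (- a)) * indicator {0..b} x)"
 unfolding h_def by (intro nn_integral_cong) (auto split: split_indicator)
 also have "... = en (b powr (- a + 1) / (- a + 1))"
 by (rule nn_integral_has_integral_lebesgue') (use has_integral_powr_from_0[of "- a" b] a b in auto)
 finally show ?thesis by (simp add: add.commute)
 qed
 have "(NN x. en (\<bar>x\<bar> powr (- a)) * indicator {-b<..<b} x) = (NN x. h x + h (0 - x))"
 proof (rule nn_integral_cong_AE)
 show "AEL x. en (\<bar>x\<bar> powr (- a)) * indicator {-b<..<b} x = h x + h (0 - x)"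
 using AE_lborel_singleton[of 0] AE_lborel_singleton[of b] AE_lborel_singleton[of "- b"]
 by eventually_elim (auto simp: h_def split: split_indicator)
 qed
 also have "... = (NN x. h x) + (NN x. h (0 - x))" by (rule nn_integral_add) measurable
 also have "(NN x. h (0 - x)) = (NN x. h x)" by (rule nn_integral_reflect_shift) measurable
 also have "(NN x. h x) + (NN x. h x) = en (b powr (1 - a) / (1 - a) + b powr (1 - a) / (1 - a))"
 unfolding 1 using a by (intro ennreal_plus[symmetric]) auto
 finally show ?thesis by simp
qed

lemma abs_powr_tail:
 fixes s q :: real
 assumes "1 <= \<bar>s\<bar>" "0 <= q"
 shows "\<bar>s\<bar> powr (- q) <= 2 powr q * (1 + \<bar>s\<bar>) powr (- q)"
proof -
 have "((1 + \<bar>s\<bar>) / 2) powr q <= \<bar>s\<bar> powr q" using assms by (intro powr_mono2) auto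
 moreover have "0 < \<bar>s\<bar> powr q" "0 < (1 + \<bar>s\<bar>) powr q" using assms by auto
 ultimately show ?thesis by (simp add: powr_minus powr_divide divide_simps mult.commute)
qed

lemma hfun_hadm: assumes g: "0 < g" "g < 1" shows "hadm (hfun ev g)"
 unfolding hadm_def
proof
 show "intg (%t. (1 / (1 + \<bar>t\<bar>)) *R hfun ev g t)"
 proof (rule integrableI_bounded)
 have "(NN t. en (norm ((1 / (1 + \<bar>t\<bar>)) *R hfun ev g t))) <=
 (NN t. en (\<bar>t\<bar> powr (- g)) * indicator {-1<..<1} t + en (2 powr g) * en ((1 + \<bar>t\<bar>) powr (- (1 + g))))"
 proof (rule nn_integral_mono)
 fix t :: real
 have n: "norm ((1 / (1 + \<bar>t\<bar>)) *R hfun ev g t) <= (1 / (1 + \<bar>t\<bar>)) * \<bar>t\<bar> powr (- g)"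
 by (simp add: abs_mult hfun_abs)
 show "en (norm ((1 / (1 + \<bar>t\<bar>)) *R hfun ev g t)) <=
 en (\<bar>t\<bar> powr (- g)) * indicator {-1<..<1} t + en (2 powr g) * en ((1 + \<bar>t\<bar>) powr (- (1 + g)))"
 proof (cases "\<bar>t\<bar> < 1")
 case True
 have "(1 / (1 + \<bar>t\<bar>)) * \<bar>t\<bar> powr (- g) <= 1 * \<bar>t\<bar> powr (- g)" by (intro mult_right_mono) auto
 with n have "en (norm ((1 / (1 + \<bar>t\<bar>)) *R hfun ev g t)) <= en (\<bar>t\<bar> powr (- g))" by (intro ennreal_leI) simp
 moreover have "t \<in> {-1<..<1}" using True by auto
 ultimately show ?thesis by (simp add: add_increasing2)
 next
 case False
 have "(1 / (1 + \<bar>t\<bar>)) * \<bar>t\<bar> powr (- g) <= (1 / (1 + \<bar>t\<bar>)) * (2 powr g * (1 + \<bar>t\<bar>) powr (- g))"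
 using False g by (intro mult_left_mono abs_powr_tail) auto
 also have "... = 2 powr g * (1 + \<bar>t\<bar>) powr (- (1 + g))" by (simp add: powr_diff powr_minus powr_add field_simps)
 finally have "en (norm ((1 / (1 + \<bar>t\<bar>)) *R hfun ev g t)) <= en (2 powr g * (1 + \<bar>t\<bar>) powr (- (1 + g)))"
 using n by (intro ennreal_leI) simp
 also have "... = en (2 powr g) * en ((1 + \<bar>t\<bar>) powr (- (1 + g)))" by (intro ennreal_mult) auto
 finally show ?thesis by (simp add: add_increasing)
 qed
 qed
 also have "... = (NN t. en (\<bar>t\<bar> powr (- g)) * indicator {-1<..<1} t) + (NN t. en (2 powr g) * en ((1 + \<bar>t\<bar>) powr (- (1 + g))))"
 by (rule nn_integral_add) measurable
 also have "(NN t. en (2 powr g) * en ((1 + \<bar>t\<bar>) powr (- (1 + g)))) = en (2 powr g) * (NN t. en ((1 + \<bar>t\<bar>) powr (- (1 + g))))"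
 by (rule nn_integral_cmult) measurable
 also have "(NN t. en (\<bar>t\<bar> powr (- g)) * indicator {-1<..<1} t) = en (2 * 1 powr (1 - g) / (1 - g))"
 by (rule nn_integral_abs_powr) (use g in auto)
 also have "en (2 * 1 powr (1 - g) / (1 - g)) + en (2 powr g) * (NN t. en ((1 + \<bar>t\<bar>) powr (- (1 + g)))) < \<infinity>"
 using nn_integral_one_plus_powr[of "1 + g"] g by (simp add: ennreal_mult_less_top)
 finally show "(NN t. en (norm ((1 / (1 + \<bar>t\<bar>)) *R hfun ev g t))) < \<infinity>" .
 qed measurable
qed measurable

lemma cauchyF_hfun_scale:
 assumes r: "0 < r" shows "cauchyF (hfun ev g) (of_real r * z) = of_real (r powr (- g)) * cauchyF (hfun ev g) z"
proof -
 have "(LI t. of_real (hfun ev g t) / (of_real r * z - of_real t)) =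
 \<bar>r\<bar> *R (LI t. of_real (hfun ev g (0 + r * t)) / (of_real r * z - of_real (0 + r * t)))"
 by (rule lborel_integral_real_affine) (use r in auto)
 also have "(LI t. of_real (hfun ev g (0 + r * t)) / (of_real r * z - of_real (0 + r * t))) =
 (LI t. of_real (r powr (- g) / r) * (of_real (hfun ev g t) / (z - of_real t)))"
 proof (intro b_integral_cong refl)
 fix t
 have "of_real r * z - of_real (0 + r * t) = of_real r * (z - of_real t)" by (simp add: right_diff_distrib)
 then show "of_real (hfun ev g (0 + r * t)) / (of_real r * z - of_real (0 + r * t)) = of_real (r powr (- g) / r) * (of_real (hfun ev g t) / (z - of_real t))"
 using r by (simp add: hfun_scale)
 qed
 also have "... = of_real (r powr (- g) / r) * (LI t. of_real (hfun ev g t) / (z - of_real t))" by (rule integral_mult_right_zero)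
 also have "\<bar>r\<bar> *R ... = of_real (r powr (- g)) * (LI t. of_real (hfun ev g t) / (z - of_real t))"
 using r by (simp add: scaleR_conv_of_real)
 finally show ?thesis by (simp add: cauchyF_def)
qed

text \<open>Differentiating the homogeneity relation along the ray at r = 1 gives Euler's equation z
  F' = - g F. Hence z powr g * F has derivative 0 on the upper half plane, which is convex and
  avoids the branch cut.\<close>

lemma cauchyF_hfun:
 assumes g: "0 < g" "g < 1"
 obtains C where "!!z. 0 < Im z ==> cauchyF (hfun ev g) z = C * z powr (- of_real g)"
proof -
 define F where "F = cauchyF (hfun ev g)"
 have Fd: "(F has_field_derivative cauchyF1 (hfun ev g) z) (at z)" if "0 < Im z" for z
 unfolding F_def by (rule cauchyF_deriv[OF hfun_hadm[OF g] that])
 have euler: "z * cauchyF1 (hfun ev g) z = - of_real g * F z" if z: "0 < Im z" for z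
 proof -
 have "((%r. of_real r * z) has_vector_derivative 1 * z) (at (1::real))"
 by (intro has_vector_derivative_mult_left) (auto intro!: derivative_eq_intros has_vector_derivative_of_real)
 from field_vector_diff_chain_at[OF this, of F "cauchyF1 (hfun ev g) z"] Fd[OF z]
 have 1: "((%r. F (of_real r * z)) has_vector_derivative z * cauchyF1 (hfun ev g) z) (at (1::real))" by (simp add: o_def)
 have "((%r. r powr (- g)) has_real_derivative - g) (at (1::real))"
 by (auto intro!: derivative_eq_intros)
 then have 2: "((%r. of_real (r powr (- g)) * F z) has_vector_derivative of_real (- g) * F z) (at (1::real))"
 by (intro has_vector_derivative_mult_left has_vector_derivative_of_real) (simp add: has_real_derivative_iff_has_vector_derivative)
 have "((%r. F (of_real r * z)) has_vector_derivative of_real (- g) * F z) (at (1::real))"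
 proof (rule has_vector_derivative_transform_within_open[OF 2, of "{0<..}"])
 show "of_real (r powr (- g)) * F z = F (of_real r * z)" if "r \<in> {0<..}" for r
 unfolding F_def using cauchyF_hfun_scale[of r] that by simp
 qed auto
 from vector_derivative_unique_at[OF 1 this] show ?thesis by simp
 qed
 define U where "U = {z::complex. 0 < Im z}"
 have "EX C. \<forall>z\<in>U. z powr (of_real g) * F z = C"
 proof (rule has_field_derivative_zero_constant)
 show "convex U" unfolding U_def by (rule convex_halfspace_Im_gt)
 fix z assume "z \<in> U"
 then have z: "0 < Im z" by (simp add: U_def)
 then have zs: "z \<notin> \<real>\<^sub>\<le>\<^sub>0" "z ~= 0" by (auto simp: complex_nonpos_Reals_iff)
 have "((%z. z powr of_real g * F z) has_field_derivative
 (of_real g * z powr (of_real g - 1)) * F z + cauchyF1 (hfun ev g) z * z powr of_real g) (at z)"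
 by (rule DERIV_mult[OF has_field_derivative_powr[OF zs(1)] Fd[OF z]])
 moreover have "z powr of_real g = z powr (of_real g - 1) * z"
 using zs powr_add[of z "of_real g - 1" 1] by simp
 then have "(of_real g * z powr (of_real g - 1)) * F z + cauchyF1 (hfun ev g) z * z powr of_real g =
 z powr (of_real g - 1) * (of_real g * F z + z * cauchyF1 (hfun ev g) z)" by (simp add: algebra_simps)
 ultimately show "((%z. z powr of_real g * F z) has_field_derivative 0) (at z within U)"
 unfolding euler[OF z] by (simp add: has_field_derivative_at_within)
 qed
 then obtain C where C: "!!z. z \<in> U ==> z powr (of_real g) * F z = C" by blast
 show ?thesis
 proof (rule that)
 fix z assume z: "0 < Im z"
 then have "z ~= 0" by auto
 then have "z powr of_real g ~= 0" by simp
 then have "F z = (z powr of_real g * F z) * z powr (- of_real g)" by (simp add: powr_minus field_simps)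
 also have "z powr of_real g * F z = C" using C[of z] z by (simp add: U_def)
 finally show "cauchyF (hfun ev g) z = C * z powr (- of_real g)" by (simp only: F_def)
 qed
qed

lemma conv_Qk_reflect:
 fixes f :: "real => real"
 assumes "!!s. f (- s) = c * f s"
 shows "conv (Qk y) f (- x) = - c * conv (Qk y) f x" "conv (Pk y) f (- x) = c * conv (Pk y) f x"
proof -
 have "conv (Qk y) f (- x) = (LI t. (%t. Qk y (- x - t) *R f t) (0 - t))" unfolding conv_def by (rule integral_reflect_shift[symmetric])
 also have "... = (LI t. - c * (Qk y (x - t) *R f t))"
 proof (intro b_integral_cong refl)
 fix t
 have "Qk y (- x - (0 - t)) = - Qk y (x - t)" unfolding Qk_def by (simp add: minus_divide_left power2_commute)
 then show "Qk y (- x - (0 - t)) *R f (0 - t) = - c * (Qk y (x - t) *R f t)" by (simp add: assms)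
 qed
 also have "... = - c * conv (Qk y) f x" unfolding conv_def by (rule integral_mult_right_zero)
 finally show "conv (Qk y) f (- x) = - c * conv (Qk y) f x" .
 have "conv (Pk y) f (- x) = (LI t. (%t. Pk y (- x - t) *R f t) (0 - t))" unfolding conv_def by (rule integral_reflect_shift[symmetric])
 also have "... = (LI t. c * (Pk y (x - t) *R f t))"
 proof (intro b_integral_cong refl)
 fix t
 have "Pk y (- x - (0 - t)) = Pk y (x - t)" unfolding Pk_def by (simp add: power2_commute)
 then show "Pk y (- x - (0 - t)) *R f (0 - t) = c * (Pk y (x - t) *R f t)" by (simp add: assms)
 qed
 also have "... = c * conv (Pk y) f x" unfolding conv_def by (rule integral_mult_right_zero)
 finally show "conv (Pk y) f (- x) = c * conv (Pk y) f x" .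
qed

text \<open>Absolute value of the factor with which the Hilbert transform maps the even power to the
  odd one (\<open>ev\<close>) or the odd one to the even one. At g = 1 / p, with \<open>ev\<close>
  exactly for p <= 2, it equals \<open>hc p\<close>.\<close>

definition hconst :: "bool => real => real" where
 "hconst ev g = (if ev then tan (pi * g / 2) else cot (pi * g / 2))"

text \<open>The Cauchy integral is C * z powr (- g), and two evaluations determine \<open>C\<close>.
  The real part is 1 because the Poisson integral returns \<open>hfun\<close> at a Lebesgue point x
  > 0. At z = i parity kills the conjugate Poisson integral of the even function and the Poisson
  integral of the odd one, which fixes the imaginary part.\<close>

lemma Q_hfun_limit:
 assumes g: "0 < g" "g < 1" and x: "x ~= 0"
 shows "((%y. \<bar>conv (Qk y) (hfun ev g) x\<bar>) ->> hconst ev g * \<bar>x\<bar> powr (- g)) (at_right 0)"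
proof -
 have h: "hadm (hfun ev g)" by (rule hfun_hadm[OF g])
 obtain C where C: "!!z. 0 < Im z ==> cauchyF (hfun ev g) z = C * z powr (- of_real g)" using cauchyF_hfun[OF g] by blast
 have lim: "((%y. cauchyF (hfun ev g) (Complex x y)) ->> C * of_real (x powr (- g))) (at_right 0)" if x: "0 < x" for x
 proof -
 have "((%y. Complex x y) ->> Complex x 0) (at_right 0)" by (intro tendsto_Complex tendsto_const tendsto_ident_at)
 moreover have "isCont (%z. C * z powr (- of_real g)) (Complex x 0)"
 using x by (intro continuous_intros) (auto simp: complex_nonpos_Reals_iff intro!: DERIV_isCont[OF has_field_derivative_powr])
 ultimately have "((%y. C * Complex x y powr (- of_real g)) ->> C * Complex x 0 powr (- of_real g)) (at_right 0)"
 by (rule isCont_tendsto_compose[rotated])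
 moreover have "Complex x 0 powr (- of_real g) = of_real (x powr (- g))"
 using x powr_of_real[of x "- g"] by (simp add: complex_of_real_def[symmetric])
 ultimately have "((%y. C * Complex x y powr (- of_real g)) ->> C * of_real (x powr (- g))) (at_right 0)" by simp
 moreover have "\<forall>\<^sub>F y in at_right 0. C * Complex x y powr (- of_real g) = cauchyF (hfun ev g) (Complex x y)"
 using eventually_at_right_less[of "0::real"] by eventually_elim (simp add: C)
 ultimately show ?thesis by (rule Lim_transform_eventually)
 qed
 have evF: "\<forall>\<^sub>F y in at_right 0. cauchyF (hfun ev g) (Complex x y) = Complex (conv (Pk y) (hfun ev g) x) (conv (Qk y) (hfun ev g) x)" for x
 using eventually_at_right_less[of "0::real"] by eventually_elim (simp add: cauchyF_Complex[OF h])
 have ReC: "Re C = 1"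
 proof -
 define f where "f t = complex_of_real (hfun ev g t)" for t
 have fh: "hadm f" unfolding f_def by (rule hadm_bounded_linear[OF bounded_linear_of_real h])
 have "EX x>0. lebesgue_point f x"
 proof (rule ccontr)
 assume "\<not> ?thesis"
 then have "x \<notin> {0<..<1}" if "lebesgue_point f x" for x using that by auto
 then have "AEL x. x \<notin> {0<..<1::real}" by (intro eventually_mono[OF AE_lebesgue_point[OF fh]])
 then have "{0<..<1::real} \<in> null_sets lborel" by (subst AE_iff_null_sets) auto
 then show False by (simp add: null_sets_def)
 qed
 then obtain x where x: "0 < x" "lebesgue_point f x" by blast
 have cf: "conv (Pk y) f x = of_real (conv (Pk y) (hfun ev g) x)" for y
 unfolding conv_def f_def by (simp add: scaleR_conv_of_real flip: of_real_mult)
 have "((%y. of_real (conv (Pk y) (hfun ev g) x) :: complex) ->> of_real (hfun ev g x)) (at_right 0)"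
 using lebesgue_point_limits(1)[OF fh x(2)] unfolding cf f_def .
 then have 1: "((%y. conv (Pk y) (hfun ev g) x) ->> hfun ev g x) (at_right 0)" by (simp only: tendsto_of_real_iff)
 have "((%y. Re (cauchyF (hfun ev g) (Complex x y))) ->> Re (C * of_real (x powr (- g)))) (at_right 0)"
 by (intro tendsto_Re lim x)
 moreover have "\<forall>\<^sub>F y in at_right 0. Re (cauchyF (hfun ev g) (Complex x y)) = conv (Pk y) (hfun ev g) x"
 using evF[of x] by eventually_elim simp
 ultimately have "((%y. conv (Pk y) (hfun ev g) x) ->> Re (C * of_real (x powr (- g)))) (at_right 0)"
 by (rule Lim_transform_eventually)
 with 1 have "hfun ev g x = Re (C * of_real (x powr (- g)))" by (intro tendsto_unique[OF trivial_limit_at_right_real])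
 then show ?thesis using x(1) by (cases ev) (simp_all add: hfun_def)
 qed
 have Ci: "cauchyF (hfun ev g) \<i> = C * cis (- (pi * g / 2))"
 proof -
 have "\<i> powr (- of_real g) = cis (- (pi * g / 2))" by (simp add: powr_def cis_conv_exp mult_ac)
 then show ?thesis using C[of \<i>] by simp
 qed
 have F1: "cauchyF (hfun ev g) \<i> = Complex (conv (Pk 1) (hfun ev g) 0) (conv (Qk 1) (hfun ev g) 0)"
 using cauchyF_Complex[OF h, of 1 0] by (simp add: imaginary_unit.code)
 have ang: "0 < pi * g / 2" "pi * g / 2 < pi / 2" using g by auto
 have sc: "0 < sin (pi * g / 2)" "0 < cos (pi * g / 2)" using ang by (auto intro: sin_gt_zero cos_gt_zero)
 have ImC: "\<bar>Im C\<bar> = hconst ev g"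
 proof (cases ev)
 case True
 have "conv (Qk 1) (hfun ev g) (- 0) = - 1 * conv (Qk 1) (hfun ev g) 0" by (rule conv_Qk_reflect) (simp add: hfun_minus True)
 then have "Im (C * cis (- (pi * g / 2))) = 0" using F1 Ci by simp
 then have "Im C * cos (pi * g / 2) = sin (pi * g / 2)" using ReC by simp
 then have "Im C = tan (pi * g / 2)" using sc by (simp add: tan_def field_simps)
 moreover have "0 < tan (pi * g / 2)" using ang by (rule tan_gt_zero)
 ultimately show ?thesis using True by (simp add: hconst_def)
 next
 case False
 have "conv (Pk 1) (hfun ev g) (- 0) = - 1 * conv (Pk 1) (hfun ev g) 0" by (rule conv_Qk_reflect) (simp add: hfun_minus False)
 then have "Re (C * cis (- (pi * g / 2))) = 0" using F1 Ci by simp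
 then have "Im C * sin (pi * g / 2) = - cos (pi * g / 2)" using ReC by simp
 then have "Im C = - cot (pi * g / 2)" using sc by (simp add: cot_def field_simps)
 moreover have "0 < cot (pi * g / 2)" using ang by (rule cot_gt_zero)
 ultimately show ?thesis using False by (simp add: hconst_def)
 qed
 have pos: "((%y. \<bar>conv (Qk y) (hfun ev g) x\<bar>) ->> hconst ev g * x powr (- g)) (at_right 0)" if x: "0 < x" for x
 proof -
 have "((%y. \<bar>Im (cauchyF (hfun ev g) (Complex x y))\<bar>) ->> \<bar>Im (C * of_real (x powr (- g)))\<bar>) (at_right 0)"
 by (intro tendsto_rabs tendsto_Im lim x)
 moreover have "\<forall>\<^sub>F y in at_right 0. \<bar>Im (cauchyF (hfun ev g) (Complex x y))\<bar> = \<bar>conv (Qk y) (hfun ev g) x\<bar>"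
 using evF[of x] by eventually_elim simp
 ultimately have "((%y. \<bar>conv (Qk y) (hfun ev g) x\<bar>) ->> \<bar>Im (C * of_real (x powr (- g)))\<bar>) (at_right 0)"
 by (rule Lim_transform_eventually)
 then show ?thesis using ImC by (simp add: abs_mult)
 qed
 show ?thesis
 proof (cases "0 < x")
 case True
 then show ?thesis using pos[OF True] by simp
 next
 case False
 then have x': "0 < - x" using x by simp
 have "\<bar>conv (Qk y) (hfun ev g) x\<bar> = \<bar>conv (Qk y) (hfun ev g) (- x)\<bar>" for y
 using conv_Qk_reflect(1)[of "hfun ev g" "if ev then 1 else -1" y x] hfun_minus[of ev g] by (cases ev) auto
 then show ?thesis using pos[OF x'] x' by simp
 qed
qed

text \<open>As \<open>g\<close> approaches 1 / p from below, the integral 2 / (1 - g p) of the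
  truncated power blows up, while the removed tail changes the transform by at most
  \<open>c0\<close> near the singularity. The ratio is thus governed by the singularity alone, and a
  window around it inside the half line suffices.\<close>

theorem hilb_lower:
 assumes p: "1 < p" and c: "0 <= c" "c < hc p"
 shows "EX f. f \<in> borel_measurable borel & (ALL t<=0. f t = 0) & 0 < pL p f & pL p f < \<infinity> &
 (ALL h. is_hilb p f h --> en (c powr p) * pL p f <= pL p (%t. indicator {0<..} t *R h t))"
proof -
 define ev where "ev \<longleftrightarrow> p <= 2"
 \<comment> \<open>Because g > 1 / (2 * p), the tail |s| powr (- 1) * |s| powr (- g) is at most |s|
   powr (- q) for |s| >= 1. This makes \<open>c0\<close> independent of \<open>g\<close>; the 4 in
   it is 2 powr 2, which bounds 2 powr q.\<close>
 define q where "q = 1 + 1 / (2 * p)"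
 define c0 where "c0 = 4 * enn2real (NN t. en ((1 + \<bar>t\<bar>) powr (- q)))"
 have q: "1 < q" "q <= 2" using p by (auto simp: q_def field_simps)
 have c0: "0 <= c0" by (simp add: c0_def)
 have hc1: "hconst ev (1 / p) = hc p" by (simp add: hconst_def hc_def ev_def mult.commute)
 have hcp: "0 < hc p" by (rule hc_nonneg[OF p])
 \<comment> \<open>Lower bound for the p-th power of the ratio: the main term over |x| < 1/2 minus
   the tail error, both divided by the total 2 / (1 - g * p).\<close>
 define R where "R g = hconst ev g powr p * (1/2) powr (1 - g * p) - p * c0 * hconst ev g powr (p - 1) * (2 * p) * ((1 - g * p) / 2)" for g
 have hcont: "(hconst ev ->> hc p) (at_left (1 / p))"
 proof -
 have "pi * (1 / p) / 2 < pi / 2" "0 < pi * (1 / p) / 2" using p by (auto simp: field_simps)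
 then have "sin (pi * (1 / p) / 2) ~= 0" "cos (pi * (1 / p) / 2) ~= 0"
 using sin_gt_zero[of "pi * (1 / p) / 2"] cos_gt_zero[of "pi * (1 / p) / 2"] by auto
 then have "((%g. hconst ev g) ->> hconst ev (1 / p)) (at_left (1 / p))"
 proof (cases ev)
 case True
 have "((%g. tan (pi * g / 2)) ->> tan (pi * (1 / p) / 2)) (at_left (1 / p))"
 using \<open>cos (pi * (1 / p) / 2) \<noteq> 0\<close> by (intro tendsto_intros) auto
 then show ?thesis using True by (simp add: hconst_def)
 next
 case False
 have "((%g. cot (pi * g / 2)) ->> cot (pi * (1 / p) / 2)) (at_left (1 / p))"
 using \<open>sin (pi * (1 / p) / 2) \<noteq> 0\<close> by (intro tendsto_intros) auto
 then show ?thesis using False by (simp add: hconst_def)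
 qed
 then show ?thesis by (simp add: hc1)
 qed
 have "(R ->> hc p powr p * (1/2) powr (1 - (1 / p) * p) - p * c0 * hc p powr (p - 1) * (2 * p) * ((1 - (1 / p) * p) / 2)) (at_left (1 / p))"
 unfolding R_def using hcp by (intro tendsto_intros hcont) auto
 moreover have "hc p powr p * (1/2) powr (1 - (1 / p) * p) - p * c0 * hc p powr (p - 1) * (2 * p) * ((1 - (1 / p) * p) / 2) = hc p powr p"
 using p by simp
 ultimately have "(R ->> hc p powr p) (at_left (1 / p))" by simp
 moreover have "c powr p < hc p powr p" using c p by (intro powr_less_mono2) auto
 ultimately have "\<forall>\<^sub>F g in at_left (1 / p). c powr p < R g" by (rule order_tendstoD(1))
 moreover have "\<forall>\<^sub>F g in at_left (1 / p). g \<in> {1 / (2 * p)<..<1 / p}" using p by (intro eventually_at_left_real) (auto simp: field_simps)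
 ultimately have "\<forall>\<^sub>F g in at_left (1 / p). c powr p < R g & g \<in> {1 / (2 * p)<..<1 / p}" by eventually_elim auto
 then obtain g where g: "c powr p < R g" "1 / (2 * p) < g" "g < 1 / p"
 using eventually_happens'[OF trivial_limit_at_left_real] by fastforce
 have g0: "0 < g" using g(2) p by (auto intro: order.strict_trans[rotated])
 have g1: "g < 1" using g(3) p order.strict_trans[OF g(3), of 1] by simp
 have gp: "g * p < 1" using g(3) p by (simp add: field_simps)
 have h: "hadm (hfun ev g)" by (rule hfun_hadm[OF g0 g1])
 define T where "T = hconst ev g"
 have T: "0 < T"
 proof -
 have "0 < pi * g / 2" "pi * g / 2 < pi / 2" using g0 g1 by auto
 then show ?thesis unfolding T_def hconst_def by (auto intro: tan_gt_zero cot_gt_zero)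
 qed
 define f0 where "f0 s = (if \<bar>s\<bar> < 1 then hfun ev g s else 0)" for s
 have [measurable]: "bm f0" unfolding f0_def by measurable
 \<comment> \<open>The shift places the singularity at 1, so that \<open>f\<close> lives on the
   interval from 0 to 2 and the window |t - 1| < 1/2 lies in the half line.\<close>
 define f where "f t = complex_of_real (f0 (t - 1))" for t
 have fm [measurable]: "bm f" unfolding f_def by measurable
 have f0n: "pL p f0 = en (2 / (1 - g * p))"
 proof -
 have "pL p f0 = (NN x. en (\<bar>x\<bar> powr (- (g * p))) * indicator {-1<..<1} x)"
 unfolding pint_def
 by (intro nn_integral_cong) (use p in \<open>auto simp: f0_def hfun_abs powr_powr abs_less_iff split: split_indicator\<close>)
 also have "... = en (2 * 1 powr (1 - g * p) / (1 - g * p))" by (rule nn_integral_abs_powr) (use gp in auto)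
 finally show ?thesis by simp
 qed
 have fn: "pL p f = en (2 / (1 - g * p))"
 proof -
 have "pL p f = (NN t. (%s. en (norm (f0 s) powr p)) (t - 1))" unfolding pint_def f_def by simp
 also have "... = pL p f0" unfolding pint_def by (rule nn_integral_shift) measurable
 finally show ?thesis using f0n by simp
 qed
 have h0: "hadm f0" by (rule Lp_hadm[OF p]) (use f0n in auto)
 have tail: "\<bar>conv (Qk y) (hfun ev g) x - conv (Qk y) f0 x\<bar> <= c0" if y: "0 < y" and x: "\<bar>x\<bar> < 1 / 2" for x y
 proof -
 have "conv (Qk y) (hfun ev g) x - conv (Qk y) f0 x = (LI s. Qk y (x - s) *R hfun ev g s - Qk y (x - s) *R f0 s)"
 unfolding conv_def by (rule b_integral_diff[symmetric, OF hadm_Qk[OF h y] hadm_Qk[OF h0 y]])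
 also have "norm ... <= (LI s. 4 * (1 + \<bar>s\<bar>) powr (- q))"
 proof (rule b_integral_norm_bound_integral)
 show "intg (%s. Qk y (x - s) *R hfun ev g s - Qk y (x - s) *R f0 s)" using hadm_Qk[OF h y] hadm_Qk[OF h0 y] by auto
 show "intg (%s. 4 * (1 + \<bar>s\<bar>) powr (- q))"
 using nn_integral_one_plus_powr[OF q(1)] by (intro integrable_mult_right integrableI_nonneg) auto
 fix s
 show "norm (Qk y (x - s) *R hfun ev g s - Qk y (x - s) *R f0 s) <= 4 * (1 + \<bar>s\<bar>) powr (- q)"
 proof (cases "\<bar>s\<bar> < 1")
 case False
 then have s: "1 <= \<bar>s\<bar>" by simp
 define u where "u = x - s"
 have u: "\<bar>s\<bar> / 2 <= \<bar>u\<bar>" unfolding u_def using s x by linarith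
 have u0: "0 < \<bar>u\<bar>" using u s by linarith
 have "\<bar>Qk y u\<bar> = \<bar>u\<bar> / (pi * (u^2 + y^2))" using sq_pos[OF y, of u] by (simp add: Qk_def abs_mult)
 also have "... <= \<bar>u\<bar> / (pi * (u^2 + 0))" using u0 y by (intro divide_left_mono mult_left_mono mult_pos_pos) (auto simp: add_pos_pos)
 also have "... = 1 / (pi * \<bar>u\<bar>)" using u0 by (simp add: power2_eq_square abs_if)
 also have "... <= 1 / (2 * (\<bar>s\<bar> / 2))" using u s pi_ge_two by (intro frac_le mult_mono) auto
 finally have Q: "\<bar>Qk y u\<bar> <= \<bar>s\<bar> powr (- 1)" using s by (simp add: powr_minus_divide)
 have "norm (Qk y (x - s) *R hfun ev g s - Qk y (x - s) *R f0 s) = \<bar>Qk y u\<bar> * \<bar>s\<bar> powr (- g)"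
 using False s by (simp add: f0_def u_def abs_mult hfun_abs)
 also have "... <= \<bar>s\<bar> powr (- 1) * \<bar>s\<bar> powr (- (1 / (2 * p)))"
 using Q s g(2) by (intro mult_mono powr_mono) auto
 also have "... = \<bar>s\<bar> powr (- q)" unfolding q_def by (subst powr_add[symmetric]) simp
 also have "... <= 2 powr q * (1 + \<bar>s\<bar>) powr (- q)" using s q by (intro abs_powr_tail) auto
 also have "... <= 2 powr 2 * (1 + \<bar>s\<bar>) powr (- q)" using q by (intro mult_right_mono powr_mono) auto
 finally show ?thesis by simp
 qed (simp add: f0_def)
 qed
 also have "... = 4 * (LI s. (1 + \<bar>s\<bar>) powr (- q))" by simp
 also have "(LI s. (1 + \<bar>s\<bar>) powr (- q)) = enn2real (NN t. en ((1 + \<bar>t\<bar>) powr (- q)))"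
 by (rule integral_eq_nn_integral) auto
 finally show ?thesis by (simp add: c0_def)
 qed
 have conv_f: "conv (Qk y) f t = of_real (conv (Qk y) f0 (t - 1))" for y t
 proof -
 have "conv (Qk y) f t = (LI s. complex_of_real (Qk y (t - s) * f0 (s - 1)))"
 unfolding conv_def f_def by (simp add: scaleR_conv_of_real)
 also have "... = of_real (LI s. Qk y (t - s) * f0 (s - 1))" by (rule integral_complex_of_real)
 also have "(LI s. Qk y (t - s) * f0 (s - 1)) = \<bar>1\<bar> *R (LI s. Qk y (t - (1 + 1 * s)) * f0 ((1 + 1 * s) - 1))"
 by (rule lborel_integral_real_affine) simp
 also have "... = conv (Qk y) f0 (t - 1)" by (simp add: conv_def algebra_simps)
 finally show ?thesis .
 qed
 have low: "en (c powr p) * pL p f <= pL p (%t. indicator {0<..} t *R k t)" if k: "is_hilb p f k" for k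
 proof -
 have [measurable]: "bm k" using k by (simp add: is_hilb_def)
 define m where "m x = T * \<bar>x\<bar> powr (- g)" for x
 have kb: "AEL t. \<bar>t - 1\<bar> < 1 / 2 --> m (t - 1) - c0 <= norm (k t)"
 proof -
 have "AEL t. ((%y. conv (Qk y) f t) ->> k t) (at_right 0)" using k by (simp add: is_hilb_def)
 then show ?thesis using AE_lborel_singleton[of 1]
 proof eventually_elim
 case (elim t)
 show ?case
 proof
 assume t: "\<bar>t - 1\<bar> < 1 / 2"
 have "((%y. \<bar>conv (Qk y) (hfun ev g) (t - 1)\<bar> - c0) ->> T * \<bar>t - 1\<bar> powr (- g) - c0) (at_right 0)"
 unfolding T_def by (intro tendsto_diff tendsto_const Q_hfun_limit g0 g1) (use elim in auto)
 moreover have "((%y. norm (conv (Qk y) f t)) ->> norm (k t)) (at_right 0)" using elim by (intro tendsto_norm) auto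
 moreover have "\<forall>\<^sub>F y in at_right 0. \<bar>conv (Qk y) (hfun ev g) (t - 1)\<bar> - c0 <= norm (conv (Qk y) f t)"
 using eventually_at_right_less[of "0::real"]
 proof eventually_elim
 case (elim y)
 show ?case using tail[OF elim t] unfolding conv_f by simp
 qed
 ultimately show "m (t - 1) - c0 <= norm (k t)"
 unfolding m_def by (intro tendsto_le[OF trivial_limit_at_right_real])
 qed
 qed
 qed
 define A where "A = en (T powr p) * en (2 * (1/2) powr (1 - g * p) / (1 - g * p))"
 define X where "X = {-1/2<..<1/2::real}"
 have XI: "(NN x. en (\<bar>x\<bar> powr (- a)) * indicator X x) = en (2 * (1/2) powr (1 - a) / (1 - a))" if "a < 1" for a
 using nn_integral_abs_powr[OF that, of "1/2"] by (simp add: X_def)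
 have [measurable]: "X \<in> sets borel" by (simp add: X_def)
 have shiftX: "(NN t. u (t - 1)) = (NN x. u x)" if "bm u" for u :: "real => ennreal"
 by (rule nn_integral_shift[OF that])
 define D where "D = p * c0 * T powr (p - 1) * (2 * p)"
 have D0: "0 <= D" using p c0 by (simp add: D_def)
 have main: "en (T powr p * (2 * (1/2) powr (1 - g * p) / (1 - g * p))) <= pL p (%t. indicator {0<..} t *R k t) + en D"
 proof -
 have "en (T powr p * (2 * (1/2) powr (1 - g * p) / (1 - g * p))) = en (T powr p) * (NN x. en (\<bar>x\<bar> powr (- (g * p))) * indicator X x)"
 unfolding XI[OF gp] using gp by (intro ennreal_mult) auto
 also have "... = (NN x. en (T powr p) * (en (\<bar>x\<bar> powr (- (g * p))) * indicator X x))"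
 by (rule nn_integral_cmult[symmetric]) measurable
 also have "... = (NN x. en (m x powr p) * indicator X x)"
 using T by (intro nn_integral_cong) (simp add: m_def powr_mult powr_powr ennreal_mult mult.assoc)
 also have "... = (NN t. (%x. en (m x powr p) * indicator X x) (t - 1))"
 by (rule shiftX[symmetric]) (simp add: m_def)
 also have "... <= (NN t. en (norm (indicator {0<..} t *R k t) powr p) + (%x. en (p * c0 * m x powr (p - 1)) * indicator X x) (t - 1))"
 proof (rule nn_integral_mono_AE)
 show "AEL t. en (m (t - 1) powr p) * indicator X (t - 1) <=
 en (norm (indicator {0<..} t *R k t) powr p) + en (p * c0 * m (t - 1) powr (p - 1)) * indicator X (t - 1)"
 using kb
 proof eventually_elim
 case (elim t)
 show ?case
 proof (cases "t - 1 \<in> X")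
 case True
 then have "-1/2 < t - 1 & t - 1 < 1/2" by (simp only: X_def greaterThanLessThan_iff)
 then have t: "\<bar>t - 1\<bar> < 1 / 2" "0 < t" by linarith+
 have m0: "0 <= m (t - 1)" using T by (simp add: m_def)
 \<comment> \<open>The tangent inequality at \<open>m\<close> is used instead of a power of m - c0,
   which may be negative. The error it leaves is of order p - 1 in \<open>m\<close>, and its
   integral stays below \<open>D\<close> while the main term grows.\<close>
 have "p * norm (k t) * m (t - 1) powr (p - 1) <= norm (k t) powr p + (p - 1) * m (t - 1) powr p"
 by (rule powr_tangent[OF p _ m0]) simp
 moreover have "p * (m (t - 1) - c0) * m (t - 1) powr (p - 1) <= p * norm (k t) * m (t - 1) powr (p - 1)"
 using elim t p by (intro mult_right_mono mult_left_mono) auto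
 moreover have mm: "m (t - 1) * m (t - 1) powr (p - 1) = m (t - 1) powr p" using m0 by (cases "m (t - 1) = 0") (auto simp: powr_diff)
 moreover have "p * (m (t - 1) - c0) * m (t - 1) powr (p - 1) = p * m (t - 1) powr p - p * c0 * m (t - 1) powr (p - 1)"
 unfolding mm[symmetric] by (simp only: left_diff_distrib right_diff_distrib mult.assoc)
 moreover have "(p - 1) * m (t - 1) powr p = p * m (t - 1) powr p - m (t - 1) powr p" by (simp add: left_diff_distrib)
 ultimately have "m (t - 1) powr p <= norm (k t) powr p + p * c0 * m (t - 1) powr (p - 1)" by linarith
 then have "en (m (t - 1) powr p) <= en (norm (k t) powr p + p * c0 * m (t - 1) powr (p - 1))" by (rule ennreal_leI)
 also have "... = en (norm (k t) powr p) + en (p * c0 * m (t - 1) powr (p - 1))"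
 using p c0 by (intro ennreal_plus) auto
 finally show ?thesis using True t by simp
 qed simp
 qed
 qed
 also have "... = pL p (%t. indicator {0<..} t *R k t) + (NN t. (%x. en (p * c0 * m x powr (p - 1)) * indicator X x) (t - 1))"
 unfolding pint_def by (rule nn_integral_add) (auto simp: m_def)
 also have "(NN t. (%x. en (p * c0 * m x powr (p - 1)) * indicator X x) (t - 1)) = (NN x. en (p * c0 * m x powr (p - 1)) * indicator X x)"
 by (rule shiftX) (simp add: m_def)
 also have "... = (NN x. en (p * c0 * T powr (p - 1)) * (en (\<bar>x\<bar> powr (- (g * (p - 1)))) * indicator X x))"
 using T p c0 by (intro nn_integral_cong) (simp add: m_def powr_mult powr_powr ennreal_mult[symmetric] mult.assoc split: split_indicator)
 also have "... = en (p * c0 * T powr (p - 1)) * (NN x. en (\<bar>x\<bar> powr (- (g * (p - 1)))) * indicator X x)"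
 by (rule nn_integral_cmult) measurable
 also have "... <= en (p * c0 * T powr (p - 1)) * en (2 * p)"
 proof (rule mult_left_mono)
 have a: "g * (p - 1) <= 1 - 1 / p"
 proof -
 have "g * (p - 1) <= (1 / p) * (p - 1)" using g(3) p by (intro mult_right_mono) auto
 then show ?thesis using p by (simp add: field_simps)
 qed
 then have a1: "g * (p - 1) < 1" using p by (auto intro: le_less_trans)
 have "(1/2) powr (1 - g * (p - 1)) <= 1" using a1 by (intro powr_le1) auto
 then have "2 * (1/2) powr (1 - g * (p - 1)) / (1 - g * (p - 1)) <= 2 * 1 / (1 / p)"
 using a p by (intro frac_le mult_left_mono) auto
 then show "(NN x. en (\<bar>x\<bar> powr (- (g * (p - 1)))) * indicator X x) <= en (2 * p)"
 unfolding XI[OF a1] using p by (intro ennreal_leI) simp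
 qed simp
 also have "... = en D" unfolding D_def using p c0 by (intro ennreal_mult[symmetric]) auto
 finally show ?thesis by (simp add: add_left_mono)
 qed
 have "c powr p * (2 / (1 - g * p)) + D <= T powr p * (2 * (1/2) powr (1 - g * p) / (1 - g * p))"
 proof -
 have "c powr p * (2 / (1 - g * p)) <= R g * (2 / (1 - g * p))" using g(1) gp by (intro mult_right_mono) auto
 also have "... = T powr p * (2 * (1/2) powr (1 - g * p) / (1 - g * p)) - D * (((1 - g * p) / 2) * (2 / (1 - g * p)))"
 proof -
 have R: "R g = T powr p * (1/2) powr (1 - g * p) - D * ((1 - g * p) / 2)" unfolding R_def D_def T_def by (simp only: mult.assoc)
 have "(a * b - d * z) * (2 / w) = a * (2 * b / w) - d * (z * (2 / w))" for a b d z w :: real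
 by (simp add: left_diff_distrib diff_divide_distrib mult_ac)
 then show ?thesis unfolding R .
 qed
 also have "((1 - g * p) / 2) * (2 / (1 - g * p)) = 1" using gp by simp
 finally show ?thesis by simp
 qed
 then have "en (c powr p * (2 / (1 - g * p)) + D) <= pL p (%t. indicator {0<..} t *R k t) + en D"
 using main by (meson ennreal_leI order_trans)
 moreover have "en (c powr p * (2 / (1 - g * p)) + D) = en (c powr p) * pL p f + en D"
 unfolding fn using gp D0 by (simp add: ennreal_plus ennreal_mult[symmetric])
 ultimately have "en D + en (c powr p) * pL p f <= en D + pL p (%t. indicator {0<..} t *R k t)"
 by (simp add: add.commute)
 then show ?thesis by (simp add: ennreal_add_left_cancel_le)
 qed
 have "f t = 0" if "t <= 0" for t using that by (simp add: f_def f0_def)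
 moreover have "0 < pL p f" "pL p f < \<infinity>" unfolding fn using gp by auto
 ultimately show ?thesis using low by (intro exI[of _ f]) auto
qed

section \<open>Weyl fractional integrals of rapidly decreasing functions\<close>

text \<open>The kernel of the Weyl integral of order \<open>a\<close>; extended by 0 to u <= 0,
  these kernels form a convolution semigroup on the line.\<close>

definition wker :: "real => real => real"
 where "wker a u = (if 0 < u then u powr (a - 1) / Gamma a else 0)"

text \<open>Clamping the argument at \<open>0\<close> lets functions on the closed half line be treated as functions on \<open>\<real>\<close>.\<close>

definition weylW :: "real => (real => complex) => real => complex"
 where "weylW a g t = (LI u. wker a u *R g (max t 0 + u))"

text \<open>Continuity and decay only: this class is preserved by \<open>weylW\<close>, and the
  derivatives of a Schwartz function enter one at a time as members of it. For t <= 0 the decay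
  condition reduces to boundedness.\<close>

definition rapid :: "(real => complex) => bool"
 where "rapid g \<longleftrightarrow> continuous_on UNIV g & (ALL m::nat. EX C. ALL t. norm (g t) <= C / (1 + max t 0) ^ m)"

lemma wker_measurable [measurable]: "bm (wker a)"
 unfolding wker_def[abs_def] by measurable

lemma wker_nonneg: "0 < a ==> 0 <= wker a u"
 by (simp add: wker_def less_imp_le Gamma_real_pos)

lemma rapid_measurable: "rapid g ==> g \<in> borel_measurable borel"
 unfolding rapid_def by (auto intro: borel_measurable_continuous_onI)

lemma rapid_bound: "rapid g ==> EX C>=0. ALL t. norm (g t) <= C / (1 + max t 0) ^ m"
proof -
 assume "rapid g"
 then obtain C where C: "!!t. norm (g t) <= C / (1 + max t 0) ^ m" unfolding rapid_def by blast
 have "0 <= C" using order_trans[OF norm_ge_zero C[of 0]] by simp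
 with C show ?thesis by blast
qed

lemma integrable_abs_powr:
 fixes a b :: real
 assumes "a < 1" "0 < b"
 shows "intg (%x. \<bar>x\<bar> powr (- a) * indicator {-b<..<b} x)"
proof (rule integrableI_nonneg)
 have "(NN x. en (\<bar>x\<bar> powr (- a) * indicator {-b<..<b} x)) = (NN x. en (\<bar>x\<bar> powr (- a)) * indicator {-b<..<b} x)"
 by (intro nn_integral_cong) (simp split: split_indicator)
 then show "(NN x. en (\<bar>x\<bar> powr (- a) * indicator {-b<..<b} x)) < \<infinity>"
 using nn_integral_abs_powr[OF assms] by simp
qed auto

lemma integrable_one_plus_powr: "1 < q ==> intg (%t::real. (1 + \<bar>t\<bar>) powr (- q))"
 using nn_integral_one_plus_powr by (intro integrableI_nonneg) auto

lemma wker_decay: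
 assumes a: "0 < a"
 shows "EX k::nat. intg (%u. wker a u / (1 + max u 0) ^ k)"
proof -
 obtain k :: nat where k: "a + 2 <= real k" using real_arch_simple by blast
 have G: "0 < Gamma a" using a by (rule Gamma_real_pos)
 have "intg (%u::real. (1 / Gamma a) * (\<bar>u\<bar> powr (- (1 - a)) * indicator {-1<..<1} u + (1 + \<bar>u\<bar>) powr (- 2)))"
 using integrable_abs_powr[of "1 - a" 1] integrable_one_plus_powr[of 2] a by (intro integrable_mult_right b_integrable_add) auto
 then have "intg (%u. wker a u / (1 + max u 0) ^ k)"
 proof (rule b_integrable_bound)
 show "AEL u. norm (wker a u / (1 + max u 0) ^ k) <= norm ((1 / Gamma a) * (\<bar>u\<bar> powr (- (1 - a)) * indicator {-1<..<1} u + (1 + \<bar>u\<bar>) powr (- 2)))"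
 proof (rule AE_I2)
 fix u :: real
 have "u powr (a - 1) / (1 + u) ^ k <= u powr (a - 1) * indicator {-1<..<1} u + (1 + u) powr (- 2)" if u: "0 < u"
 proof (cases "u < 1")
 case True
 have "u powr (a - 1) / (1 + u) ^ k <= u powr (a - 1) / 1" using u by (intro divide_left_mono one_le_power) auto
 then show ?thesis using True u by (auto intro: order_trans)
 next
 case False
 have "u powr (a - 1) <= u powr a" using False by (intro powr_mono) auto
 also have "... <= (1 + u) powr a" using u a by (intro powr_mono2) auto
 finally have "u powr (a - 1) / (1 + u) ^ k <= (1 + u) powr a / (1 + u) powr (real k)" using u by (simp add: powr_realpow divide_right_mono)
 also have "... = (1 + u) powr (a - real k)" by (simp add: powr_diff)
 also have "... <= (1 + u) powr (- 2)" using u k by (intro powr_mono) auto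
 finally show ?thesis by (auto intro: order_trans)
 qed
 then have "0 < u ==> u powr (a - 1) / (1 + u) ^ k / Gamma a <= (u powr (a - 1) * indicator {-1<..<1} u + (1 + u) powr (- 2)) / Gamma a"
 using G by (intro divide_right_mono) auto
 moreover have "0 <= (\<bar>u\<bar> powr (- (1 - a)) * indicator {-1<..<1} u + (1 + \<bar>u\<bar>) powr (- 2))" by simp
 ultimately show "norm (wker a u / (1 + max u 0) ^ k) <= norm ((1 / Gamma a) * (\<bar>u\<bar> powr (- (1 - a)) * indicator {-1<..<1} u + (1 + \<bar>u\<bar>) powr (- 2)))"
 using G by (cases "0 < u") (simp_all add: wker_def abs_mult mult.commute)
 qed
 qed measurable
 then show ?thesis by blast
qed

text \<open>Decay of order m + k is split by (1 + T) ^ m * (1 + u) ^ k <= (1 + T + u) ^ (m + k) with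
  T = max t 0. The part in \<open>u\<close> makes the kernel integrable, the part in T survives as
  decay of the Weyl integral.\<close>

lemma wker_dominate:
 assumes a: "0 < a" and g: "rapid g"
 shows "EX k::nat. EX C>=0. intg (%u. wker a u / (1 + max u 0) ^ k) &
 (ALL t u. norm (wker a u *R g (max t 0 + u)) <= C / (1 + max t 0) ^ m * (wker a u / (1 + max u 0) ^ k))"
proof -
 obtain k :: nat where k: "intg (%u. wker a u / (1 + max u 0) ^ k)" using wker_decay[OF a] by blast
 obtain C where C: "0 <= C" "!!t. norm (g t) <= C / (1 + max t 0) ^ (m + k)" using rapid_bound[OF g] by blast
 have "norm (wker a u *R g (max t 0 + u)) <= C / (1 + max t 0) ^ m * (wker a u / (1 + max u 0) ^ k)" for t u
 proof (cases "0 < u")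
 case True
 have "norm (g (max t 0 + u)) <= C / (1 + (max t 0 + u)) ^ (m + k)" using C(2)[of "max t 0 + u"] True by simp
 also have "... <= C / ((1 + max t 0) ^ m * (1 + u) ^ k)"
 proof (rule divide_left_mono)
 show "(1 + max t 0) ^ m * (1 + u) ^ k <= (1 + (max t 0 + u)) ^ (m + k)"
 unfolding power_add using True by (intro mult_mono power_mono) auto
 qed (use C True in \<open>auto intro!: mult_pos_pos zero_less_power add_pos_nonneg\<close>)
 finally have "wker a u * norm (g (max t 0 + u)) <= wker a u * (C / ((1 + max t 0) ^ m * (1 + u) ^ k))"
 by (intro mult_left_mono wker_nonneg a)
 then show ?thesis using True wker_nonneg[OF a, of u] by (simp add: mult_ac)
 qed (simp add: wker_def)
 then show ?thesis using k C(1) by blast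
qed

lemma weylW_integrable:
 assumes a: "0 < a" and g: "rapid g"
 shows "intg (%u. wker a u *R g (max t 0 + u))"
proof -
 note [measurable] = rapid_measurable[OF g]
 obtain k :: nat and C where k: "0 <= C" "intg (%u. wker a u / (1 + max u 0) ^ k)"
 "!!t u. norm (wker a u *R g (max t 0 + u)) <= C / (1 + max t 0) ^ 0 * (wker a u / (1 + max u 0) ^ k)"
 using wker_dominate[OF a g, of 0] by blast
 have n: "0 <= wker a u / (1 + max u 0) ^ k" for u using wker_nonneg[OF a, of u] by simp
 show ?thesis
 by (rule b_integrable_bound[OF integrable_mult_right[OF k(2), of C]])
 (use k(3)[of _ t] k(1) wker_nonneg[OF a] in \<open>auto simp: abs_mult\<close>)
qed

lemma rapid_weylW:
 assumes a: "0 < a" and g: "rapid g"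
 shows "rapid (weylW a g)"
 unfolding rapid_def
proof (intro conjI allI)
 note [measurable] = rapid_measurable[OF g]
 have gc: "isCont g x" for x using g unfolding rapid_def by (simp add: continuous_on_eq_continuous_at)
 show "continuous_on UNIV (weylW a g)"
 proof (rule continuous_at_imp_continuous_on, rule ballI, rule continuous_at_sequentiallyI)
 fix x :: real and X :: "nat => real"
 assume X: "X -->> x"
 obtain k :: nat and C where k: "0 <= C" "intg (%u. wker a u / (1 + max u 0) ^ k)"
 "!!t u. norm (wker a u *R g (max t 0 + u)) <= C / (1 + max t 0) ^ 0 * (wker a u / (1 + max u 0) ^ k)"
 using wker_dominate[OF a g, of 0] by blast
 show "(%n. weylW a g (X n)) -->> weylW a g x"
 unfolding weylW_def
 proof (rule integral_dominated_convergence)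
 show "intg (%u. C * (wker a u / (1 + max u 0) ^ k))" using k(2) by (rule integrable_mult_right)
 show "AEL u. (%n. wker a u *R g (max (X n) 0 + u)) -->> wker a u *R g (max x 0 + u)"
 by (intro AE_I2 tendsto_scaleR tendsto_const isCont_tendsto_compose[OF gc] tendsto_add tendsto_max X)
 show "AEL u. norm (wker a u *R g (max (X n) 0 + u)) <= C * (wker a u / (1 + max u 0) ^ k)" for n
 using k(3)[of _ "X n"] by (intro AE_I2) simp
 qed measurable
 qed
 fix m :: nat
 obtain k :: nat and C where k: "0 <= C" "intg (%u. wker a u / (1 + max u 0) ^ k)"
 "!!t u. norm (wker a u *R g (max t 0 + u)) <= C / (1 + max t 0) ^ m * (wker a u / (1 + max u 0) ^ k)"
 using wker_dominate[OF a g, of m] by blast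
 have "norm (weylW a g t) <= C * (LI u. wker a u / (1 + max u 0) ^ k) / (1 + max t 0) ^ m" for t
 proof -
 have "norm (weylW a g t) <= (LI u. C / (1 + max t 0) ^ m * (wker a u / (1 + max u 0) ^ k))"
 unfolding weylW_def
 by (rule b_integral_norm_bound_integral[OF weylW_integrable[OF a g] integrable_mult_right[OF k(2)]]) (rule k(3))
 then show ?thesis unfolding integral_mult_right_zero by simp
 qed
 then show "EX C. ALL t. norm (weylW a g t) <= C / (1 + max t 0) ^ m" by blast
qed

text \<open>The substitution v = u x turns the convolution into the Beta integral, and Beta a b =
  Gamma a * Gamma b / Gamma (a + b).\<close>

lemma wker_convolve_nn:
 assumes a: "0 < a" and b: "0 < b"
 shows "(NN v. en (wker a v * wker b (u - v))) = en (wker (a + b) u)"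
proof (cases "0 < u")
 case False
 then have "(%v. en (wker a v * wker b (u - v))) = (%v. 0)" by (intro ext) (auto simp: wker_def)
 then show ?thesis using False by (simp add: wker_def)
next
 case u: True
 have G: "0 < Gamma a" "0 < Gamma b" "0 < Gamma (a + b)" using a b by (auto intro: Gamma_real_pos)
 have 1: "en (wker a (0 + u * x) * wker b (u - (0 + u * x))) =
 en (u powr (a + b - 2) / (Gamma a * Gamma b)) * (en (x powr (a - 1) * (1 - x) powr (b - 1)) * indicator {0..1} x)" for x
 proof (cases "0 < x & x < 1")
 case True
 have e: "u - u * x = u * (1 - x)" by (simp add: algebra_simps)
 have p: "u powr (a + b - 2) = u powr (a - 1) * u powr (b - 1)" by (simp flip: powr_add)
 show ?thesis using True u G unfolding p by (simp add: wker_def e powr_mult flip: ennreal_mult)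
 next
 case False
 have "x * u < 0 \<or> x = 0 \<or> x = 1 \<or> u * 1 < u * x" using False u by (auto simp: mult_less_0_iff)
 then show ?thesis using False u by (auto simp: wker_def mult.commute zero_less_mult_iff split: split_indicator)
 qed
 have "(NN v. en (wker a v * wker b (u - v))) = en \<bar>u\<bar> * (NN x. en (wker a (0 + u * x) * wker b (u - (0 + u * x))))"
 by (rule nn_integral_real_affine) (use u in auto)
 also have "... = en u * (en (u powr (a + b - 2) / (Gamma a * Gamma b)) * en (Beta a b))"
 unfolding 1 using u nn_integral_has_integral_lebesgue'[OF _ has_integral_Beta_real[OF a b]] by (subst nn_integral_cmult) auto
 also have "... = en (u * (u powr (a + b - 2) / (Gamma a * Gamma b) * Beta a b))"
 using u G by (subst ennreal_mult[symmetric], simp, simp add: Beta_def, subst ennreal_mult[symmetric]) (auto simp: Beta_def)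
 also have "u * (u powr (a + b - 2) / (Gamma a * Gamma b) * Beta a b) = (u powr 1 * u powr (a + b - 2)) / Gamma (a + b)"
 using u G by (simp add: Beta_def)
 also have "u powr 1 * u powr (a + b - 2) = u powr (a + b - 1)" by (subst powr_add[symmetric]) (rule arg_cong2[where f="(powr)"], simp_all)
 finally show ?thesis using u by (simp add: wker_def)
qed

lemma wker_convolve:
 assumes a: "0 < a" and b: "0 < b"
 shows "intg (%v. wker a v * wker b (u - v))" "(LI v. wker a v * wker b (u - v)) = wker (a + b) u"
proof -
 show "intg (%v. wker a v * wker b (u - v))"
 by (rule integrableI_nonneg) (use wker_convolve_nn[OF a b, of u] wker_nonneg a b in auto)
 have "(LI v. wker a v * wker b (u - v)) = enn2real (NN v. en (wker a v * wker b (u - v)))"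
 by (rule integral_eq_nn_integral) (use wker_nonneg a b in auto)
 then show "(LI v. wker a v * wker b (u - v)) = wker (a + b) u"
 unfolding wker_convolve_nn[OF a b] using wker_nonneg[of "a + b" u] a b by simp
qed

lemma weylW_weylW:
 assumes a: "0 < a" and b: "0 < b" and g: "rapid g"
 shows "weylW a (weylW b g) t = weylW (a + b) g t"
proof -
 note [measurable] = rapid_measurable[OF g]
 define T where "T = max t 0"
 have T: "0 <= T" by (simp add: T_def)
 have ab: "0 < a + b" using a b by simp
 define K where "K u v = (wker a u * wker b (v - u)) *R g (T + v)" for u v
 have [measurable]: "case_prod K \<in> borel_measurable (lborel \<Otimes>\<^sub>M lborel)" unfolding K_def[abs_def] by measurable
 have 1: "wker a u *R weylW b g (T + u) = (LI v. K u v)" for u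
 proof (cases "0 < u")
 case True
 have "weylW b g (T + u) = (LI v. wker b (v - u) *R g (T + v))"
 unfolding weylW_def using T True lborel_integral_real_affine[of 1 "%v. wker b v *R g (T + u + v)" "- u"] by (simp add: algebra_simps)
 then show ?thesis by (simp add: K_def flip: integral_scaleR_right)
 qed (simp add: K_def wker_def)
 have 2: "(LI u. K u v) = wker (a + b) v *R g (T + v)" for v
 unfolding K_def using wker_convolve[OF a b, of v] by simp
 have "(NN u. (NN v. en (norm (K u v)))) = (NN v. (NN u. en (norm (K u v))))"
 by (rule tonelli_lborel[symmetric]) measurable
 also have "... = (NN v. en (norm (wker (a + b) v *R g (T + v))))"
 proof (intro nn_integral_cong)
 fix v
 have "(NN u. en (norm (K u v))) = (NN u. en (wker a u * wker b (v - u)) * en (norm (g (T + v))))"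
 unfolding K_def using wker_nonneg a b by (intro nn_integral_cong) (simp add: abs_mult flip: ennreal_mult)
 also have "... = en (wker (a + b) v) * en (norm (g (T + v)))"
 by (subst nn_integral_multc) (auto simp: wker_convolve_nn[OF a b])
 also have "... = en (norm (wker (a + b) v *R g (T + v)))"
 using wker_nonneg[OF ab, of v] by (simp flip: ennreal_mult)
 finally show "(NN u. en (norm (K u v))) = en (norm (wker (a + b) v *R g (T + v)))" .
 qed
 also have "... < \<infinity>" using weylW_integrable[OF ab g, of t] unfolding T_def integrable_iff_bounded by simp
 finally have fin: "(NN u. (NN v. en (norm (K u v)))) < \<infinity>" .
 have "weylW a (weylW b g) t = (LI u. LI v. K u v)"
 unfolding weylW_def[of a] T_def[symmetric] 1 ..
 also have "... = (LI v. LI u. K u v)" by (rule fubini_lborel(1)[symmetric, OF _ fin]) measurable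
 finally show ?thesis unfolding 2 weylW_def[of "a + b"] T_def[symmetric] .
qed

lemma weylW_cmult: "weylW a (%t. c * g t) t = c * weylW a g t"
 unfolding weylW_def by (simp flip: integral_mult_right_zero)

lemma weylW_cong: "(!!t. 0 <= t ==> f t = g t) ==> weylW a f t = weylW a g t"
 unfolding weylW_def by (intro b_integral_cong) (auto simp: wker_def)

lemma rapid_cmult:
 assumes g: "rapid g"
 shows "rapid (%t. c * g t)"
 unfolding rapid_def
proof (intro conjI allI)
 show "continuous_on UNIV (%t. c * g t)" using g unfolding rapid_def by (intro continuous_intros) auto
 fix m :: nat
 obtain C where C: "!!t. norm (g t) <= C / (1 + max t 0) ^ m" using g unfolding rapid_def by blast
 have "norm (c * g t) <= norm c * C / (1 + max t 0) ^ m" for t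
 using mult_left_mono[OF C[of t] norm_ge_zero[of c]] by (simp add: norm_mult)
 then show "EX C. ALL t. norm (c * g t) <= C / (1 + max t 0) ^ m" by blast
qed

lemma weylW_one_eq:
 assumes g: "rapid g" and t: "0 <= t"
 shows "weylW 1 g t = weylW 1 g 0 - integral {0..t} g"
proof -
 note [measurable] = rapid_measurable[OF g]
 have e: "weylW 1 g s = (LI u. indicator {s<..} u *R g u)" "intg (%u. indicator {s<..} u *R g u)" if s: "0 <= s" for s
 proof -
 have i: "wker 1 u *R g (max s 0 + u) = indicator {s<..} (s + u) *R g (s + u)" for u
 using s by (auto simp: wker_def split: split_indicator)
 show "weylW 1 g s = (LI u. indicator {s<..} u *R g u)"
 unfolding weylW_def i using lborel_integral_real_affine[of 1 "%u. indicator {s<..} u *R g u" s] by simp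
 show "intg (%u. indicator {s<..} u *R g u)"
 using weylW_integrable[OF zero_less_one g, of s] unfolding i
 using lborel_integrable_real_affine_iff[of 1 "%u. indicator {s<..} u *R g u" s] by simp
 qed
 have gc: "continuous_on {0..t} g" using g unfolding rapid_def by (auto intro: continuous_on_subset)
 have "weylW 1 g 0 - weylW 1 g t = (LI u. indicator {0<..} u *R g u - indicator {t<..} u *R g u)"
 using e[of 0] e[of t] t by simp
 also have "... = (LINT u:{0..t}|lborel. g u)"
 unfolding set_lebesgue_integral_def
 proof (rule integral_cong_AE)
 show "AEL u. indicator {0<..} u *R g u - indicator {t<..} u *R g u = indicator {0..t} u *R g u"
 using AE_lborel_singleton[of 0] by eventually_elim (use t in \<open>auto split: split_indicator\<close>)
 qed measurable
 also have "... = integral {0..t} g"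
 by (rule set_borel_integral_eq_integral(2)) (use gc in \<open>auto intro: borel_integrable_atLeastAtMost' \<close>)
 finally show ?thesis unfolding eq_diff_eq diff_eq_eq by (simp only: add.commute)
qed

lemma at_within_Ici_Icc: "(t::real) < b ==> at t within {a..} = at t within {a..b}"
 by (rule at_within_nhd[of _ "{..<b}"]) auto

lemma weylW_one_deriv:
 assumes g: "rapid g" and t: "0 <= t"
 shows "(weylW 1 g has_vector_derivative - g t) (at t within {0..})"
proof -
 have gc: "continuous_on {0..t+1} g" using g unfolding rapid_def by (auto intro: continuous_on_subset)
 have "((%u. weylW 1 g 0 - integral {0..u} g) has_vector_derivative 0 - g t) (at t within {0..t+1})"
 using t by (intro has_vector_derivative_diff has_vector_derivative_const integral_has_vector_derivative gc) auto
 then have "((%u. weylW 1 g 0 - integral {0..u} g) has_vector_derivative - g t) (at t within {0..})"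
 using at_within_Ici_Icc[of t "t+1" 0] by simp
 then show ?thesis
 by (rule has_vector_derivative_transform[rotated 2], use t in simp, intro weylW_one_eq[OF g], simp)
qed

text \<open>By \<open>weylW_one_deriv\<close> the sum of weylW 1 G' and G has derivative 0 and is
  constant; both summands decay, so the constant is 0.\<close>

lemma weylW_one_of_deriv:
 assumes G: "rapid G" and G': "rapid G'" and d: "!!t. 0 <= t ==> (G has_vector_derivative G' t) (at t within {0..})" and t: "0 <= t"
 shows "weylW 1 G' t = - G t"
proof -
 have "((%x. weylW 1 G' x + G x) has_vector_derivative 0) (at x within {0..})" if "x \<in> {0..}" for x
 using has_vector_derivative_add[OF weylW_one_deriv[OF G', of x] d[of x]] that by simp
 then obtain c where "!!x. x \<in> {0..} ==> weylW 1 G' x + G x = c"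
 using has_vector_derivative_zero_constant[of "{0..}" "%x. weylW 1 G' x + G x"] by blast
 then have c: "weylW 1 G' x + G x = c" if "0 <= x" for x using that by simp
 obtain A where A: "0 <= A" "!!t. norm (weylW 1 G' t) <= A / (1 + max t 0) ^ 1" using rapid_bound[OF rapid_weylW[OF zero_less_one G']] by blast
 obtain B where B: "0 <= B" "!!t. norm (G t) <= B / (1 + max t 0) ^ 1" using rapid_bound[OF G] by blast
 have le: "norm c <= (A + B) / (1 + x)" if x: "0 <= x" for x
 proof -
 have "norm c <= norm (weylW 1 G' x) + norm (G x)" using norm_triangle_ineq[of "weylW 1 G' x" "G x"] by (simp add: c[OF x])
 also have "... <= A / (1 + x) + B / (1 + x)" using A(2)[of x] B(2)[of x] x by (intro add_mono) auto
 finally show ?thesis by (simp add: add_divide_distrib)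
 qed
 have "((%x. (A + B) / (1 + x)) ->> 0) at_top" by real_asymp
 then have "norm c <= 0"
 by (rule tendsto_lowerbound) (auto intro!: eventually_at_top_linorderI[of 0] le)
 then show ?thesis using c[OF t] by (simp add: eq_neg_iff_add_eq_0)
qed

lemma weylW_diff:
 assumes "0 < a" "rapid f" "rapid g"
 shows "weylW a (%t. f t - g t) t = weylW a f t - weylW a g t"
 unfolding weylW_def using weylW_integrable[OF assms(1,2), of t] weylW_integrable[OF assms(1,3), of t] by (simp add: scaleR_diff_right)

lemma weylW_sum:
 assumes "0 < a" "!!j. rapid (g j)"
 shows "weylW a (%t. \<Sum>j<N. g j t) t = (\<Sum>j<(N::nat). weylW a (g j) t)"
 unfolding weylW_def using weylW_integrable[OF assms, of _ t] by (simp add: scaleR_sum_right)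

lemma rapid_add:
 assumes f: "rapid f" and g: "rapid g"
 shows "rapid (%t. f t + g t)"
 unfolding rapid_def
proof (intro conjI allI)
 show "continuous_on UNIV (%t. f t + g t)" using f g unfolding rapid_def by (intro continuous_intros) auto
 fix m :: nat
 obtain C where C: "!!t. norm (f t) <= C / (1 + max t 0) ^ m" using f unfolding rapid_def by blast
 obtain D where D: "!!t. norm (g t) <= D / (1 + max t 0) ^ m" using g unfolding rapid_def by blast
 have "norm (f t + g t) <= (C + D) / (1 + max t 0) ^ m" for t
 using norm_triangle_mono[OF C[of t] D[of t]] by (simp add: add_divide_distrib)
 then show "EX C. ALL t. norm (f t + g t) <= C / (1 + max t 0) ^ m" by blast
qed

lemma rapid_zero: "rapid (%t. 0)"
 unfolding rapid_def by (auto intro!: exI[of _ 0])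

lemma rapid_sum: "(!!j. rapid (g j)) ==> rapid (%t. \<Sum>j<(N::nat). g j t)"
 by (induction N) (auto intro: rapid_zero rapid_add)

lemma rapid_diff: "rapid f ==> rapid g ==> rapid (%t. f t - g t)"
 using rapid_add[of f "%t. -1 * g t"] rapid_cmult[of g "-1"] by simp

lemma rapid_exp:
 assumes k: "1 <= k"
 shows "rapid (%t. complex_of_real (exp (- k * max t 0)))"
 unfolding rapid_def
proof (intro conjI allI)
 show "continuous_on UNIV (%t. complex_of_real (exp (- k * max t 0)))" by (intro continuous_intros)
 fix m :: nat
 have "norm (complex_of_real (exp (- k * max t 0))) <= real m ^ m / (1 + max t 0) ^ m" for t
 proof -
 define s where "s = max t 0"
 have s: "0 <= s" by (simp add: s_def)
 have "(1 + s) ^ m <= real m ^ m * exp s"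
 proof (cases "m = 0")
 case False
 have "1 + s <= real m * (1 + s / real m)" using False s by (simp add: distrib_left)
 also have "... <= real m * exp (s / real m)" by (intro mult_left_mono exp_ge_add_one_self) auto
 finally have "(1 + s) ^ m <= (real m * exp (s / real m)) ^ m" using s by (intro power_mono) auto
 also have "... = real m ^ m * exp (real m * (s / real m))" by (simp only: power_mult_distrib exp_of_nat_mult)
 finally show ?thesis using False by simp
 qed (use s in simp)
 moreover have "exp (- (k * s)) <= exp (- s)" using mult_right_mono[OF k s] by simp
 then have "(1 + s) ^ m * exp (- (k * s)) <= (1 + s) ^ m * exp (- s)" using s by (intro mult_left_mono) auto
 moreover have "(1 + s) ^ m * exp (- s) <= (real m ^ m * exp s) * exp (- s)" using calculation(1) by (rule mult_right_mono) simp
 moreover have "exp s * exp (- s) = 1" by (simp flip: exp_add)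
 then have "(real m ^ m * exp s) * exp (- s) = real m ^ m" by (simp only: mult.assoc mult_1_right)
 ultimately have "(1 + s) ^ m * exp (- (k * s)) <= real m ^ m" by linarith
 then have "exp (- (k * s)) * (1 + s) ^ m <= real m ^ m" by (simp only: mult.commute)
 then show ?thesis unfolding s_def[symmetric] using s by (simp add: pos_le_divide_eq)
 qed
 then show "EX C. ALL t. norm (complex_of_real (exp (- k * max t 0))) <= C / (1 + max t 0) ^ m" by blast
qed

lemma wker_exp:
 assumes a: "0 < a" and k: "0 < k"
 shows "(LI u. wker a u * exp (- k * u)) = k powr (- a)"
proof -
 have G: "0 < Gamma a" using a by (rule Gamma_real_pos)
 define f where "f x = en (x powr (a - 1) / exp x) * indicator {0..} x" for x :: real
 have [measurable]: "bm f" unfolding f_def by measurable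
 have "en (Gamma a) = (NN x. f x)"
 unfolding f_def by (rule nn_integral_has_integral_lebesgue'[OF _ Gamma_integral_real[OF a], symmetric]) simp
 also have "... = en \<bar>k\<bar> * (NN u. f (0 + k * u))" by (rule nn_integral_real_affine) (use k in auto)
 also have "(NN u. f (0 + k * u)) = (NN u. en (k powr (a - 1) * Gamma a) * en (wker a u * exp (- k * u)))"
 proof (intro nn_integral_cong)
 fix u :: real
 show "f (0 + k * u) = en (k powr (a - 1) * Gamma a) * en (wker a u * exp (- k * u))"
 proof (cases "0 < u")
 case True
 then show ?thesis using k G by (simp add: f_def wker_def powr_mult exp_minus field_simps flip: ennreal_mult)
 next
 case False
 then have "k * u <= 0" using k by (simp add: mult_le_0_iff)
 then show ?thesis using False by (auto simp: f_def wker_def split: split_indicator)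
 qed
 qed
 also have "... = en (k powr (a - 1) * Gamma a) * (NN u. en (wker a u * exp (- k * u)))"
 by (rule nn_integral_cmult) measurable
 finally have e: "en (Gamma a) = en (k * (k powr (a - 1) * Gamma a)) * (NN u. en (wker a u * exp (- k * u)))"
 using k G by (simp add: ennreal_mult mult.assoc)
 have ka: "k * k powr (a - 1) = k powr a" using k powr_add[of k 1 "a - 1"] by simp
 have I: "(LI u. wker a u * exp (- k * u)) = enn2real (NN u. en (wker a u * exp (- k * u)))"
 by (rule integral_eq_nn_integral) (use wker_nonneg[OF a] in auto)
 have "Gamma a = enn2real (en (k * (k powr (a - 1) * Gamma a)) * (NN u. en (wker a u * exp (- k * u))))"
 unfolding e[symmetric] using G by simp
 also have "... = k powr a * Gamma a * (LI u. wker a u * exp (- k * u))"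
 unfolding enn2real_mult I using k G by (simp flip: ka)
 finally show ?thesis using G k by (simp add: powr_minus field_simps)
qed

text \<open>Exponentials are eigenfunctions of every Weyl integral; the eigenvalue is the Laplace
  transform of the kernel. This is why exponential sums serve as the dense class: their fractional
  derivatives are explicit.\<close>

lemma weylW_exp:
 assumes a: "0 < a" and k: "0 < k" and t: "0 <= t"
 shows "weylW a (%s. complex_of_real (exp (- k * max s 0))) t = of_real (k powr (- a) * exp (- k * t))"
proof -
 have e: "wker a u *R complex_of_real (exp (- k * max (max t 0 + u) 0)) = complex_of_real (exp (- k * t) * (wker a u * exp (- k * u)))" for u
 using t by (cases "0 < u") (simp_all add: wker_def scaleR_conv_of_real distrib_left exp_diff exp_minus field_simps)
 show ?thesis unfolding weylW_def e integral_complex_of_real integral_mult_right_zero wker_exp[OF a k] by (simp only: mult.commute)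
qed

section \<open>Schwartz functions on the half line and their fractional derivatives\<close>

lemma at_within_Ici_nontrivial: "(0::real) <= t ==> at t within {0..} ~= bot"
proof -
 assume "0 <= t"
 then have "at_right t <= at t within {0..}" by (intro at_le) auto
 then show ?thesis using trivial_limit_at_right_real[of t] by (auto simp: bot_unique)
qed

lemma half_derivI: "0 <= t ==> (f has_vector_derivative d) (at t within {0..}) ==> half_deriv f t = d"
 unfolding half_deriv_def by (rule vector_derivative_within[OF at_within_Ici_nontrivial])

text \<open>\<open>half_deriv\<close> rests on a choice, so its iterates are computed by exhibiting
  the whole chain \<open>G\<close> of successive derivatives.\<close>

lemma half_deriv_iter:
 assumes d: "!!k t. 0 <= t ==> (G k has_vector_derivative G (Suc k) t) (at t within {0..})"
 and f: "!!t. 0 <= t ==> f t = G 0 t"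
 shows "0 <= t ==> (half_deriv ^^ k) f t = G k t"
proof (induction k arbitrary: t)
 case (Suc k)
 have "((half_deriv ^^ k) f has_vector_derivative G (Suc k) t) (at t within {0..})"
 by (rule has_vector_derivative_transform[OF _ _ d[of t k]]) (use Suc in auto)
 then show ?case using half_derivI[OF Suc.prems] by simp
qed (use f in simp)

lemma schwartz_halfI:
 assumes r: "!!k. rapid (G k)" and d: "!!k t. 0 <= t ==> (G k has_vector_derivative G (Suc k) t) (at t within {0..})"
 and f: "!!t. 0 <= t ==> f t = G 0 t"
 shows "f \<in> schwartz_half"
proof -
 have it: "(half_deriv ^^ n) f t = G n t" if "0 <= t" for n t
 by (rule half_deriv_iter[where G=G and f=f]) (use d f that in auto)
 have "(half_deriv ^^ n) f differentiable (at t within {0..})" if t: "0 <= t" for n t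
 proof -
 have "((half_deriv ^^ n) f has_vector_derivative G (Suc n) t) (at t within {0..})"
 by (rule has_vector_derivative_transform[OF _ _ d[of t n]]) (use t it in auto)
 then show ?thesis by (rule differentiableI_vector)
 qed
 moreover have "bounded ((%t. t ^ m *R (half_deriv ^^ n) f t) ` {0..})" for m n
 proof -
 obtain C where C: "0 <= C" "!!t. norm (G n t) <= C / (1 + max t 0) ^ m" using rapid_bound[OF r] by blast
 have "norm (t ^ m *R (half_deriv ^^ n) f t) <= C" if t: "0 <= t" for t
 proof -
 have "norm (t ^ m *R (half_deriv ^^ n) f t) = t ^ m * norm (G n t)" using t it[OF t] by simp
 also have "... <= (1 + t) ^ m * (C / (1 + t) ^ m)" using t C(2)[of t] C(1) by (intro mult_mono power_mono) auto
 also have "... = C" using t by simp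
 finally show ?thesis .
 qed
 then show ?thesis unfolding bounded_iff by auto
 qed
 ultimately show ?thesis unfolding schwartz_half_def by blast
qed

text \<open>Constant continuation to the left makes each derivative a continuous function on the
  whole line, as \<open>rapid\<close> requires.\<close>

definition clampD :: "nat => (real => complex) => real => complex"
 where "clampD k F t = (half_deriv ^^ k) F (max t 0)"

lemma clampD_0: "0 <= t ==> clampD 0 F t = F t"
 by (simp add: clampD_def)

lemma clampD_deriv:
 assumes F: "F \<in> schwartz_half" and t: "0 <= t"
 shows "(clampD k F has_vector_derivative clampD (Suc k) F t) (at t within {0..})"
proof -
 have "((half_deriv ^^ k) F has_vector_derivative clampD (Suc k) F t) (at t within {0..})"
 using F t unfolding schwartz_half_def by (auto simp: clampD_def half_deriv_def[of "(half_deriv ^^ k) F"] vector_derivative_works)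
 then show ?thesis by (rule has_vector_derivative_transform[rotated 2]) (use t in \<open>auto simp: clampD_def\<close>)
qed

lemma rapid_clampD:
 assumes F: "F \<in> schwartz_half"
 shows "rapid (clampD k F)"
 unfolding rapid_def
proof (intro conjI allI)
 have "continuous_on {0..} ((half_deriv ^^ k) F)"
 using F unfolding schwartz_half_def by (auto simp: continuous_on_eq_continuous_within intro!: differentiable_imp_continuous_within)
 then show "continuous_on UNIV (clampD k F)"
 unfolding clampD_def[abs_def] by (rule continuous_on_compose2) (auto intro!: continuous_intros)
 fix m :: nat
 have b: "bounded ((%t. t ^ j *R (half_deriv ^^ k) F t) ` {0..})" for j using F unfolding schwartz_half_def by blast
 obtain A where A: "!!t. 0 <= t ==> norm (t ^ 0 *R (half_deriv ^^ k) F t) <= A" using b[of 0] unfolding bounded_iff by auto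
 obtain B where B: "!!t. 0 <= t ==> norm (t ^ m *R (half_deriv ^^ k) F t) <= B" using b[of m] unfolding bounded_iff by auto
 have "norm (clampD k F t) <= 2 ^ m * (A + B) / (1 + max t 0) ^ m" for t
 proof -
 define s where "s = max t 0"
 have s: "0 <= s" by (simp add: s_def)
 have "(1 + s) ^ m <= (2 * max 1 s) ^ m" using s by (intro power_mono) auto
 also have "... = 2 ^ m * max 1 s ^ m" by (rule power_mult_distrib)
 also have "max 1 s ^ m <= 1 + s ^ m" using s by (cases "1 <= s") (auto simp: max_def)
 finally have "(1 + s) ^ m * norm ((half_deriv ^^ k) F s) <= 2 ^ m * (1 + s ^ m) * norm ((half_deriv ^^ k) F s)" by (simp add: mult_right_mono)
 also have "... = 2 ^ m * (norm ((half_deriv ^^ k) F s) + s ^ m * norm ((half_deriv ^^ k) F s))" by (simp add: algebra_simps)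
 also have "... <= 2 ^ m * (A + B)" using A[OF s] B[OF s] s by (intro mult_left_mono add_mono) auto
 finally show ?thesis using s unfolding clampD_def s_def[symmetric] by (simp add: pos_le_divide_eq mult.commute)
 qed
 then show "EX C. ALL t. norm (clampD k F t) <= C / (1 + max t 0) ^ m" by blast
qed

lemma weyl_int_eq:
 assumes a: "0 < a" and g: "rapid g" and t: "0 <= t" and fg: "!!s. 0 <= s ==> f s = g s"
 shows "weyl_int a f t = weylW a g t"
proof -
 note [measurable] = rapid_measurable[OF g]
 have G: "0 < Gamma a" using a by (rule Gamma_real_pos)
 have "(LINT s:{t<..}|lebesgue. ((s - t) powr (a - 1)) *R f s) = (LINT s|lebesgue. Gamma a *R (wker a (s - t) *R g s))"
 unfolding set_lebesgue_integral_def using t fg G by (intro b_integral_cong) (auto simp: wker_def split: split_indicator)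
 also have "... = (LI s. Gamma a *R (wker a (s - t) *R g s))" by (rule integral_completion) measurable
 also have "... = Gamma a *R (LI s. wker a (s - t) *R g s)" by (simp only: integral_scaleR_right)
 also have "(LI s. wker a (s - t) *R g s) = weylW a g t"
 unfolding weylW_def using lborel_integral_real_affine[of 1 "%s. wker a (s - t) *R g s" t] t by simp
 finally show ?thesis using G by (simp add: weyl_int_def)
qed

text \<open>The fractional derivative with the n-fold derivative inside the Weyl integral, whereas
  \<open>weyl_deriv\<close> has it outside. In this form it is visibly \<open>rapid\<close>.\<close>

definition weylD :: "real => (real => complex) => real => complex"
 where "weylD al F t = (let n = nat \<lfloor>al\<rfloor> + 1 in (-1) ^ n * weylW (real n - al) (clampD n F) t)"

lemma weyl_order_pos: "0 < al ==> 0 < real (nat \<lfloor>al\<rfloor> + 1) - al"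
 by linarith

lemma rapid_weylD: "0 < al ==> F \<in> schwartz_half ==> rapid (weylD al F)"
 unfolding weylD_def[abs_def] Let_def by (intro rapid_cmult rapid_weylW rapid_clampD weyl_order_pos)

text \<open>To differentiate a Weyl integral, \<open>A\<close> writes the integral of the k-th
  derivative as minus an integral of order 1 of the one for the next derivative; integrals of order
  1 are differentiated by the fundamental theorem. The n-fold derivative thus moves inside one step
  at a time.\<close>

lemma weyl_deriv_eq:
 assumes al: "0 < al" and F: "F \<in> schwartz_half" and t: "0 <= t"
 shows "weyl_deriv al F t = weylD al F t"
proof -
 define n where "n = nat \<lfloor>al\<rfloor> + 1"
 define b where "b = real n - al"
 have b: "0 < b" unfolding b_def n_def by (rule weyl_order_pos[OF al])
 have A: "weylW b (clampD k F) s = - weylW 1 (weylW b (clampD (Suc k) F)) s" if s: "0 <= s" for k s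
 proof -
 have "weylW b (clampD k F) s = weylW b (%r. -1 * weylW 1 (clampD (Suc k) F) r) s"
 by (intro weylW_cong) (simp add: weylW_one_of_deriv[OF rapid_clampD[OF F] rapid_clampD[OF F] clampD_deriv[OF F]])
 also have "... = - weylW (b + 1) (clampD (Suc k) F) s"
 unfolding weylW_cmult weylW_weylW[OF b zero_less_one rapid_clampD[OF F]] by simp
 also have "... = - weylW 1 (weylW b (clampD (Suc k) F)) s"
 unfolding weylW_weylW[OF zero_less_one b rapid_clampD[OF F]] by (simp add: add.commute)
 finally show ?thesis .
 qed
 have d: "(weylW b (clampD k F) has_vector_derivative weylW b (clampD (Suc k) F) s) (at s within {0..})" if s: "0 <= s" for k s
 proof -
 have "((%s. - weylW 1 (weylW b (clampD (Suc k) F)) s) has_vector_derivative - (- weylW b (clampD (Suc k) F) s)) (at s within {0..})"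
 by (intro has_vector_derivative_minus weylW_one_deriv rapid_weylW b rapid_clampD F s)
 then have "((%s. - weylW 1 (weylW b (clampD (Suc k) F)) s) has_vector_derivative weylW b (clampD (Suc k) F) s) (at s within {0..})"
 by (simp only: minus_minus)
 then show ?thesis by (rule has_vector_derivative_transform[rotated 2]) (use s A in auto)
 qed
 have "(half_deriv ^^ n) (weyl_int b F) t = weylW b (clampD n F) t"
 by (rule half_deriv_iter[where G="%k. weylW b (clampD k F)", OF d _ t])
 (auto intro!: weyl_int_eq[OF b rapid_clampD[OF F]] simp: clampD_def)
 then show ?thesis using al unfolding weyl_deriv_def weylD_def Let_def n_def[symmetric] b_def[symmetric] by simp
qed

text \<open>The orders al and n - al add up to the integer n, and n integrations of order 1 undo n
  derivatives, with signs that cancel against (-1) ^ n.\<close>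

lemma weylW_weylD:
 assumes al: "0 < al" and F: "F \<in> schwartz_half" and t: "0 <= t"
 shows "weylW al (weylD al F) t = F t"
proof -
 define n where "n = nat \<lfloor>al\<rfloor> + 1"
 have b: "0 < real n - al" unfolding n_def by (rule weyl_order_pos[OF al])
 have I: "weylW (real (Suc k)) (clampD (Suc k) F) t = (-1) ^ Suc k * F t" for k
 proof (induction k)
 case 0
 show ?case using weylW_one_of_deriv[OF rapid_clampD[OF F] rapid_clampD[OF F] clampD_deriv[OF F] t, of 0] t by (simp add: clampD_def)
 next
 case (Suc k)
 have "weylW (real (Suc (Suc k))) (clampD (Suc (Suc k)) F) t = weylW (real (Suc k) + 1) (clampD (Suc (Suc k)) F) t" by (simp add: add.commute)
 also have "... = weylW (real (Suc k)) (weylW 1 (clampD (Suc (Suc k)) F)) t"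
 by (rule weylW_weylW[OF _ zero_less_one rapid_clampD[OF F], symmetric]) simp
 also have "... = weylW (real (Suc k)) (%s. -1 * clampD (Suc k) F s) t"
 by (intro weylW_cong) (simp add: weylW_one_of_deriv[OF rapid_clampD[OF F] rapid_clampD[OF F] clampD_deriv[OF F]])
 also have "... = -1 * weylW (real (Suc k)) (clampD (Suc k) F) t" by (rule weylW_cmult)
 finally show ?case unfolding Suc.IH by simp
 qed
 have "weylW al (weylD al F) t = (-1) ^ n * weylW al (weylW (real n - al) (clampD n F)) t"
 unfolding weylD_def[abs_def] Let_def n_def[symmetric] by (rule weylW_cmult)
 also have "... = (-1) ^ n * weylW (real n) (clampD n F) t"
 unfolding weylW_weylW[OF al b rapid_clampD[OF F]] by simp
 also have "weylW (real n) (clampD n F) t = (-1) ^ n * F t" using I[of "nat \<lfloor>al\<rfloor>"] by (simp only: n_def Suc_eq_plus1)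
 finally show ?thesis by (simp flip: power_mult_distrib mult.assoc)
qed

lemma clampD_diff:
 assumes F: "F \<in> schwartz_half" and G: "G \<in> schwartz_half"
 shows "(%t. F t - G t) \<in> schwartz_half" "clampD k (%t. F t - G t) s = clampD k F s - clampD k G s"
proof -
 have d: "((%s. clampD k F s - clampD k G s) has_vector_derivative clampD (Suc k) F t - clampD (Suc k) G t) (at t within {0..})" if "0 <= t" for k t
 by (intro has_vector_derivative_diff clampD_deriv F G that)
 show "(%t. F t - G t) \<in> schwartz_half"
 by (rule schwartz_halfI[where G="%k s. clampD k F s - clampD k G s", OF _ d]) (auto intro!: rapid_diff rapid_clampD F G simp: clampD_0)
 show "clampD k (%t. F t - G t) s = clampD k F s - clampD k G s"
 proof -
 have "(half_deriv ^^ k) (%t. F t - G t) (max s 0) = clampD k F (max s 0) - clampD k G (max s 0)"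
 by (rule half_deriv_iter[where G="%k s. clampD k F s - clampD k G s"]) (use d in \<open>auto simp: clampD_0\<close>)
 then show ?thesis by (simp add: clampD_def)
 qed
qed

lemma weylD_diff:
 assumes al: "0 < al" and F: "F \<in> schwartz_half" and G: "G \<in> schwartz_half"
 shows "weylD al (%t. F t - G t) t = weylD al F t - weylD al G t"
 unfolding weylD_def Let_def clampD_diff(2)[OF F G, abs_def] weylW_diff[OF weyl_order_pos[OF al] rapid_clampD[OF F] rapid_clampD[OF G]]
 by (rule right_diff_distrib)

text \<open>The frequencies start at 1, so every term decays. On t >= 0 these are the polynomials in
  exp (- t) without constant term.\<close>

definition exp_sum :: "nat => (nat => complex) => real => complex"
 where "exp_sum N c t = (\<Sum>j<N. c j * of_real (exp (- real (Suc j) * max t 0)))"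

lemma rapid_exp_sum: "rapid (exp_sum N c)"
 unfolding exp_sum_def[abs_def] by (intro rapid_sum rapid_cmult rapid_exp) simp

lemma exp_sum_deriv:
 assumes t: "0 <= t"
 shows "(exp_sum N (%j. of_real ((- real (Suc j)) ^ k) * c j) has_vector_derivative exp_sum N (%j. of_real ((- real (Suc j)) ^ Suc k) * c j) t) (at t within {0..})"
proof -
 have "((%t. \<Sum>j<N. of_real ((- real (Suc j)) ^ k) * c j * of_real (exp (- real (Suc j) * t))) has_vector_derivative
 (\<Sum>j<N. of_real ((- real (Suc j)) ^ k) * c j * of_real (exp (- real (Suc j) * t) * (- real (Suc j))))) (at t within {0..})"
 by (intro has_vector_derivative_sum has_vector_derivative_mult_right has_vector_derivative_of_real)
 (auto intro!: derivative_eq_intros simp: has_real_derivative_iff_has_vector_derivative[symmetric])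
 also have "(\<Sum>j<N. of_real ((- real (Suc j)) ^ k) * c j * of_real (exp (- real (Suc j) * t) * (- real (Suc j)))) =
 exp_sum N (%j. of_real ((- real (Suc j)) ^ Suc k) * c j) t"
 unfolding exp_sum_def using t by (intro sum.cong) (simp_all add: mult_ac)
 finally show ?thesis
 by (rule has_vector_derivative_transform[rotated 2]) (use t in \<open>auto simp: exp_sum_def\<close>)
qed

lemma exp_sum_schwartz: "exp_sum N c \<in> schwartz_half"
 by (rule schwartz_halfI[where G="%k. exp_sum N (%j. of_real ((- real (Suc j)) ^ k) * c j)", OF rapid_exp_sum exp_sum_deriv]) auto

lemma exp_sum_weylD:
 assumes al: "0 < al" and t: "0 <= t"
 shows "weylD al (exp_sum N c) t = exp_sum N (%j. of_real (real (Suc j) powr al) * c j) t"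
proof -
 define n where "n = nat \<lfloor>al\<rfloor> + 1"
 have b: "0 < real n - al" unfolding n_def by (rule weyl_order_pos[OF al])
 have D: "clampD n (exp_sum N c) = (%s. \<Sum>j<N. (of_real ((- real (Suc j)) ^ n) * c j) * of_real (exp (- real (Suc j) * max s 0)))"
 proof
 fix s
 have "(half_deriv ^^ n) (exp_sum N c) (max s 0) = exp_sum N (%j. of_real ((- real (Suc j)) ^ n) * c j) (max s 0)"
 by (rule half_deriv_iter[where G="%k. exp_sum N (%j. of_real ((- real (Suc j)) ^ k) * c j)", OF exp_sum_deriv]) auto
 then show "clampD n (exp_sum N c) s = (\<Sum>j<N. (of_real ((- real (Suc j)) ^ n) * c j) * of_real (exp (- real (Suc j) * max s 0)))"
 by (simp add: clampD_def exp_sum_def)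
 qed
 have co: "(-1) ^ n * ((- x) ^ n * x powr (- (real n - al))) = x powr al" if x: "0 < x" for x :: real
 proof -
 have "(-1) ^ n * ((- x) ^ n * x powr (- (real n - al))) = x powr real n * x powr (- (real n - al))"
 using x by (simp add: powr_realpow flip: mult.assoc power_mult_distrib)
 also have "... = x powr al" by (simp flip: powr_add)
 finally show ?thesis .
 qed
 have tm: "(-1) ^ n * ((of_real ((- real (Suc j)) ^ n) * c j) * of_real (real (Suc j) powr (- (real n - al)) * exp (- real (Suc j) * t))) =
 of_real (real (Suc j) powr al) * c j * of_real (exp (- real (Suc j) * max t 0))" for j
 proof -
 have "(-1) ^ n * ((of_real ((- real (Suc j)) ^ n) * c j) * of_real (real (Suc j) powr (- (real n - al)) * exp (- real (Suc j) * t))) =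
 of_real ((-1) ^ n * ((- real (Suc j)) ^ n * real (Suc j) powr (- (real n - al)))) * c j * of_real (exp (- real (Suc j) * t))"
 by (simp only: of_real_mult of_real_power of_real_minus of_real_1 mult_ac)
 moreover have "0 < real (Suc j)" by simp
 ultimately show ?thesis unfolding max_absorb1[OF t] by (simp only: co)
 qed
 have "weylD al (exp_sum N c) t = (-1) ^ n * (\<Sum>j<N. (of_real ((- real (Suc j)) ^ n) * c j) * of_real (real (Suc j) powr (- (real n - al)) * exp (- real (Suc j) * t)))"
 proof -
 have "weylW (real n - al) (%s. \<Sum>j<N. (of_real ((- real (Suc j)) ^ n) * c j) * of_real (exp (- real (Suc j) * max s 0))) t =
 (\<Sum>j<N. weylW (real n - al) (%s. (of_real ((- real (Suc j)) ^ n) * c j) * of_real (exp (- real (Suc j) * max s 0))) t)"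
 proof (rule weylW_sum[OF b])
 show "rapid (%s. (of_real ((- real (Suc j)) ^ n) * c j) * of_real (exp (- real (Suc j) * max s 0)))" for j
 by (intro rapid_cmult rapid_exp) simp
 qed
 also have "... = (\<Sum>j<N. (of_real ((- real (Suc j)) ^ n) * c j) * of_real (real (Suc j) powr (- (real n - al)) * exp (- real (Suc j) * t)))"
 proof (rule sum.cong[OF refl])
 fix j
 have j: "0 < real (Suc j)" by simp
 show "weylW (real n - al) (%s. (of_real ((- real (Suc j)) ^ n) * c j) * of_real (exp (- real (Suc j) * max s 0))) t =
 (of_real ((- real (Suc j)) ^ n) * c j) * of_real (real (Suc j) powr (- (real n - al)) * exp (- real (Suc j) * t))"
 unfolding weylW_cmult weylW_exp[OF b j t] ..
 qed
 finally show ?thesis unfolding weylD_def Let_def n_def[symmetric] D by simp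
 qed
 then show ?thesis unfolding exp_sum_def sum_distrib_left tm .
qed

section \<open>Borel representatives of classes on the half line\<close>

lemma AE_half_line: "(AE t in half_line. P t) \<longleftrightarrow> (AEL t. 0 < t --> P t)"
 by (simp add: AE_restrict_space_iff AE_completion_iff)

text \<open>Borel representatives on \<open>\<real>\<close> that vanish on the negative half line.\<close>

definition lp_rep :: "real => (real => complex) => (real => complex) => bool"
 where "lp_rep p f f0 \<longleftrightarrow> f \<in> borel_measurable half_line & f0 \<in> borel_measurable borel & (ALL t<=0. f0 t = 0) &
 (AEL t. 0 < t --> f t = f0 t) & pL p f0 < \<infinity>"

lemma half_line_measurable_iff:
 "f \<in> borel_measurable half_line \<longleftrightarrow> (%t. indicator {0<..} t *R f t) \<in> borel_measurable lebesgue" for f :: "real => complex"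
 by (rule borel_measurable_restrict_space_iff) simp

lemma lp_repI:
 assumes m: "bm f0" and z: "!!t. t <= 0 ==> f0 t = 0" and ae: "AEL t. 0 < t --> f t = f0 t" and fin: "pL p f0 < \<infinity>"
 shows "lp_rep p f f0"
proof -
 have "(%t. indicator {0<..} t *R f t) \<in> borel_measurable lebesgue"
 proof (rule borel_measurable_AE)
 show "f0 \<in> borel_measurable lebesgue" by (rule measurable_completion) (use m in simp)
 show "AE t in lebesgue. f0 t = indicator {0<..} t *R f t"
 unfolding AE_completion_iff using ae by eventually_elim (use z in \<open>auto split: split_indicator\<close>)
 qed
 then show ?thesis using assms unfolding lp_rep_def half_line_measurable_iff by blast
qed

lemma half_line_nn:
 assumes z: "!!t. t <= 0 ==> f0 t = 0" and ae: "AEL t. 0 < t --> f t = f0 t"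
 shows "(\<integral>\<^sup>+t. en (norm (f t) powr p) \<partial>half_line) = pL p f0"
proof -
 have "(\<integral>\<^sup>+t. en (norm (f t) powr p) \<partial>half_line) = (NN t. en (norm (f t) powr p) * indicator {0<..} t)"
 by (subst nn_integral_restrict_space) (auto simp: nn_integral_completion)
 also have "... = pL p f0"
 unfolding pint_def
 proof (rule nn_integral_cong_AE)
 show "AEL t. en (norm (f t) powr p) * indicator {0<..} t = en (norm (f0 t) powr p)"
 using ae by eventually_elim (use z in \<open>auto split: split_indicator\<close>)
 qed
 finally show ?thesis .
qed

lemma lp_rep_Lp:
 assumes r: "lp_rep p f f0"
 shows "f \<in> Lp p" "Lp_norm p f = enn2real (pL p f0) powr (1 / p)"
proof -
 have [measurable]: "f \<in> borel_measurable half_line" using r by (simp add: lp_rep_def)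
 have n: "(\<integral>\<^sup>+t. en (norm (f t) powr p) \<partial>half_line) = pL p f0" using r unfolding lp_rep_def by (intro half_line_nn) auto
 show "f \<in> Lp p" unfolding Lp_def using r n by (auto intro!: integrableI_nonneg simp: lp_rep_def)
 show "Lp_norm p f = enn2real (pL p f0) powr (1 / p)"
 unfolding Lp_norm_def n[symmetric] by (subst integral_eq_nn_integral) auto
qed

lemma Lp_rep:
 assumes f: "f \<in> Lp p"
 shows "EX f0. lp_rep p f f0"
proof -
 define u where "u t = indicator {0<..} t *R f t" for t
 have [measurable]: "u \<in> borel_measurable lebesgue" using f unfolding Lp_def half_line_measurable_iff u_def by simp
 obtain a where a [measurable]: "a \<in> borel_measurable lborel" and ae_a: "AEL t. Re (u t) = a t"
 using completion_ex_borel_measurable_real[of "%t. Re (u t)" lborel] by auto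
 obtain b where b [measurable]: "b \<in> borel_measurable lborel" and ae_b: "AEL t. Im (u t) = b t"
 using completion_ex_borel_measurable_real[of "%t. Im (u t)" lborel] by auto
 define f0 where "f0 t = (if 0 < t then complex_of_real (a t) + \<i> * complex_of_real (b t) else 0)" for t
 have m: "bm f0" unfolding f0_def[abs_def] using a b by simp
 have z: "t <= 0 ==> f0 t = 0" for t by (simp add: f0_def)
 have ae: "AEL t. 0 < t --> f t = f0 t"
 using ae_a ae_b by eventually_elim (auto simp: f0_def u_def complex_eq_iff)
 have "pL p f0 < \<infinity>"
 proof -
 have "(\<integral>\<^sup>+t. en (norm (f t) powr p) \<partial>half_line) = pL p f0" by (rule half_line_nn[OF z ae])
 then show ?thesis using f by (auto simp: Lp_def integrable_iff_bounded)
 qed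
 then show ?thesis using lp_repI[OF m z ae] by blast
qed

lemma lp_rep_AE_eq:
 assumes f: "lp_rep p f f0" and g: "lp_rep p g g0"
 shows "ae_eq f g \<longleftrightarrow> (AEL t. f0 t = g0 t)"
proof -
 have f': "AEL t. 0 < t --> f t = f0 t" and g': "AEL t. 0 < t --> g t = g0 t"
 and z: "!!t. t <= 0 ==> f0 t = g0 t" using f g by (auto simp: lp_rep_def)
 show ?thesis unfolding ae_eq_def AE_half_line
 proof
 assume "AEL t. 0 < t --> f t = g t"
 with f' g' show "AEL t. f0 t = g0 t" by eventually_elim (metis z not_le)
 next
 assume "AEL t. f0 t = g0 t"
 with f' g' show "AEL t. 0 < t --> f t = g t" by eventually_elim auto
 qed
qed

text \<open>The bridge from the operators, which integrate Lebesgue measurable functions, to Borel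
  functions on the line, for which Fubini and the affine substitutions are available.\<close>

lemma lebesgue_int_rep:
 assumes r: "lp_rep p f f0" and [measurable]: "bm w" "A \<in> sets borel" and A: "A \<subseteq> {0<..}"
 shows "(LINT s:A|lebesgue. w s *R f s) = (LI s. (indicator A s * w s) *R f0 s)"
proof -
 have [measurable]: "bm f0" "(%t. indicator {0<..} t *R f t) \<in> borel_measurable lebesgue"
 using r by (auto simp: lp_rep_def half_line_measurable_iff)
 have [measurable]: "w \<in> borel_measurable lebesgue" "(%s. indicator A s :: real) \<in> borel_measurable lebesgue" "f0 \<in> borel_measurable lebesgue"
 by (rule measurable_completion, simp)+
 have e: "indicator A s *R (w s *R f s) = (indicator A s * w s) *R (indicator {0<..} s *R f s)" for s
 using A by (auto split: split_indicator)
 have "(LINT s:A|lebesgue. w s *R f s) = (LINT s|lebesgue. (indicator A s * w s) *R f0 s)"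
 unfolding set_lebesgue_integral_def e
 proof (rule integral_cong_AE)
 have "AEL t. 0 < t --> f t = f0 t" using r by (simp add: lp_rep_def)
 then show "AE s in lebesgue. (indicator A s * w s) *R (indicator {0<..} s *R f s) = (indicator A s * w s) *R f0 s"
 unfolding AE_completion_iff by eventually_elim (use A in \<open>auto split: split_indicator\<close>)
 qed measurable
 also have "... = (LI s. (indicator A s * w s) *R f0 s)" by (rule integral_completion) measurable
 finally show ?thesis .
qed

section \<open>The operators as dilation averages\<close>

text \<open>Comes from the substitution s = r t in \<open>D_plus_inv\<close>: all powers of
  \<open>t\<close> cancel, and s > t becomes r > 1.\<close>

definition dkern :: "real => real => real"
 where "dkern al r = (if 1 < r then al * (r - 1) powr (al - 1) / r powr al else 0)"

definition skern :: "real => real => real => real"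
 where "skern \<beta> \<mu> r = (if 0 < r then r powr (\<beta> - 1) / (1 + r) powr \<mu> else 0)"

lemma dkern_measurable [measurable]: "dkern al \<in> borel_measurable borel" unfolding dkern_def[abs_def] by measurable
lemma skern_measurable [measurable]: "skern \<beta> \<mu> \<in> borel_measurable borel" unfolding skern_def[abs_def] by measurable

text \<open>The majorant has one integrable power singularity at \<open>c\<close> and an integrable
  power tail; \<open>c\<close> is 1 for \<open>dkern\<close> and 0 for \<open>skern\<close>.\<close>

lemma dil_kernelI:
 fixes k :: "real => real"
 assumes [measurable]: "bm k" and nn: "!!r. 0 <= k r" and z: "!!r. r <= 0 ==> k r = 0"
 and a: "a < 1" and q: "1 < q" and C: "0 <= C"
 and near: "!!r. \<bar>r - c\<bar> < 1 ==> 0 < r ==> k r * r powr (- (1 / p)) <= C * \<bar>r - c\<bar> powr (- a)"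
 and far: "!!r. 1 <= \<bar>r - c\<bar> ==> 0 < r ==> k r * r powr (- (1 / p)) <= C * (1 + \<bar>r\<bar>) powr (- q)"
 shows "dil_kernel p k"
proof -
 define B where "B r = C * (\<bar>r - c\<bar> powr (- a) * indicator {-1<..<1} (r - c)) + C * (1 + \<bar>r\<bar>) powr (- q)" for r
 have "intg (%r. \<bar>r - c\<bar> powr (- a) * indicator {-1<..<1} (r - c))"
 using lborel_integrable_real_affine[OF integrable_abs_powr[OF a zero_less_one], of 1 "- c"] by simp
 then have B: "intg B"
 unfolding B_def[abs_def] using integrable_one_plus_powr[OF q] by (intro b_integrable_add integrable_mult_right)
 have "intg (%r. k r * r powr (- (1 / p)))"
 proof (rule b_integrable_bound[OF B], simp, rule AE_I2)
 fix r :: real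
 have B0: "0 <= B r" using C by (simp add: B_def)
 have "k r * r powr (- (1 / p)) <= B r"
 proof (cases "0 < r")
 case r: True
 show ?thesis
 proof (cases "\<bar>r - c\<bar> < 1")
 case True
 then have i: "indicator {-1<..<1} (r - c) = (1::real)" by (simp add: abs_less_iff)
 have "0 <= C * (1 + \<bar>r\<bar>) powr (- q)" using C by simp
 then show ?thesis using near[OF True r] unfolding B_def i by simp
 next
 case False
 then have "1 <= \<bar>r - c\<bar>" by simp
 moreover have "0 <= C * (\<bar>r - c\<bar> powr (- a) * indicator {-1<..<1} (r - c))" using C by simp
 ultimately show ?thesis using far[OF _ r] unfolding B_def by linarith
 qed
 qed (use z B0 in simp)
 then show "norm (k r * r powr (- (1 / p))) <= norm (B r)" using nn[of r] B0 by (simp add: abs_mult)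
 qed
 then show ?thesis unfolding dil_kernel_def using nn z by auto
qed

text \<open>Near r = 1 the kernel has the singularity (r - 1) powr (al - 1). For r >= 2 the powers
  in numerator and denominator combine to order r powr (- 1), and the weight r powr (- (1 / p)) adds
  the decay that makes the tail integrable.\<close>

lemma dil_kernel_dkern:
 assumes al: "0 < al" and p: "1 < p"
 shows "dil_kernel p (dkern al)"
proof (rule dil_kernelI[where a="1 - al" and q="1 + 1 / p" and C="al * (2 * 2 powr (1 + 1 / p))" and c=1])
 have C: "al <= al * (2 * 2 powr (1 + 1 / p))" using al p ge_one_powr_ge_zero[of 2 "1 + 1 / p"] by simp
 fix r :: real
 assume r: "0 < r"
 have rr: "r powr (- (1 / p)) / r powr al <= 1" if "1 < r"
 proof -
 have "r powr (- (1 / p)) / r powr al = r powr (- (1 / p) - al)" by (simp add: powr_diff)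
 also have "... <= r powr 0"
 proof (rule powr_mono)
 have "0 < 1 / p" using p by simp
 then show "- (1 / p) - al <= 0" using al by linarith
 qed (use that in simp)
 finally show ?thesis using that by simp
 qed
 show "dkern al r * r powr (- (1 / p)) <= al * (2 * 2 powr (1 + 1 / p)) * \<bar>r - 1\<bar> powr (- (1 - al))"
 proof (cases "1 < r")
 case True
 have "dkern al r * r powr (- (1 / p)) = al * (r - 1) powr (al - 1) * (r powr (- (1 / p)) / r powr al)" using True by (simp add: dkern_def)
 also have "... <= al * (r - 1) powr (al - 1) * 1" using rr[OF True] al by (intro mult_left_mono) auto
 also have "... <= al * (2 * 2 powr (1 + 1 / p)) * (r - 1) powr (al - 1)" using mult_right_mono[OF C, of "(r - 1) powr (al - 1)"] by simp
 finally show ?thesis using True by simp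
 qed (use al in \<open>simp add: dkern_def\<close>)
 assume "1 <= \<bar>r - 1\<bar>"
 with r have r2: "2 <= r" by linarith
 have "(r - 1) powr (al - 1) <= 2 * r powr (al - 1)"
 proof (cases "1 <= al")
 case True
 have "(r - 1) powr (al - 1) <= r powr (al - 1)" using True r2 by (intro powr_mono2) auto
 moreover have "0 <= r powr (al - 1)" by simp
 ultimately show ?thesis by linarith
 next
 case False
 have "(r - 1) powr (al - 1) <= (r / 2) powr (al - 1)" using False r2 by (intro powr_mono2') auto
 also have "... = r powr (al - 1) * 2 powr (1 - al)" using r2 by (simp add: powr_divide powr_diff)
 also have "... <= r powr (al - 1) * 2 powr 1" using al by (intro mult_left_mono powr_mono) auto
 finally show ?thesis by simp
 qed
 then have "dkern al r * r powr (- (1 / p)) <= al * (2 * r powr (al - 1)) / r powr al * r powr (- (1 / p))"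
 using r2 al by (auto simp: dkern_def intro!: mult_right_mono divide_right_mono mult_left_mono)
 also have "... = al * 2 * (r powr (al - 1) / r powr al * r powr (- (1 / p)))" by simp
 also have "r powr (al - 1) / r powr al * r powr (- (1 / p)) = r powr ((al - 1) - al + (- (1 / p)))" by (simp only: powr_add powr_diff)
 also have "(al - 1) - al + (- (1 / p)) = - (1 + 1 / p)" by simp
 also have "al * 2 * r powr (- (1 + 1 / p)) <= al * 2 * (2 powr (1 + 1 / p) * (1 + \<bar>r\<bar>) powr (- (1 + 1 / p)))"
 using abs_powr_tail[of r "1 + 1 / p"] r2 p al by (intro mult_left_mono) auto
 finally show "dkern al r * r powr (- (1 / p)) <= al * (2 * 2 powr (1 + 1 / p)) * (1 + \<bar>r\<bar>) powr (- (1 + 1 / p))" by (simp only: mult.assoc)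
qed (use al p in \<open>auto simp: dkern_def\<close>)

text \<open>With c = \<beta> - 1 / p the weighted kernel behaves like r powr (c - 1) at 0 and like r
  powr (c - 1 - \<mu>) at infinity, so the two hypotheses are exactly integrability at the two
  ends.\<close>

lemma dil_kernel_skern:
 assumes b: "0 < \<beta> - 1 / p" "\<beta> - 1 / p < \<mu>"
 shows "dil_kernel p (skern \<beta> \<mu>)"
proof (rule dil_kernelI[where a="1 - (\<beta> - 1 / p)" and q="1 + (\<mu> - (\<beta> - 1 / p))" and C="2 powr (1 + (\<mu> - (\<beta> - 1 / p)))" and c=0])
 define c where "c = \<beta> - 1 / p"
 have \<mu>: "0 < \<mu>" "c < \<mu>" using b by (auto simp: c_def)
 fix r :: real
 assume r: "0 < r"
 have e: "skern \<beta> \<mu> r * r powr (- (1 / p)) = r powr (c - 1) / (1 + r) powr \<mu>"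
 proof -
 have "r powr (c - 1) = r powr (\<beta> - 1) * r powr (- (1 / p))" unfolding c_def powr_add[symmetric] by (rule arg_cong[where f="(powr) r"]) simp
 then show ?thesis using r by (simp add: skern_def)
 qed
 have "r powr (c - 1) / (1 + r) powr \<mu> <= r powr (c - 1) / 1" using r \<mu> by (intro divide_left_mono ge_one_powr_ge_zero) auto
 also have "... <= 2 powr (1 + (\<mu> - c)) * r powr (c - 1)"
 using mult_right_mono[OF ge_one_powr_ge_zero[of 2 "1 + (\<mu> - c)"], of "r powr (c - 1)"] \<mu> by simp
 finally show "skern \<beta> \<mu> r * r powr (- (1 / p)) <= 2 powr (1 + (\<mu> - (\<beta> - 1 / p))) * \<bar>r - 0\<bar> powr (- (1 - (\<beta> - 1 / p)))"
 unfolding e c_def[symmetric] using r by simp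
 assume "1 <= \<bar>r - 0\<bar>"
 have "r powr (c - 1) / (1 + r) powr \<mu> <= r powr (c - 1) / r powr \<mu>" using r \<mu> by (intro divide_left_mono powr_mono2) auto
 also have "... = r powr (- (1 + (\<mu> - c)))" unfolding powr_diff[symmetric] by (rule arg_cong[where f="(powr) r"]) simp
 also have "... <= 2 powr (1 + (\<mu> - c)) * (1 + \<bar>r\<bar>) powr (- (1 + (\<mu> - c)))"
 using abs_powr_tail[of r "1 + (\<mu> - c)"] \<open>1 \<le> \<bar>r - 0\<bar>\<close> r \<mu> by auto
 finally show "skern \<beta> \<mu> r * r powr (- (1 / p)) <= 2 powr (1 + (\<mu> - (\<beta> - 1 / p))) * (1 + \<bar>r\<bar>) powr (- (1 + (\<mu> - (\<beta> - 1 / p))))"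
 unfolding e c_def[symmetric] .
qed (use b in \<open>auto simp: skern_def\<close>)

lemma dil_avg_nonpos:
 assumes "!!t. t <= 0 ==> f0 t = 0" "dil_kernel p k" "t <= 0"
 shows "dil_avg k f0 t = (0 :: complex)"
proof -
 have z: "k r *R f0 (r * t) = 0" for r
 using assms by (cases "r <= 0") (auto simp: dil_kernel_def mult_nonneg_nonpos)
 show ?thesis unfolding dil_avg_def z by simp
qed

lemma dil_avg_dkern:
 assumes t: "0 < t"
 shows "al *R (LI s. (indicator {t<..} s * ((s - t) powr (al - 1) / s powr al)) *R f0 s) = dil_avg (dkern al) (f0 :: real => complex) t"
proof -
 define F where "F s = (indicator {t<..} s * ((s - t) powr (al - 1) / s powr al)) *R f0 s" for s
 have e: "(al * t) *R F (0 + t * r) = dkern al r *R f0 (r * t)" for r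
 proof (cases "1 < r")
 case True
 have "t * r - t = t * (r - 1)" by (simp add: algebra_simps)
 then have "(t * r - t) powr (al - 1) / (t * r) powr al = t powr (al - 1) / t powr al * ((r - 1) powr (al - 1) / r powr al)"
 using t True by (simp add: powr_mult)
 also have "t powr (al - 1) / t powr al = t powr (- 1)" by (simp flip: powr_diff)
 finally have "al * t * ((t * r - t) powr (al - 1) / (t * r) powr al) = dkern al r"
 using t True by (simp add: dkern_def powr_minus)
 moreover have "indicator {t<..} (t * r) = (1::real)" using t True by simp
 ultimately show ?thesis unfolding F_def by (simp add: mult.commute)
 next
 case False
 then have "t * r <= t" using t by (simp add: mult_le_cancel_left2)
 then show ?thesis using False by (simp add: F_def dkern_def)
 qed
 have "al *R (LI s. F s) = (al * t) *R (LI r. F (0 + t * r))"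
 using lborel_integral_real_affine[of t F 0] t by simp
 also have "... = (LI r. (al * t) *R F (0 + t * r))" by (rule integral_scaleR_right[symmetric])
 finally show ?thesis unfolding e dil_avg_def unfolding F_def .
qed

lemma D_plus_inv_dil:
 assumes "0 < al" "lp_rep p f f0" "0 < t"
 shows "D_plus_inv al f t = dil_avg (dkern al) f0 t"
proof -
 have "{t<..} \<subseteq> {0<..}" using assms(3) by auto
 then have "(LINT s:{t<..}|lebesgue. ((s - t) powr (al - 1) / s powr al) *R f s) =
 (LI s. (indicator {t<..} s * ((s - t) powr (al - 1) / s powr al)) *R f0 s)"
 by (intro lebesgue_int_rep[OF assms(2)]) measurable
 then show ?thesis unfolding dil_avg_dkern[OF assms(3), symmetric] D_plus_inv_def using assms(1) by simp
qed

lemma S_op_dil: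
 assumes r: "lp_rep p f f0" and t: "0 < t"
 shows "S_op \<beta> \<mu> f t = dil_avg (skern \<beta> \<mu>) f0 t"
proof -
 define F where "F s = (indicator {0<..} s * (s powr (\<beta> - 1) / (s + t) powr \<mu>)) *R f0 s" for s
 have e: "(t powr (\<mu> - \<beta>) * t) *R F (0 + t * r) = skern \<beta> \<mu> r *R f0 (r * t)" for r
 proof (cases "0 < r")
 case True
 have "t * r + t = t * (1 + r)" by (simp add: algebra_simps)
 then have "(t * r) powr (\<beta> - 1) / (t * r + t) powr \<mu> = t powr (\<beta> - 1) / t powr \<mu> * (r powr (\<beta> - 1) / (1 + r) powr \<mu>)"
 using t True by (simp add: powr_mult)
 also have "t powr (\<beta> - 1) / t powr \<mu> = t powr (\<beta> - 1 - \<mu>)" by (simp add: powr_diff)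
 finally have "t powr (\<mu> - \<beta>) * t * ((t * r) powr (\<beta> - 1) / (t * r + t) powr \<mu>) = (t powr (\<mu> - \<beta>) * t powr 1 * t powr (\<beta> - 1 - \<mu>)) * skern \<beta> \<mu> r"
 using t True by (simp add: skern_def)
 also have "t powr (\<mu> - \<beta>) * t powr 1 * t powr (\<beta> - 1 - \<mu>) = 1" unfolding powr_add[symmetric] using t by simp
 finally show ?thesis using t True unfolding F_def by (simp add: mult.commute)
 next
 case False
 then have "t * r <= 0" using t by (simp add: mult_le_0_iff)
 then show ?thesis using False by (simp add: F_def skern_def)
 qed
 have "S_op \<beta> \<mu> f t = t powr (\<mu> - \<beta>) *R (LI s. F s)"
 unfolding S_op_def F_def by (subst lebesgue_int_rep[OF r]) auto
 also have "... = (t powr (\<mu> - \<beta>) * t) *R (LI r. F (0 + t * r))"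
 using lborel_integral_real_affine[of t F 0] t by simp
 also have "... = (LI r. (t powr (\<mu> - \<beta>) * t) *R F (0 + t * r))" by (rule integral_scaleR_right[symmetric])
 finally show ?thesis unfolding e dil_avg_def .
qed

lemma lp_rep_dil:
 assumes p: "1 < p" and k: "dil_kernel p k" and r: "lp_rep p f f0" and e: "!!t. 0 < t ==> g t = dil_avg k f0 t"
 shows "lp_rep p g (dil_avg k f0)"
proof (rule lp_repI)
 have [measurable]: "bm f0" "bm k" using r k by (auto simp: lp_rep_def dil_kernel_def)
 show "bm (dil_avg k f0)" by measurable
 show "dil_avg k f0 t = 0" if "t <= 0" for t by (rule dil_avg_nonpos[OF _ k that]) (use r in \<open>auto simp: lp_rep_def\<close>)
 show "pL p (dil_avg k f0) < \<infinity>" by (rule pint_dil_avg_finite[OF k _ p]) (use r in \<open>auto simp: lp_rep_def\<close>)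
qed (use e in auto)

text \<open>For ep < t the punctured domain is the part of ep < |t - s| inside the half line, and
  the representative vanishes outside it. So the truncated integral is pi times the convolution with
  \<open>hker ep\<close>; pi cancels against the factor i / pi, and i remains.\<close>

lemma H_plus_hilb:
 assumes r: "lp_rep p f f0" and g: "is_hilb p f0 g"
 shows "AEL t. 0 < t --> H_plus f t = \<i> * g t"
proof -
 have "AEL t. ((%ep. conv (hker ep) f0 t) ->> g t) (at_right 0)" using g by (simp add: is_hilb_def)
 then show ?thesis
 proof eventually_elim
 case (elim t)
 show ?case
 proof
 assume t0: "0 < t"
 have z: "!!s. s <= 0 ==> f0 s = 0" using r by (simp add: lp_rep_def)
 have e: "(LINT s:{0<..<t - ep} \<union> {t + ep<..}|lebesgue. f s / of_real (t - s)) = of_real pi * conv (hker ep) f0 t" if "0 < ep" "ep < t" for ep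
 proof -
 have "(LINT s:{0<..<t - ep} \<union> {t + ep<..}|lebesgue. f s / of_real (t - s)) = (LINT s:{0<..<t - ep} \<union> {t + ep<..}|lebesgue. (1 / (t - s)) *R f s)"
 by (simp add: scaleR_conv_of_real)
 also have "... = (LI s. (indicator ({0<..<t - ep} \<union> {t + ep<..}) s * (1 / (t - s))) *R f0 s)"
 by (rule lebesgue_int_rep[OF r]) (use that t0 in auto)
 also have "... = (LI s. pi *R (hker ep (t - s) *R f0 s))"
 proof (rule b_integral_cong[OF refl])
 fix s :: real
 show "(indicator ({0<..<t - ep} \<union> {t + ep<..}) s * (1 / (t - s))) *R f0 s = pi *R (hker ep (t - s) *R f0 s)"
 using z[of s] that by (cases "s <= 0") (auto simp: hker_def split: split_indicator)
 qed
 also have "... = of_real pi * conv (hker ep) f0 t" unfolding conv_def integral_scaleR_right by (rule scaleR_conv_of_real)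
 finally show ?thesis .
 qed
 have "((%ep. of_real pi * conv (hker ep) f0 t) ->> of_real pi * g t) (at_right 0)" by (intro tendsto_mult tendsto_const elim)
 moreover have "\<forall>\<^sub>F ep in at_right 0. of_real pi * conv (hker ep) f0 t = (LINT s:{0<..<t - ep} \<union> {t + ep<..}|lebesgue. f s / of_real (t - s))"
 using eventually_at_right_real[OF t0] by eventually_elim (rule e[symmetric], auto)
 ultimately have "((%ep. LINT s:{0<..<t - ep} \<union> {t + ep<..}|lebesgue. f s / of_real (t - s)) ->> of_real pi * g t) (at_right 0)"
 by (rule Lim_transform_eventually)
 then have "Lim (at_right 0) (%ep. LINT s:{0<..<t - ep} \<union> {t + ep<..}|lebesgue. f s / of_real (t - s)) = of_real pi * g t"
 by (intro tendsto_Lim trivial_limit_at_right_real)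
 then show "H_plus f t = \<i> * g t" by (simp add: H_plus_def)
 qed
 qed
qed

section \<open>Injectivity of the Abel operator\<close>

lemma poly_approx_real:
 fixes q :: "real => real"
 assumes "continuous_on {0..1} q" "0 < e"
 shows "EX (N::nat) a. \<forall>x\<in>{0..1}. \<bar>q x - (\<Sum>j<N. a j * x ^ j)\<bar> < e"
proof -
 obtain g where g: "real_polynomial_function g" "!!x. x \<in> {0..1} ==> \<bar>q x - g x\<bar> < e"
 using Stone_Weierstrass_real_polynomial_function[OF compact_Icc assms] by blast
 obtain a n where "g = (%x. \<Sum>i\<le>n. a i * x ^ i)" using g(1) unfolding real_polynomial_function_iff_sum by blast
 then have "\<forall>x\<in>{0..1}. \<bar>q x - (\<Sum>j<Suc n. a j * x ^ j)\<bar> < e" using g(2) by (simp only: lessThan_Suc_atMost) simp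
 then show ?thesis by blast
qed

lemma poly_approx:
 fixes q :: "real => complex"
 assumes q: "continuous_on {0..1} q" and e: "0 < e"
 shows "EX (N::nat) a. \<forall>x\<in>{0..1}. norm (q x - (\<Sum>j<N. a j * of_real (x ^ j))) < e"
proof -
 have qR: "continuous_on {0..1} (%x. Re (q x))" "continuous_on {0..1} (%x. Im (q x))" using q by (auto intro: continuous_intros)
 obtain N1 :: nat and a1 where 1: "\<forall>x\<in>{0..1}. \<bar>Re (q x) - (\<Sum>j<N1. a1 j * x ^ j)\<bar> < e / 2" using poly_approx_real[OF qR(1), of "e / 2"] e by auto
 obtain N2 :: nat and a2 where 2: "\<forall>x\<in>{0..1}. \<bar>Im (q x) - (\<Sum>j<N2. a2 j * x ^ j)\<bar> < e / 2" using poly_approx_real[OF qR(2), of "e / 2"] e by auto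
 define N where "N = max N1 N2"
 define a where "a j = Complex (if j < N1 then a1 j else 0) (if j < N2 then a2 j else 0)" for j
 have pad: "(\<Sum>j<N. (if j < M then b j else 0) * x ^ j) = (\<Sum>j<M. b j * x ^ j)" if "M <= N" for M b and x :: real
 using that by (intro sum.mono_neutral_cong_right) auto
 have "norm (q x - (\<Sum>j<N. a j * of_real (x ^ j))) < e" if x: "x \<in> {0..1}" for x
 proof -
 have pp: "(\<Sum>j<N. (if j < N1 then a1 j else 0) * x ^ j) = (\<Sum>j<N1. a1 j * x ^ j)" "(\<Sum>j<N. (if j < N2 then a2 j else 0) * x ^ j) = (\<Sum>j<N2. a2 j * x ^ j)"
 by (rule pad, simp add: N_def)+
 define d where "d = q x - (\<Sum>j<N. a j * of_real (x ^ j))"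
 have "Re d = Re (q x) - (\<Sum>j<N1. a1 j * x ^ j)" "Im d = Im (q x) - (\<Sum>j<N2. a2 j * x ^ j)"
 unfolding d_def a_def by (simp_all add: Re_sum Im_sum pp flip: of_real_power)
 then show ?thesis using 1 2 x cmod_le[of d] unfolding d_def by fastforce
 qed
 then show ?thesis by blast
qed

text \<open>The substitution 1 / t = 1 / s + x, that is t = s / (1 + s x), splits exp (- l / t) into
  exp (- l / s) * exp (- l * x) and turns the Abel kernel into x powr (al - 1), which leaves a Gamma
  integral.\<close>

lemma exp_abel:
 assumes al: "0 < al" and l: "0 < l" and s: "0 < s"
 shows "(NN t. en ((s - t) powr (al - 1) * exp (- l / t) * t powr (- 1 - al)) * indicator {0<..<s} t) =
 en (s powr (al - 1) * exp (- l / s) * (Gamma al * l powr (- al)))"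
proof -
 define g where "g x = s / (1 + s * x)" for x
 define g' where "g' x = - (s^2 / (1 + s * x)^2)" for x
 define f where "f t = (s - t) powr (al - 1) * exp (- l / t) * t powr (- 1 - al)" for t
 define A where "A = s powr (al - 1) * exp (- l / s) * Gamma al"
 have G: "0 < Gamma al" using al by (rule Gamma_real_pos)
 have y: "1 < 1 + s * x" if "0 < x" for x using that s by simp
 have key: "\<bar>g' x\<bar> * f (g x) = A * (wker al x * exp (- l * x))" if x: "0 < x" for x
 proof -
 \<comment> \<open>With the logarithms of s, x and 1 + s x all powers become exponentials of linear
   forms, and the exponents of 1 + s x add up to 0.\<close>
 define S X Y where "S = ln s" and "X = ln x" and "Y = ln (1 + s * x)"
 have e: "s = exp S" "x = exp X" "1 + s * x = exp Y" using s x less_trans[OF zero_less_one y[OF x]] by (simp_all add: S_def X_def Y_def)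
 have 1: "\<bar>g' x\<bar> = exp (2 * S - 2 * Y)" unfolding g'_def e(3) by (subst e(1)) (simp add: exp_diff exp_double)
 have 2: "g x = exp (S - Y)" unfolding g_def e(3) by (subst e(1)) (simp add: exp_diff)
 have "s - g x = s * s * x / (1 + s * x)" using y[OF x] unfolding g_def by (simp add: field_simps)
 also have "... = exp (S + S + X - Y)" unfolding e(3) exp_diff exp_add e(1)[symmetric] e(2)[symmetric] ..
 finally have 3: "s - g x = exp (S + S + X - Y)" .
 have 4: "- l / g x = - l / s + - l * x" using s y[OF x] unfolding g_def by (simp add: field_simps)
 have P: "exp u powr b = exp (b * u)" for u b :: real by (simp add: powr_def)
 have "\<bar>g' x\<bar> * f (g x) = exp (- l / s) * exp (- l * x) * (exp (2 * S - 2 * Y) * exp ((al - 1) * (S + S + X - Y)) * exp ((- 1 - al) * (S - Y)))"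
 unfolding f_def 1 4 3 exp_add[of "- l / s"] unfolding 2 P by (simp only: mult_ac)
 also have "exp (2 * S - 2 * Y) * exp ((al - 1) * (S + S + X - Y)) * exp ((- 1 - al) * (S - Y)) = exp ((al - 1) * S) * exp ((al - 1) * X)"
 unfolding exp_add[symmetric] by (rule arg_cong[where f=exp]) (simp add: algebra_simps)
 also have "... = s powr (al - 1) * x powr (al - 1)" using s x by (simp add: powr_def S_def X_def)
 finally show ?thesis using x G by (simp add: A_def wker_def mult_ac)
 qed
 have img: "g ` {0<..} = {0<..<s}"
 proof (intro equalityI subsetI)
 fix t assume "t \<in> g ` {0<..}"
 then obtain x where x: "0 < x" "t = g x" by auto
 show "t \<in> {0<..<s}" using s y[OF x(1)] unfolding x(2) g_def by (simp add: divide_less_eq)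
 next
 fix t assume t: "t \<in> {0<..<s}"
 then have "0 < 1 / t - 1 / s" "g (1 / t - 1 / s) = t" using s by (simp_all add: g_def field_simps)
 then show "t \<in> g ` {0<..}" by (metis greaterThan_iff image_eqI)
 qed
 have inj: "inj_on g {0<..}"
 using s by (intro inj_onI) (auto simp: g_def frac_eq_eq dest: y)
 have der: "(g has_field_derivative g' x) (at x within {0<..})" if "x \<in> {0<..}" for x
 unfolding g_def g'_def using y[of x] that by (auto intro!: derivative_eq_intros simp: power2_eq_square)
 have int: "intg (%x. wker al x * exp (- l * x))"
 using not_integrable_integral_eq[of lborel "%x. wker al x * exp (- l * x)"] wker_exp[OF al l] l by auto
 have ind: "indicator {0<..} x *R (\<bar>g' x\<bar> * f (g x)) = A * (wker al x * exp (- l * x))" for x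
 using key[of x] by (cases "0 < x") (auto simp: wker_def)
 have si: "set_integrable lebesgue {0<..} (%x. \<bar>g' x\<bar> * f (g x))"
 unfolding set_integrable_def ind by (subst integrable_completion) (use int in auto)
 have "integral {0<..} (%x. \<bar>g' x\<bar> * f (g x)) = (LINT x:{0<..}|lebesgue. \<bar>g' x\<bar> * f (g x))"
 by (rule set_lebesgue_integral_eq_integral(2)[OF si, symmetric])
 also have "... = (LI x. A * (wker al x * exp (- l * x)))" unfolding set_lebesgue_integral_def ind by (rule integral_completion) measurable
 also have "... = A * l powr (- al)" unfolding integral_mult_right_zero wker_exp[OF al l] ..
 finally have lhs: "integral {0<..} (%x. \<bar>g' x\<bar> * f (g x)) = A * l powr (- al)" .
 have c: "f absolutely_integrable_on {0<..<s} & integral {0<..<s} f = A * l powr (- al)"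
 unfolding img[symmetric]
 proof (rule iffD1[OF has_absolute_integral_change_of_variables_1'[where f=f and g=g and g'=g' and S="{0<..}" and b="A * l powr (- al)"]])
 show "{0<..} \<in> sets (lebesgue :: real measure)" by simp
 show "(%x. \<bar>g' x\<bar> * f (g x)) absolutely_integrable_on {0<..} & integral {0<..} (%x. \<bar>g' x\<bar> * f (g x)) = A * l powr (- al)"
 by (rule conjI[OF si lhs])
 qed (erule der, rule inj)
 have "(f has_integral integral {0<..<s} f) {0<..<s}"
 by (rule integrable_integral[OF set_lebesgue_integral_eq_integral(1)[OF conjunct1[OF c]]])
 then have "(f has_integral A * l powr (- al)) {0<..<s}" unfolding conjunct2[OF c] .
 then have "(NN t. en (f t) * indicator {0<..<s} t) = en (A * l powr (- al))"
 by (rule nn_integral_has_integral_lebesgue'[rotated]) (simp add: f_def)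
 then show ?thesis unfolding f_def A_def by (simp only: mult.assoc)
qed

definition eweight :: "real => real => real"
 where "eweight l s = (if 0 < s then exp (- l / s) / s else 0)"

lemma eweight_measurable [measurable]: "bm (eweight l)"
 unfolding eweight_def[abs_def] by measurable

lemma eweight_integrable:
 assumes l: "0 < l" and h: "hadm (h :: real => complex)"
 shows "intg (%s. eweight l s *R h s)"
proof (rule hadm_integrable[OF h])
 fix s :: real
 show "\<bar>eweight l s\<bar> <= (1 + 1 / l) * (1 / (1 + \<bar>s\<bar>))"
 proof (cases "0 < s")
 case True
 have "1 + l / s <= exp (l / s)" by (rule exp_ge_add_one_self)
 then have "s + l <= s * exp (l / s)" using mult_left_mono[of "1 + l / s" "exp (l / s)" s] True by (simp add: distrib_left)
 then have "1 / (s * exp (l / s)) <= 1 / (s + l)" using True l by (intro divide_left_mono mult_pos_pos) auto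
 also have "... <= (1 + 1 / l) * (1 / (1 + s))"
 proof -
 have "1 + s <= (1 + 1 / l) * (s + l)" using True l by (simp add: field_simps)
 then show ?thesis using True l by (simp add: divide_simps mult.commute)
 qed
 finally show ?thesis using True by (simp add: eweight_def exp_minus field_simps)
 qed (use l in \<open>simp add: eweight_def\<close>)
qed measurable

text \<open>After the exchange of integrals \<open>exp_abel\<close> leaves s powr (al - 1) / s powr
  al = 1 / s next to exp (- l / s), so al survives only in the positive constant
  \<open>c\<close>.\<close>

lemma abel_moment:
 fixes h :: "real => complex"
 assumes al: "0 < al" and l: "0 < l" and h: "hadm h"
 and ae: "AEL t. 0 < t --> (LI s. (indicator {t<..} s * ((s - t) powr (al - 1) / s powr al)) *R h s) = 0"
 shows "(LI s. eweight l s *R h s) = 0"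
proof -
 note [measurable] = hadm_measurable[OF h]
 define c where "c = Gamma al * l powr (- al)"
 have c: "0 < c" using al l Gamma_real_pos[of al] by (simp add: c_def)
 define K where "K t s = (if 0 < t & t < s then (s - t) powr (al - 1) * exp (- l / t) * t powr (- 1 - al) / s powr al else 0)" for t s
 have [measurable]: "case_prod K \<in> borel_measurable (borel \<Otimes>\<^sub>M borel)" unfolding K_def[abs_def] by measurable
 have K0: "0 <= K t s" for t s by (simp add: K_def)
 have w0: "0 <= eweight l s" for s by (simp add: eweight_def)
 have Kn: "(NN t. en (K t s)) = en (c * eweight l s)" for s
 proof (cases "0 < s")
 case True
 have sp: "s powr (al - 1) / s powr al = 1 / s" using True by (simp add: powr_minus_divide flip: powr_diff)
 have "(NN t. en (K t s)) = (NN t. en (1 / s powr al) * (en ((s - t) powr (al - 1) * exp (- l / t) * t powr (- 1 - al)) * indicator {0<..<s} t))"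
 by (intro nn_integral_cong) (auto simp: K_def ennreal_mult[symmetric] split: split_indicator)
 also have "... = en (1 / s powr al) * en (s powr (al - 1) * exp (- l / s) * (Gamma al * l powr (- al)))"
 unfolding exp_abel[OF al l True, symmetric] by (rule nn_integral_cmult) measurable
 also have "... = en (s powr (al - 1) / s powr al * exp (- l / s) * c)"
 unfolding c_def[symmetric] using c by (simp flip: ennreal_mult)
 finally show ?thesis unfolding sp using True by (simp add: eweight_def mult.commute)
 next
 case False
 then have "K t s = 0" for t by (simp add: K_def)
 then show ?thesis using False by (simp add: eweight_def)
 qed
 have Ki: "intg (%t. K t s)" for s by (rule integrableI_nonneg) (auto simp: K0 Kn)
 have Kv: "(LI t. K t s) = c * eweight l s" for s
 using integral_eq_nn_integral[of "%t. K t s" lborel] Kn[of s] c w0[of s] K0 by simp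
 have mK: "case_prod (%s t. K t s *R h s) \<in> borel_measurable (lborel \<Otimes>\<^sub>M lborel)" by measurable
 have ih: "intg (%s. c *R (eweight l s *R h s))" using eweight_integrable[OF l h] by (rule integrable_scaleR_right)
 have "(NN s. (NN t. en (norm (K t s *R h s)))) = (NN s. en (norm (c *R (eweight l s *R h s))))"
 proof (intro nn_integral_cong)
 fix s
 have "(NN t. en (norm (K t s *R h s))) = (NN t. en (K t s) * en (norm (h s)))"
 by (intro nn_integral_cong) (simp add: K0 flip: ennreal_mult)
 also have "... = en (c * eweight l s) * en (norm (h s))" by (subst nn_integral_multc) (auto simp: Kn)
 also have "... = en (norm (c *R (eweight l s *R h s)))" using c w0[of s] by (simp add: mult.assoc flip: ennreal_mult)
 finally show "(NN t. en (norm (K t s *R h s))) = en (norm (c *R (eweight l s *R h s)))" .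
 qed
 also have "... < \<infinity>" using ih unfolding integrable_iff_bounded by simp
 finally have fin: "(NN s. (NN t. en (norm (K t s *R h s)))) < \<infinity>" .
 have "0 = (LI t. LI s. K t s *R h s)"
 proof (rule integral_eq_zero_AE[symmetric])
 show "AEL t. (LI s. K t s *R h s) = 0"
 using ae
 proof eventually_elim
 case (elim t)
 show ?case
 proof (cases "0 < t")
 case True
 have e: "K t s *R h s = (exp (- l / t) * t powr (- 1 - al)) *R ((indicator {t<..} s * ((s - t) powr (al - 1) / s powr al)) *R h s)" for s
 using True by (auto simp: K_def split: split_indicator)
 show ?thesis unfolding e integral_scaleR_right using elim True by simp
 qed (simp add: K_def)
 qed
 qed
 also have "... = (LI s. LI t. K t s *R h s)" by (rule fubini_lborel(1)[OF mK fin])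
 also have "... = (LI s. c *R (eweight l s *R h s))" using Ki by (simp add: Kv)
 also have "... = c *R (LI s. eweight l s *R h s)" by (rule integral_scaleR_right)
 finally show ?thesis using c by simp
qed

text \<open>From moments to zero: x = exp (- 1 / s) takes values in the unit interval, and its power
  j corresponds to l = j + 1, one factor being spent on making \<open>m\<close> integrable.
  Weierstrass extends the vanishing to continuous functions of x, ramps extend it to the sets s <=
  S, and at Lebesgue points of \<open>m\<close> vanishing interval integrals force m = 0.\<close>

lemma abel_injective:
 fixes h :: "real => complex"
 assumes al: "0 < al" and h: "hadm h"
 and ae: "AEL t. 0 < t --> (LI s. (indicator {t<..} s * ((s - t) powr (al - 1) / s powr al)) *R h s) = 0"
 shows "AEL t. 0 < t --> h t = 0"
proof -
 note [measurable] = hadm_measurable[OF h]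
 define x where "x s = (if 0 < s then exp (- 1 / s) else 0)" for s :: real
 define m where "m s = eweight 1 s *R h s" for s
 have [measurable]: "bm x" "bm m" unfolding x_def[abs_def] m_def[abs_def] by measurable
 have x01: "x s \<in> {0..1}" for s by (auto simp: x_def)
 have m: "intg m" unfolding m_def[abs_def] by (rule eweight_integrable[OF zero_less_one h])
 have mom: "(LI s. of_real (x s ^ j) * m s) = 0" for j
 proof -
 have "of_real (x s ^ j) * m s = eweight (real (Suc j)) s *R h s" for s
 proof (cases "0 < s")
 case True
 have "exp (- 1 / s) ^ j * exp (- 1 / s) = exp (- 1 / s) ^ Suc j" by simp
 also have "... = exp (- real (Suc j) / s)" by (simp only: exp_of_nat_mult[symmetric] times_divide_eq_right mult_minus_right mult_1_right minus_divide_left)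
 finally show ?thesis using True by (simp add: x_def m_def eweight_def scaleR_conv_of_real mult.assoc flip: of_real_mult of_real_power)
 qed (simp add: m_def eweight_def)
 then show ?thesis using abel_moment[OF al _ h ae, of "real (Suc j)"] by simp
 qed
 have mi: "intg (%s. of_real (k (x s)) * m s)" if k: "continuous_on {0..1} k" "bm k" for k :: "real => real"
 proof -
 obtain B where "\<forall>z\<in>k ` {0..1}. norm z <= B"
 using compact_imp_bounded[OF compact_continuous_image[OF k(1) compact_Icc]] unfolding bounded_iff by blast
 then have B: "norm (k y) <= B" if "y \<in> {0..1}" for y using that by blast
 note [measurable] = k(2)
 have "0 <= B" using order_trans[OF norm_ge_zero B[of 0]] by simp
 then show ?thesis
 by (intro b_integrable_bound[OF integrable_mult_right[OF integrable_norm[OF m], of B]])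
 (use B x01 in \<open>auto simp: norm_mult abs_mult intro!: mult_right_mono AE_I2\<close>)
 qed
 have cont: "(LI s. of_real (k (x s)) * m s) = 0" if k: "continuous_on UNIV k" for k :: "real => real"
 proof -
 have k1: "continuous_on {0..1} k" using k by (rule continuous_on_subset) simp
 have [measurable]: "bm k" using k by (rule borel_measurable_continuous_onI)
 define I where "I = (LI s. of_real (k (x s)) * m s)"
 have "norm I <= e * (LI s. norm (m s))" if e: "0 < e" for e
 proof -
 obtain N :: nat and a where a: "\<forall>y\<in>{0..1}. \<bar>k y - (\<Sum>j<N. a j * y ^ j)\<bar> < e" using poly_approx_real[OF k1 e] by blast
 define P where "P y = (\<Sum>j<N. a j * y ^ j)" for y
 have P: "continuous_on {0..1} P" "bm P" unfolding P_def[abs_def] by (intro continuous_intros, measurable)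
 have Pm: "of_real (P (x s)) * m s = (\<Sum>j<N. of_real (a j) * (of_real (x s ^ j) * m s))" for s
 by (simp add: P_def sum_distrib_right mult.assoc)
 have ij: "intg (%s. of_real (a j) * (of_real (x s ^ j) * m s))" for j
 by (intro integrable_mult_right mi continuous_intros) measurable
 have "(LI s. of_real (P (x s)) * m s) = (\<Sum>j<N. of_real (a j) * (LI s. of_real (x s ^ j) * m s))"
 unfolding Pm using ij by (simp only: b_integral_sum integral_mult_right_zero)
 then have P0: "(LI s. of_real (P (x s)) * m s) = 0" unfolding mom by simp
 then have "I = (LI s. of_real (k (x s)) * m s - of_real (P (x s)) * m s)"
 unfolding I_def using b_integral_diff[OF mi[OF k1] mi[OF P]] by simp
 also have "norm ... <= (LI s. e * norm (m s))"
 proof (rule b_integral_norm_bound_integral)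
 show "norm (of_real (k (x s)) * m s - of_real (P (x s)) * m s) <= e * norm (m s)" for s
 proof -
 have "\<bar>k (x s) - P (x s)\<bar> <= e" using a x01[of s] unfolding P_def by (auto intro: less_imp_le)
 moreover have "of_real (k (x s)) * m s - of_real (P (x s)) * m s = of_real (k (x s) - P (x s)) * m s" by (simp only: of_real_diff left_diff_distrib)
 ultimately show ?thesis by (simp only: norm_mult norm_of_real mult_right_mono norm_ge_zero)
 qed
 qed (use mi[OF k1] mi[OF P] m in \<open>auto intro!: b_integrable_diff integrable_mult_right\<close>)
 finally show ?thesis by simp
 qed
 then have le: "norm I <= e * (LI s. norm (m s))" if "0 < e" for e using that by blast
 define M where "M = (LI s. norm (m s))"
 have M0: "0 <= M" unfolding M_def by (intro b_integral_nonneg) simp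
 have "I = 0"
 proof (rule ccontr)
 assume "I ~= 0"
 then have I: "0 < norm I" by simp
 have "norm I <= norm I / (2 * (M + 1)) * M"
 proof -
 have "0 < norm I / (2 * (M + 1))" using I M0 by (intro divide_pos_pos) auto
 then show ?thesis using le unfolding M_def[symmetric] by blast
 qed
 also have "... = norm I * (M / (2 * (M + 1)))" by simp
 also have "... <= norm I * (1 / 2)"
 proof (rule mult_left_mono)
 show "M / (2 * (M + 1)) <= 1 / 2" using M0 by (simp add: divide_le_eq)
 qed simp
 finally show False using I by simp
 qed
 then show ?thesis by (simp add: I_def)
 qed
 have ini: "(LI s. indicator {..S} s *R m s) = 0" if S: "0 < S" for S
 proof -
 \<comment> \<open>Ramps of slope \<open>n\<close>, equal to 1 up to x S and eventually 0 beyond.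
   Since \<open>x\<close> is monotone they converge to the indicator of s <= S.\<close>
 define r where "r n y = max 0 (min 1 (1 - real n * (y - x S)))" for n :: nat and y
 have rc: "continuous_on UNIV (r n)" for n unfolding r_def by (intro continuous_intros)
 have [measurable]: "bm (r n)" for n using rc by (rule borel_measurable_continuous_onI)
 have "(%n. LI s. of_real (r n (x s)) * m s) -->> (LI s. indicator {..S} s *R m s)"
 proof (rule integral_dominated_convergence[where w="%s. norm (m s)"])
 show "intg (%s. norm (m s))" using m by (rule integrable_norm)
 show "AEL s. (%n. of_real (r n (x s)) * m s) -->> indicator {..S} s *R m s"
 proof (intro AE_I2)
 fix s :: real
 show "(%n. of_real (r n (x s)) * m s) -->> indicator {..S} s *R m s"
 proof (cases "s <= S")
 case True
 have "x s <= x S" using True S by (auto simp: x_def frac_le)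
 then have "real n * (x s - x S) <= 0" for n by (simp add: mult_nonneg_nonpos)
 then have "r n (x s) = 1" for n unfolding r_def by (simp add: min_def max_def)
 then show ?thesis using True by simp
 next
 case False
 have lt: "x S < x s" using False S by (auto simp: x_def frac_less2)
 obtain n0 :: nat where n0: "1 < real n0 * (x s - x S)" using lt reals_Archimedean3[of "x s - x S"] by auto
 have "\<forall>\<^sub>F n in sequentially. of_real (r n (x s)) * m s = 0"
 using eventually_ge_at_top[of n0]
 proof eventually_elim
 case (elim n)
 have "real n0 * (x s - x S) <= real n * (x s - x S)" using elim lt by (intro mult_right_mono) auto
 then show ?case using n0 by (simp add: r_def)
 qed
 then show ?thesis using False by (auto intro: tendsto_eventually)
 qed
 qed
 show "AEL s. norm (of_real (r n (x s)) * m s) <= norm (m s)" for n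
 by (intro AE_I2) (auto simp: norm_mult r_def intro!: mult_left_le_one_le)
 qed measurable
 then show ?thesis unfolding cont[OF rc] by (simp add: LIMSEQ_const_iff)
 qed
 have "hadm (%s. m s)"
 unfolding hadm_def
 proof
 show "intg (%t. (1 / (1 + \<bar>t\<bar>)) *R m t)"
 by (rule b_integrable_bound[OF m]) (auto intro!: AE_I2 simp: divide_le_eq mult_le_cancel_left1)
 qed measurable
 from right_lebesgue_point[OF this] show ?thesis
 proof eventually_elim
 case (elim y)
 show ?case
 proof
 assume y0: "0 < y"
 have "m y = 0"
 proof (rule ccontr)
 assume my: "m y ~= 0"
 then obtain d where d: "0 < d" "ALL h. 0 < h & h < d --> (LINT t:{y..y+h}|lborel. norm (m t - m y)) <= norm (m y) / 2 * h"
 using elim[rule_format, of "norm (m y) / 2"] by auto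
 define b where "b = d / 2"
 have b: "0 < b" "b < d" using d(1) by (auto simp: b_def)
 have i1: "intg (%t. indicator {y..y+b} t *R m t)" using m by (rule integrable_mult_indicator[rotated]) simp
 have i2: "intg (%t. indicator {y..y+b} t *R m y)"
 proof (rule integrable_scaleR_left)
 show "intg (indicator {y..y+b} :: real => real)" by (rule integrable_real_indicator) (use b in auto)
 qed
 have v2: "(LI t. indicator {y..y+b} t *R m y) = b *R m y" using b by simp
 have iS: "intg (%t. indicator {..S} t *R m t)" for S :: real using m by (rule integrable_mult_indicator[rotated]) simp
 have "(LI t. indicator {y..y+b} t *R m t) = (LI t. indicator {..y+b} t *R m t - indicator {..y} t *R m t)"
 proof (rule integral_cong_AE)
 show "AEL t. indicator {y..y+b} t *R m t = indicator {..y+b} t *R m t - indicator {..y} t *R m t"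
 using AE_lborel_singleton[of y] by eventually_elim (use b in \<open>auto split: split_indicator\<close>)
 qed measurable
 also have "... = 0" using iS ini[of "y + b"] ini[of y] y0 b by simp
 finally have z: "(LI t. indicator {y..y+b} t *R m t) = 0" .
 have "b * norm (m y) = norm (LI t. indicator {y..y+b} t *R (m t - m y))"
 unfolding scaleR_diff_right b_integral_diff[OF i1 i2] z v2 using b by simp
 also have "... <= (LI t. norm (indicator {y..y+b} t *R (m t - m y)))" by (rule integral_norm_bound)
 also have "... = (LINT t:{y..y+b}|lborel. norm (m t - m y))" unfolding set_lebesgue_integral_def by simp
 also have "... <= norm (m y) / 2 * b" using d(2) b by blast
 finally show False using b my by simp
 qed
 then show "h y = 0" using y0 by (auto simp: m_def eweight_def)
 qed
 qed
qed

section \<open>Density of exponential sums\<close>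

lemma pint_dominated:
 fixes G :: "nat => real => complex"
 assumes p: "0 < p" and [measurable]: "!!n. G n \<in> borel_measurable borel" "bm w"
 and dom: "!!n t. norm (G n t) <= w t" and fin: "pL p w < \<infinity>"
 and lim: "AEL t. (%n. G n t) -->> 0"
 shows "(%n. pL p (G n)) -->> 0"
proof -
 have "(%n. (NN t. en (norm (G n t) powr p))) -->> (\<integral>\<^sup>+t. 0 \<partial>(lborel :: real measure))"
 proof (rule nn_integral_dominated_convergence[where w="%t. en (norm (w t) powr p)"])
 show "AEL t. en (norm (G n t) powr p) <= en (norm (w t) powr p)" for n
 using order_trans[OF dom[of n] abs_ge_self] p by (intro AE_I2 ennreal_leI powr_mono2) auto
 show "(NN t. en (norm (w t) powr p)) < \<infinity>" using fin unfolding pint_def .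
 show "AEL t. (%n. en (norm (G n t) powr p)) -->> 0"
 using lim
 proof eventually_elim
 case (elim t)
 have "(%n. norm (G n t)) -->> 0" using elim by (rule tendsto_norm_zero)
 then have "(%n. norm (G n t) powr p) -->> 0" by (rule tendsto_zero_powrI[OF _ tendsto_const]) (use p in auto)
 then show ?case using tendsto_ennrealI by fastforce
 qed
 qed measurable
 then show ?thesis by (simp add: pint_def)
qed

lemma rapid_powr_bound:
 assumes al: "0 <= al" and g: "rapid g"
 shows "EX C>=0. ALL t>0. norm (of_real (t powr al) * g t) <= C * (1 + t) powr (- 1)"
proof -
 obtain m :: nat where m: "al + 1 <= real m" using real_arch_simple by blast
 obtain C where C: "0 <= C" "!!t. norm (g t) <= C / (1 + max t 0) ^ m" using rapid_bound[OF g] by blast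
 have "norm (of_real (t powr al) * g t) <= C * (1 + t) powr (- 1)" if t: "0 < t" for t
 proof -
 have "t powr al * norm (g t) <= (1 + t) powr al * (C / (1 + t) ^ m)"
 using C(2)[of t] t al C(1) by (intro mult_mono powr_mono2) auto
 then have "norm (of_real (t powr al) * g t) <= (1 + t) powr al * (C / (1 + t) powr real m)"
 using t by (simp add: norm_mult powr_realpow)
 also have "... = C * (1 + t) powr (al - real m)" by (simp add: powr_diff)
 also have "... <= C * (1 + t) powr (- 1)" using C(1) t m by (intro mult_left_mono powr_mono) auto
 finally show ?thesis .
 qed
 with C(1) show ?thesis by blast
qed

lemma rapid_powr_pint:
 assumes p: "1 < p" and al: "0 <= al" and g: "rapid g"
 shows "pL p (%t. if 0 < t then of_real (t powr al) * g t else 0) < \<infinity>"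
proof -
 obtain C where C: "0 <= C" "!!t. 0 < t ==> norm (of_real (t powr al) * g t) <= C * (1 + t) powr (- 1)" using rapid_powr_bound[OF al g] by blast
 have "pL p (%t. if 0 < t then of_real (t powr al) * g t else 0) <= pL p (%t. C * (1 + \<bar>t\<bar>) powr (- 1))"
 using p C by (intro pint_mono) auto
 also have "... = en (C powr p) * (NN t. en ((1 + \<bar>t\<bar>) powr (- p)))"
 proof -
 have "norm (C * (1 + \<bar>t\<bar>) powr (- 1)) powr p = C powr p * (1 + \<bar>t\<bar>) powr (- p)" for t :: real
 using C(1) by (simp add: abs_mult powr_divide powr_minus_divide)
 then show ?thesis unfolding pint_def by (simp add: ennreal_mult nn_integral_cmult)
 qed
 also have "... < \<infinity>" using nn_integral_one_plus_powr[OF p] by (simp add: ennreal_mult_less_top)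
 finally show ?thesis .
qed

definition good :: "real => (real => complex) => bool"
 where "good p h \<longleftrightarrow> h \<in> borel_measurable borel & (ALL t<=0. h t = 0) & pL p h < \<infinity>"

lemma good_rep: "good p h ==> lp_rep p h h"
 unfolding good_def by (intro lp_repI) auto

lemma lp_rep_good: "lp_rep p f h ==> good p h"
 unfolding good_def lp_rep_def by auto

definition powr_exp :: "real => (real => complex) => real => complex"
 where "powr_exp al g t = (if 0 < t then of_real (t powr al) * g t else 0)"

lemma powr_exp_good:
 assumes "1 < p" "0 <= al" "rapid g"
 shows "good p (powr_exp al g)"
proof -
 note [measurable] = rapid_measurable[OF assms(3)]
 have "powr_exp al g \<in> borel_measurable borel" unfolding powr_exp_def[abs_def] by measurable
 then show ?thesis using rapid_powr_pint[OF assms] unfolding good_def powr_exp_def[abs_def] by simp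
qed

lemma exists_pint_small:
 assumes "(%n. pint M p (G n)) -->> 0" "0 < (e::real)"
 shows "EX n. pint M p (G n) <= en e"
proof -
 have "\<forall>\<^sub>F n in sequentially. pint M p (G n) < en e" by (rule order_tendstoD(2)[OF assms(1)]) (use assms(2) in simp)
 then show ?thesis by (auto dest!: eventually_happens intro: less_imp_le)
qed

text \<open>Write h t = t powr al * exp (- t) * w t with \<open>w\<close> bounded. Continuous
  approximants of \<open>w\<close> become, in the variable exp (- t), continuous functions on the
  closed unit interval, where Weierstrass applies. The factor exp (- t) split off makes
  \<open>E0\<close> p-integrable, so uniform errors are harmless, and raises all frequencies to at
  least 1.\<close>

lemma exp_dense_bounded:
 fixes h :: "real => complex"
 assumes p: "1 < p" and al: "0 <= al" and [measurable]: "bm h" and R: "0 < R"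
 and B: "0 < B" "!!t. norm ((t powr (- al) * exp t) *R h t) <= B" and supp: "!!t. t <= 0 \<or> R < t ==> h t = 0" and e: "0 < e"
 shows "EX N c. pL p (%t. powr_exp al (exp_sum N c) t - h t) <= en e"
proof -
 define w where "w t = (t powr (- al) * exp t) *R h t" for t
 define E0 where "E0 = powr_exp al (%t. complex_of_real (exp (- 1 * max t 0)))"
 define G where "G u = powr_exp al (%t. complex_of_real (exp (- 1 * max t 0)) * u t)" for u :: "real => complex"
 have E0g: "good p E0" unfolding E0_def by (intro powr_exp_good p al rapid_exp) simp
 then have E0m [measurable]: "bm E0" and E0f: "pL p E0 < \<infinity>" by (auto simp: good_def)
 have Gn: "norm (G u t - G v t) = norm (u t - v t) * norm (E0 t)" for u v t
 by (simp add: G_def E0_def powr_exp_def norm_mult flip: right_diff_distrib)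
 have Gm [measurable]: "bm (G u)" if [measurable]: "bm u" for u
 unfolding G_def powr_exp_def[abs_def] by measurable
 have wm [measurable]: "bm w" unfolding w_def[abs_def] by measurable
 have hw: "h = G w"
 proof
 fix t
 have "t powr al * (exp (- t) * (t powr (- al) * exp t)) = 1" if "0 < t"
 using that by (simp add: powr_minus exp_minus field_simps)
 then show "h t = G w t"
 using supp[of t] by (auto simp: G_def powr_exp_def w_def scaleR_conv_of_real mult.assoc[symmetric] simp flip: of_real_mult)
 qed
 have "w \<in> borel_measurable lebesgue" by (rule measurable_completion) simp
 then have "w measurable_on UNIV" by (rule lebesgue_measurable_imp_measurable_on) simp
 then obtain Z g where Z: "negligible Z" and gc: "!!n. continuous_on UNIV (g n)" and gl: "!!x. x \<notin> Z ==> (%n. g n x) -->> w x"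
 unfolding measurable_on_def by auto
 \<comment> \<open>The numerator cuts off between R and 2 R, where \<open>w\<close> is already 0,
   and the denominator pulls the values into the ball of radius \<open>B\<close>. Continuity and the
   limit \<open>w\<close> are preserved.\<close>
 define u where "u n t = (max 0 (min 1 (2 - t / R)) / max 1 (norm (g n t) / B)) *R g n t" for n :: nat and t
 have uc: "continuous_on UNIV (u n)" for n
 unfolding u_def using R B(1) by (intro continuous_intros gc continuous_on_divide) (auto simp: max_def)
 have um [measurable]: "bm (u n)" for n using uc by (rule borel_measurable_continuous_onI)
 have ub: "norm (u n t) <= B" for n t
 proof -
 have "norm (u n t) = max 0 (min 1 (2 - t / R)) * (norm (g n t) / max 1 (norm (g n t) / B))" by (simp add: u_def)
 also have "... <= 1 * B" using B(1) by (intro mult_mono) (auto simp: divide_le_eq max_def field_simps)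
 finally show ?thesis by simp
 qed
 have ul: "(%n. u n x) -->> w x" if "x \<notin> Z" for x
 proof -
 have "(%n. u n x) -->> (max 0 (min 1 (2 - x / R)) / max 1 (norm (w x) / B)) *R w x"
 unfolding u_def using B(1) by (intro tendsto_intros gl that) (auto simp: max_def)
 moreover have "max 1 (norm (w x) / B) = 1" using B(1) B(2)[of x] by (simp add: w_def max_def divide_le_eq)
 moreover have "max 0 (min 1 (2 - x / R)) *R w x = w x"
 proof (cases "R < x")
 case False
 then have "x / R <= 1" using R by simp
 then show ?thesis by (simp add: min_def)
 qed (use supp in \<open>simp add: w_def\<close>)
 ultimately show ?thesis by simp
 qed
 have cv: "(%n. pL p (%t. G (u n) t - G w t)) -->> 0"
 proof (rule pint_dominated[where w="%t. (B + B) * norm (E0 t)"])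
 show "norm (G (u n) t - G w t) <= (B + B) * norm (E0 t)" for n t
 unfolding Gn using norm_triangle_ineq4[of "u n t" "w t"] ub[of n t] B(2)[of t] by (intro mult_right_mono) (auto simp: w_def)
 show "pL p (%t. (B + B) * norm (E0 t)) < \<infinity>"
 using E0f by (subst pint_cmult) (auto simp: ennreal_mult_less_top)
 have "AE x in lebesgue. x \<notin> Z" using Z by (simp add: negligible_iff_null_sets AE_not_in)
 then have "AEL x. x \<notin> Z" unfolding AE_completion_iff .
 then show "AEL t. (%n. G (u n) t - G w t) -->> 0"
 proof eventually_elim
 case (elim t)
 have "(%n. norm (u n t - w t) * norm (E0 t)) -->> 0 * norm (E0 t)"
 by (intro tendsto_mult tendsto_const tendsto_norm_zero LIM_zero ul[OF elim])
 then have "(%n. norm (G (u n) t - G w t)) -->> 0" unfolding Gn by simp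
 then show ?case by (rule tendsto_norm_zero_cancel)
 qed
 qed (use p in auto)
 define b where "b = e / (2 powr p * 2)"
 have b0: "0 < b" using e by (simp add: b_def)
 obtain n where n: "pL p (%t. G (u n) t - G w t) <= en b" using exists_pint_small[OF cv b0] by blast
 \<comment> \<open>The approximant as a function of x = exp (- t). Stopping the logarithm at -2 R
   makes it continuous at x = 0 and loses nothing, since \<open>u n\<close> vanishes from 2 R
   on.\<close>
 define q where "q x = u n (- ln (max x (exp (- (2 * R)))))" for x
 have qc: "continuous_on {0..1} q"
 proof -
 have "0 < max x (exp (- (2 * R)))" for x by (simp add: less_max_iff_disj)
 then have "max x (exp (- (2 * R))) ~= 0" for x by (metis less_irrefl)
 then have "continuous_on {0..1} (%x. - ln (max x (exp (- (2 * R)))))" by (intro continuous_intros ballI)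
 then show ?thesis unfolding q_def by (rule continuous_on_compose2[OF uc]) simp
 qed
 have qe: "q (exp (- t)) = u n t" if "0 < t" for t
 proof (cases "t <= 2 * R")
 case True
 then show ?thesis by (simp add: q_def max_def)
 next
 case False
 then have "2 <= t / R" using R by (simp add: pos_le_divide_eq)
 then have "u n t = 0" by (simp add: u_def)
 moreover have "u n (2 * R) = 0" using R by (simp add: u_def)
 ultimately show ?thesis using False by (simp add: q_def max_def)
 qed
 obtain K where K: "pL p E0 = en K" "0 <= K" using E0f by (cases "pL p E0") auto
 \<comment> \<open>The uniform tolerance for which d powr p times the integral \<open>K\<close> of
   \<open>E0\<close> is at most \<open>b\<close>; the 1 guards against K = 0.\<close>
 define d where "d = (b / (K + 1)) powr (1 / p)"
 have d: "0 < d" "d powr p * K <= b"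
 proof -
 show "0 < d" using b0 K(2) by (simp add: d_def)
 have "d powr p = b / (K + 1)" using b0 K(2) p by (simp add: d_def powr_powr)
 then have "d powr p * K = b * (K / (K + 1))" by simp
 also have "... <= b * 1" using b0 K(2) by (intro mult_left_mono) auto
 finally show "d powr p * K <= b" by simp
 qed
 obtain N :: nat and c where c: "\<forall>x\<in>{0..1}. norm (q x - (\<Sum>j<N. c j * of_real (x ^ j))) < d" using poly_approx[OF qc d(1)] by blast
 have es: "exp_sum N c t = complex_of_real (exp (- 1 * max t 0)) * (\<Sum>j<N. c j * of_real (exp (- t) ^ j))" if t: "0 < t" for t
 unfolding exp_sum_def sum_distrib_left
 proof (rule sum.cong[OF refl])
 fix j
 have "exp (- real (Suc j) * max t 0) = exp (- t) * exp (- t) ^ j"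
 using t by (simp add: distrib_right left_diff_distrib flip: exp_of_nat_mult exp_add)
 then show "c j * complex_of_real (exp (- real (Suc j) * max t 0)) = complex_of_real (exp (- 1 * max t 0)) * (c j * complex_of_real (exp (- t) ^ j))"
 using t by (simp add: mult_ac)
 qed
 have le: "norm (powr_exp al (exp_sum N c) t - G (u n) t) <= norm (complex_of_real d * E0 t)" for t
 proof (cases "0 < t")
 case True
 have "powr_exp al (exp_sum N c) t - G (u n) t = E0 t * ((\<Sum>j<N. c j * of_real (exp (- t) ^ j)) - q (exp (- t)))"
 using True by (simp add: powr_exp_def G_def E0_def es[OF True] qe[OF True] algebra_simps)
 moreover have "norm (q (exp (- t)) - (\<Sum>j<N. c j * of_real (exp (- t) ^ j))) <= d" using c[rule_format, of "exp (- t)"] True by simp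
 then have "norm (E0 t) * norm (q (exp (- t)) - (\<Sum>j<N. c j * of_real (exp (- t) ^ j))) <= norm (E0 t) * d" by (rule mult_left_mono) simp
 ultimately show ?thesis using d(1) by (simp add: norm_mult norm_minus_commute mult.commute)
 qed (simp add: powr_exp_def G_def)
 have "pL p (%t. powr_exp al (exp_sum N c) t - G (u n) t) <= pL p (%t. complex_of_real d * E0 t)"
 using p le by (intro pint_mono) auto
 also have "... = en (d powr p * K)" using d(1) K by (subst pint_cmult) (auto simp: ennreal_mult)
 also have "... <= en b" using d(2) by (rule ennreal_leI)
 finally have 1: "pL p (%t. powr_exp al (exp_sum N c) t - G (u n) t) <= en b" .
 have [measurable]: "powr_exp al (exp_sum N c) \<in> borel_measurable borel" using powr_exp_good[OF p al rapid_exp_sum, of N c] by (simp add: good_def)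
 have "pL p (%t. powr_exp al (exp_sum N c) t - h t) <= en (2 powr p) * (pL p (%t. powr_exp al (exp_sum N c) t - G (u n) t) + pL p (%t. G (u n) t - h t))"
 by (rule pint_triangle3) (use p in auto)
 also have "... <= en (2 powr p) * (en b + en b)" using 1 n by (intro mult_left_mono add_mono) (auto simp: hw[symmetric])
 also have "... = en e" using b0 by (simp add: b_def flip: ennreal_plus ennreal_mult)
 finally show ?thesis by blast
qed

text \<open>Truncation to 1 / (n + 1) <= t <= n with bounded values makes t powr (- al) * exp t * h
  t bounded; the lower end tames the power of t at 0.\<close>

lemma exp_dense:
 assumes p: "1 < p" and al: "0 <= al" and h: "good p h" and e: "0 < e"
 shows "EX N c. pL p (%t. powr_exp al (exp_sum N c) t - h t) <= en e"
proof -
 have hm [measurable]: "bm h" and z: "!!t. t <= 0 ==> h t = 0" and fin: "pL p h < \<infinity>" using h by (auto simp: good_def)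
 define v where "v n t = indicator {1 / real (Suc n)..} t *R cutoff n h t" for n t
 have vm [measurable]: "bm (v n)" for n unfolding v_def[abs_def] by measurable
 have cv: "(%n. pL p (%t. v n t - h t)) -->> 0"
 proof (rule pint_dominated[where w="%t. norm (h t)"])
 show "norm (v n t - h t) <= norm (h t)" for n t by (auto simp: v_def cutoff_def split: split_indicator)
 show "AEL t. (%n. v n t - h t) -->> 0"
 proof (intro AE_I2 LIM_zero)
 fix t
 show "(%n. v n t) -->> h t"
 proof (cases "0 < t")
 case True
 then have "\<forall>\<^sub>F n in sequentially. inverse (real (Suc n)) < t" using LIMSEQ_inverse_real_of_nat by (auto simp: order_tendsto_iff)
 then have "\<forall>\<^sub>F n in sequentially. cutoff n h t = v n t" by eventually_elim (simp add: v_def inverse_eq_divide)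
 with cutoff_tendsto[of h t] show ?thesis by (rule Lim_transform_eventually)
 next
 case False
 have "\<not> 1 / real (Suc n) <= t" for n using False by (smt (verit) of_nat_0_less_iff zero_less_Suc zero_less_divide_1_iff)
 then have "v n t = 0" for n by (simp add: v_def)
 then show ?thesis using z[of t] False by simp
 qed
 qed
 qed (use p fin in auto)
 define b where "b = e / (2 powr p * 2)"
 have b0: "0 < b" using e by (simp add: b_def)
 obtain n where n: "pL p (%t. v n t - h t) <= en b" using exists_pint_small[OF cv b0] by blast
 have "EX N c. pL p (%t. powr_exp al (exp_sum N c) t - v n t) <= en b"
 proof (rule exp_dense_bounded[OF p al vm, where R="real n + 1" and B="(real (Suc n)) powr al * exp (real n) * (real n + 1)"])
 fix t :: real
 show "norm ((t powr (- al) * exp t) *R v n t) <= real (Suc n) powr al * exp (real n) * (real n + 1)"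
 proof (cases "1 / real (Suc n) <= t & t <= real n")
 case True
 have t0: "0 < t" using True by (smt (verit) of_nat_0_less_iff zero_less_Suc zero_less_divide_1_iff)
 have "1 / t <= real (Suc n)" using True t0 by (simp add: field_simps)
 then have "(1 / t) powr al <= real (Suc n) powr al" using t0 al by (intro powr_mono2) auto
 moreover have "(1 / t) powr al = t powr (- al)" by (simp add: powr_divide powr_minus_divide)
 ultimately have 1: "t powr (- al) <= real (Suc n) powr al" by simp
 have 2: "norm (v n t) <= real n + 1" using cutoff_le(2)[of n h t] by (auto simp: v_def split: split_indicator)
 have "norm ((t powr (- al) * exp t) *R v n t) = t powr (- al) * exp t * norm (v n t)" by (simp add: abs_mult)
 also have "... <= real (Suc n) powr al * exp (real n) * (real n + 1)" using 1 2 True by (intro mult_mono) auto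
 finally show ?thesis .
 next
 case False
 then have "v n t = 0" by (auto simp: v_def cutoff_def split: split_indicator)
 then show ?thesis by simp
 qed
 show "v n t = 0" if "t <= 0 \<or> real n + 1 < t"
 proof -
 have "\<not> (1 / real (Suc n) <= t & t <= real n)" using that by (smt (verit) of_nat_0_less_iff zero_less_Suc zero_less_divide_1_iff)
 then show ?thesis by (auto simp: v_def cutoff_def split: split_indicator)
 qed
 qed (use b0 in auto)
 then obtain N c where N: "pL p (%t. powr_exp al (exp_sum N c) t - v n t) <= en b" by blast
 have [measurable]: "powr_exp al (exp_sum N c) \<in> borel_measurable borel" using powr_exp_good[OF p al rapid_exp_sum, of N c] by (simp add: good_def)
 have "pL p (%t. powr_exp al (exp_sum N c) t - h t) <= en (2 powr p) * (pL p (%t. powr_exp al (exp_sum N c) t - v n t) + pL p (%t. v n t - h t))"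
 by (rule pint_triangle3) (use p in auto)
 also have "... <= en (2 powr p) * (en b + en b)" using N n by (intro mult_left_mono add_mono) auto
 also have "... = en e" using b0 by (simp add: b_def flip: ennreal_plus ennreal_mult)
 finally show ?thesis by blast
qed

section \<open>The completion as an image of p-integrable functions\<close>

definition schwD :: "real => (real => complex) => real => complex"
 where "schwD al F = powr_exp al (%t. of_real (1 / Gamma (al + 1)) * weylD al F t)"

lemma schwD_good: "1 < p ==> 0 < al ==> F \<in> schwartz_half ==> good p (schwD al F)"
 unfolding schwD_def by (intro powr_exp_good rapid_cmult rapid_weylD) auto

lemma schwartz_D_rep:
 assumes p: "1 < p" and al: "0 < al" and F: "F \<in> schwartz_half"
 shows "lp_rep p (schwartz_D al F) (schwD al F)"
proof (rule lp_repI)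
 show "AEL t. 0 < t --> schwartz_D al F t = schwD al F t"
 by (intro AE_I2) (simp add: schwartz_D_def schwD_def powr_exp_def weyl_deriv_eq[OF al F] scaleR_conv_of_real)
qed (use schwD_good[OF assms] in \<open>auto simp: good_def\<close>)

lemma schwD_diff:
 assumes "0 < al" "F \<in> schwartz_half" "G \<in> schwartz_half"
 shows "schwD al (%t. F t - G t) t = schwD al F t - schwD al G t"
 by (simp add: schwD_def powr_exp_def weylD_diff[OF assms] algebra_simps)

lemma schwartz_norm_eq:
 assumes al: "0 < al" and p: "1 < p"
 shows "schwartz_norm al p F = Lp_norm p (schwartz_D al F)"
proof -
 have G: "0 < Gamma (al + 1)" using al by (intro Gamma_real_pos) simp
 define I where "I = (LINT t|half_line. norm (weyl_deriv al F t) powr p * t powr (al * p))"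
 have I0: "0 <= I" unfolding I_def by (intro b_integral_nonneg) auto
 have "(LINT t|half_line. norm (schwartz_D al F t) powr p) = (LINT t|half_line. Gamma (al + 1) powr (- p) * (norm (weyl_deriv al F t) powr p * t powr (al * p)))"
 proof (rule b_integral_cong[OF refl])
 fix t :: real
 have "norm (schwartz_D al F t) = Gamma (al + 1) powr (- 1) * (norm (weyl_deriv al F t) * t powr al)"
 using G by (simp add: schwartz_D_def powr_minus_divide)
 then show "norm (schwartz_D al F t) powr p = Gamma (al + 1) powr (- p) * (norm (weyl_deriv al F t) powr p * t powr (al * p))"
 using G by (simp add: powr_divide powr_mult powr_powr powr_minus_divide)
 qed
 then have "Lp_norm p (schwartz_D al F) = (Gamma (al + 1) powr (- p) * I) powr (1 / p)" unfolding Lp_norm_def I_def by simp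
 also have "... = Gamma (al + 1) powr (- 1) * I powr (1 / p)" using I0 G p by (simp add: powr_mult powr_powr)
 finally show ?thesis using G unfolding schwartz_norm_def I_def[symmetric] by (simp add: powr_minus_divide)
qed

text \<open>As al / Gamma (al + 1) = 1 / Gamma al, the inverse operator applied to
  \<open>schwD\<close> is the Weyl integral of \<open>weylD\<close>, which returns
  \<open>F\<close>.\<close>

lemma dil_avg_schwD:
 assumes al: "0 < al" and F: "F \<in> schwartz_half" and t: "0 < t"
 shows "dil_avg (dkern al) (schwD al F) t = F t"
proof -
 have G: "0 < Gamma al" using al by (rule Gamma_real_pos)
 have Ga: "Gamma (al + 1) = al * Gamma al" using al by (intro Gamma_plus1) (auto dest: nonpos_Ints_nonpos)
 have e: "al *R ((indicator {t<..} s * ((s - t) powr (al - 1) / s powr al)) *R schwD al F s) = wker al (s - t) *R weylD al F s" for s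
 using t al G by (cases "t < s") (simp_all add: schwD_def powr_exp_def wker_def Ga scaleR_conv_of_real)
 have "dil_avg (dkern al) (schwD al F) t = (LI s. wker al (s - t) *R weylD al F s)"
 unfolding dil_avg_dkern[OF t, symmetric] integral_scaleR_right[symmetric] e ..
 also have "... = weylW al (weylD al F) t"
 unfolding weylW_def using lborel_integral_real_affine[of 1 "%s. wker al (s - t) *R weylD al F s" t] t by simp
 also have "... = F t" by (rule weylW_weylD[OF al F]) (use t in simp)
 finally show ?thesis .
qed

text \<open>The fractional derivative multiplies exp (- k t) by k powr al, so exponential sums are
  mapped onto exponential sums; \<open>c'\<close> is chosen to produce the coefficients
  \<open>c\<close>.\<close>

lemma schwD_dense:
 assumes p: "1 < p" and al: "0 < al" and h: "good p h" and e: "0 < e"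
 shows "\<exists>F\<in>schwartz_half. pL p (%t. schwD al F t - h t) <= en e"
proof -
 have G: "0 < Gamma (al + 1)" using al by (intro Gamma_real_pos) simp
 obtain N c where N: "pL p (%t. powr_exp al (exp_sum N c) t - h t) <= en e" using exp_dense[OF p _ h e] al by (meson less_imp_le)
 define c' where "c' j = of_real (Gamma (al + 1) * real (Suc j) powr (- al)) * c j" for j
 have "of_real (1 / Gamma (al + 1)) * (of_real (real (Suc j) powr al) * c' j) = c j" for j
 proof -
 have "1 / Gamma (al + 1) * (real (Suc j) powr al * (Gamma (al + 1) * real (Suc j) powr (- al))) = 1"
 using G by (simp add: powr_minus field_simps)
 then show ?thesis unfolding c'_def by (simp only: mult.assoc[symmetric] of_real_mult[symmetric]) simp
 qed
 then have "of_real (1 / Gamma (al + 1)) * weylD al (exp_sum N c') t = exp_sum N c t" if "0 <= t" for t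
 unfolding exp_sum_weylD[OF al that] exp_sum_def sum_distrib_left mult.assoc[symmetric] by (simp only:)
 then have "schwD al (exp_sum N c') = powr_exp al (exp_sum N c)" by (intro ext) (simp add: schwD_def powr_exp_def)
 then show ?thesis using N exp_sum_schwartz by (metis (no_types))
qed

lemma lp_pint:
 assumes r: "lp_rep p f f0" and p: "0 < p"
 shows "pL p f0 = en (Lp_norm p f powr p)"
proof -
 obtain x where x: "pL p f0 = en x" "0 <= x" using r unfolding lp_rep_def by (cases "pL p f0") auto
 then show ?thesis unfolding lp_rep_Lp(2)[OF r] using p by (simp add: powr_powr)
qed

lemma Lp_norm_nonneg: "0 <= Lp_norm p f"
 by (simp add: Lp_norm_def)

lemma lp_tendsto:
 assumes p: "0 < p" and r: "!!n. lp_rep p (F n) (G n)"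
 shows "(%n. Lp_norm p (F n)) -->> 0 \<longleftrightarrow> (%n. pL p (G n)) -->> 0"
proof
 assume "(%n. Lp_norm p (F n)) -->> 0"
 then have "(%n. Lp_norm p (F n) powr p) -->> 0" by (rule tendsto_zero_powrI[OF _ tendsto_const]) (use p Lp_norm_nonneg in auto)
 then have "(%n. en (Lp_norm p (F n) powr p)) -->> en 0" by (rule tendsto_ennrealI)
 then show "(%n. pL p (G n)) -->> 0" unfolding lp_pint[OF r p] by simp
next
 assume "(%n. pL p (G n)) -->> 0"
 then have "(%n. enn2real (pL p (G n))) -->> 0" using tendsto_enn2real[of "%n. pL p (G n)" 0] by simp
 then show "(%n. Lp_norm p (F n)) -->> 0"
 unfolding lp_rep_Lp(2)[OF r] by (rule tendsto_zero_powrI[OF _ tendsto_const]) (use p in auto)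
qed

lemma goodD: "good p h ==> h \<in> borel_measurable borel" "good p h ==> t <= 0 ==> h t = 0" "good p h ==> pL p h < \<infinity>"
 by (auto simp: good_def)

lemma lp_rep_diff:
 assumes p: "1 < p" and f: "lp_rep p f f0" and g: "lp_rep p g g0"
 shows "lp_rep p (%t. f t - g t) (%t. f0 t - g0 t)"
proof (rule lp_repI)
 have "AEL t. 0 < t --> f t = f0 t" "AEL t. 0 < t --> g t = g0 t" using f g by (auto simp: lp_rep_def)
 then show "AEL t. 0 < t --> f t - g t = f0 t - g0 t" by eventually_elim auto
 show "pL p (%t. f0 t - g0 t) < \<infinity>" by (rule pint_diff_finite) (use f g p in \<open>auto simp: lp_rep_def\<close>)
qed (use f g in \<open>auto simp: lp_rep_def\<close>)

lemma lp_rep_add: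
 assumes p: "1 < p" and f: "lp_rep p f f0" and g: "lp_rep p g g0"
 shows "lp_rep p (%t. f t + g t) (%t. f0 t + g0 t)"
proof (rule lp_repI)
 have "AEL t. 0 < t --> f t = f0 t" "AEL t. 0 < t --> g t = g0 t" using f g by (auto simp: lp_rep_def)
 then show "AEL t. 0 < t --> f t + g t = f0 t + g0 t" by eventually_elim auto
 show "pL p (%t. f0 t + g0 t) < \<infinity>" by (rule pint_add_finite) (use f g p in \<open>auto simp: lp_rep_def\<close>)
qed (use f g in \<open>auto simp: lp_rep_def\<close>)

lemma lp_rep_cmult:
 assumes f: "lp_rep p f f0"
 shows "lp_rep p (%t. c * f t) (%t. c * f0 t)"
proof (rule lp_repI)
 have "AEL t. 0 < t --> f t = f0 t" using f by (auto simp: lp_rep_def)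
 then show "AEL t. 0 < t --> c * f t = c * f0 t" by eventually_elim auto
 show "pL p (%t. c * f0 t) < \<infinity>" by (subst pint_cmult) (use f in \<open>auto simp: lp_rep_def ennreal_mult_less_top\<close>)
qed (use f in \<open>auto simp: lp_rep_def\<close>)

lemma lp_rep_cong_AE:
 assumes f: "lp_rep p f f0" and ae: "AEL t. f0 t = f1 t" and g: "good p f1"
 shows "lp_rep p f f1"
proof (rule lp_repI)
 have "AEL t. 0 < t --> f t = f0 t" using f by (auto simp: lp_rep_def)
 with ae show "AEL t. 0 < t --> f t = f1 t" by eventually_elim auto
qed (use g in \<open>auto simp: good_def\<close>)

lemma good_dil: "1 < p ==> dil_kernel p k ==> good p h ==> good p (dil_avg k h)"
 by (rule lp_rep_good[OF lp_rep_dil[OF _ _ good_rep]]) auto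

lemma dil_avg_diff_AE:
 fixes f g :: "real => complex"
 assumes "1 < p" "dil_kernel p k" "good p f" "good p g"
 shows "AEL t. dil_avg k (%t. f t - g t) t = dil_avg k f t - dil_avg k g t"
 using dil_avg_integrable[OF assms(2) goodD(1)[OF assms(3)] assms(1) goodD(3)[OF assms(3)]]
 dil_avg_integrable[OF assms(2) goodD(1)[OF assms(4)] assms(1) goodD(3)[OF assms(4)]]
 by eventually_elim (simp add: dil_avg_def scaleR_diff_right)

lemma dil_avg_tendsto:
 assumes p: "1 < p" and k: "dil_kernel p k" and G: "!!n. good p (G n)" and h: "good p h"
 and lim: "(%n. pL p (%t. G n t - h t)) -->> 0"
 shows "(%n. pL p (%t. dil_avg k (G n) t - dil_avg k h t)) -->> 0"
proof (rule tendsto_sandwich[of "%n. 0" _ _ "%n. en (dil_norm p k powr p) * pL p (%t. G n t - h t)"])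
 have "pL p (%t. dil_avg k (G n) t - dil_avg k h t) <= en (dil_norm p k powr p) * pL p (%t. G n t - h t)" for n
 proof -
 have "pL p (%t. dil_avg k (G n) t - dil_avg k h t) = pL p (dil_avg k (%t. G n t - h t))"
 using dil_avg_diff_AE[OF p k G h, of n] by (intro pint_cong_AE) (auto elim: eventually_mono)
 also have "... <= en (dil_norm p k powr p) * pL p (%t. G n t - h t)"
 by (rule pint_dil_avg[OF k _ p]) (use goodD(1)[OF G] goodD(1)[OF h] in auto)
 finally show ?thesis .
 qed
 then show "\<forall>\<^sub>F n in sequentially. pL p (%t. dil_avg k (G n) t - dil_avg k h t) <= en (dil_norm p k powr p) * pL p (%t. G n t - h t)"
 by (intro always_eventually allI)
 show "(%n. en (dil_norm p k powr p) * pL p (%t. G n t - h t)) -->> 0"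
 using ennreal_tendsto_cmult[OF _ lim, of "en (dil_norm p k powr p)"] by simp
qed auto

lemma pint_lim_unique:
 fixes a b :: "real => complex"
 assumes p: "1 < p" and [measurable]: "!!n. G n \<in> borel_measurable borel" "bm a" "bm b"
 and a: "(%n. pL p (%t. G n t - a t)) -->> 0" and b: "(%n. pL p (%t. G n t - b t)) -->> 0"
 shows "AEL t. a t = b t"
proof -
 have "(%n. en (2 powr p) * (pL p (%t. G n t - a t) + pL p (%t. G n t - b t))) -->> en (2 powr p) * (0 + 0)"
 by (intro ennreal_tendsto_cmult tendsto_add a b) simp
 moreover have "pL p (%t. a t - b t) <= en (2 powr p) * (pL p (%t. G n t - a t) + pL p (%t. G n t - b t))" for n
 using pint_triangle3[of a lborel "G n" b p] p by (simp add: pint_diff_commute[of _ _ a])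
 ultimately have "pL p (%t. a t - b t) <= 0" by (intro LIMSEQ_le_const[of _ _ "pL p (%t. a t - b t)"]) auto
 then have "AEL t. a t - b t = 0" by (subst pint_eq_0_iff[symmetric]) auto
 then show ?thesis by (auto elim: eventually_mono)
qed

lemma dinv_inj:
 assumes p: "1 < p" and al: "0 < al" and f: "good p f" and g: "good p g"
 and ae: "AEL t. dil_avg (dkern al) f t = dil_avg (dkern al) g t"
 shows "AEL t. f t = g t"
proof -
 have k: "dil_kernel p (dkern al)" by (rule dil_kernel_dkern[OF al p])
 have d: "good p (%t. f t - g t)" using lp_rep_good[OF lp_rep_diff[OF p good_rep[OF f] good_rep[OF g]]] .
 have "AEL t. 0 < t --> (LI s. (indicator {t<..} s * ((s - t) powr (al - 1) / s powr al)) *R (f s - g s)) = 0"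
 using dil_avg_diff_AE[OF p k f g] ae
 proof eventually_elim
 case (elim t)
 show ?case using elim al dil_avg_dkern[of t al "%s. f s - g s"] by auto
 qed
 then have "AEL t. 0 < t --> f t - g t = 0"
 by (rule abel_injective[OF al Lp_hadm[OF p goodD(1)[OF d] goodD(3)[OF d]]])
 then show ?thesis
 by (rule eventually_mono) (metis goodD(2)[OF f] goodD(2)[OF g] eq_iff_diff_eq_0 not_le)
qed

text \<open>Each \<open>F n\<close> is the inverse operator applied to its fractional derivative,
  and that operator is continuous in p-norm. Comparing limits, the limit \<open>h\<close> of the
  derivatives determines the function \<open>f\<close>.\<close>

lemma represents_limit:
 assumes p: "1 < p" and al: "0 < al" and rF: "represents al p F f" and f: "lp_rep p f f0" and h: "good p h"
 and lim: "(%n. pL p (%t. schwD al (F n) t - h t)) -->> 0"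
 shows "AEL t. f0 t = dil_avg (dkern al) h t"
proof -
 have k: "dil_kernel p (dkern al)" by (rule dil_kernel_dkern[OF al p])
 have F: "F n \<in> schwartz_half" for n using rF by (simp add: represents_def)
 have g: "good p (schwD al (F n))" for n by (rule schwD_good[OF p al F])
 have "lp_rep p (F n) (dil_avg (dkern al) (schwD al (F n)))" for n
 by (rule lp_rep_dil[OF p k good_rep[OF g]]) (rule dil_avg_schwD[OF al F, symmetric])
 then have r: "lp_rep p (%t. F n t - f t) (%t. dil_avg (dkern al) (schwD al (F n)) t - f0 t)" for n by (rule lp_rep_diff[OF p _ f])
 have "(%n. pL p (%t. dil_avg (dkern al) (schwD al (F n)) t - f0 t)) -->> 0"
 using lp_tendsto[OF _ r] p rF by (simp add: represents_def)
 moreover have "bm f0" using f by (simp add: lp_rep_def)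
 ultimately show ?thesis
 using pint_lim_unique[OF p, of "%n. dil_avg (dkern al) (schwD al (F n))"] dil_avg_tendsto[OF p k g h lim] goodD(1)[OF good_dil[OF p k g]] goodD(1)[OF good_dil[OF p k h]] by blast
qed

lemma schwartz_norm_diff_pint:
 assumes p: "1 < p" and al: "0 < al" and F: "F \<in> schwartz_half" and G: "G \<in> schwartz_half"
 shows "pL p (%t. schwD al F t - schwD al G t) = en (schwartz_norm al p (%t. F t - G t) powr p)"
proof -
 have "lp_rep p (schwartz_D al (%t. F t - G t)) (schwD al (%t. F t - G t))" by (rule schwartz_D_rep[OF p al clampD_diff(1)[OF F G]])
 then have "pL p (schwD al (%t. F t - G t)) = en (schwartz_norm al p (%t. F t - G t) powr p)"
 unfolding schwartz_norm_eq[OF al p] by (rule lp_pint) (use p in simp)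
 then show ?thesis unfolding schwD_diff[OF al F G, abs_def] .
qed

lemma represents_cauchy:
 assumes p: "1 < p" and al: "0 < al" and rF: "represents al p F f"
 shows "EX h. good p h & (%n. pL p (%t. schwD al (F n) t - h t)) -->> 0"
proof -
 have F: "F n \<in> schwartz_half" for n using rF by (simp add: represents_def)
 have g: "good p (schwD al (F n))" for n by (rule schwD_good[OF p al F])
 have m: "schwD al (F n) \<in> borel_measurable lborel" for n using goodD(1)[OF g] by simp
 obtain f1 where f1: "f1 \<in> borel_measurable lborel" "pL p f1 < \<infinity>" "(%n. pL p (%t. schwD al (F n) t - f1 t)) -->> 0"
 proof (rule riesz_fischer[OF m p goodD(3)[OF g]])
 fix e :: real
 assume e: "0 < e"
 then have "0 < e powr (1 / p)" by simp
 then obtain N where N: "ALL m>=N. ALL n>=N. schwartz_norm al p (%t. F m t - F n t) < e powr (1 / p)" using rF unfolding represents_def by blast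
 have "pL p (%t. schwD al (F m) t - schwD al (F n) t) <= en e" if mn: "N <= m" "N <= n" for m n
 proof -
 have "schwartz_norm al p (%t. F m t - F n t) powr p <= (e powr (1 / p)) powr p"
 using N mn p by (intro powr_mono2) (auto simp: schwartz_norm_eq[OF al p] Lp_norm_nonneg less_imp_le)
 also have "... = e" using e p by (simp add: powr_powr)
 finally show ?thesis unfolding schwartz_norm_diff_pint[OF p al F F] by (rule ennreal_leI)
 qed
 then show "EX N. ALL m>=N. ALL n>=N. pL p (%t. schwD al (F m) t - schwD al (F n) t) <= en e" by blast
 qed
 define h where "h t = (if 0 < t then f1 t else 0)" for t
 have [measurable]: "bm f1" using f1(1) by simp
 have hm: "bm h" unfolding h_def[abs_def] by measurable
 have "pL p h <= pL p f1" using p by (intro pint_mono) (auto simp: h_def)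
 then have "good p h" using f1(2) hm unfolding good_def by (auto simp: h_def intro: le_less_trans)
 moreover have "(%n. pL p (%t. schwD al (F n) t - h t)) -->> 0"
 proof (rule tendsto_sandwich[OF _ _ tendsto_const f1(3)])
 have "pL p (%t. schwD al (F n) t - h t) <= pL p (%t. schwD al (F n) t - f1 t)" for n
 using p goodD(2)[OF g] by (intro pint_mono) (auto simp: h_def)
 then show "\<forall>\<^sub>F n in sequentially. pL p (%t. schwD al (F n) t - h t) <= pL p (%t. schwD al (F n) t - f1 t)" by (intro always_eventually allI)
 qed auto
 ultimately show ?thesis by blast
qed

text \<open>The converse: every \<open>h\<close> occurs. Density supplies Schwartz functions whose
  fractional derivatives tend to \<open>h\<close>, and continuity of the inverse operator makes the
  functions themselves converge to \<open>f\<close>.\<close>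

lemma represents_exists:
 assumes p: "1 < p" and al: "0 < al" and h: "good p h" and f: "lp_rep p f (dil_avg (dkern al) h)"
 shows "EX F. represents al p F f & (%n. pL p (%t. schwD al (F n) t - h t)) -->> 0"
proof -
 have k: "dil_kernel p (dkern al)" by (rule dil_kernel_dkern[OF al p])
 have "EX G. G \<in> schwartz_half & pL p (%t. schwD al G t - h t) <= en (inverse (real (Suc n)))" for n
 using schwD_dense[OF p al h, of "inverse (real (Suc n))"] by auto
 then obtain F where F: "!!n. F n \<in> schwartz_half" and Fl: "!!n. pL p (%t. schwD al (F n) t - h t) <= en (inverse (real (Suc n)))" by metis
 have g: "good p (schwD al (F n))" for n by (rule schwD_good[OF p al F])
 note [measurable] = goodD(1)[OF g] goodD(1)[OF h]
 have lim: "(%n. pL p (%t. schwD al (F n) t - h t)) -->> 0"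
 proof (rule tendsto_sandwich[of "%n. 0" _ _ "%n. en (inverse (real (Suc n)))"])
 show "(%n. en (inverse (real (Suc n)))) -->> 0" using tendsto_ennrealI[OF LIMSEQ_inverse_real_of_nat] by simp
 qed (use Fl in auto)
 have "represents al p F f"
 unfolding represents_def
 proof (intro conjI allI impI)
 show "F n \<in> schwartz_half" for n by (rule F)
 show "f \<in> Lp p" by (rule lp_rep_Lp(1)[OF f])
 have "lp_rep p (F n) (dil_avg (dkern al) (schwD al (F n)))" for n
 by (rule lp_rep_dil[OF p k good_rep[OF g]]) (rule dil_avg_schwD[OF al F, symmetric])
 then have r: "lp_rep p (%t. F n t - f t) (%t. dil_avg (dkern al) (schwD al (F n)) t - dil_avg (dkern al) h t)" for n by (rule lp_rep_diff[OF p _ f])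
 show "(%n. Lp_norm p (%t. F n t - f t)) -->> 0"
 using lp_tendsto[OF _ r] dil_avg_tendsto[OF p k g h lim] p by simp
 fix e :: real
 assume e: "0 < e"
 \<comment> \<open>With the triangle factor 2 powr p and two terms of size d the total is two thirds
   of e powr p, which gives the strict inequality.\<close>
 define d where "d = e powr p / (2 powr p * 3)"
 have d: "0 < d" using e by (simp add: d_def)
 have "\<forall>\<^sub>F n in sequentially. pL p (%t. schwD al (F n) t - h t) < en d" by (rule order_tendstoD(2)[OF lim]) (use d in simp)
 then obtain N where N: "!!n. N <= n ==> pL p (%t. schwD al (F n) t - h t) < en d" by (auto simp: eventually_sequentially)
 have "schwartz_norm al p (%t. F m t - F n t) < e" if mn: "N <= m" "N <= n" for m n
 proof (rule ccontr)
 assume "\<not> ?thesis"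
 then have "e powr p <= schwartz_norm al p (%t. F m t - F n t) powr p" using e p by (intro powr_mono2) auto
 then have "en (e powr p) <= pL p (%t. schwD al (F m) t - schwD al (F n) t)"
 unfolding schwartz_norm_diff_pint[OF p al F F] by (rule ennreal_leI)
 also have "... <= en (2 powr p) * (pL p (%t. schwD al (F m) t - h t) + pL p (%t. h t - schwD al (F n) t))"
 by (rule pint_triangle3) (use p in auto)
 also have "... <= en (2 powr p) * (en d + en d)"
 using N[OF mn(1)] N[OF mn(2)] by (intro mult_left_mono add_mono) (auto simp: pint_diff_commute[of _ _ h] less_imp_le)
 also have "... = en (2 powr p * (d + d))" using d by (simp flip: ennreal_plus ennreal_mult)
 finally have "e powr p <= 2 powr p * (d + d)" using d by (subst (asm) ennreal_le_iff) auto
 also have "... = e powr p * (2 / 3)" by (simp add: d_def)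
 finally show False using e by simp
 qed
 then show "EX N. ALL m>=N. ALL n>=N. schwartz_norm al p (%t. F m t - F n t) < e" by blast
 qed
 with lim show ?thesis by blast
qed

text \<open>\<open>h\<close> stands for the image of \<open>f\<close> under \<open>D_plus\<close>.
  Describing elements by \<open>h\<close> reduces norm, fractional derivative and Hilbert transform
  on the space to p-integrable functions, with al = 0 included.\<close>

definition T_rep :: "real => real => (real => complex) => (real => complex) => bool"
 where "T_rep al p f h \<longleftrightarrow> good p h & lp_rep p f (if al = 0 then h else dil_avg (dkern al) h)"

lemma T_space_iff:
 assumes p: "1 < p" and al: "0 <= al"
 shows "f \<in> T_space al p \<longleftrightarrow> (EX h. T_rep al p f h)"
proof (cases "al = 0")
 case True
 have "f \<in> Lp p \<longleftrightarrow> (EX h. good p h & lp_rep p f h)" using Lp_rep[of f p] lp_rep_Lp(1)[of p f] lp_rep_good[of p f] by blast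
 then show ?thesis using True by (simp add: T_space_def T_rep_def)
next
 case False
 then have a: "0 < al" using al by simp
 have k: "dil_kernel p (dkern al)" by (rule dil_kernel_dkern[OF a p])
 have fwd: "EX h. T_rep al p f h" if rF: "represents al p F f" for F
 proof -
 obtain f0 where f0: "lp_rep p f f0" using rF Lp_rep unfolding represents_def by blast
 obtain h where h: "good p h" "(%n. pL p (%t. schwD al (F n) t - h t)) -->> 0" using represents_cauchy[OF p a rF] by blast
 show ?thesis unfolding T_rep_def
 using lp_rep_cong_AE[OF f0 represents_limit[OF p a rF f0 h] good_dil[OF p k h(1)]] h(1) False by auto
 qed
 have "EX F. represents al p F f" if "T_rep al p f h" for h
 using represents_exists[OF p a, of h f] that False by (auto simp: T_rep_def)
 with fwd show ?thesis using False unfolding T_space_def by auto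
qed

text \<open>The description by \<open>THE\<close> requires that the limit not depend on the
  representing sequence. The limits of the fractional derivatives of two such sequences have the
  same image under the inverse operator, so by injectivity they agree almost everywhere.\<close>

lemma T_norm_eq:
 assumes p: "1 < p" and al: "0 <= al" and r: "T_rep al p f h"
 shows "T_norm al p f = enn2real (pL p h) powr (1 / p)"
proof (cases "al = 0")
 case True
 then show ?thesis using r lp_rep_Lp(2) unfolding T_norm_def T_rep_def by auto
next
 case False
 then have a: "0 < al" using al by simp
 have h: "good p h" and f: "lp_rep p f (dil_avg (dkern al) h)" using r False by (auto simp: T_rep_def)
 have lim: "(%n. schwartz_norm al p (F n)) -->> enn2real (pL p h1) powr (1 / p)"
 if rF: "represents al p F f" and h1: "good p h1" and l: "(%n. pL p (%t. schwD al (F n) t - h1 t)) -->> 0" for F h1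
 proof -
 have F: "F n \<in> schwartz_half" for n using rF by (simp add: represents_def)
 have g: "good p (schwD al (F n))" for n by (rule schwD_good[OF p a F])
 have "(%n. pL p (schwD al (F n))) -->> pL p h1"
 by (rule pint_tendsto[OF _ _ p goodD(3)[OF h1] l]) (use goodD(1)[OF g] goodD(1)[OF h1] in auto)
 moreover have "pL p h1 = en (enn2real (pL p h1))" using goodD(3)[OF h1] by (simp add: less_top)
 ultimately have "(%n. enn2real (pL p (schwD al (F n)))) -->> enn2real (pL p h1)"
 using tendsto_enn2real[of "%n. pL p (schwD al (F n))" "enn2real (pL p h1)"] by simp
 then have "(%n. enn2real (pL p (schwD al (F n))) powr (1 / p)) -->> enn2real (pL p h1) powr (1 / p)"
 by (rule tendsto_powr'[OF _ tendsto_const]) (use p in auto)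
 then show ?thesis unfolding schwartz_norm_eq[OF a p] lp_rep_Lp(2)[OF schwartz_D_rep[OF p a F]] .
 qed
 have "(THE c. EX F. represents al p F f & (%n. schwartz_norm al p (F n)) -->> c) = enn2real (pL p h) powr (1 / p)"
 proof (rule the_equality)
 show "EX F. represents al p F f & (%n. schwartz_norm al p (F n)) -->> enn2real (pL p h) powr (1 / p)"
 using represents_exists[OF p a h f] lim h by blast
 fix c
 assume "EX F. represents al p F f & (%n. schwartz_norm al p (F n)) -->> c"
 then obtain F where F: "represents al p F f" "(%n. schwartz_norm al p (F n)) -->> c" by blast
 obtain h1 where h1: "good p h1" "(%n. pL p (%t. schwD al (F n) t - h1 t)) -->> 0" using represents_cauchy[OF p a F(1)] by blast
 have "AEL t. h t = h1 t" by (rule dinv_inj[OF p a h h1(1) represents_limit[OF p a F(1) f h1]])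
 then have "pL p h = pL p h1" by (rule pint_cong_AE)
 then show "c = enn2real (pL p h) powr (1 / p)" using LIMSEQ_unique[OF F(2) lim[OF F(1) h1]] by simp
 qed
 then show ?thesis using False by (simp add: T_norm_def)
qed

text \<open>Whatever function the choice in \<open>D_plus\<close> returns, the inverse operator maps
  its representative to \<open>f\<close> almost everywhere, and injectivity identifies it with
  \<open>h\<close>.\<close>

lemma D_plus_rep:
 assumes p: "1 < p" and al: "0 <= al" and r: "T_rep al p f h"
 shows "lp_rep p (D_plus al p f) h"
proof (cases "al = 0")
 case True
 then show ?thesis using r by (simp add: D_plus_def T_rep_def)
next
 case False
 then have a: "0 < al" using al by simp
 have h: "good p h" and f: "lp_rep p f (dil_avg (dkern al) h)" using r False by (auto simp: T_rep_def)
 have iff: "(%n. Lp_norm p (%t. schwartz_D al (F n) t - h2 t)) -->> 0 \<longleftrightarrow> (%n. pL p (%t. schwD al (F n) t - h3 t)) -->> 0"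
 if rF: "represents al p F f" and h3: "lp_rep p h2 h3" for F h2 h3
 by (rule lp_tendsto) (use p rF in \<open>auto intro!: lp_rep_diff[OF p schwartz_D_rep[OF p a] h3] simp: represents_def\<close>)
 define P where "P h' \<longleftrightarrow> h' \<in> Lp p & (EX F. represents al p F f & (%n. Lp_norm p (%t. schwartz_D al (F n) t - h' t)) -->> 0)" for h'
 obtain F where F: "represents al p F f" "(%n. pL p (%t. schwD al (F n) t - h t)) -->> 0" using represents_exists[OF p a h f] by blast
 have "P h" unfolding P_def using lp_rep_Lp(1)[OF good_rep[OF h]] F iff[OF F(1) good_rep[OF h]] by blast
 then have "P (SOME h'. P h')" by (rule someI[of P])
 then have "P (D_plus al p f)" using False unfolding D_plus_def P_def by simp
 then obtain G where D: "D_plus al p f \<in> Lp p" and G: "represents al p G f" "(%n. Lp_norm p (%t. schwartz_D al (G n) t - D_plus al p f t)) -->> 0"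
 unfolding P_def by blast
 obtain h3 where h3: "lp_rep p (D_plus al p f) h3" using Lp_rep[OF D] by blast
 have "AEL t. dil_avg (dkern al) h t = dil_avg (dkern al) h3 t"
 by (rule represents_limit[OF p a G(1) f lp_rep_good[OF h3]]) (use iff[OF G(1) h3] G(2) in blast)
 then have "AEL t. h t = h3 t" by (rule dinv_inj[OF p a h lp_rep_good[OF h3]])
 then have "AEL t. h3 t = h t" by (rule eventually_mono) simp
 then show ?thesis by (rule lp_rep_cong_AE[OF h3 _ h])
qed

section \<open>The Hilbert transform on the half line\<close>

definition hp :: "(real => complex) => real => complex"
 where "hp g t = (if 0 < t then \<i> * g t else 0)"

lemma hilb_ex: "1 < p ==> lp_rep p f f0 ==> EX g. is_hilb p f0 g"
 by (rule hilb_exists) (auto simp: lp_rep_def)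

lemma pint_hp:
 assumes p: "1 < p" and g: "is_hilb p f0 g"
 shows "pL p (hp g) <= en (hc p powr p) * pL p f0"
proof -
 have "pL p (hp g) <= pL p g" using p by (intro pint_mono) (auto simp: hp_def norm_mult)
 then show ?thesis using g unfolding is_hilb_def by (blast intro: order_trans)
qed

lemma H_rep:
 assumes p: "1 < p" and f: "lp_rep p f f0" and g: "is_hilb p f0 g"
 shows "lp_rep p (H_plus f) (hp g)"
proof (rule lp_repI)
 have [measurable]: "bm g" using g by (simp add: is_hilb_def)
 show "bm (hp g)" unfolding hp_def[abs_def] by measurable
 show "AEL t. 0 < t --> H_plus f t = hp g t" using H_plus_hilb[OF f g] by eventually_elim (simp add: hp_def)
 have "en (hc p powr p) * pL p f0 < \<infinity>" using f by (simp add: lp_rep_def ennreal_mult_less_top)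
 then show "pL p (hp g) < \<infinity>" using pint_hp[OF p g] by (rule le_less_trans[rotated])
qed (simp add: hp_def)

text \<open>Averages over r > 0 do not mix the half lines, so restricting the transform to t > 0
  commutes with them; on the whole line \<open>hilb_dil_avg\<close> applies.\<close>

lemma H_dil:
 assumes p: "1 < p" and k: "dil_kernel p k" and f: "lp_rep p f f0" and f': "lp_rep p f' (dil_avg k f0)" and g: "is_hilb p f0 g"
 shows "lp_rep p (H_plus f') (dil_avg k (hp g))"
proof -
 obtain g' where g': "is_hilb p (dil_avg k f0) g'" using hilb_ex[OF p f'] by blast
 have gd: "good p (hp g)" by (rule lp_rep_good[OF H_rep[OF p f g]])
 have ae: "AEL t. g' t = dil_avg k g t"
 by (rule hilb_dil_avg[OF k _ p _ g g']) (use f in \<open>auto simp: lp_rep_def\<close>)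
 have "AEL t. hp g' t = dil_avg k (hp g) t"
 using ae
 proof eventually_elim
 case (elim t)
 show ?case
 proof (cases "0 < t")
 case True
 have e: "k r *R hp g (r * t) = \<i> * (k r *R g (r * t))" for r
 using k True by (cases "0 < r") (auto simp: dil_kernel_def hp_def)
 have "dil_avg k (hp g) t = \<i> * dil_avg k g t" unfolding dil_avg_def e by (rule integral_mult_right_zero)
 then show ?thesis using True elim by (simp add: hp_def)
 next
 case False
 then have "dil_avg k (hp g) t = 0" by (intro dil_avg_nonpos[OF _ k]) (auto simp: hp_def)
 then show ?thesis using False by (simp add: hp_def)
 qed
 qed
 then show ?thesis by (rule lp_rep_cong_AE[OF H_rep[OF p f' g'] _ good_dil[OF p k gd]])
qed

text \<open>Read off from the truncated integrals, which are linear for each \<open>ep\<close>, by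
  uniqueness of limits.\<close>

lemma hilb_linear:
 assumes f: "hadm f" and g: "hadm g" and a: "is_hilb p f a" and b: "is_hilb p g b" and e: "is_hilb p (%t. c * f t + d * g t) u"
 shows "AEL t. u t = c * a t + d * b t"
proof -
 have "AEL x. ((%ep. conv (hker ep) f x) ->> a x) (at_right 0)" "AEL x. ((%ep. conv (hker ep) g x) ->> b x) (at_right 0)"
 "AEL x. ((%ep. conv (hker ep) (%t. c * f t + d * g t) x) ->> u x) (at_right 0)"
 using a b e by (auto simp: is_hilb_def)
 then show ?thesis
 proof eventually_elim
 case (elim x)
 have E: "conv (hker ep) (%t. c * f t + d * g t) x = c * conv (hker ep) f x + d * conv (hker ep) g x" if "0 < ep" for ep
 proof -
 have e: "hker ep (x - t) *R (c * f t + d * g t) = c * (hker ep (x - t) *R f t) + d * (hker ep (x - t) *R g t)" for t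
 by (simp add: scaleR_add_right)
 show ?thesis
 unfolding conv_def e b_integral_add[OF integrable_mult_right[OF hadm_hker[OF f that]] integrable_mult_right[OF hadm_hker[OF g that]]] integral_mult_right_zero ..
 qed
 have "((%ep. c * conv (hker ep) f x + d * conv (hker ep) g x) ->> c * a x + d * b x) (at_right 0)" by (intro tendsto_intros elim)
 moreover have "\<forall>\<^sub>F ep in at_right 0. c * conv (hker ep) f x + d * conv (hker ep) g x = conv (hker ep) (%t. c * f t + d * g t) x"
 using eventually_at_right_less[of "0::real"] by eventually_elim (rule E[symmetric])
 ultimately have "((%ep. conv (hker ep) (%t. c * f t + d * g t) x) ->> c * a x + d * b x) (at_right 0)" by (rule Lim_transform_eventually)
 then show ?case using tendsto_unique[OF trivial_limit_at_right_real elim(3)] by blast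
 qed
qed

lemma H_linear:
 assumes p: "1 < p" and f: "lp_rep p f f0" and g: "lp_rep p g g0"
 shows "ae_eq (H_plus (%t. c * f t + d * g t)) (%t. c * H_plus f t + d * H_plus g t)"
proof -
 have r: "lp_rep p (%t. c * f t + d * g t) (%t. c * f0 t + d * g0 t)" by (intro lp_rep_add lp_rep_cmult p f g)
 obtain a b u where h: "is_hilb p f0 a" "is_hilb p g0 b" "is_hilb p (%t. c * f0 t + d * g0 t) u"
 using hilb_ex[OF p f] hilb_ex[OF p g] hilb_ex[OF p r] by blast
 have "hadm f0" "hadm g0" using f g by (auto intro!: Lp_hadm[OF p] simp: lp_rep_def)
 then have "AEL t. u t = c * a t + d * b t" using hilb_linear h by blast
 then have "AEL t. hp u t = c * hp a t + d * hp b t" by eventually_elim (simp add: hp_def algebra_simps)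
 moreover have "lp_rep p (%t. c * H_plus f t + d * H_plus g t) (%t. c * hp a t + d * hp b t)"
 by (intro lp_rep_add lp_rep_cmult p H_rep[OF p f h(1)] H_rep[OF p g h(2)])
 ultimately show ?thesis using lp_rep_AE_eq[OF H_rep[OF p r h(3)]] by blast
qed

text \<open>In the parametrisation by \<open>h\<close> the operator acts again as the Hilbert
  transform. Commutation with \<open>D_plus\<close>, boundedness and the operator norm on the space
  all follow from this.\<close>

lemma T_rep_H:
 assumes p: "1 < p" and al: "0 <= al" and r: "T_rep al p f h" and g: "is_hilb p h g"
 shows "T_rep al p (H_plus f) (hp g)"
proof -
 have h: "good p h" using r by (simp add: T_rep_def)
 have gd: "good p (hp g)" by (rule lp_rep_good[OF H_rep[OF p good_rep[OF h] g]])
 show ?thesis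
 proof (cases "al = 0")
 case True
 then show ?thesis using r gd H_rep[OF p _ g, of f] by (simp add: T_rep_def)
 next
 case False
 then have a: "0 < al" using al by simp
 show ?thesis
 using H_dil[OF p dil_kernel_dkern[OF a p] good_rep[OF h] _ g, of f] r gd False by (simp add: T_rep_def)
 qed
qed

text \<open>For p <= 2 the maximum is p', and the angles pi / (2 p) and pi / (2 p') add up to pi /
  2, which exchanges tangent and cotangent.\<close>

lemma hc_cot:
 assumes p: "1 < p" and pp: "1 / p + 1 / p' = 1"
 shows "hc p = cot (pi / (2 * max p p'))"
proof (cases "p <= 2")
 case True
 have "1 / p < 1" using p by simp
 then have "0 < 1 / p'" using pp by linarith
 then have p': "0 < p'" by simp
 have "1 / 2 <= 1 / p" using True p by (intro divide_left_mono) auto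
 then have "1 / p' <= 1 / 2" using pp by linarith
 then have "2 <= p'" using p' by (simp add: field_simps)
 then have m: "max p p' = p'" using True by simp
 have "pi / (2 * p') = (pi / 2) * (1 / p')" by simp
 also have "1 / p' = 1 - 1 / p" using pp by linarith
 also have "(pi / 2) * (1 - 1 / p) = pi / 2 - pi / (2 * p)" by (simp add: right_diff_distrib)
 finally have "cot (pi / (2 * p')) = tan (pi / (2 * p))" by (simp add: tan_def cot_def sin_diff cos_diff)
 then show ?thesis using True m by (simp add: hc_def)
next
 case False
 have "1 / p < 1 / 2" using False p by (intro divide_strict_left_mono) auto
 then have q: "1 / 2 < 1 / p'" using pp by linarith
 then have "0 < 1 / p'" by linarith
 then have p': "0 < p'" by simp
 have "p' < 2" using q p' by (simp add: field_simps)
 then show ?thesis using False by (simp add: hc_def)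
qed

theorem theorem2:
  fixes p p' \<alpha> :: real
  assumes "1 < p" and "1 / p + 1 / p' = 1" and "0 \<le> \<alpha>"
  shows
    "(\<forall>h\<in>Lp p. ae_eq (D_plus_inv \<alpha> (H_plus h)) (H_plus (D_plus_inv \<alpha> h))) \<and>
     ((\<forall>f\<in>T_space \<alpha> p. ae_eq (D_plus \<alpha> p (H_plus f)) (H_plus (D_plus \<alpha> p f))) \<and>
      bounded_op (T_space \<alpha> p) (T_norm \<alpha> p) H_plus \<and>
      op_norm (T_space \<alpha> p) (T_norm \<alpha> p) H_plus = cot (pi / (2 * max p p'))) \<and>
     (\<forall>\<beta> \<mu>. 0 < \<beta> - 1 / p \<and> \<beta> - 1 / p < \<mu> \<longrightarrow>
       (\<forall>f\<in>T_space \<alpha> p. ae_eq (H_plus (S_op \<beta> \<mu> f)) (S_op \<beta> \<mu> (H_plus f))))"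
proof -
 note p = assms(1) and \<alpha> = assms(3)
 have p0: "0 < p" using p by simp
 have hc0: "0 < hc p" by (rule hc_nonneg[OF p])
 have Tob: "EX h. T_rep \<alpha> p f h" if "f \<in> T_space \<alpha> p" for f by (rule iffD1[OF T_space_iff[OF p \<alpha>] that])
 have Tin: "f \<in> T_space \<alpha> p" if "T_rep \<alpha> p f h" for f h unfolding T_space_iff[OF p \<alpha>] by (rule exI[where x=h]) (rule that)
 \<comment> \<open>One argument for (i) and (iii): \<open>A\<close> is any operator that acts as a
   dilation average on representatives.\<close>
 have comm: "ae_eq (A (H_plus f)) (H_plus (A f))"
 if f: "f \<in> Lp p" and k: "dil_kernel p k" and A: "!!f f0 t. lp_rep p f f0 ==> 0 < t ==> A f t = dil_avg k f0 t" for A k f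
 proof -
 obtain f0 where f0: "lp_rep p f f0" using Lp_rep[OF f] by blast
 obtain g where g: "is_hilb p f0 g" using hilb_ex[OF p f0] by blast
 have H: "lp_rep p (H_plus f) (hp g)" by (rule H_rep[OF p f0 g])
 have "lp_rep p (A f) (dil_avg k f0)" by (rule lp_rep_dil[OF p k f0]) (rule A[OF f0])
 then have "lp_rep p (H_plus (A f)) (dil_avg k (hp g))" by (rule H_dil[OF p k f0 _ g])
 then show ?thesis using lp_rep_AE_eq[OF lp_rep_dil[OF p k H A[OF H]]] by simp
 qed
 have TL: "f \<in> Lp p" if "f \<in> T_space \<alpha> p" for f
 using Tob[OF that] lp_rep_Lp(1)[of p f] unfolding T_rep_def by blast
 have i: "ae_eq (D_plus_inv \<alpha> (H_plus h)) (H_plus (D_plus_inv \<alpha> h))" if h: "h \<in> Lp p" for h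
 proof (cases "\<alpha> = 0")
 case False
 then have a: "0 < \<alpha>" using \<alpha> by simp
 show ?thesis by (rule comm[OF h dil_kernel_dkern[OF a p] D_plus_inv_dil[OF a]])
 qed (simp add: D_plus_inv_def ae_eq_def)
 have iii: "ae_eq (H_plus (S_op \<beta> \<mu> f)) (S_op \<beta> \<mu> (H_plus f))" if b: "0 < \<beta> - 1 / p" "\<beta> - 1 / p < \<mu>" and f: "f \<in> T_space \<alpha> p" for \<beta> \<mu> f
 proof -
 have "ae_eq (S_op \<beta> \<mu> (H_plus f)) (H_plus (S_op \<beta> \<mu> f))" by (rule comm[OF TL[OF f] dil_kernel_skern[OF b] S_op_dil])
 then show ?thesis unfolding ae_eq_def by (rule eventually_mono) (rule sym)
 qed
 have ii: "ae_eq (D_plus \<alpha> p (H_plus f)) (H_plus (D_plus \<alpha> p f))" if fT: "f \<in> T_space \<alpha> p" for f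
 proof -
 obtain h where r: "T_rep \<alpha> p f h" using Tob[OF fT] ..
 have D: "lp_rep p (D_plus \<alpha> p f) h" by (rule D_plus_rep[OF p \<alpha> r])
 obtain g where g: "is_hilb p h g" using hilb_ex[OF p D] by blast
 have "lp_rep p (D_plus \<alpha> p (H_plus f)) (hp g)" by (rule D_plus_rep[OF p \<alpha> T_rep_H[OF p \<alpha> r g]])
 then show ?thesis using lp_rep_AE_eq[OF _ H_rep[OF p D g]] by simp
 qed
 have bd: "H_plus f \<in> T_space \<alpha> p" "T_norm \<alpha> p (H_plus f) <= hc p * T_norm \<alpha> p f" if fT: "f \<in> T_space \<alpha> p" for f
 proof -
 obtain h where r: "T_rep \<alpha> p f h" using Tob[OF fT] ..
 have h: "good p h" using r by (simp add: T_rep_def)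
 obtain g where g: "is_hilb p h g" using hilb_ex[OF p good_rep[OF h]] by blast
 have r': "T_rep \<alpha> p (H_plus f) (hp g)" by (rule T_rep_H[OF p \<alpha> r g])
 show "H_plus f \<in> T_space \<alpha> p" by (rule Tin[OF r'])
 have "enn2real (pL p (hp g)) <= enn2real (en (hc p powr p) * pL p h)"
 using pint_hp[OF p g] goodD(3)[OF h] by (intro enn2real_mono) (auto simp: ennreal_mult_less_top)
 also have "... = hc p powr p * enn2real (pL p h)" by (simp add: enn2real_mult)
 finally have "enn2real (pL p (hp g)) powr (1 / p) <= (hc p powr p * enn2real (pL p h)) powr (1 / p)"
 using p0 by (intro powr_mono2) auto
 also have "... = hc p * enn2real (pL p h) powr (1 / p)" using p0 hc0 by (simp add: powr_mult powr_powr)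
 finally show "T_norm \<alpha> p (H_plus f) <= hc p * T_norm \<alpha> p f" unfolding T_norm_eq[OF p \<alpha> r] T_norm_eq[OF p \<alpha> r'] .
 qed
 have N0: "0 <= T_norm \<alpha> p f" if fT: "f \<in> T_space \<alpha> p" for f
 proof -
 obtain h where "T_rep \<alpha> p f h" using Tob[OF fT] ..
 then show ?thesis using T_norm_eq[OF p \<alpha>, of f h] by simp
 qed
 have lin: "ae_eq (H_plus (%t. c * f t + d * g t)) (%t. c * H_plus f t + d * H_plus g t)" if fT: "f \<in> T_space \<alpha> p" and gT: "g \<in> T_space \<alpha> p" for f g c d
 proof -
 obtain f0 where f0: "lp_rep p f f0" using Lp_rep[OF TL[OF fT]] ..
 obtain g0 where g0: "lp_rep p g g0" using Lp_rep[OF TL[OF gT]] ..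
 show ?thesis by (rule H_linear[OF p f0 g0])
 qed
 have bo: "bounded_op (T_space \<alpha> p) (T_norm \<alpha> p) H_plus"
 unfolding bounded_op_def
 proof (intro conjI ballI allI exI[of _ "hc p"])
 show "ae_eq (H_plus (%t. f t + g t)) (%t. H_plus f t + H_plus g t)" if "f \<in> T_space \<alpha> p" "g \<in> T_space \<alpha> p" for f g
 using lin[OF that, of 1 1] by simp
 show "ae_eq (H_plus (%t. c * f t)) (%t. c * H_plus f t)" if "f \<in> T_space \<alpha> p" for f c
 using lin[OF that that, of c 0] by simp
 show "H_plus f \<in> T_space \<alpha> p" if "f \<in> T_space \<alpha> p" for f by (rule bd(1)[OF that])
 show "T_norm \<alpha> p (H_plus f) <= hc p * T_norm \<alpha> p f" if "f \<in> T_space \<alpha> p" for f by (rule bd(2)[OF that])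
 qed
 have ub: "T_norm \<alpha> p (H_plus f) / T_norm \<alpha> p f <= hc p" if f: "f \<in> T_space \<alpha> p" for f
 \<comment> \<open>For an element of norm 0 the quotient is 0, since division by 0 yields 0, and it
   does not disturb the supremum.\<close>
 proof (cases "T_norm \<alpha> p f = 0")
 case False
 then have "0 < T_norm \<alpha> p f" using N0[OF f] by simp
 then show ?thesis using bd(2)[OF f] by (simp only: pos_divide_le_eq)
 qed (use hc0 in simp)
 have lb: "\<exists>f\<in>T_space \<alpha> p. c <= T_norm \<alpha> p (H_plus f) / T_norm \<alpha> p f" if c: "0 < c" "c < hc p" for c
 proof -
 obtain h where h: "bm h" "ALL t<=0. h t = 0" "0 < pL p h" "pL p h < \<infinity>"
 and low: "ALL g. is_hilb p h g --> en (c powr p) * pL p h <= pL p (%t. indicator {0<..} t *R g t)"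
 using hilb_lower[OF p less_imp_le[OF c(1)] c(2)] by blast
 have hg: "good p h" using h by (simp add: good_def)
 \<comment> \<open>The nearly extremal \<open>h\<close> is carried into the space by the inverse of
   \<open>D_plus\<close>; the norm of the image is that of \<open>h\<close>.\<close>
 define f where "f = (if \<alpha> = 0 then h else dil_avg (dkern \<alpha>) h)"
 have "good p f"
 unfolding f_def using hg good_dil[OF p dil_kernel_dkern[OF _ p] hg] \<alpha> by auto
 then have r: "T_rep \<alpha> p f h" using hg good_rep[of p f] by (simp add: T_rep_def f_def)
 obtain g where g: "is_hilb p h g" using hilb_ex[OF p good_rep[OF hg]] by blast
 have r': "T_rep \<alpha> p (H_plus f) (hp g)" by (rule T_rep_H[OF p \<alpha> r g])
 have fin: "pL p (hp g) < \<infinity>" using r' by (auto simp: T_rep_def good_def)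
 define a where "a = enn2real (pL p h)"
 have a: "0 < a" using h(3,4) by (simp add: a_def enn2real_positive_iff)
 have "en (c powr p) * pL p h <= pL p (hp g)"
 by (rule order_trans[OF low[rule_format, OF g]], rule pint_mono) (use p0 in \<open>auto simp: hp_def norm_mult split: split_indicator\<close>)
 then have "enn2real (en (c powr p) * pL p h) <= enn2real (pL p (hp g))" using fin by (intro enn2real_mono) auto
 then have "c powr p * a <= enn2real (pL p (hp g))" by (simp add: enn2real_mult a_def)
 then have "(c powr p * a) powr (1 / p) <= enn2real (pL p (hp g)) powr (1 / p)" using p0 a by (intro powr_mono2) auto
 moreover have "(c powr p * a) powr (1 / p) = c * a powr (1 / p)" using c(1) a p0 by (simp add: powr_mult powr_powr)
 ultimately have "c * T_norm \<alpha> p f <= T_norm \<alpha> p (H_plus f)" unfolding T_norm_eq[OF p \<alpha> r] T_norm_eq[OF p \<alpha> r'] a_def by simp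
 moreover have "0 < T_norm \<alpha> p f" unfolding T_norm_eq[OF p \<alpha> r] using a by (simp add: a_def)
 ultimately have "c <= T_norm \<alpha> p (H_plus f) / T_norm \<alpha> p f" by (simp only: pos_le_divide_eq)
 moreover have "f \<in> T_space \<alpha> p" by (rule Tin[OF r])
 ultimately show ?thesis by blast
 qed
 have opn: "op_norm (T_space \<alpha> p) (T_norm \<alpha> p) H_plus = hc p"
 unfolding op_norm_def
 proof (rule antisym)
 have "0 < hc p / 2" "hc p / 2 < hc p" using hc0 by auto
 then have ne: "T_space \<alpha> p ~= {}" using lb[of "hc p / 2"] by auto
 show "(SUP f\<in>T_space \<alpha> p. T_norm \<alpha> p (H_plus f) / T_norm \<alpha> p f) <= hc p" by (rule cSUP_least[OF ne ub])
 have bb: "bdd_above ((%f. T_norm \<alpha> p (H_plus f) / T_norm \<alpha> p f) ` T_space \<alpha> p)" by (rule bdd_aboveI2[OF ub])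
 show "hc p <= (SUP f\<in>T_space \<alpha> p. T_norm \<alpha> p (H_plus f) / T_norm \<alpha> p f)"
 proof (rule dense_le_bounded[OF hc0])
 fix c assume c: "0 < c" "c < hc p"
 obtain f where "f \<in> T_space \<alpha> p" "c <= T_norm \<alpha> p (H_plus f) / T_norm \<alpha> p f" using lb[OF c] ..
 then show "c <= (SUP f\<in>T_space \<alpha> p. T_norm \<alpha> p (H_plus f) / T_norm \<alpha> p f)" by (rule cSUP_upper2[OF bb])
 qed
 qed
 show ?thesis
 proof (intro conjI ballI allI impI)
 show "op_norm (T_space \<alpha> p) (T_norm \<alpha> p) H_plus = cot (pi / (2 * max p p'))" unfolding opn by (rule hc_cot[OF assms(1,2)])
 show "ae_eq (H_plus (S_op \<beta> \<mu> f)) (S_op \<beta> \<mu> (H_plus f))" if "0 < \<beta> - 1 / p & \<beta> - 1 / p < \<mu>" "f \<in> T_space \<alpha> p" for \<beta> \<mu> f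
 by (rule iii) (use that in auto)
 qed (fact bo | erule i | erule ii)+
qed

end
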